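(* Let $2\le p<\infty$, let $W=(W_1,W_2):\mathbb{R}^2\to\mathbb{R}^2$ be a real vector-valued function, and let $u\in W^{2,p}_{loc}(\mathbb{R}^2)$ be a real-valued solution of $$\Delta u+W\cdot\nabla u=0\quad\text{in }\mathbb{R}^2$$ with $|u(z)|\le C_0$ on $\mathbb{R}^2$ for some constant $C_0>0$. (i) Suppose $2<p<\infty$, $\|W\|_{L^p(\mathbb{R}^2)}\le\tilde K$ and $|\nabla u(0)|=1$. Then there exist constants $C>0$ and $R_0>1$ depending only on $p,\tilde K,C_0$ such that for all $R\ge R_0$ $$\inf_{|z_0|=R}\ \sup_{|z-z_0|<1}|u(z)|\ \ge\ \exp\left(-CR^{1-2/p}\log R\right).$$ (ii) Suppose $p=2$, $\|W\|_{L^2(\mathbb{R}^2)}\le K$ and $\int_{B_1}|\nabla u|^2\ge 1$. Then there exist constants $C>0$ and $R_0>1$ depending only on $K,C_0$ such that for all $R\ge R_0$ $$\inf_{|z_0|=R}\ \sup_{|z-z_0|<1}|u(z)|\ \ge\ R^{-C}.$$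
   Context: $B_r$ denotes the open ball of radius $r$ centered at $0$ in $\mathbb{R}^2$. The equation holds almost everywhere. For $2\le p<\infty$ functions in $W^{2,p}_{loc}(\mathbb{R}^2)$ are identified with their continuous representatives; for $p>2$ these are $C^1$, so $\nabla u(0)$ is well defined. *)

theory Defs
  imports "HOL-Analysis.Analysis"
begin

definition partial_deriv :: "'n::finite \<Rightarrow> (real^'n \<Rightarrow> real) \<Rightarrow> real^'n \<Rightarrow> real" where
  "partial_deriv i f x = frechet_derivative f (at x) (axis i 1)"

primrec C_k :: "nat \<Rightarrow> (real^'n::finite \<Rightarrow> real) \<Rightarrow> bool" where
  "C_k 0 f \<longleftrightarrow> continuous_on UNIV f"
| "C_k (Suc k) f \<longleftrightarrow> f differentiable_on UNIV \<and> (\<forall>i. C_k k (partial_deriv i f))"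

definition test_function :: "(real^'n::finite \<Rightarrow> real) \<Rightarrow> bool" where
  "test_function \<phi> \<longleftrightarrow> (\<forall>k. C_k k \<phi>) \<and> compact (closure {x. \<phi> x \<noteq> 0})"

definition in_Lp :: "real \<Rightarrow> (real^'n::finite \<Rightarrow> real^'m::finite) \<Rightarrow> bool" where
  "in_Lp p f \<longleftrightarrow> f \<in> borel_measurable lebesgue \<and> integrable lebesgue (\<lambda>x. norm (f x) powr p)"

text \<open>Meaningful for functions satisfying \<^const>\<open>in_Lp\<close> only: the Bochner integral of a
  non-integrable function is 0.\<close>

definition Lp_norm :: "real \<Rightarrow> (real^'n::finite \<Rightarrow> real^'m::finite) \<Rightarrow> real" where
  "Lp_norm p f = (LINT x|lebesgue. norm (f x) powr p) powr (1 / p)"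

definition locally_Lp :: "real \<Rightarrow> (real^'n::finite \<Rightarrow> real) \<Rightarrow> bool" where
  "locally_Lp p f \<longleftrightarrow> f \<in> borel_measurable lebesgue \<and>
     (\<forall>K. compact K \<longrightarrow> set_integrable lebesgue K (\<lambda>x. \<bar>f x\<bar> powr p))"

definition has_weak_partial ::
    "'n::finite \<Rightarrow> (real^'n \<Rightarrow> real) \<Rightarrow> (real^'n \<Rightarrow> real) \<Rightarrow> bool" where
  "has_weak_partial i f g \<longleftrightarrow> locally_Lp 1 f \<and> locally_Lp 1 g \<and>
     (\<forall>\<phi>. test_function \<phi> \<longrightarrow>
        (LINT x|lebesgue. f x * partial_deriv i \<phi> x) = - (LINT x|lebesgue. g x * \<phi> x))"

text \<open>\<open>W\<^sup>k\<^sup>,\<^sup>p\<^sub>l\<^sub>o\<^sub>c\<close> on the whole space: all weak derivatives of order at most \<open>k\<close> exist and are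
  locally in \<open>L\<^sup>p\<close> (for \<open>p \<ge> 1\<close>).\<close>

primrec sobolev_loc :: "nat \<Rightarrow> real \<Rightarrow> (real^'n::finite \<Rightarrow> real) \<Rightarrow> bool" where
  "sobolev_loc 0 p f \<longleftrightarrow> locally_Lp p f"
| "sobolev_loc (Suc k) p f \<longleftrightarrow> locally_Lp p f \<and>
     (\<forall>i. \<exists>g. has_weak_partial i f g \<and> sobolev_loc k p g)"

text \<open>Weak derivatives are unique almost everywhere; some representative is chosen. All later uses
  (equations holding almost everywhere and integrals) are independent of this choice.\<close>

definition weak_partial :: "'n::finite \<Rightarrow> (real^'n \<Rightarrow> real) \<Rightarrow> real^'n \<Rightarrow> real" where
  "weak_partial i f = (SOME g. has_weak_partial i f g)"

definition weak_grad :: "(real^'n::finite \<Rightarrow> real) \<Rightarrow> real^'n \<Rightarrow> real^'n" where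
  "weak_grad f x = (\<chi> i. weak_partial i f x)"

definition weak_laplacian :: "(real^'n::finite \<Rightarrow> real) \<Rightarrow> real^'n \<Rightarrow> real" where
  "weak_laplacian f x = (\<Sum>i\<in>UNIV. weak_partial i (weak_partial i f) x)"

text \<open>Continuity singles out the continuous representative of the Sobolev class, so that \<open>u\<close> has
  pointwise values.\<close>

definition bounded_solution ::
    "real \<Rightarrow> real \<Rightarrow> (real^2 \<Rightarrow> real^2) \<Rightarrow> (real^2 \<Rightarrow> real) \<Rightarrow> bool" where
  "bounded_solution p C0 W u \<longleftrightarrow>
     sobolev_loc 2 p u \<and> continuous_on UNIV u \<and>
     (AE x in lebesgue. weak_laplacian u x + W x \<bullet> weak_grad u x = 0) \<and>
     (\<forall>z. \<bar>u z\<bar> \<le> C0)"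

end

theory Submission
  imports Defs "HOL-Complex_Analysis.Conformal_Mappings"
begin

text \<open>Let \<open>g = (u\<^sub>x - \<i> u\<^sub>y) / 2\<close>. The equation becomes \<open>\<partial>g / \<partial>\<zeta>' = \<alpha> g\<close>, where \<open>\<zeta>'\<close> is the conjugate variable and
  \<open>\<bar>\<alpha>\<bar> \<le> \<bar>W\<bar> / 2\<close>. If \<open>\<omega>\<close> is the Cauchy transform of \<open>\<alpha>\<close> on a large ball, then \<open>exp (- \<omega>) g\<close> is holomorphic.
  Three circles centred at \<open>z\<^sub>0\<close>, \<open>\<bar>z\<^sub>0\<bar> = R\<close>, compare its size near \<open>z\<^sub>0\<close> with its size on \<open>B(z\<^sub>0, 2 R)\<close>,
  which contains \<open>B(0, R)\<close>; the Caccioppoli inequality bounds \<open>g\<close> near \<open>z\<^sub>0\<close> by the supremum of \<open>\<bar>u\<bar>\<close>.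
  For \<open>p > 2\<close> Hoelder's inequality gives \<open>\<bar>\<omega>\<bar> \<le> C R\<^sup>1\<^sup>-\<^sup>2\<^sup>/\<^sup>p\<close>. For \<open>p = 2\<close> the function \<open>\<omega>\<close> is unbounded, but
  \<open>exp (2 \<bar>\<omega>\<bar>)\<close> has bounded averages (an inequality of Trudinger type), which is enough for \<open>L\<^sup>2\<close> estimates of \<open>g\<close>.\<close>

section \<open>Calculus in the plane\<close>

text \<open>Three circles are used with a free integer n in place of an interpolation exponent. They
  bound exp(-\<omega>) g on B(z0, 2 R) by the maximum of a near term, (16 R)^n times the size of g
  near z0, and a far term, (4/5)^n times its size on the large ball. The normalisation at the origin
  bounds this maximum from below. Once n makes the far term too small, the near term must carry the
  bound, and u near z0 has size at least about (16 R)^(-n). The two rates are two sizes of n: for p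
  = 2 the L^2 norm of W is invariant under scaling and n is independent of R; for p > 2 the factor
  exp(C R^(1-2/p)) makes n proportional to R^(1-2/p). The quotient \<alpha> is only known to be in
  L^p, too rough for exp(-\<omega>) to be a multiplier of C^1 test functions. So no exactly
  holomorphic function is built: a truncated and mollified \<alpha> makes exp(-\<omega>) g
  holomorphic up to an error of arbitrarily small L^1 norm. The potential of that error is small off
  a set of small measure, and all bounds are uniform in the approximation.\<close>

definition has_partials ::
    "(real^2 \<Rightarrow> 'a::real_normed_vector) \<Rightarrow> (real^2 \<Rightarrow> 'a) \<Rightarrow> (real^2 \<Rightarrow> 'a) \<Rightarrow> bool" where
  "has_partials f f1 f2 \<longleftrightarrow>
     (\<forall>x. (f has_derivative (\<lambda>h. (h$1) *\<^sub>R f1 x + (h$2) *\<^sub>R f2 x)) (at x)) \<and>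
     continuous_on UNIV f1 \<and> continuous_on UNIV f2"

lemma has_partialsD:
  assumes "has_partials f f1 f2"
  shows "(f has_derivative (\<lambda>h. (h$1) *\<^sub>R f1 x + (h$2) *\<^sub>R f2 x)) (at x within S)"
    and "continuous_on S f" "continuous_on S f1" "continuous_on S f2"
proof -
  show d: "(f has_derivative (\<lambda>h. (h$1) *\<^sub>R f1 x + (h$2) *\<^sub>R f2 x)) (at x within S)" for x S
    using assms unfolding has_partials_def by (blast intro: has_derivative_at_withinI)
  show "continuous_on S f"
    by (rule has_derivative_continuous_on[OF d])
  show "continuous_on S f1" "continuous_on S f2"
    using assms unfolding has_partials_def by (auto intro: continuous_on_subset)
qed

lemma has_partials_borel:
  fixes f :: "real^2 \<Rightarrow> 'a::{real_normed_vector, second_countable_topology}"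
  assumes "has_partials f f1 f2"
  shows "f \<in> borel_measurable borel" "f1 \<in> borel_measurable borel" "f2 \<in> borel_measurable borel"
  using has_partialsD[OF assms, where S=UNIV] by (auto intro: borel_measurable_continuous_onI)

lemma has_partials_const: "has_partials (\<lambda>x. c) (\<lambda>x. 0) (\<lambda>x. 0)"
  by (simp add: has_partials_def)

lemma has_partials_add:
  assumes "has_partials f f1 f2" "has_partials g g1 g2"
  shows "has_partials (\<lambda>x. f x + g x) (\<lambda>x. f1 x + g1 x) (\<lambda>x. f2 x + g2 x)"
  unfolding has_partials_def
  by (intro conjI allI continuous_intros has_partialsD[OF assms(1)] has_partialsD[OF assms(2)]
      has_derivative_eq_rhs[OF has_derivative_add[OF has_partialsD(1)[OF assms(1)] has_partialsD(1)[OF assms(2)]]])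
    (auto simp: algebra_simps)

lemma has_partials_bounded_linear:
  assumes "bounded_linear T" "has_partials f f1 f2"
  shows "has_partials (\<lambda>x. T (f x)) (\<lambda>x. T (f1 x)) (\<lambda>x. T (f2 x))"
proof -
  interpret bounded_linear T by fact
  show ?thesis
    unfolding has_partials_def
    by (intro conjI allI continuous_on has_partialsD[OF assms(2)]
      has_derivative_eq_rhs[OF has_derivative[OF has_partialsD(1)[OF assms(2)]]])
    (auto simp: add scaleR)
qed

lemma has_partials_mult:
  fixes f :: "real^2 \<Rightarrow> 'a::real_normed_algebra"
  assumes "has_partials f f1 f2" "has_partials g g1 g2"
  shows "has_partials (\<lambda>x. f x * g x) (\<lambda>x. f1 x * g x + f x * g1 x) (\<lambda>x. f2 x * g x + f x * g2 x)"
  unfolding has_partials_def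
  by (intro conjI allI continuous_intros has_partialsD[OF assms(1)] has_partialsD[OF assms(2)]
      has_derivative_eq_rhs[OF has_derivative_mult[OF has_partialsD(1)[OF assms(1)] has_partialsD(1)[OF assms(2)]]])
    (auto simp: algebra_simps)

lemma has_partials_exp:
  fixes f :: "real^2 \<Rightarrow> complex"
  assumes "has_partials f f1 f2"
  shows "has_partials (\<lambda>x. exp (f x)) (\<lambda>x. f1 x * exp (f x)) (\<lambda>x. f2 x * exp (f x))"
proof -
  have "((\<lambda>x. exp (f x)) has_derivative (\<lambda>h. exp (f x) * ((h$1) *\<^sub>R f1 x + (h$2) *\<^sub>R f2 x))) (at x)" for x
    using has_derivative_compose[OF has_partialsD(1)[OF assms] DERIV_exp[unfolded has_field_derivative_def]]
    by simp
  then show ?thesis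
    unfolding has_partials_def
    by (intro conjI allI continuous_intros has_partialsD[OF assms])
       (auto simp: algebra_simps elim!: has_derivative_eq_rhs)
qed

lemma has_partials_reflect:
  assumes "has_partials f f1 f2"
  shows "has_partials (\<lambda>x. f (z - x)) (\<lambda>x. - f1 (z - x)) (\<lambda>x. - f2 (z - x))"
proof -
  have "((\<lambda>x. f (z - x)) has_derivative (\<lambda>h. ((- h)$1) *\<^sub>R f1 (z - x) + ((- h)$2) *\<^sub>R f2 (z - x))) (at x)" for x
    by (rule has_derivative_compose[OF _ has_partialsD(1)[OF assms]]) (auto intro!: derivative_eq_intros)
  moreover have "continuous_on UNIV (\<lambda>x. - f1 (z - x))" "continuous_on UNIV (\<lambda>x. - f2 (z - x))"
    by (intro continuous_intros continuous_on_compose2[OF has_partialsD(3)[OF assms, of UNIV]]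
        continuous_on_compose2[OF has_partialsD(4)[OF assms, of UNIV]]; simp)+
  ultimately show ?thesis
    unfolding has_partials_def by simp
qed

lemma norm_sq_2: "(norm (x::real^2))\<^sup>2 = (x$1)\<^sup>2 + (x$2)\<^sup>2"
  by (simp add: norm_vec_def L2_set_def sum_2)

text \<open>The profile takes the squared norm because that is a polynomial: no case distinction
  arises at the centre. The Cauchy kernels, cutoffs and bumps below are all built from profiles of
  this kind.\<close>

lemma has_partials_radial:
  fixes m m' :: "real \<Rightarrow> real"
  assumes "\<And>s. (m has_real_derivative m' s) (at s)" "continuous_on UNIV m'"
  shows "has_partials (\<lambda>x. m ((norm (x - z))\<^sup>2)) (\<lambda>x. 2 * (x - z)$1 * m' ((norm (x - z))\<^sup>2))
            (\<lambda>x. 2 * (x - z)$2 * m' ((norm (x - z))\<^sup>2))"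
proof -
  have "((\<lambda>x. m ((norm (x - z))\<^sup>2)) has_derivative
     (\<lambda>h. m' ((norm (x - z))\<^sup>2) * (2 * ((x - z)$1 * h$1 + (x - z)$2 * h$2)))) (at x)" for x :: "real^2"
  proof (rule has_derivative_compose[OF _ assms(1)[unfolded has_field_derivative_def]])
    have "((\<lambda>x. (x - z)$1 * (x - z)$1 + (x - z)$2 * (x - z)$2) has_derivative
       (\<lambda>h. 2 * ((x - z)$1 * h$1 + (x - z)$2 * h$2))) (at x)"
      by (auto intro!: derivative_eq_intros bounded_linear.has_derivative[OF bounded_linear_vec_nth] simp: algebra_simps)
    then show "((\<lambda>x. (norm (x - z))\<^sup>2) has_derivative
       (\<lambda>h. 2 * ((x - z)$1 * h$1 + (x - z)$2 * h$2))) (at x)"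
      unfolding norm_sq_2 by (simp add: power2_eq_square)
  qed
  moreover have "continuous_on UNIV (\<lambda>x. m' ((norm (x - z))\<^sup>2))"
    by (rule continuous_on_compose2[OF assms(2)]) (auto intro!: continuous_intros)
  ultimately show ?thesis
    unfolding has_partials_def
    by (auto intro!: continuous_intros elim!: has_derivative_eq_rhs simp: algebra_simps)
qed

section \<open>Reflections and translations of Lebesgue measure\<close>

lemma lborel_distr_reflect: "distr lborel borel (\<lambda>x. a - x) = (lborel :: 'a::euclidean_space measure)"
  using lborel_affine[of "-1" a] by (auto simp: density_1)

lemma lborel_distr_translate: "distr lborel borel (\<lambda>x. x - a) = (lborel :: 'a::euclidean_space measure)"
proof -
  have "(+) (- a) = (\<lambda>x. x - a)" by auto
  then show ?thesis using lborel_distr_plus[of "-a"] by simp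
qed

lemma nn_integral_reflect:
  fixes a :: "'a::euclidean_space"
  assumes [measurable]: "f \<in> borel_measurable borel"
  shows "(\<integral>\<^sup>+x. f (a - x) \<partial>lborel) = (\<integral>\<^sup>+x. f x \<partial>lborel)"
  by (subst (2) lborel_distr_reflect[of a, symmetric]) (simp add: nn_integral_distr)

lemma integral_reflect:
  fixes a :: "'a::euclidean_space" and f :: "'a \<Rightarrow> 'b::{banach, second_countable_topology}"
  assumes [measurable]: "f \<in> borel_measurable borel"
  shows "(LINT x|lborel. f (a - x)) = (LINT x|lborel. f x)"
  by (subst (2) lborel_distr_reflect[of a, symmetric]) (simp add: integral_distr)

lemma integral_translate:
  fixes a :: "'a::euclidean_space" and f :: "'a \<Rightarrow> 'b::{banach, second_countable_topology}"
  assumes [measurable]: "f \<in> borel_measurable borel"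
  shows "(LINT x|lborel. f (x - a)) = (LINT x|lborel. f x)"
  by (subst (2) lborel_distr_translate[of a, symmetric]) (simp add: integral_distr)

lemma integrable_reflect:
  fixes a :: "'a::euclidean_space" and f :: "'a \<Rightarrow> 'b::{banach, second_countable_topology}"
  assumes "integrable lborel f"
  shows "integrable lborel (\<lambda>x. f (a - x))"
  by (rule integrable_distr[of "\<lambda>x. a - x" lborel borel]) (use assms in \<open>simp_all add: lborel_distr_reflect\<close>)

lemma integrable_translate:
  fixes a :: "'a::euclidean_space" and f :: "'a \<Rightarrow> 'b::{banach, second_countable_topology}"
  assumes "integrable lborel f"
  shows "integrable lborel (\<lambda>x. f (x - a))"
  by (rule integrable_distr[of "\<lambda>x. x - a" lborel borel]) (use assms in \<open>simp_all add: lborel_distr_translate\<close>)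

section \<open>Convolution with a kernel\<close>

definition conv ::
    "(real^2 \<Rightarrow> 'a::{real_normed_field,banach,second_countable_topology}) \<Rightarrow> (real^2 \<Rightarrow> 'a) \<Rightarrow> real^2 \<Rightarrow> 'a" where
  "conv f K x = (LINT y|lborel. f y * K (x - y))"

lemma conv_integrable:
  fixes f K :: "real^2 \<Rightarrow> 'a::{real_normed_field,banach,second_countable_topology}"
  assumes "integrable lborel f" and [measurable]: "K \<in> borel_measurable borel" and B: "\<And>x. norm (K x) \<le> B"
  shows "integrable lborel (\<lambda>y. f y * K (x - y))"
proof (rule Bochner_Integration.integrable_bound)
  show "integrable lborel (\<lambda>y. norm (f y) * B)"
    using assms(1) by (intro integrable_mult_left integrable_norm)
  show "(\<lambda>y. f y * K (x - y)) \<in> borel_measurable lborel"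
    using borel_measurable_integrable[OF assms(1)] by measurable
  have "0 \<le> B" using B[of 0] norm_ge_zero order_trans by blast
  then show "AE y in lborel. norm (f y * K (x - y)) \<le> norm (norm (f y) * B)"
    using B by (auto simp: norm_mult intro!: mult_left_mono AE_I2)
qed

lemma conv_commute:
  fixes f K :: "real^2 \<Rightarrow> 'a::{real_normed_field,banach,second_countable_topology}"
  assumes [measurable]: "f \<in> borel_measurable borel" "K \<in> borel_measurable borel"
  shows "conv f K x = (LINT y|lborel. f (x - y) * K y)"
  using integral_reflect[of "\<lambda>y. f (x - y) * K y" x] by (simp add: conv_def)

lemma norm_conv_le:
  fixes f K :: "real^2 \<Rightarrow> 'a::{real_normed_field,banach,second_countable_topology}"
  assumes "integrable lborel f" "K \<in> borel_measurable borel" and "\<And>x. norm (K x) \<le> B"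
  shows "norm (conv f K x) \<le> B * (LINT y|lborel. norm (f y))"
proof -
  have "norm (conv f K x) \<le> (LINT y|lborel. norm (f y) * B)"
    unfolding conv_def
    using assms by (intro Bochner_Integration.integral_norm_bound_integral)
      (auto simp: norm_mult intro!: mult_left_mono conv_integrable)
  then show ?thesis by (simp add: mult.commute)
qed

lemma continuous_on_conv:
  fixes f K :: "real^2 \<Rightarrow> 'a::{real_normed_field,banach,second_countable_topology}"
  assumes f: "integrable lborel f" and K: "continuous_on UNIV K" and B: "\<And>x. norm (K x) \<le> B"
  shows "continuous_on UNIV (conv f K)"
  unfolding continuous_on_sequentially comp_def
proof (intro ballI allI impI)
  fix x :: "nat \<Rightarrow> real^2" and a assume x: "(\<forall>n. x n \<in> UNIV) \<and> x \<longlonglongrightarrow> a"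
  have [measurable]: "K \<in> borel_measurable borel" by (rule borel_measurable_continuous_onI[OF K])
  have [measurable]: "f \<in> borel_measurable borel" using borel_measurable_integrable[OF f] by simp
  show "(\<lambda>n. conv f K (x n)) \<longlonglongrightarrow> conv f K a"
    unfolding conv_def
  proof (rule integral_dominated_convergence[where w="\<lambda>y. norm (f y) * B"])
    show "integrable lborel (\<lambda>y. norm (f y) * B)"
      using f by (intro integrable_mult_left integrable_norm)
    show "AE y in lborel. (\<lambda>n. f y * K (x n - y)) \<longlonglongrightarrow> f y * K (a - y)"
      using x by (intro AE_I2 tendsto_intros continuous_on_tendsto_compose[OF K]) auto
    show "AE y in lborel. norm (f y * K (x n - y)) \<le> norm (f y) * B" for n
      using B by (auto simp: norm_mult intro!: mult_left_mono)
  qed measurable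
qed

text \<open>All derivatives fall on the kernel, so mere integrability of \<open>f\<close> suffices.
  The difference quotients of \<open>K\<close> are bounded by the mean value inequality, which
  supplies the dominating function for passing to the limit under the integral.\<close>

lemma has_partials_conv:
  fixes f K :: "real^2 \<Rightarrow> 'a::{real_normed_field,banach,second_countable_topology}"
  assumes f: "integrable lborel f" and K: "has_partials K K1 K2"
    and B: "\<And>x. norm (K x) \<le> B" "\<And>x. norm (K1 x) \<le> B" "\<And>x. norm (K2 x) \<le> B"
  shows "has_partials (conv f K) (conv f K1) (conv f K2)"
proof -
  note [measurable] = has_partials_borel[OF K]
  have [measurable]: "f \<in> borel_measurable borel" using borel_measurable_integrable[OF f] by simp
  have B0: "B \<ge> 0" using B(1)[of 0] norm_ge_zero order_trans by blast
  have i: "integrable lborel (\<lambda>y. f y * K (x - y))" "integrable lborel (\<lambda>y. f y * K1 (x - y))"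
     "integrable lborel (\<lambda>y. f y * K2 (x - y))" for x
    using f B by (auto intro!: conv_integrable)
  have D: "norm ((h$1) *\<^sub>R K1 x + (h$2) *\<^sub>R K2 x) \<le> 2 * B * norm h" for h x
  proof -
    have "norm ((h$1) *\<^sub>R K1 x + (h$2) *\<^sub>R K2 x) \<le> \<bar>h$1\<bar> * norm (K1 x) + \<bar>h$2\<bar> * norm (K2 x)"
      by (rule order_trans[OF norm_triangle_ineq]) simp
    also have "\<dots> \<le> norm h * B + norm h * B"
      by (intro add_mono mult_mono B component_le_norm_cart) auto
    finally show ?thesis by simp
  qed
  have L: "norm (K (x + h) - K x) \<le> 2 * B * norm h" for x h
    using differentiable_bound[of UNIV K "\<lambda>x h. (h$1) *\<^sub>R K1 x + (h$2) *\<^sub>R K2 x" "2 * B" "x + h" x]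
      has_partialsD(1)[OF K] D by (auto intro!: onorm_le)
  have "(conv f K has_derivative (\<lambda>h. (h$1) *\<^sub>R conv f K1 x + (h$2) *\<^sub>R conv f K2 x)) (at x)" for x
    unfolding has_derivative_at
  proof (intro conjI)
    show "bounded_linear (\<lambda>h. (h$1) *\<^sub>R conv f K1 x + (h$2) *\<^sub>R conv f K2 x)"
      by (intro bounded_linear_add bounded_linear_compose[OF bounded_linear_scaleR_left bounded_linear_vec_nth])
    \<comment> \<open>Dominated convergence is a statement about sequences, so the limit h -> 0 is
      tested on an arbitrary null sequence of nonzero increments.\<close>
    have "(\<lambda>n. (conv f K (x + h n) - conv f K x - ((h n$1) *\<^sub>R conv f K1 x + (h n$2) *\<^sub>R conv f K2 x)) /\<^sub>R norm (h n)) \<longlonglongrightarrow> 0"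
      if h: "\<forall>n. h n \<noteq> 0" "h \<longlonglongrightarrow> 0" for h :: "nat \<Rightarrow> real^2"
    proof -
      let ?q = "\<lambda>n y. f y * ((K (x + h n - y) - K (x - y) - ((h n$1) *\<^sub>R K1 (x - y) + (h n$2) *\<^sub>R K2 (x - y))) /\<^sub>R norm (h n))"
      have eq: "(conv f K (x + h n) - conv f K x - ((h n$1) *\<^sub>R conv f K1 x + (h n$2) *\<^sub>R conv f K2 x)) /\<^sub>R norm (h n)
          = (LINT y|lborel. ?q n y)" for n
      proof -
        have "(LINT y|lborel. ?q n y) = (LINT y|lborel. (f y * K (x + h n - y) - f y * K (x - y) - ((h n$1) *\<^sub>R (f y * K1 (x - y)) + (h n$2) *\<^sub>R (f y * K2 (x - y)))) /\<^sub>R norm (h n))"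
          by (intro Bochner_Integration.integral_cong refl) (simp add: algebra_simps)
        note eq2 = this
        show ?thesis
          unfolding eq2 unfolding conv_def using i by simp
      qed
      have "(\<lambda>n. LINT y|lborel. ?q n y) \<longlonglongrightarrow> (LINT y|(lborel::(real^2) measure). 0)"
      proof (rule integral_dominated_convergence[where w="\<lambda>y. norm (f y) * (4 * B)"])
        show "integrable lborel (\<lambda>y. norm (f y) * (4 * B))"
          using f by (intro integrable_mult_left integrable_norm)
        show "AE y in lborel. (\<lambda>n. ?q n y) \<longlonglongrightarrow> 0"
        proof (intro AE_I2 tendsto_mult_right_zero)
          fix y
          have "((\<lambda>h. norm (K (x - y + h) - K (x - y) - ((h$1) *\<^sub>R K1 (x - y) + (h$2) *\<^sub>R K2 (x - y))) / norm h) \<longlongrightarrow> 0) (at 0)"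
            using has_partialsD(1)[OF K, of "x - y" UNIV] by (simp add: has_derivative_at)
          then have "(\<lambda>n. norm (K (x - y + h n) - K (x - y) - ((h n$1) *\<^sub>R K1 (x - y) + (h n$2) *\<^sub>R K2 (x - y))) / norm (h n)) \<longlonglongrightarrow> 0"
            using h unfolding tendsto_at_iff_sequentially comp_def by auto
          then show "(\<lambda>n. (K (x + h n - y) - K (x - y) - ((h n$1) *\<^sub>R K1 (x - y) + (h n$2) *\<^sub>R K2 (x - y))) /\<^sub>R norm (h n)) \<longlonglongrightarrow> 0"
            by (subst tendsto_norm_zero_iff[symmetric]) (simp add: divide_inverse mult.commute diff_add_eq)
        qed
        show "AE y in lborel. norm (?q n y) \<le> norm (f y) * (4 * B)" for n
        proof (intro AE_I2)
          fix y
          have "norm (K (x + h n - y) - K (x - y) - ((h n$1) *\<^sub>R K1 (x - y) + (h n$2) *\<^sub>R K2 (x - y))) \<le> 2 * B * norm (h n) + 2 * B * norm (h n)"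
            using L[of "x - y" "h n"] D[of "h n" "x - y"]
              norm_triangle_ineq4[of "K (x + h n - y) - K (x - y)" "(h n$1) *\<^sub>R K1 (x - y) + (h n$2) *\<^sub>R K2 (x - y)"]
            by (simp add: diff_add_eq)
          then have "norm (K (x + h n - y) - K (x - y) - ((h n$1) *\<^sub>R K1 (x - y) + (h n$2) *\<^sub>R K2 (x - y))) / norm (h n) \<le> 4 * B"
            using h by (simp add: field_simps)
          from mult_left_mono[OF this norm_ge_zero[of "f y"]] show "norm (?q n y) \<le> norm (f y) * (4 * B)"
            by (simp add: norm_mult divide_inverse mult_ac)
        qed
      qed measurable
      then show ?thesis by (simp add: eq)
    qed
    then have "((\<lambda>h. (conv f K (x + h) - conv f K x - ((h$1) *\<^sub>R conv f K1 x + (h$2) *\<^sub>R conv f K2 x)) /\<^sub>R norm h) \<longlongrightarrow> 0) (at 0)"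
      unfolding tendsto_at_iff_sequentially comp_def by auto
    then show "((\<lambda>h. norm (conv f K (x + h) - conv f K x - ((h$1) *\<^sub>R conv f K1 x + (h$2) *\<^sub>R conv f K2 x)) / norm h) \<longlongrightarrow> 0) (at 0)"
      by (subst (asm) tendsto_norm_zero_iff[symmetric]) (simp add: divide_inverse mult.commute)
  qed
  then show ?thesis
    unfolding has_partials_def
    using continuous_on_conv[OF f has_partialsD(3)[OF K] B(2)] continuous_on_conv[OF f has_partialsD(4)[OF K] B(3)] by blast
qed

text \<open>The induction runs over indicators of sets of finite measure, sums, and dominated
  pointwise limits. Only the indicator case has content; outer regularity reduces it to open
  sets.\<close>

lemma L1_translation_continuous:
  fixes f :: "'a::euclidean_space \<Rightarrow> 'b::{banach, second_countable_topology}"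
  assumes "integrable lborel f" "y \<longlonglongrightarrow> 0"
  shows "(\<lambda>n. LINT x|lborel. norm (f (x - y n) - f x)) \<longlonglongrightarrow> 0"
  using assms(1)
proof (induction rule: integrable_induct)
  case (base A c)
  have [measurable]: "A \<in> sets borel" using base by simp
  have iA: "integrable lborel (indicat_real A)" using base by simp
  show ?case
  proof (rule LIMSEQ_I)
    fix r :: real assume r: "r > 0"
    \<comment> \<open>The final estimate is 4 e |c|; the summand 1 keeps the denominator positive
      when c = 0.\<close>
    define e where "e = r / (4 * (norm c + 1))"
    have e: "e > 0" using r by (simp add: e_def add_nonneg_pos)
    obtain U where U: "open U" "A \<subseteq> U" "emeasure lborel (U - A) < e"
      using outer_regular_lborel[of A e] base e by auto
    have [measurable]: "U \<in> sets borel" using U by simp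
    have Ufin: "emeasure lborel (U - A) < \<infinity>"
      using less_trans[OF U(3) ennreal_less_top] by simp
    have iUA: "integrable lborel (indicat_real (U - A))"
      using Ufin by simp
    have "indicat_real U = (\<lambda>x. indicat_real (U - A) x + indicat_real A x)"
      using U(2) by (auto simp: indicator_def fun_eq_iff)
    then have iU: "integrable lborel (indicat_real U)"
      using iUA iA by simp
    have mUA: "(LINT x|lborel. indicat_real (U - A) x) < e"
    proof -
      have "emeasure lborel (U - A) = ennreal (measure lborel (U - A))"
        using Ufin by (intro emeasure_eq_ennreal_measure) auto
      then show ?thesis using U(3) by (simp add: ennreal_less_iff)
    qed
    \<comment> \<open>For open U only one half of the symmetric difference is controlled pointwise:
      a point of U stays in U under small shifts. The other half has the same measure, because U and
      its translate do. Below, with b and a the indicators of U at x and at the shifted point and h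
      = b (1 - a), this is |a - b| = 2 h + (a - b), where a - b integrates to 0.\<close>
    have "(\<lambda>n. LINT x|lborel. indicat_real U x * (1 - indicat_real U (x - y n))) \<longlonglongrightarrow> (LINT x|(lborel::'a measure). 0)"
    proof (rule integral_dominated_convergence[where w="indicat_real U"])
      show "AE x in lborel. (\<lambda>n. indicat_real U x * (1 - indicat_real U (x - y n))) \<longlonglongrightarrow> 0"
      proof (intro AE_I2)
        fix x
        show "(\<lambda>n. indicat_real U x * (1 - indicat_real U (x - y n))) \<longlonglongrightarrow> 0"
        proof (cases "x \<in> U")
          case True
          have "(\<lambda>n. x - y n) \<longlonglongrightarrow> x - 0" by (intro tendsto_intros assms)
          then have "eventually (\<lambda>n. x - y n \<in> U) sequentially"
            using True U(1) by (simp add: topological_tendstoD)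
          then have "eventually (\<lambda>n. indicat_real U x * (1 - indicat_real U (x - y n)) = 0) sequentially"
            by eventually_elim simp
          then show ?thesis by (rule tendsto_eventually)
        qed simp
      qed
    qed (use iU in \<open>auto simp: indicator_def\<close>)
    then have "(\<lambda>n. LINT x|lborel. indicat_real U x * (1 - indicat_real U (x - y n))) \<longlonglongrightarrow> 0" by simp
    then obtain N where N: "\<And>n. n \<ge> N \<Longrightarrow> \<bar>LINT x|lborel. indicat_real U x * (1 - indicat_real U (x - y n))\<bar> < e"
      using e unfolding LIMSEQ_def dist_norm by fastforce
    have "norm (LINT x|lborel. norm (indicat_real A (x - y n) *\<^sub>R c - indicat_real A x *\<^sub>R c)) < r" if "n \<ge> N" for n
    proof -
      let ?h = "\<lambda>x. indicat_real U x * (1 - indicat_real U (x - y n))"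
      have ih: "integrable lborel ?h"
        using iU by (rule Bochner_Integration.integrable_bound) (auto simp: indicator_def)
      have iUt: "integrable lborel (\<lambda>x. indicat_real U (x - y n))" and
         iUAt: "integrable lborel (\<lambda>x. indicat_real (U - A) (x - y n))"
        using integrable_translate[OF iU] integrable_translate[OF iUA] by auto
      have "(LINT x|lborel. norm (indicat_real A (x - y n) *\<^sub>R c - indicat_real A x *\<^sub>R c))
        \<le> (LINT x|lborel. norm c * (2 * ?h x + (indicat_real U (x - y n) - indicat_real U x) + (indicat_real (U - A) (x - y n) + indicat_real (U - A) x)))"
      proof (rule Bochner_Integration.integral_mono')
        show "integrable lborel (\<lambda>x. norm c * (2 * ?h x + (indicat_real U (x - y n) - indicat_real U x) + (indicat_real (U - A) (x - y n) + indicat_real (U - A) x)))"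
          using ih iUt iUAt iU iUA by simp
        show "norm (indicat_real A (x - y n) *\<^sub>R c - indicat_real A x *\<^sub>R c)
           \<le> norm c * (2 * ?h x + (indicat_real U (x - y n) - indicat_real U x) + (indicat_real (U - A) (x - y n) + indicat_real (U - A) x))" for x
          using U(2) by (auto simp: indicator_def)
      qed (auto simp: indicator_def)
      also have "\<dots> = norm c * (2 * (LINT x|lborel. ?h x) + ((LINT x|lborel. indicat_real U (x - y n)) - (LINT x|lborel. indicat_real U x))
           + ((LINT x|lborel. indicat_real (U - A) (x - y n)) + (LINT x|lborel. indicat_real (U - A) x)))"
        using ih iUt iUAt iU iUA by simp
      also have "\<dots> = norm c * (2 * (LINT x|lborel. ?h x) + 2 * (LINT x|lborel. indicat_real (U - A) x))"
        by (simp add: integral_translate[of "indicat_real U"] integral_translate[of "indicat_real (U - A)"])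
      also have "\<dots> \<le> norm c * (2 * e + 2 * e)"
        using N[OF that] mUA by (intro mult_left_mono add_mono) auto
      also have "\<dots> < (norm c + 1) * (4 * e)" using e by simp
      also have "\<dots> = r" using norm_ge_zero[of c] unfolding e_def by (simp add: field_simps add_nonneg_eq_0_iff)
      finally show ?thesis by simp
    qed
    then show "\<exists>N. \<forall>n\<ge>N. norm ((LINT x|lborel. norm (indicat_real A (x - y n) *\<^sub>R c - indicat_real A x *\<^sub>R c)) - 0) < r"
      by auto
  qed
next
  case (add f g)
  have i: "integrable lborel (\<lambda>x. norm (f (x - y n) - f x))" "integrable lborel (\<lambda>x. norm (g (x - y n) - g x))" for n
    using add by (auto intro!: integrable_norm Bochner_Integration.integrable_diff integrable_translate)
  have s: "(\<lambda>n. (LINT x|lborel. norm (f (x - y n) - f x)) + (LINT x|lborel. norm (g (x - y n) - g x))) \<longlonglongrightarrow> 0"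
    using tendsto_add[OF add(3,4)] by simp
  show ?case
  proof (rule tendsto_sandwich[OF _ _ tendsto_const s]; intro always_eventually allI)
    fix n
    have "(LINT x|lborel. norm (f (x - y n) + g (x - y n) - (f x + g x))) \<le> (LINT x|lborel. norm (f (x - y n) - f x) + norm (g (x - y n) - g x))"
    proof (rule Bochner_Integration.integral_mono')
      show "integrable lborel (\<lambda>x. norm (f (x - y n) - f x) + norm (g (x - y n) - g x))" using i by simp
      show "norm (f (x - y n) + g (x - y n) - (f x + g x)) \<le> norm (f (x - y n) - f x) + norm (g (x - y n) - g x)" for x
        using norm_triangle_ineq[of "f (x - y n) - f x" "g (x - y n) - g x"] by (simp add: algebra_simps)
    qed auto
    then show "(LINT x|lborel. norm (f (x - y n) + g (x - y n) - (f x + g x))) \<le> (LINT x|lborel. norm (f (x - y n) - f x)) + (LINT x|lborel. norm (g (x - y n) - g x))"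
      using i by simp
  qed simp
next
  case (lim f s)
  have ifs: "integrable lborel (\<lambda>x. f x - s k x)" for k using lim by simp
  have "(\<lambda>k. LINT x|lborel. norm (f x - s k x)) \<longlonglongrightarrow> (LINT x|(lborel::'a measure). 0)"
  proof (rule integral_dominated_convergence[where w="\<lambda>x. 3 * norm (f x)"])
    show "AE x in lborel. (\<lambda>k. norm (f x - s k x)) \<longlonglongrightarrow> 0"
    proof (intro AE_I2)
      fix x :: 'a assume "x \<in> space lborel"
      then have "(\<lambda>k. f x - s k x) \<longlonglongrightarrow> f x - f x" using lim(2) by (intro tendsto_intros) auto
      then show "(\<lambda>k. norm (f x - s k x)) \<longlonglongrightarrow> 0" using tendsto_norm_zero by fastforce
    qed
    show "AE x in lborel. norm (norm (f x - s k x)) \<le> 3 * norm (f x)" for k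
    proof (intro AE_I2)
      fix x :: 'a assume "x \<in> space lborel"
      then show "norm (norm (f x - s k x)) \<le> 3 * norm (f x)"
        using lim(3)[of x k] norm_triangle_ineq4[of "f x" "s k x"] by simp
    qed
  qed (use lim in auto)
  then have s0: "(\<lambda>k. LINT x|lborel. norm (f x - s k x)) \<longlonglongrightarrow> 0" by simp
  show ?case
  proof (rule LIMSEQ_I)
    fix r :: real assume r: "r > 0"
    then have "eventually (\<lambda>k. (LINT x|lborel. norm (f x - s k x)) < r / 4) sequentially"
      using order_tendstoD(2)[OF s0, of "r/4"] by simp
    then obtain k where k: "(LINT x|lborel. norm (f x - s k x)) < r / 4"
      by (auto simp: eventually_sequentially)
    obtain N where N: "\<And>n. n \<ge> N \<Longrightarrow> (LINT x|lborel. norm (s k (x - y n) - s k x)) < r / 4"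
      using order_tendstoD(2)[OF lim(5)[of k], of "r/4"] r by (auto simp: eventually_sequentially)
    have "norm (LINT x|lborel. norm (f (x - y n) - f x)) < r" if "n \<ge> N" for n
    proof -
      have ist: "integrable lborel (\<lambda>x. f (x - y n) - s k (x - y n))" using integrable_translate[OF ifs] .
      have isk: "integrable lborel (\<lambda>x. s k (x - y n) - s k x)" using lim(1) integrable_translate by (intro Bochner_Integration.integrable_diff) auto
      have "(LINT x|lborel. norm (f (x - y n) - f x)) \<le> (LINT x|lborel. norm (f (x - y n) - s k (x - y n)) + norm (s k (x - y n) - s k x) + norm (f x - s k x))"
      proof (rule Bochner_Integration.integral_mono')
        show "integrable lborel (\<lambda>x. norm (f (x - y n) - s k (x - y n)) + norm (s k (x - y n) - s k x) + norm (f x - s k x))"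
          using ifs[of k] ist isk by simp
        show "norm (f (x - y n) - f x) \<le> norm (f (x - y n) - s k (x - y n)) + norm (s k (x - y n) - s k x) + norm (f x - s k x)" for x
        proof -
          have "norm (f (x - y n) - f x) = norm ((f (x - y n) - s k (x - y n)) + (s k (x - y n) - s k x) - (f x - s k x))" by simp
          then show ?thesis
            using norm_triangle_ineq4[of "(f (x - y n) - s k (x - y n)) + (s k (x - y n) - s k x)" "f x - s k x"]
              norm_triangle_ineq[of "f (x - y n) - s k (x - y n)" "s k (x - y n) - s k x"] by linarith
        qed
      qed auto
      also have "\<dots> = (LINT x|lborel. norm (f (x - y n) - s k (x - y n))) + (LINT x|lborel. norm (s k (x - y n) - s k x)) + (LINT x|lborel. norm (f x - s k x))"
        using ifs[of k] ist isk by simp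
      also have "(LINT x|lborel. norm (f (x - y n) - s k (x - y n))) = (LINT x|lborel. norm (f x - s k x))"
        using borel_measurable_integrable[OF ifs[of k]] by (intro integral_translate[of "\<lambda>x. norm (f x - s k x)"]) simp
      finally have "(LINT x|lborel. norm (f (x - y n) - f x)) < r" using k N[OF that] r by simp
      then show ?thesis by simp
    qed
    then show "\<exists>N. \<forall>n\<ge>N. norm ((LINT x|lborel. norm (f (x - y n) - f x)) - 0) < r" by auto
  qed
qed

text \<open>Smoothness is not part of the definition: the same L^1 statements serve the smooth
  \<open>rho\<close> and the kernel \<open>cP\<close>, which is only continuous.\<close>

definition mollifier :: "real \<Rightarrow> (real^2 \<Rightarrow> real) \<Rightarrow> bool" where
  "mollifier \<delta> K \<longleftrightarrow> K \<in> borel_measurable borel \<and> (\<forall>x. 0 \<le> K x) \<and> bounded (range K) \<and>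
     (\<forall>x. norm x \<ge> \<delta> \<longrightarrow> K x = 0) \<and> (LINT x|lborel. K x) = 1"

lemma mollifierD:
  assumes "mollifier \<delta> K"
  shows "K \<in> borel_measurable borel" "\<And>x. 0 \<le> K x" "\<And>x. norm x \<ge> \<delta> \<Longrightarrow> K x = 0" "(LINT x|lborel. K x) = 1"
    "integrable lborel K" "\<exists>B. \<forall>x. norm (K x) \<le> B"
proof -
  show "K \<in> borel_measurable borel" "\<And>x. 0 \<le> K x" "\<And>x. norm x \<ge> \<delta> \<Longrightarrow> K x = 0"
    and i: "(LINT x|lborel. K x) = 1"
    using assms unfolding mollifier_def by blast+
  show "integrable lborel K" using i not_integrable_integral_eq[of lborel K] by fastforce
  show "\<exists>B. \<forall>x. norm (K x) \<le> B"
    using assms unfolding mollifier_def bounded_iff by blast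
qed

text \<open>The difference of the mollification and f is the average of the translation differences
  f(x - y) - f(x) with weight K(y). Tonelli moves the L^1 norm inside, where only |y| < \<delta>
  counts. Integrability comes out of the same estimate.\<close>

lemma mollify_L1_bound:
  fixes f :: "real^2 \<Rightarrow> 'a::{real_normed_field,banach,second_countable_topology}"
  assumes f: "integrable lborel f" and K: "mollifier \<delta> K"
    and tr: "\<And>y. norm y < \<delta> \<Longrightarrow> (LINT x|lborel. norm (f (x - y) - f x)) \<le> \<eta>"
  shows "(LINT x|lborel. norm (conv f (\<lambda>x. of_real (K x)) x - f x)) \<le> \<eta>"
    and "integrable lborel (conv f (\<lambda>x. of_real (K x)))"
proof -
  note [measurable] = mollifierD(1)[OF K]
  have [measurable]: "f \<in> borel_measurable borel" using borel_measurable_integrable[OF f] by simp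
  obtain B where B: "\<And>x. norm (K x) \<le> B" using mollifierD(6)[OF K] by blast
  let ?c = "conv f (\<lambda>x. of_real (K x))"
  have m: "?c \<in> borel_measurable borel" unfolding conv_def by measurable
  have iK: "integrable lborel (\<lambda>y. (of_real (K y) :: 'a))"
    using mollifierD(5)[OF K] by (rule integrable_of_real)
  have d: "ennreal (norm (?c x - f x)) \<le> (\<integral>\<^sup>+y. ennreal (norm (f (x - y) - f x)) * ennreal (K y) \<partial>lborel)" for x
  proof -
    have i1: "integrable lborel (\<lambda>y. f (x - y) * of_real (K y))"
      using integrable_reflect[OF conv_integrable[OF f, of "\<lambda>y. of_real (K y)" B x], of x] B by simp
    have i2: "integrable lborel (\<lambda>y. f x * of_real (K y))" using iK by simp
    have "f x = (LINT y|lborel. f x * of_real (K y))"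
      using mollifierD(4)[OF K] integral_bounded_linear[OF bounded_linear_of_real[where 'a='a] mollifierD(5)[OF K]] iK by simp
    then have "?c x - f x = (LINT y|lborel. f (x - y) * of_real (K y)) - (LINT y|lborel. f x * of_real (K y))"
      by (simp add: conv_commute)
    also have "\<dots> = (LINT y|lborel. (f (x - y) - f x) * of_real (K y))"
      using i1 i2 by (simp add: left_diff_distrib)
    also have "ennreal (norm \<dots>) \<le> (\<integral>\<^sup>+y. ennreal (norm ((f (x - y) - f x) * of_real (K y))) \<partial>lborel)"
      by (rule integral_norm_bound_ennreal) (use i1 i2 in \<open>simp add: left_diff_distrib\<close>)
    also have "\<dots> = (\<integral>\<^sup>+y. ennreal (norm (f (x - y) - f x)) * ennreal (K y) \<partial>lborel)"
      using mollifierD(2)[OF K] by (simp add: norm_mult ennreal_mult)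
    finally show ?thesis .
  qed
  \<comment> \<open>A kernel of integral 1 cannot vanish identically, so \<delta> > 0 and the
    hypothesis applies to y = 0.\<close>
  have \<eta>: "0 \<le> \<eta>"
  proof -
    have "\<not> \<delta> \<le> 0"
    proof
      assume "\<delta> \<le> 0"
      then have "K x = 0" for x using mollifierD(3)[OF K, of x] norm_ge_zero[of x] by linarith
      then have "K = (\<lambda>x. 0)" by blast
      then show False using mollifierD(4)[OF K] by simp
    qed
    then have "(LINT x|lborel. norm (f (x - 0) - f x)) \<le> \<eta>" by (intro tr) auto
    then show ?thesis by simp
  qed
  have "(\<integral>\<^sup>+x. ennreal (norm (?c x - f x)) \<partial>lborel) \<le> (\<integral>\<^sup>+x. \<integral>\<^sup>+y. ennreal (norm (f (x - y) - f x)) * ennreal (K y) \<partial>lborel \<partial>lborel)"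
    by (intro nn_integral_mono d)
  also have "\<dots> = (\<integral>\<^sup>+y. \<integral>\<^sup>+x. ennreal (norm (f (x - y) - f x)) * ennreal (K y) \<partial>lborel \<partial>lborel)"
    by (rule lborel_pair.Fubini'[symmetric]) measurable
  also have "\<dots> \<le> (\<integral>\<^sup>+y. ennreal \<eta> * ennreal (K y) \<partial>lborel)"
  proof (intro nn_integral_mono)
    fix y
    show "(\<integral>\<^sup>+x. ennreal (norm (f (x - y) - f x)) * ennreal (K y) \<partial>lborel) \<le> ennreal \<eta> * ennreal (K y)"
    proof (cases "norm y < \<delta>")
      case True
      have "(\<integral>\<^sup>+x. ennreal (norm (f (x - y) - f x)) \<partial>lborel) = ennreal (LINT x|lborel. norm (f (x - y) - f x))"
        using f by (intro nn_integral_eq_integral) (auto intro!: integrable_norm Bochner_Integration.integrable_diff integrable_translate)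
      also have "\<dots> \<le> ennreal \<eta>" using tr[OF True] by (rule ennreal_leI)
      finally show ?thesis by (simp add: nn_integral_multc mult_right_mono)
    next
      case False
      then show ?thesis using mollifierD(3)[OF K, of y] by simp
    qed
  qed
  also have "\<dots> = ennreal \<eta> * (\<integral>\<^sup>+y. ennreal (K y) \<partial>lborel)" by (rule nn_integral_cmult) measurable
  also have "(\<integral>\<^sup>+y. ennreal (K y) \<partial>lborel) = 1"
    using mollifierD[OF K] by (subst nn_integral_eq_integral) auto
  finally have fin: "(\<integral>\<^sup>+x. ennreal (norm (?c x - f x)) \<partial>lborel) \<le> ennreal \<eta>" by simp
  have i: "integrable lborel (\<lambda>x. ?c x - f x)"
    using m fin by (intro integrableI_bounded) (auto simp: top_unique le_less_trans[OF _ ennreal_less_top])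
  have "ennreal (LINT x|lborel. norm (?c x - f x)) = (\<integral>\<^sup>+x. ennreal (norm (?c x - f x)) \<partial>lborel)"
    using i by (intro nn_integral_eq_integral[symmetric]) auto
  with fin show "(LINT x|lborel. norm (?c x - f x)) \<le> \<eta>"
    using \<eta> by (metis ennreal_le_iff)
  show "integrable lborel ?c"
    using Bochner_Integration.integrable_add[OF i f] by simp
qed

theorem mollify_L1_tendsto:
  fixes f :: "real^2 \<Rightarrow> 'a::{real_normed_field,banach,second_countable_topology}"
  assumes f: "integrable lborel f" and K: "\<And>n. mollifier (\<delta> n) (K n)" and \<delta>: "\<delta> \<longlonglongrightarrow> 0"
  shows "(\<lambda>n. LINT x|lborel. norm (conv f (\<lambda>x. of_real (K n x)) x - f x)) \<longlonglongrightarrow> 0"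
proof (rule LIMSEQ_I)
  fix r :: real assume r: "r > 0"
  \<comment> \<open>Continuity of translation is available for sequences; uniformity for small y
    follows by contradiction, with counterexamples y n of norm below 1/(n+1).\<close>
  have "\<exists>d>0. \<forall>y. norm y < d \<longrightarrow> (LINT x|lborel. norm (f (x - y) - f x)) \<le> r / 2"
  proof (rule ccontr)
    assume "\<not> ?thesis"
    then have "\<exists>y. norm y < d \<and> (LINT x|lborel. norm (f (x - y) - f x)) > r / 2" if "d > 0" for d
      using that by (meson not_le)
    then have "\<exists>y. norm y < inverse (real (Suc n)) \<and> (LINT x|lborel. norm (f (x - y) - f x)) > r / 2" for n
      by simp
    then have "\<forall>n. \<exists>y. norm y < inverse (real (Suc n)) \<and> (LINT x|lborel. norm (f (x - y) - f x)) > r / 2" by blast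
    from choice[OF this] obtain y where y: "\<And>n. norm (y n) < inverse (real (Suc n))" "\<And>n. (LINT x|lborel. norm (f (x - y n) - f x)) > r / 2"
      by blast
    have "y \<longlonglongrightarrow> 0"
      using y(1) by (intro Lim_null_comparison[OF _ LIMSEQ_inverse_real_of_nat] always_eventually) (auto intro: less_imp_le)
    from L1_translation_continuous[OF f this] have "eventually (\<lambda>n. (LINT x|lborel. norm (f (x - y n) - f x)) < r / 2) sequentially"
      using r by (intro order_tendstoD) auto
    then obtain n where "(LINT x|lborel. norm (f (x - y n) - f x)) < r / 2"
      by (auto simp: eventually_sequentially)
    with y(2)[of n] show False by simp
  qed
  then obtain d where d: "d > 0" "\<And>y. norm y < d \<Longrightarrow> (LINT x|lborel. norm (f (x - y) - f x)) \<le> r / 2" by blast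
  obtain N where N: "\<And>n. n \<ge> N \<Longrightarrow> \<delta> n < d"
    using order_tendstoD(2)[OF \<delta> d(1)] by (auto simp: eventually_sequentially)
  have "norm ((LINT x|lborel. norm (conv f (\<lambda>x. of_real (K n x)) x - f x)) - 0) < r" if "n \<ge> N" for n
  proof -
    have "(LINT x|lborel. norm (conv f (\<lambda>x. of_real (K n x)) x - f x)) \<le> r / 2"
      using N[OF that] by (intro mollify_L1_bound(1)[OF f K] d) auto
    then show ?thesis using r by simp
  qed
  then show "\<exists>N. \<forall>n\<ge>N. norm ((LINT x|lborel. norm (conv f (\<lambda>x. of_real (K n x)) x - f x)) - 0) < r" by blast
qed

section \<open>The Cauchy kernel\<close>

text \<open>Two formulas that match to first order at the junction give a differentiable function.
  The profile \<open>cm\<close> and the truncated square (max 0 t)^2 are handled in this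
  way.\<close>

lemma DERIV_glue:
  fixes f g :: "real \<Rightarrow> real"
  assumes f: "\<And>x. x \<le> a \<Longrightarrow> (f has_real_derivative f' x) (at x)"
    and g: "\<And>x. x \<ge> a \<Longrightarrow> (g has_real_derivative g' x) (at x)"
    and "f a = g a" "f' a = g' a"
  shows "((\<lambda>x. if x \<le> a then f x else g x) has_real_derivative (if x \<le> a then f' x else g' x)) (at x)"
proof -
  have [simp]: "{..a} \<union> {a<..} = UNIV" by auto
  have "((\<lambda>x. if x \<in> {..a} then f x else g x) has_vector_derivative (if x \<in> {..a} then f' x else g' x)) (at x within UNIV)"
  proof (rule has_vector_derivative_If_within_closures[of x "{..a}" "{a<..}"])
    show "(f has_vector_derivative f' x) (at x within {..a} \<union> closure {..a} \<inter> closure {a<..})"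
      if "x \<in> {..a} \<union> closure {..a} \<inter> closure {a<..}"
    proof -
      have "x \<le> a" using that by auto
      from f[OF this] have "(f has_vector_derivative f' x) (at x)"
        by (simp add: has_real_derivative_iff_has_vector_derivative)
      then show ?thesis by (rule has_vector_derivative_at_within)
    qed
    show "(g has_vector_derivative g' x) (at x within {a<..} \<union> closure {..a} \<inter> closure {a<..})"
      if "x \<in> {a<..} \<union> closure {..a} \<inter> closure {a<..}"
    proof -
      have "x \<ge> a" using that by auto
      from g[OF this] have "(g has_vector_derivative g' x) (at x)"
        by (simp add: has_real_derivative_iff_has_vector_derivative)
      then show ?thesis by (rule has_vector_derivative_at_within)
    qed
    show "f x = g x" "f' x = g' x" if "x \<in> closure {..a}" "x \<in> closure {a<..}"
    proof -
      have "x = a" using that by auto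
      then show "f x = g x" "f' x = g' x" using assms(3,4) by auto
    qed
  qed auto
  then show ?thesis by (simp add: has_real_derivative_iff_has_vector_derivative)
qed

lemma continuous_glue:
  fixes f g :: "real \<Rightarrow> real"
  assumes "continuous_on {..a} f" "continuous_on {a..} g" "f a = g a"
  shows "continuous_on UNIV (\<lambda>x. if x \<le> a then f x else g x)"
proof -
  have "continuous_on ({..a} \<union> {a..}) (\<lambda>x. if x \<le> a then f x else g x)"
    by (rule continuous_on_If) (use assms in auto)
  moreover have "{..a} \<union> {a..} = UNIV" by auto
  ultimately show ?thesis by simp
qed

definition zc :: "real^2 \<Rightarrow> complex" where "zc x = Complex (x$1) (x$2)"

lemma norm_zc [simp]: "norm (zc x) = norm x"
  by (simp add: zc_def cmod_def norm_vec_def L2_set_def sum_2)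

lemma zc_simps [simp]: "zc (x - y) = zc x - zc y" "zc (x + y) = zc x + zc y" "zc 0 = 0" "zc x = 0 \<longleftrightarrow> x = 0"
  by (auto simp: zc_def complex_eq_iff vec_eq_iff forall_2)

definition dbar :: "(real^2 \<Rightarrow> complex) \<Rightarrow> (real^2 \<Rightarrow> complex) \<Rightarrow> real^2 \<Rightarrow> complex" where
  "dbar f1 f2 x = (f1 x + \<i> * f2 x) / 2"

text \<open>\<open>ck \<epsilon>\<close> is a \<open>C\<^sup>1\<close> regularisation of the Cauchy kernel \<open>1/z\<close>. It agrees with \<open>1/z\<close> for
  \<open>\<bar>z\<bar> \<ge> \<epsilon>\<close>, and its \<open>dbar\<close>-derivative \<open>cP \<epsilon>\<close> is, up to a constant, an approximate identity.\<close>

definition cm :: "real \<Rightarrow> real \<Rightarrow> real" where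
  "cm \<epsilon> s = (if s \<le> \<epsilon>\<^sup>2 then (2 * \<epsilon>\<^sup>2 - s) / \<epsilon>^4 else 1 / s)"

definition cm' :: "real \<Rightarrow> real \<Rightarrow> real" where
  "cm' \<epsilon> s = (if s \<le> \<epsilon>\<^sup>2 then - 1 / \<epsilon>^4 else - 1 / s\<^sup>2)"

definition ck :: "real \<Rightarrow> real^2 \<Rightarrow> complex" where
  "ck \<epsilon> x = cnj (zc x) * of_real (cm \<epsilon> ((norm x)\<^sup>2))"

definition ck1 :: "real \<Rightarrow> real^2 \<Rightarrow> complex" where
  "ck1 \<epsilon> x = of_real (cm \<epsilon> ((norm x)\<^sup>2)) + cnj (zc x) * of_real (2 * x$1 * cm' \<epsilon> ((norm x)\<^sup>2))"

definition ck2 :: "real \<Rightarrow> real^2 \<Rightarrow> complex" where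
  "ck2 \<epsilon> x = - \<i> * of_real (cm \<epsilon> ((norm x)\<^sup>2)) + cnj (zc x) * of_real (2 * x$2 * cm' \<epsilon> ((norm x)\<^sup>2))"

definition cP :: "real \<Rightarrow> real^2 \<Rightarrow> real" where
  "cP \<epsilon> x = (if (norm x)\<^sup>2 \<le> \<epsilon>\<^sup>2 then 2 * (\<epsilon>\<^sup>2 - (norm x)\<^sup>2) / \<epsilon>^4 else 0)"

text \<open>For s \<le> \<epsilon>^2 the function \<open>cm\<close> is the tangent line of 1/s at s
  = \<epsilon>^2. Value and slope therefore match at the junction and the profile is C^1.\<close>

lemma cm_derivative:
  assumes "\<epsilon> > 0"
  shows "(cm \<epsilon> has_real_derivative cm' \<epsilon> s) (at s)" "continuous_on UNIV (cm' \<epsilon>)"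
proof -
  define a where "a = \<epsilon>\<^sup>2"
  have a: "a > 0" using assms by (simp add: a_def)
  have cm: "cm \<epsilon> = (\<lambda>s. if s \<le> a then (2 * a - s) / a\<^sup>2 else 1 / s)"
    and cm': "cm' \<epsilon> = (\<lambda>s. if s \<le> a then - 1 / a\<^sup>2 else - 1 / s\<^sup>2)"
  proof -
    have e4: "\<epsilon>^4 = a\<^sup>2" by (simp add: a_def)
    show "cm \<epsilon> = (\<lambda>s. if s \<le> a then (2 * a - s) / a\<^sup>2 else 1 / s)"
      "cm' \<epsilon> = (\<lambda>s. if s \<le> a then - 1 / a\<^sup>2 else - 1 / s\<^sup>2)"
      unfolding cm_def[abs_def] cm'_def[abs_def] e4 a_def[symmetric] by (rule refl)+
  qed
  show "(cm \<epsilon> has_real_derivative cm' \<epsilon> s) (at s)"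
    unfolding cm cm'
  proof (rule DERIV_glue)
    show "((\<lambda>s. (2 * a - s) / a\<^sup>2) has_real_derivative - 1 / a\<^sup>2) (at x)" for x
    proof -
      have "((\<lambda>s. (2 * a - s) / a\<^sup>2) has_real_derivative (0 - 1) / a\<^sup>2) (at x)"
        by (intro DERIV_cdivide DERIV_diff DERIV_const DERIV_ident)
      then show ?thesis by simp
    qed
    show "((\<lambda>s. 1 / s) has_real_derivative - 1 / x\<^sup>2) (at x)" if "a \<le> x" for x
      using that a by (auto intro!: derivative_eq_intros simp: power2_eq_square)
    show "(2 * a - a) / a\<^sup>2 = 1 / a" using a by (simp add: power2_eq_square)
  qed simp
  show "continuous_on UNIV (cm' \<epsilon>)"
    unfolding cm'
    by (rule continuous_glue) (use a in \<open>auto intro!: continuous_intros\<close>)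
qed

lemma has_partials_cnj_zc: "has_partials (\<lambda>x. cnj (zc x)) (\<lambda>x. 1) (\<lambda>x. - \<i>)"
proof -
  have "linear (\<lambda>x. cnj (zc x))"
    by (intro linearI) (auto simp: zc_def complex_eq_iff)
  then have "((\<lambda>x. cnj (zc x)) has_derivative (\<lambda>x. cnj (zc x))) (at x)" for x
    by (intro bounded_linear_imp_has_derivative) (simp add: linear_conv_bounded_linear)
  moreover have "cnj (zc h) = (h$1) *\<^sub>R 1 + (h$2) *\<^sub>R (- \<i>)" for h
    by (auto simp: zc_def complex_eq_iff)
  ultimately show ?thesis
    unfolding has_partials_def by simp
qed

lemma has_partials_ck:
  assumes "\<epsilon> > 0"
  shows "has_partials (ck \<epsilon>) (ck1 \<epsilon>) (ck2 \<epsilon>)"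
proof -
  have "has_partials (\<lambda>x::real^2. cm \<epsilon> ((norm x)\<^sup>2)) (\<lambda>x. 2 * x$1 * cm' \<epsilon> ((norm x)\<^sup>2)) (\<lambda>x. 2 * x$2 * cm' \<epsilon> ((norm x)\<^sup>2))"
    using has_partials_radial[where z=0, OF cm_derivative[OF assms]] by simp
  from has_partials_bounded_linear[OF bounded_linear_of_real this]
  have "has_partials (\<lambda>x::real^2. complex_of_real (cm \<epsilon> ((norm x)\<^sup>2))) (\<lambda>x. of_real (2 * x$1 * cm' \<epsilon> ((norm x)\<^sup>2))) (\<lambda>x. of_real (2 * x$2 * cm' \<epsilon> ((norm x)\<^sup>2)))" .
  from has_partials_mult[OF has_partials_cnj_zc this] show ?thesis
    by (simp add: ck_def[abs_def] ck1_def[abs_def] ck2_def[abs_def])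
qed

text \<open>A tangent line of the convex function 1/s lies below it, which is the bound
  \<open>s * cm \<epsilon> s \<le> 1\<close>: the regularised kernel never exceeds the singular one.
  The last two bounds make \<open>ck\<close> and its partials bounded for fixed \<epsilon>.\<close>

lemma cm_ineq:
  assumes "\<epsilon> > 0" "s \<ge> 0"
  shows "0 \<le> cm \<epsilon> s" "s * cm \<epsilon> s \<le> 1" "cm \<epsilon> s \<le> 2 / \<epsilon>\<^sup>2" "s * \<bar>cm' \<epsilon> s\<bar> \<le> 1 / \<epsilon>\<^sup>2"
proof -
  define a where "a = \<epsilon>\<^sup>2"
  have a: "a > 0" using assms by (simp add: a_def)
  have cm: "cm \<epsilon> s = (if s \<le> a then (2 * a - s) / a\<^sup>2 else 1 / s)"
    and cm': "cm' \<epsilon> s = (if s \<le> a then - 1 / a\<^sup>2 else - 1 / s\<^sup>2)"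
    by (simp_all add: cm_def cm'_def a_def)
  show "0 \<le> cm \<epsilon> s" using assms a by (auto simp: cm)
  have sq: "0 \<le> (s - a)\<^sup>2" by simp
  show "s * cm \<epsilon> s \<le> 1"
  proof (cases "s \<le> a")
    case True
    have "s * (2 * a - s) \<le> a\<^sup>2" using sq by (simp add: power2_eq_square algebra_simps)
    then show ?thesis using True a by (simp add: cm)
  next
    case False
    then show ?thesis using a by (simp add: cm)
  qed
  show "cm \<epsilon> s \<le> 2 / \<epsilon>\<^sup>2"
  proof (cases "s \<le> a")
    case True
    have "(2 * a - s) / a\<^sup>2 \<le> (2 * a) / a\<^sup>2" using assms by (intro divide_right_mono) auto
    also have "\<dots> = 2 / a" using a by (simp add: power2_eq_square)
    finally show ?thesis using True by (simp add: cm a_def)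
  next
    case False
    then have "1 / s \<le> 1 / a" using a by (intro divide_left_mono) auto
    also have "\<dots> \<le> 2 / a" using a by (intro divide_right_mono) auto
    finally show ?thesis using False by (simp add: cm a_def)
  qed
  show "s * \<bar>cm' \<epsilon> s\<bar> \<le> 1 / \<epsilon>\<^sup>2"
  proof (cases "s \<le> a")
    case True
    have "s * (1 / a\<^sup>2) \<le> a * (1 / a\<^sup>2)" using True by (intro mult_right_mono) auto
    also have "\<dots> = 1 / a" using a by (simp add: power2_eq_square)
    finally show ?thesis using True a by (simp add: cm' a_def)
  next
    case False
    then have "s * (1 / s\<^sup>2) = 1 / s" using a by (simp add: power2_eq_square)
    also have "\<dots> \<le> 1 / a" using False a by (intro divide_left_mono) auto
    finally show ?thesis using False a by (simp add: cm' a_def)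
  qed
qed

lemma norm_ck_le: "\<epsilon> > 0 \<Longrightarrow> norm (ck \<epsilon> x) \<le> inverse (norm x)"
  using cm_ineq(1,2)[of \<epsilon> "(norm x)\<^sup>2"]
  by (cases "x = 0") (auto simp: ck_def norm_mult field_simps power2_eq_square)

lemma ck_far: "\<epsilon> > 0 \<Longrightarrow> norm x \<ge> \<epsilon> \<Longrightarrow> ck \<epsilon> x = inverse (zc x)"
proof -
  assume e: "\<epsilon> > 0" and x: "norm x \<ge> \<epsilon>"
  have x2: "\<epsilon>\<^sup>2 \<le> (norm x)\<^sup>2" using e x by (intro power_mono) auto
  have nz: "zc x \<noteq> 0" using e x by auto
  have "cm \<epsilon> ((norm x)\<^sup>2) = 1 / (norm x)\<^sup>2"
  proof (cases "(norm x)\<^sup>2 = \<epsilon>\<^sup>2")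
    case True
    have "cm \<epsilon> (\<epsilon>\<^sup>2) = \<epsilon>\<^sup>2 / (\<epsilon>\<^sup>2 * \<epsilon>\<^sup>2)" by (simp add: cm_def flip: power_add)
    moreover have "\<epsilon>\<^sup>2 / (\<epsilon>\<^sup>2 * \<epsilon>\<^sup>2) = 1 / \<epsilon>\<^sup>2"
      using e by (intro nonzero_divide_mult_cancel_left) simp
    ultimately show ?thesis using True by (simp only:)
  qed (use x2 in \<open>auto simp: cm_def\<close>)
  then have "ck \<epsilon> x = cnj (zc x) / of_real ((norm (zc x))\<^sup>2)"
    by (simp add: ck_def)
  also have "\<dots> = inverse (zc x)"
    using nz by (simp only: complex_norm_square) (simp add: field_simps)
  finally show ?thesis .
qed

lemma norm_ck_bounds:
  assumes "\<epsilon> > 0"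
  shows "norm (ck \<epsilon> x) \<le> 2 / \<epsilon>" "norm (ck1 \<epsilon> x) \<le> 4 / \<epsilon>\<^sup>2" "norm (ck2 \<epsilon> x) \<le> 4 / \<epsilon>\<^sup>2"
proof -
  note c = cm_ineq[OF assms, of "(norm x)\<^sup>2"]
  show "norm (ck \<epsilon> x) \<le> 2 / \<epsilon>"
  proof (cases "norm x \<le> \<epsilon>")
    case True
    have "norm (ck \<epsilon> x) \<le> \<epsilon> * (2 / \<epsilon>\<^sup>2)"
    proof -
      have "norm x * cm \<epsilon> ((norm x)\<^sup>2) \<le> \<epsilon> * (2 / \<epsilon>\<^sup>2)"
        by (rule mult_mono) (use c True assms in auto)
      then show ?thesis using c(1) by (simp add: ck_def norm_mult)
    qed
    then show ?thesis using assms by (simp add: power2_eq_square)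
  next
    case False
    have "norm (ck \<epsilon> x) \<le> inverse (norm x)" by (rule norm_ck_le[OF assms])
    also have "\<dots> \<le> inverse \<epsilon>" using False assms by (intro le_imp_inverse_le) auto
    also have "\<dots> \<le> 2 / \<epsilon>" using assms by (simp add: divide_inverse)
    finally show ?thesis .
  qed
  have k: "norm (cnj (zc x) * of_real (2 * x$i * cm' \<epsilon> ((norm x)\<^sup>2))) \<le> 2 / \<epsilon>\<^sup>2" for i
  proof -
    have "norm (cnj (zc x) * of_real (2 * x$i * cm' \<epsilon> ((norm x)\<^sup>2))) = 2 * (norm x * \<bar>x$i\<bar> * \<bar>cm' \<epsilon> ((norm x)\<^sup>2)\<bar>)"
      by (simp add: norm_mult abs_mult)
    also have "\<dots> \<le> 2 * (norm x * norm x * \<bar>cm' \<epsilon> ((norm x)\<^sup>2)\<bar>)"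
      by (intro mult_left_mono mult_right_mono component_le_norm_cart) auto
    also have "\<dots> \<le> 2 * (1 / \<epsilon>\<^sup>2)" using c(4) by (intro mult_left_mono) (auto simp: power2_eq_square)
    finally show ?thesis by simp
  qed
  show "norm (ck1 \<epsilon> x) \<le> 4 / \<epsilon>\<^sup>2"
    unfolding ck1_def by (rule order_trans[OF norm_triangle_ineq]) (use c k[of 1] in simp)
  show "norm (ck2 \<epsilon> x) \<le> 4 / \<epsilon>\<^sup>2"
    unfolding ck2_def by (rule order_trans[OF norm_triangle_ineq]) (use c k[of 2] in \<open>simp add: norm_mult\<close>)
qed

lemma ck_bounded:
  assumes "\<epsilon> > 0"
  obtains B where "\<And>x. norm (ck \<epsilon> x) \<le> B" "\<And>x. norm (ck1 \<epsilon> x) \<le> B" "\<And>x. norm (ck2 \<epsilon> x) \<le> B"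
proof
  fix x
  show "norm (ck \<epsilon> x) \<le> max (2 / \<epsilon>) (4 / \<epsilon>\<^sup>2)" "norm (ck1 \<epsilon> x) \<le> max (2 / \<epsilon>) (4 / \<epsilon>\<^sup>2)" "norm (ck2 \<epsilon> x) \<le> max (2 / \<epsilon>) (4 / \<epsilon>\<^sup>2)"
    using norm_ck_bounds[OF assms, of x] by auto
qed

text \<open>Since dbar of the conjugate of z is 1 and dbar of |z|^2 is z, the kernel has the
  derivative m(s) + s m'(s) at s = |z|^2, with m the profile. This vanishes for m(s) = 1/s, so only
  the disc where the kernel was regularised contributes.\<close>

lemma dbar_ck: "\<epsilon> > 0 \<Longrightarrow> dbar (ck1 \<epsilon>) (ck2 \<epsilon>) x = of_real (cP \<epsilon> x)"
proof -
  assume e: "\<epsilon> > 0"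
  have "dbar (ck1 \<epsilon>) (ck2 \<epsilon>) x = of_real (cm \<epsilon> ((norm x)\<^sup>2)) + cnj (zc x) * zc x * of_real (cm' \<epsilon> ((norm x)\<^sup>2))"
    by (auto simp: dbar_def ck1_def ck2_def complex_eq_iff zc_def algebra_simps)
  also have "cnj (zc x) * zc x = of_real ((norm x)\<^sup>2)"
    by (metis complex_norm_square mult.commute norm_zc)
  also have "of_real (cm \<epsilon> ((norm x)\<^sup>2)) + of_real ((norm x)\<^sup>2) * of_real (cm' \<epsilon> ((norm x)\<^sup>2)) = complex_of_real (cm \<epsilon> ((norm x)\<^sup>2) + (norm x)\<^sup>2 * cm' \<epsilon> ((norm x)\<^sup>2))"
    by simp
  also have "cm \<epsilon> ((norm x)\<^sup>2) + (norm x)\<^sup>2 * cm' \<epsilon> ((norm x)\<^sup>2) = cP \<epsilon> x"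
  proof -
    define a where "a = \<epsilon>\<^sup>2"
    define t where "t = (norm x)\<^sup>2"
    have a: "a > 0" using e by (simp add: a_def)
    have e4: "\<epsilon>^4 = a\<^sup>2" by (simp add: a_def)
    have "t * (1 / t\<^sup>2) = 1 / t" by (simp add: power2_eq_square)
    moreover have "(2 * a - t) / a\<^sup>2 + t * (- 1 / a\<^sup>2) = 2 * (a - t) / a\<^sup>2"
      by (simp add: diff_divide_distrib)
    ultimately show ?thesis
      unfolding cm_def cm'_def cP_def e4 a_def[symmetric] t_def[symmetric] by simp
  qed
  finally show ?thesis .
qed

lemma cP_measurable [measurable]: "cP \<epsilon> \<in> borel_measurable borel"
  unfolding cP_def[abs_def] by measurable

lemma cP_bounds:
  assumes "\<epsilon> > 0"
  shows "0 \<le> cP \<epsilon> x" "cP \<epsilon> x \<le> 2 / \<epsilon>\<^sup>2" "norm x \<ge> \<epsilon> \<Longrightarrow> cP \<epsilon> x = 0" "norm x \<le> \<epsilon> / 2 \<Longrightarrow> cP \<epsilon> x \<ge> 3 / (2 * \<epsilon>\<^sup>2)"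
proof -
  define a where "a = \<epsilon>\<^sup>2"
  have a: "a > 0" using assms by (simp add: a_def)
  have cP: "cP \<epsilon> x = (if (norm x)\<^sup>2 \<le> a then 2 * (a - (norm x)\<^sup>2) / a\<^sup>2 else 0)"
    by (simp add: cP_def a_def)
  show "0 \<le> cP \<epsilon> x" by (auto simp: cP)
  have "2 * (a - (norm x)\<^sup>2) / a\<^sup>2 \<le> 2 * a / a\<^sup>2" by (intro divide_right_mono) auto
  also have "\<dots> = 2 / a" using a by (simp add: power2_eq_square)
  finally show "cP \<epsilon> x \<le> 2 / \<epsilon>\<^sup>2" using a by (simp add: cP a_def)
  show "cP \<epsilon> x = 0" if "norm x \<ge> \<epsilon>"
  proof -
    have "\<epsilon>\<^sup>2 \<le> (norm x)\<^sup>2" using assms that by (intro power_mono) auto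
    then show ?thesis by (auto simp: cP_def)
  qed
  show "cP \<epsilon> x \<ge> 3 / (2 * \<epsilon>\<^sup>2)" if "norm x \<le> \<epsilon> / 2"
  proof -
    have "(norm x)\<^sup>2 \<le> (\<epsilon> / 2)\<^sup>2" using that by (intro power_mono) auto
    then have n: "(norm x)\<^sup>2 \<le> a / 4" by (simp add: a_def power_divide)
    have "3 / (2 * a) = 2 * (a - a / 4) / a\<^sup>2" using a by (simp add: power2_eq_square field_simps)
    also have "\<dots> \<le> 2 * (a - (norm x)\<^sup>2) / a\<^sup>2" using n by (intro divide_right_mono) auto
    also have "\<dots> = cP \<epsilon> x" using n a by (simp add: cP)
    finally show ?thesis by (simp only: a_def)
  qed
qed

definition cc :: "real \<Rightarrow> real" where "cc \<epsilon> = (LINT x|lborel. cP \<epsilon> x)"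

lemma content_ball_2: "r \<ge> 0 \<Longrightarrow> measure lborel (ball (z::real^2) r) = pi * r\<^sup>2"
  and emeasure_ball_2: "r \<ge> 0 \<Longrightarrow> emeasure lborel (ball (z::real^2) r) = ennreal (pi * r\<^sup>2)"
proof -
  assume "r \<ge> 0"
  then show "emeasure lborel (ball (z::real^2) r) = ennreal (pi * r\<^sup>2)"
    by (simp add: emeasure_ball unit_ball_vol_2)
  then show "measure lborel (ball (z::real^2) r) = pi * r\<^sup>2"
    by (simp add: measure_def)
qed

lemma integrable_indicator_ball: "integrable lborel (\<lambda>x. indicat_real (ball (z::real^2) r) x * c)"
  using emeasure_lborel_ball_finite[of z r] by (intro integrable_mult_left integrable_real_indicator) auto

lemma integrable_bounded_support:
  fixes f :: "real^2 \<Rightarrow> 'a::{banach,second_countable_topology}"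
  assumes [measurable]: "f \<in> borel_measurable borel" and "\<And>x. norm (f x) \<le> B" and "\<And>x. x \<notin> ball z r \<Longrightarrow> f x = 0"
  shows "integrable lborel f"
proof (rule Bochner_Integration.integrable_bound[OF integrable_indicator_ball[of z r B]])
  show "AE x in lborel. norm (f x) \<le> norm (indicat_real (ball z r) x * B)"
  proof (intro AE_I2)
    fix x
    show "norm (f x) \<le> norm (indicat_real (ball z r) x * B)"
      using assms(2)[of x] assms(3)[of x] by (cases "x \<in> ball z r") simp_all
  qed
qed simp

lemma integrable_cP: "\<epsilon> > 0 \<Longrightarrow> integrable lborel (cP \<epsilon>)"
  by (rule integrable_bounded_support[of _ "2 / \<epsilon>\<^sup>2" 0 \<epsilon>]) (simp_all add: cP_bounds(1,2,3))

text \<open>In polar coordinates the mass is pi for every \<epsilon>. Bounds free of \<epsilon> are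
  enough for what follows, and comparison with the balls of radius \<epsilon>/2 and \<epsilon> gives
  3 pi / 8 and 2 pi without computing the integral.\<close>

lemma cc_bounds:
  assumes "\<epsilon> > 0"
  shows "1 \<le> cc \<epsilon>" "cc \<epsilon> \<le> 8"
proof -
  have "(LINT x|lborel. indicat_real (ball (0::real^2) (\<epsilon>/2)) x * (3 / (2 * \<epsilon>\<^sup>2))) \<le> cc \<epsilon>"
    unfolding cc_def
    by (rule Bochner_Integration.integral_mono[OF integrable_indicator_ball integrable_cP[OF assms]])
      (use cP_bounds[OF assms] in \<open>auto simp: indicator_def\<close>)
  also have "(LINT x|lborel. indicat_real (ball (0::real^2) (\<epsilon>/2)) x * (3 / (2 * \<epsilon>\<^sup>2))) = 3 * pi / 8"
    using assms by (simp add: content_ball_2 field_simps power2_eq_square)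
  finally show "1 \<le> cc \<epsilon>" using pi_gt3 by linarith
  have "cc \<epsilon> \<le> (LINT x|lborel. indicat_real (ball (0::real^2) \<epsilon>) x * (2 / \<epsilon>\<^sup>2))"
    unfolding cc_def
    by (rule Bochner_Integration.integral_mono[OF integrable_cP[OF assms] integrable_indicator_ball])
      (use cP_bounds[OF assms] in \<open>auto simp: indicator_def\<close>)
  also have "\<dots> = 2 * pi"
    using assms by (simp add: content_ball_2 field_simps power2_eq_square)
  finally show "cc \<epsilon> \<le> 8" using pi_less_4 by linarith
qed

lemma mollifier_cP:
  assumes "\<epsilon> > 0"
  shows "mollifier \<epsilon> (\<lambda>x. cP \<epsilon> x / cc \<epsilon>)"
  unfolding mollifier_def
proof (intro conjI allI impI)
  note c = cc_bounds[OF assms] and b = cP_bounds[OF assms]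
  show "0 \<le> cP \<epsilon> x / cc \<epsilon>" for x using c b by simp
  show "cP \<epsilon> x / cc \<epsilon> = 0" if "\<epsilon> \<le> norm x" for x using b that by simp
  show "(LINT x|lborel. cP \<epsilon> x / cc \<epsilon>) = 1" using c unfolding cc_def by simp
  have "norm (cP \<epsilon> x / cc \<epsilon>) \<le> 2 / \<epsilon>\<^sup>2" for x
  proof -
    have "cP \<epsilon> x / cc \<epsilon> \<le> cP \<epsilon> x / 1" using c b by (intro divide_left_mono) auto
    then show ?thesis using b[of x] c by simp
  qed
  then show "bounded (range (\<lambda>x. cP \<epsilon> x / cc \<epsilon>))" unfolding bounded_iff by blast
qed measurable

section \<open>Integrals of |x|^(a - 2) over balls\<close>

lemma ball_borel_measurable [measurable]: "ball (z::'a::metric_space) r \<in> sets borel"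
  by simp

text \<open>The ball is cut into dyadic rings on which the integrand is constant up to a factor; the
  resulting terms form a geometric series of ratio (1/2)^a. The factor 1/a is kept explicit because
  \<open>pot_moment\<close> uses a = 1/m with m arbitrarily large.\<close>

lemma riesz_integral_ball:
  assumes "0 < a" "a \<le> 1" "0 < r"
  shows "(\<integral>\<^sup>+x. indicator (ball 0 r) x * ennreal (norm (x::real^2) powr (a - 2)) \<partial>lborel) \<le> ennreal (26 * r powr a / a)"
proof -
  let ?c = "\<lambda>k::nat. (r / 2^(k+1)) powr (a - 2)"
  let ?B = "\<lambda>k::nat. ball (0::real^2) (r / 2^k)"
  have p: "indicator (ball 0 r) x * ennreal (norm x powr (a - 2)) \<le> (\<Sum>k. ennreal (?c k) * indicator (?B k) x)" for x :: "real^2"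
  proof (cases "x = 0 \<or> norm x \<ge> r")
    case False
    then have x: "0 < norm x" "norm x < r" by auto
    have "\<exists>k. r / 2^(k+1) \<le> norm x \<and> norm x < r / 2^k"
    proof -
      obtain n where "(1/2)^n < norm x / r"
        using real_arch_pow_inv[of "norm x / r" "1/2"] x assms by auto
      then have "r * (1/2)^n < norm x" using assms by (simp add: pos_less_divide_eq mult.commute)
      then have ex: "\<exists>n. r / 2^n \<le> norm x"
        by (intro exI[of _ n]) (simp add: power_divide)
      define n where "n = (LEAST n. r / 2^n \<le> norm x)"
      have n: "r / 2^n \<le> norm x" unfolding n_def using ex by (rule LeastI_ex)
      have "n \<noteq> 0" using n x by (cases n) auto
      then obtain k where k: "n = k + 1" by (metis Suc_eq_plus1 not0_implies_Suc)
      have "\<not> r / 2^k \<le> norm x" using not_less_Least[of k "\<lambda>n. r / 2^n \<le> norm x"] k unfolding n_def by simp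
      then show ?thesis using n k by (auto intro!: exI[of _ k])
    qed
    then obtain k where k: "r / 2^(k+1) \<le> norm x" "norm x < r / 2^k" by blast
    have "norm x powr (a - 2) \<le> ?c k"
      using k assms by (intro powr_mono2') auto
    then have "indicator (ball 0 r) x * ennreal (norm x powr (a - 2)) \<le> ennreal (?c k) * indicator (?B k) x"
      using x k by (simp add: ennreal_leI)
    also have "\<dots> \<le> (\<Sum>k. ennreal (?c k) * indicator (?B k) x)"
    proof -
      define F where "F k = ennreal (?c k) * indicator (?B k) x" for k
      have "(\<Sum>j\<in>{k}. F j) \<le> (\<Sum>j. F j)" by (rule sum_le_suminf) auto
      then have "F k \<le> (\<Sum>j. F j)" by simp
      then show ?thesis unfolding F_def .
    qed
    finally show ?thesis .
  qed auto
  have q: "0 < (1/2::real) powr a" "(1/2::real) powr a < 1" using assms by (auto simp: powr01_less_one)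
  \<comment> \<open>Convexity of exp puts (1/2)^a below its chord 1 - a/2 on [0, 1]; this is the
    source of the factor 1/a.\<close>
  have q1: "1 - (1/2::real) powr a \<ge> a / 2"
  proof -
    have "exp ((1 - a) *\<^sub>R 0 + a *\<^sub>R ln (1/2::real)) \<le> (1 - a) * exp 0 + a * exp (ln (1/2))"
      using assms by (intro convex_onD[OF exp_convex]) auto
    then have "(1/2::real) powr a \<le> (1 - a) + a * (1/2)" by (simp add: powr_def)
    then show ?thesis by (simp add: field_simps)
  qed
  have t: "?c k * (pi * (r / 2^k)\<^sup>2) = (pi * r powr a * 2 powr (2 - a)) * ((1/2) powr a)^k" for k
  proof -
    define x where "x = r / 2^k"
    have x: "x > 0" using assms by (simp add: x_def)
    have "r / 2^(k+1) = x * (1/2)" by (simp add: x_def)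
    then have "?c k = x powr (a - 2) * (1/2) powr (a - 2)"
      using x by (simp only: powr_mult)
    also have "(1/2::real) powr (a - 2) = 2 powr (2 - a)"
      by (simp add: powr_divide powr_minus_divide[symmetric] flip: powr_minus)
    finally have "?c k * (pi * x\<^sup>2) = pi * 2 powr (2 - a) * (x powr (a - 2) * x powr 2)"
      using x by simp
    also have "x powr (a - 2) * x powr 2 = x powr a" by (simp flip: powr_add)
    also have "x powr a = r powr a * ((1/2)^k) powr a"
    proof -
      have "x = r * (1/2)^k" by (simp add: x_def power_divide)
      then show ?thesis using assms by (simp only: powr_mult)
    qed
    also have "((1/2::real)^k) powr a = ((1/2) powr a)^k"
      by (simp only: powr_realpow[symmetric] powr_powr powr_gt_zero) (simp add: powr_realpow[symmetric] powr_powr mult.commute)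
    finally show ?thesis by (simp add: x_def mult_ac)
  qed
  have "(\<integral>\<^sup>+x. indicator (ball 0 r) x * ennreal (norm (x::real^2) powr (a - 2)) \<partial>lborel)
      \<le> (\<integral>\<^sup>+x. (\<Sum>k. ennreal (?c k) * indicator (?B k) x) \<partial>lborel)"
    by (intro nn_integral_mono p)
  also have "\<dots> = (\<Sum>k. \<integral>\<^sup>+x. ennreal (?c k) * indicator (?B k) x \<partial>lborel)"
    by (rule nn_integral_suminf) measurable
  also have "\<dots> = (\<Sum>k. ennreal ((pi * r powr a * 2 powr (2 - a)) * ((1/2) powr a)^k))"
  proof (intro suminf_cong)
    fix k
    have "(\<integral>\<^sup>+x. ennreal (?c k) * indicator (?B k) x \<partial>lborel) = ennreal (?c k) * ennreal (pi * (r / 2^k)\<^sup>2)"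
      using assms by (subst nn_integral_cmult_indicator) (auto simp: emeasure_ball_2)
    also have "\<dots> = ennreal (?c k * (pi * (r / 2^k)\<^sup>2))"
      by (rule ennreal_mult[symmetric]) auto
    finally show "(\<integral>\<^sup>+x. ennreal (?c k) * indicator (?B k) x \<partial>lborel) = ennreal ((pi * r powr a * 2 powr (2 - a)) * ((1/2) powr a)^k)"
      by (simp only: t)
  qed
  also have "\<dots> = ennreal (\<Sum>k. (pi * r powr a * 2 powr (2 - a)) * ((1/2) powr a)^k)"
    using q by (intro suminf_ennreal2) (auto intro!: summable_mult summable_geometric)
  also have "(\<Sum>k. (pi * r powr a * 2 powr (2 - a)) * ((1/2) powr a)^k) = (pi * r powr a * 2 powr (2 - a)) * (1 / (1 - (1/2) powr a))"
    using q by (subst suminf_mult) (auto simp: suminf_geometric summable_geometric)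
  \<comment> \<open>The constants multiply to 3.2 * 4 * 2 = 25.6, rounded up to 26.\<close>
  also have "\<dots> \<le> (3.2 * r powr a * 4) * (1 / (a / 2))"
  proof (intro mult_mono)
    show "pi \<le> 3.2" using pi_approx by simp
    have "2 powr (2 - a) \<le> (2::real) powr 2" using assms by (intro powr_mono) auto
    then show "2 powr (2 - a) \<le> (4::real)" by simp
    show "1 / (1 - (1/2) powr a) \<le> 1 / (a / 2)" using q1 q assms by (intro divide_left_mono) auto
  qed (use q in auto)
  also have "\<dots> \<le> 26 * r powr a / a" using assms by (simp add: field_simps)
  finally show ?thesis by (simp add: ennreal_leI)
qed

text \<open>The ball about z0 lies in the ball of radius 2 r about z, where the centred estimate
  applies; 2^a \<le> 2 doubles the constant.\<close>

lemma riesz_integral_ball':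
  assumes "0 < a" "a \<le> 1" "0 < r" "z \<in> ball z0 r"
  shows "(\<integral>\<^sup>+x. indicator (ball z0 r) x * ennreal (norm (z - x :: real^2) powr (a - 2)) \<partial>lborel) \<le> ennreal (52 * r powr a / a)"
proof -
  have "(\<integral>\<^sup>+x. indicator (ball z0 r) x * ennreal (norm (z - x :: real^2) powr (a - 2)) \<partial>lborel)
    \<le> (\<integral>\<^sup>+x. indicator (ball 0 (2 * r)) (z - x) * ennreal (norm (z - x) powr (a - 2)) \<partial>lborel)"
  proof (intro nn_integral_mono mult_right_mono)
    fix x
    show "(indicator (ball z0 r) x :: ennreal) \<le> indicator (ball 0 (2 * r)) (z - x)"
      using assms(4) dist_triangle_lt[of z z0 x "2*r"]
      by (auto simp: indicator_def dist_norm[symmetric] dist_commute)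
  qed auto
  also have "\<dots> = (\<integral>\<^sup>+x. indicator (ball 0 (2 * r)) x * ennreal (norm (x::real^2) powr (a - 2)) \<partial>lborel)"
    by (rule nn_integral_reflect[of "\<lambda>x. indicator (ball 0 (2 * r)) x * ennreal (norm (x::real^2) powr (a - 2))"]) measurable
  also have "\<dots> \<le> ennreal (26 * (2 * r) powr a / a)"
    using assms by (intro riesz_integral_ball) auto
  also have "26 * (2 * r) powr a / a \<le> 52 * r powr a / a"
  proof -
    have "2 powr a \<le> (2::real) powr 1" using assms by (intro powr_mono) auto
    then show ?thesis using assms by (simp add: powr_mult field_simps)
  qed
  finally show ?thesis by (simp add: ennreal_leI)
qed

section \<open>Local representation of weak solutions of the inhomogeneous Cauchy-Riemann equation\<close>

lemma DERIV_max0_sq: "((\<lambda>t::real. (max 0 t)\<^sup>2) has_real_derivative 2 * max 0 t) (at t)"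
proof -
  have "((\<lambda>x::real. if x \<le> 0 then 0 else x\<^sup>2) has_real_derivative (if t \<le> 0 then 0 else 2 * t)) (at t)"
    by (rule DERIV_glue) (auto intro!: derivative_eq_intros)
  moreover have "(\<lambda>x::real. if x \<le> 0 then 0 else x\<^sup>2) = (\<lambda>t. (max 0 t)\<^sup>2)" by (auto simp: fun_eq_iff max_def)
  moreover have "(if t \<le> 0 then 0 else 2 * t) = 2 * max 0 t" by (simp add: max_def)
  ultimately show ?thesis by simp
qed

text \<open>Two truncated squares in succession: the inner one flattens the graph at t = 1, the
  outer one at t = 0, which gives a C^1 step from 0 to 1. C^1 is the regularity of the test
  functions \<open>test_in\<close>.\<close>

definition smooth_step :: "real \<Rightarrow> real" where "smooth_step t = (max 0 (1 - (max 0 (1 - t))\<^sup>2))\<^sup>2"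
definition smooth_step' :: "real \<Rightarrow> real" where "smooth_step' t = 4 * max 0 (1 - (max 0 (1 - t))\<^sup>2) * max 0 (1 - t)"

lemma smooth_step_DERIV: "(smooth_step has_real_derivative smooth_step' t) (at t)"
proof -
  have "((\<lambda>t. 1 - (max 0 (1 - t))\<^sup>2) has_real_derivative 0 - (2 * max 0 (1 - t)) * (0 - 1)) (at t)"
    by (intro DERIV_diff DERIV_const DERIV_chain2[OF DERIV_max0_sq] DERIV_ident)
  from DERIV_chain2[OF DERIV_max0_sq this] show ?thesis
    by (simp add: smooth_step_def[abs_def] smooth_step'_def mult_ac)
qed

lemma smooth_step_simps:
  "t \<ge> 1 \<Longrightarrow> smooth_step t = 1" "t \<le> 0 \<Longrightarrow> smooth_step t = 0"
  "t \<ge> 1 \<Longrightarrow> smooth_step' t = 0" "t \<le> 0 \<Longrightarrow> smooth_step' t = 0"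
  "0 \<le> smooth_step t" "smooth_step t \<le> 1" "0 \<le> smooth_step' t" "smooth_step' t \<le> 4"
proof -
  show "smooth_step t = 1" "smooth_step' t = 0" if "t \<ge> 1" using that by (simp_all add: smooth_step_def smooth_step'_def max_def)
  have "max 0 (1 - (max 0 (1 - t))\<^sup>2) = 0" if "t \<le> 0"
  proof -
    have "max 0 (1 - t) = 1 - t" "1 \<le> (1 - t)\<^sup>2" using that by (simp_all add: one_le_power)
    then show ?thesis by simp
  qed
  then show z: "smooth_step t = 0" "smooth_step' t = 0" if "t \<le> 0" using that by (simp_all add: smooth_step_def smooth_step'_def)
  show "0 \<le> smooth_step t" "0 \<le> smooth_step' t" by (simp_all add: smooth_step_def smooth_step'_def)
  show "smooth_step t \<le> 1" by (auto simp: smooth_step_def abs_square_le_1 max_def)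
  show "smooth_step' t \<le> 4"
  proof (cases "t \<le> 0")
    case False
    have "max 0 (1 - (max 0 (1 - t))\<^sup>2) * max 0 (1 - t) \<le> 1 * 1"
      using False by (intro mult_mono) auto
    then show ?thesis by (simp add: smooth_step'_def)
  qed (simp add: z)
qed

text \<open>The step is applied to (b^2 - |x - z|^2) / (b^2 - a^2), which is 1 on the inner and 0 on
  the outer circle. The gradient bound is 2 |x - z| \<le> 2 b times the slope bound 4 / (b^2 -
  a^2).\<close>

lemma cutoff_exists:
  assumes "0 < a" "a < b"
  obtains \<phi> \<phi>1 \<phi>2 :: "real^2 \<Rightarrow> real" where "has_partials \<phi> \<phi>1 \<phi>2"
    "\<And>x. 0 \<le> \<phi> x" "\<And>x. \<phi> x \<le> 1"
    "\<And>x. norm (x - z) \<le> a \<Longrightarrow> \<phi> x = 1 \<and> \<phi>1 x = 0 \<and> \<phi>2 x = 0"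
    "\<And>x. norm (x - z) \<ge> b \<Longrightarrow> \<phi> x = 0 \<and> \<phi>1 x = 0 \<and> \<phi>2 x = 0"
    "\<And>x. \<bar>\<phi>1 x\<bar> \<le> 8 * b / (b\<^sup>2 - a\<^sup>2)" "\<And>x. \<bar>\<phi>2 x\<bar> \<le> 8 * b / (b\<^sup>2 - a\<^sup>2)"
proof -
  define d where "d = b\<^sup>2 - a\<^sup>2"
  have d: "d > 0" using assms by (simp add: d_def power_strict_mono)
  define m where "m s = smooth_step ((b\<^sup>2 - s) / d)" for s
  define m' where "m' s = - smooth_step' ((b\<^sup>2 - s) / d) / d" for s
  have dm: "(m has_real_derivative m' s) (at s)" for s
  proof -
    have "((\<lambda>s. (b\<^sup>2 - s) / d) has_real_derivative (0 - 1) / d) (at s)"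
      by (intro DERIV_cdivide DERIV_diff DERIV_const DERIV_ident)
    from DERIV_chain2[OF smooth_step_DERIV this] show ?thesis by (simp add: m_def[abs_def] m'_def)
  qed
  have cm: "continuous_on UNIV m'"
    unfolding m'_def smooth_step'_def using d by (intro continuous_intros) auto
  have p: "has_partials (\<lambda>x. m ((norm (x - z))\<^sup>2)) (\<lambda>x. 2 * (x - z)$1 * m' ((norm (x - z))\<^sup>2))
            (\<lambda>x. 2 * (x - z)$2 * m' ((norm (x - z))\<^sup>2))"
    by (rule has_partials_radial[OF dm cm])
  have in1: "m ((norm (x - z))\<^sup>2) = 1 \<and> m' ((norm (x - z))\<^sup>2) = 0" if "norm (x - z) \<le> a" for x
  proof -
    have "(norm (x - z))\<^sup>2 \<le> a\<^sup>2" using that by (intro power_mono) auto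
    then have "(b\<^sup>2 - (norm (x - z))\<^sup>2) / d \<ge> 1" using d by (simp add: d_def)
    then show ?thesis by (simp add: m_def m'_def smooth_step_simps)
  qed
  have out: "m ((norm (x - z))\<^sup>2) = 0 \<and> m' ((norm (x - z))\<^sup>2) = 0" if "norm (x - z) \<ge> b" for x
  proof -
    have "b\<^sup>2 \<le> (norm (x - z))\<^sup>2" using that assms by (intro power_mono) auto
    then have "(b\<^sup>2 - (norm (x - z))\<^sup>2) / d \<le> 0" using d by (simp add: divide_nonpos_pos)
    then show ?thesis by (simp add: m_def m'_def smooth_step_simps)
  qed
  have bd: "\<bar>2 * (x - z)$i * m' ((norm (x - z))\<^sup>2)\<bar> \<le> 8 * b / (b\<^sup>2 - a\<^sup>2)" for x i
  proof (cases "norm (x - z) \<ge> b")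
    case True
    then show ?thesis using out[OF True] assms d by (simp add: d_def)
  next
    case False
    have m': "\<bar>m' ((norm (x - z))\<^sup>2)\<bar> \<le> 4 / d"
      using d smooth_step_simps(7,8) by (simp add: m'_def divide_right_mono)
    have c: "\<bar>(x - z)$i\<bar> \<le> b" using False component_le_norm_cart[of "x - z" i] by linarith
    have "\<bar>2 * (x - z)$i * m' ((norm (x - z))\<^sup>2)\<bar> = 2 * (\<bar>(x - z)$i\<bar> * \<bar>m' ((norm (x - z))\<^sup>2)\<bar>)" by (simp only: abs_mult mult.assoc abs_numeral)
    also have "\<dots> \<le> 2 * (b * (4 / d))" using c m' assms by (intro mult_left_mono mult_mono) auto
    finally show ?thesis by (simp add: d_def)
  qed
  show ?thesis
    by (rule that[OF p]) (use in1 out bd in \<open>auto simp: m_def smooth_step_simps\<close>)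
qed

text \<open>For an open ball D the support may reach the boundary. The class is stable under
  multiplication by arbitrary C^1 functions, which is how Cauchy kernels and exponentials enter test
  functions.\<close>

definition test_in :: "(real^2) set \<Rightarrow> (real^2 \<Rightarrow> 'a::real_normed_vector) \<Rightarrow> (real^2 \<Rightarrow> 'a) \<Rightarrow> (real^2 \<Rightarrow> 'a) \<Rightarrow> bool" where
  "test_in D \<psi> \<psi>1 \<psi>2 \<longleftrightarrow> has_partials \<psi> \<psi>1 \<psi>2 \<and> (\<forall>x. x \<notin> D \<longrightarrow> \<psi> x = 0 \<and> \<psi>1 x = 0 \<and> \<psi>2 x = 0)"

lemma continuous_support_bounded:
  fixes f :: "real^2 \<Rightarrow> 'a::real_normed_vector"
  assumes "continuous_on UNIV f" "\<And>x. x \<notin> ball z r \<Longrightarrow> f x = 0"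
  obtains B where "\<And>x. norm (f x) \<le> B"
proof -
  have "compact (f ` cball z r)"
    by (intro compact_continuous_image continuous_on_subset[OF assms(1)]) auto
  then have "bounded (f ` cball z r)" by (rule compact_imp_bounded)
  then obtain B where B: "\<forall>x\<in>cball z r. norm (f x) \<le> B" unfolding bounded_iff by auto
  have "norm (f x) \<le> max B 0" for x
    using B assms(2)[of x] by (cases "x \<in> cball z r") (auto simp: le_max_iff_disj)
  then show ?thesis by (rule that)
qed

lemma test_in_bounded:
  assumes "test_in (ball z r) \<psi> \<psi>1 \<psi>2"
  obtains B where "\<And>x. norm (\<psi> x) \<le> B" "\<And>x. norm (\<psi>1 x) \<le> B" "\<And>x. norm (\<psi>2 x) \<le> B"
proof -
  have p: "has_partials \<psi> \<psi>1 \<psi>2" and o: "\<And>x. x \<notin> ball z r \<Longrightarrow> \<psi> x = 0 \<and> \<psi>1 x = 0 \<and> \<psi>2 x = 0"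
    using assms unfolding test_in_def by blast+
  obtain B0 where "\<And>x. norm (\<psi> x) \<le> B0" using continuous_support_bounded[OF has_partialsD(2)[OF p]] o by blast
  moreover obtain B1 where "\<And>x. norm (\<psi>1 x) \<le> B1" using continuous_support_bounded[OF has_partialsD(3)[OF p]] o by blast
  moreover obtain B2 where "\<And>x. norm (\<psi>2 x) \<le> B2" using continuous_support_bounded[OF has_partialsD(4)[OF p]] o by blast
  ultimately show ?thesis by (intro that[of "max B0 (max B1 B2)"]) (auto simp: le_max_iff_disj)
qed

lemma integrable_mult_bounded:
  fixes f g :: "'b \<Rightarrow> 'a::{real_normed_algebra,banach,second_countable_topology}"
  assumes "integrable M f" "g \<in> borel_measurable M" "\<And>x. norm (g x) \<le> B"
  shows "integrable M (\<lambda>x. f x * g x)"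
proof (rule Bochner_Integration.integrable_bound)
  show "integrable M (\<lambda>x. norm (f x) * B)" using assms(1) by (intro integrable_mult_left integrable_norm)
  show "(\<lambda>x. f x * g x) \<in> borel_measurable M" using assms borel_measurable_integrable[OF assms(1)] by measurable
  have "norm (f x * g x) \<le> norm (norm (f x) * B)" for x
  proof -
    have "norm (f x * g x) \<le> norm (f x) * norm (g x)" by (rule norm_mult_ineq)
    also have "\<dots> \<le> norm (f x) * B" using assms(3) by (rule mult_left_mono) simp
    also have "\<dots> \<le> norm (norm (f x) * B)" by simp
    finally show ?thesis .
  qed
  then show "AE x in M. norm (f x * g x) \<le> norm (norm (f x) * B)" by simp
qed

text \<open>Integration by parts without boundary terms, obtained from translation invariance. The
  convolution of \<psi> with the indicator of a large ball is constant near 0; its derivatives there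
  are the same convolutions of the partials, that is, their integrals.\<close>

lemma integral_partials_zero:
  fixes \<psi> :: "real^2 \<Rightarrow> 'a::{real_normed_field,banach,second_countable_topology}"
  assumes t: "test_in (ball z r) \<psi> \<psi>1 \<psi>2"
  shows "(LINT x|lborel. \<psi>1 x) = 0" "(LINT x|lborel. \<psi>2 x) = 0"
proof -
  have p: "has_partials \<psi> \<psi>1 \<psi>2" and o: "\<And>x. x \<notin> ball z r \<Longrightarrow> \<psi> x = 0 \<and> \<psi>1 x = 0 \<and> \<psi>2 x = 0"
    using t unfolding test_in_def by blast+
  note [measurable] = has_partials_borel[OF p]
  obtain B where B: "\<And>x. norm (\<psi> x) \<le> B" "\<And>x. norm (\<psi>1 x) \<le> B" "\<And>x. norm (\<psi>2 x) \<le> B"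
    by (rule test_in_bounded[OF t]) blast
  define L where "L = norm z + r + 1"
  let ?f = "\<lambda>x::real^2. (of_real (indicator (ball 0 L) x) :: 'a)"
  have f: "integrable lborel ?f"
    using integrable_indicator_ball[of 0 L 1] by (intro integrable_of_real) simp
  have far: "indicat_real (ball 0 L) y = 1" if "x \<in> ball 0 1" "x - y \<in> ball z r" for x y :: "real^2"
  proof -
    have "norm (x - y - z) < r" using that(2) by (simp add: dist_norm norm_minus_commute)
    moreover have "norm x < 1" using that(1) by simp
    moreover have "norm y \<le> norm x + norm z + norm (x - y - z)"
      using norm_triangle_ineq4[of "x - z" "x - y - z"] norm_triangle_ineq4[of x z] by simp
    ultimately show ?thesis by (simp add: L_def)
  qed
  have eq: "conv ?f K x = (LINT y|lborel. K y)" if "x \<in> ball 0 1" and [measurable]: "K \<in> borel_measurable borel" and "\<And>y. y \<notin> ball z r \<Longrightarrow> K y = 0" for K x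
  proof -
    have "conv ?f K x = (LINT y|lborel. K (x - y))"
      unfolding conv_def
    proof (rule Bochner_Integration.integral_cong[OF refl])
      fix y show "of_real (indicator (ball 0 L) y) * K (x - y) = K (x - y)"
        using far[OF that(1), of y] that(3)[of "x - y"] by (cases "x - y \<in> ball z r") auto
    qed
    also have "\<dots> = (LINT y|lborel. K y)" by (rule integral_reflect) measurable
    finally show ?thesis .
  qed
  have d: "(conv ?f \<psi> has_derivative (\<lambda>h. (h$1) *\<^sub>R conv ?f \<psi>1 0 + (h$2) *\<^sub>R conv ?f \<psi>2 0)) (at 0)"
    using has_partialsD(1)[OF has_partials_conv[OF f p B]] .
  have "((\<lambda>x::real^2. LINT y|lborel. \<psi> y) has_derivative (\<lambda>h. (h$1) *\<^sub>R conv ?f \<psi>1 0 + (h$2) *\<^sub>R conv ?f \<psi>2 0)) (at 0)"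
    by (rule has_derivative_transform_within_open[OF d, of "ball 0 1"]) (use eq o in auto)
  from has_derivative_unique[OF this has_derivative_const]
  have z: "(h$1) *\<^sub>R conv ?f \<psi>1 0 + (h$2) *\<^sub>R conv ?f \<psi>2 0 = 0" for h :: "real^2"
    by (auto dest: fun_cong)
  have "conv ?f \<psi>1 0 = 0" "conv ?f \<psi>2 0 = 0"
    using z[of "axis 1 1"] z[of "axis 2 1"] by (auto simp: axis_def)
  then show "(LINT x|lborel. \<psi>1 x) = 0" "(LINT x|lborel. \<psi>2 x) = 0"
    using eq[of 0 \<psi>1] eq[of 0 \<psi>2] o by auto
qed

text \<open>The sign of the integration by parts is absorbed in \<open>e\<close>: weakly, dbar f = -
  e. Test functions are complex valued because Cauchy kernels are inserted into them.\<close>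

definition weak_dbar :: "(real^2) set \<Rightarrow> (real^2 \<Rightarrow> complex) \<Rightarrow> (real^2 \<Rightarrow> complex) \<Rightarrow> bool" where
  "weak_dbar D f e \<longleftrightarrow> (\<forall>\<psi> \<psi>1 \<psi>2. test_in D \<psi> \<psi>1 \<psi>2 \<longrightarrow>
     (LINT x|lborel. f x * dbar \<psi>1 \<psi>2 x) = (LINT x|lborel. e x * \<psi> x))"

text \<open>The Riesz potential of order 1 of |q|, which dominates the Cauchy transform. Values in
  \<open>ennreal\<close> allow it to be infinite at some points.\<close>

definition pot :: "(real^2 \<Rightarrow> complex) \<Rightarrow> real^2 \<Rightarrow> ennreal" where
  "pot q z = (\<integral>\<^sup>+\<xi>. ennreal (norm (q \<xi>) * inverse (norm (z - \<xi>))) \<partial>lborel)"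

text \<open>The bound does not see \<epsilon>, because |ck| stays below the singular kernel.\<close>

lemma norm_conv_ck_le:
  assumes "integrable lborel q" "\<epsilon> > 0"
  shows "ennreal (norm (conv q (ck \<epsilon>) z)) \<le> pot q z"
proof -
  obtain B where B: "\<And>x. norm (ck \<epsilon> x) \<le> B" by (rule ck_bounded[OF assms(2)]) blast
  have "integrable lborel (\<lambda>y. q y * ck \<epsilon> (z - y))"
    by (rule conv_integrable[OF assms(1) _ B]) (rule has_partials_borel(1)[OF has_partials_ck[OF assms(2)]])
  then have "ennreal (norm (conv q (ck \<epsilon>) z)) \<le> (\<integral>\<^sup>+\<xi>. ennreal (norm (q \<xi> * ck \<epsilon> (z - \<xi>))) \<partial>lborel)"
    unfolding conv_def by (rule integral_norm_bound_ennreal)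
  also have "\<dots> \<le> pot q z"
    unfolding pot_def norm_mult
    by (intro nn_integral_mono ennreal_leI mult_left_mono norm_ck_le assms) auto
  finally show ?thesis .
qed

lemma dbar_measurable:
  assumes "has_partials f f1 f2"
  shows "dbar f1 f2 \<in> borel_measurable borel"
  using has_partials_borel[OF assms] unfolding dbar_def[abs_def] by measurable

lemma norm_dbar_le: "norm (f1 x) \<le> B \<Longrightarrow> norm (f2 x) \<le> B \<Longrightarrow> norm (dbar f1 f2 x) \<le> B"
  using norm_triangle_ineq[of "f1 x" "\<i> * f2 x"] by (simp add: dbar_def norm_divide norm_mult)

text \<open>A regularised Cauchy-Pompeiu formula. The test function is \<phi>(\<xi>) ck(z - \<xi>);
  its dbar splits into a part carrying the derivative of the cutoff and, with a minus sign, \<phi>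
  times the approximate identity \<open>cP\<close>.\<close>

lemma weak_dbar_representation:
  assumes f: "integrable lborel f" and e: "integrable lborel e" and w: "weak_dbar (ball z0 r) f e"
    and t: "test_in (ball z0 r) \<phi> \<phi>1 \<phi>2" and \<epsilon>: "\<epsilon> > 0"
  shows "conv (\<lambda>x. f x * \<phi> x) (\<lambda>x. of_real (cP \<epsilon> x)) z =
     conv (\<lambda>x. f x * dbar \<phi>1 \<phi>2 x) (ck \<epsilon>) z - conv (\<lambda>x. e x * \<phi> x) (ck \<epsilon>) z"
proof -
  have p: "has_partials \<phi> \<phi>1 \<phi>2" and o: "\<And>x. x \<notin> ball z0 r \<Longrightarrow> \<phi> x = 0 \<and> \<phi>1 x = 0 \<and> \<phi>2 x = 0"
    using t unfolding test_in_def by blast+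
  note [measurable] = has_partials_borel[OF p] dbar_measurable[OF p]
  obtain B where B: "\<And>x. norm (\<phi> x) \<le> B" "\<And>x. norm (\<phi>1 x) \<le> B" "\<And>x. norm (\<phi>2 x) \<le> B"
    by (rule test_in_bounded[OF t]) blast
  obtain C where C: "\<And>x. norm (ck \<epsilon> x) \<le> C" by (rule ck_bounded[OF \<epsilon>]) blast
  note pk = has_partials_ck[OF \<epsilon>]
  have "test_in (ball z0 r) (\<lambda>\<xi>. \<phi> \<xi> * ck \<epsilon> (z - \<xi>)) (\<lambda>\<xi>. \<phi>1 \<xi> * ck \<epsilon> (z - \<xi>) + \<phi> \<xi> * - ck1 \<epsilon> (z - \<xi>))
     (\<lambda>\<xi>. \<phi>2 \<xi> * ck \<epsilon> (z - \<xi>) + \<phi> \<xi> * - ck2 \<epsilon> (z - \<xi>))"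
    unfolding test_in_def using has_partials_mult[OF p has_partials_reflect[OF pk]] o by auto
  from w[unfolded weak_dbar_def, rule_format, OF this]
  have E1: "(LINT x|lborel. f x * dbar (\<lambda>\<xi>. \<phi>1 \<xi> * ck \<epsilon> (z - \<xi>) + \<phi> \<xi> * - ck1 \<epsilon> (z - \<xi>))
     (\<lambda>\<xi>. \<phi>2 \<xi> * ck \<epsilon> (z - \<xi>) + \<phi> \<xi> * - ck2 \<epsilon> (z - \<xi>)) x) = conv (\<lambda>x. e x * \<phi> x) (ck \<epsilon>) z"
    by (simp add: conv_def mult.assoc)
  have E2: "dbar (\<lambda>\<xi>. \<phi>1 \<xi> * ck \<epsilon> (z - \<xi>) + \<phi> \<xi> * - ck1 \<epsilon> (z - \<xi>))
     (\<lambda>\<xi>. \<phi>2 \<xi> * ck \<epsilon> (z - \<xi>) + \<phi> \<xi> * - ck2 \<epsilon> (z - \<xi>)) x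
     = dbar \<phi>1 \<phi>2 x * ck \<epsilon> (z - x) - \<phi> x * of_real (cP \<epsilon> (z - x))" for x
    unfolding dbar_ck[OF \<epsilon>, symmetric] by (simp add: dbar_def field_simps)
  have E3: "(LINT x|lborel. f x * (dbar \<phi>1 \<phi>2 x * ck \<epsilon> (z - x) - \<phi> x * of_real (cP \<epsilon> (z - x))))
     = (LINT x|lborel. (f x * dbar \<phi>1 \<phi>2 x) * ck \<epsilon> (z - x) - (f x * \<phi> x) * of_real (cP \<epsilon> (z - x)))"
    by (simp add: algebra_simps)
  also have "\<dots> = conv (\<lambda>x. f x * dbar \<phi>1 \<phi>2 x) (ck \<epsilon>) z - conv (\<lambda>x. f x * \<phi> x) (\<lambda>x. of_real (cP \<epsilon> x)) z"
    unfolding conv_def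
  proof (rule Bochner_Integration.integral_diff)
    show "integrable lborel (\<lambda>x. f x * dbar \<phi>1 \<phi>2 x * ck \<epsilon> (z - x))"
      by (rule conv_integrable[OF integrable_mult_bounded[OF f _ norm_dbar_le[OF B(2,3)]] has_partials_borel(1)[OF pk] C]) measurable
    show "integrable lborel (\<lambda>x. f x * \<phi> x * complex_of_real (cP \<epsilon> (z - x)))"
      by (rule conv_integrable[OF integrable_mult_bounded[OF f _ B(1)], where B="2 / \<epsilon>\<^sup>2"]) (use cP_bounds[OF \<epsilon>] in auto)
  qed
  finally have E4: "(LINT x|lborel. f x * (dbar \<phi>1 \<phi>2 x * ck \<epsilon> (z - x) - \<phi> x * of_real (cP \<epsilon> (z - x)))) =
    conv (\<lambda>x. f x * dbar \<phi>1 \<phi>2 x) (ck \<epsilon>) z - conv (\<lambda>x. f x * \<phi> x) (\<lambda>x. of_real (cP \<epsilon> x)) z" .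
  have aux: "X = Y - Z" if "Y - X = Z" for X Y Z :: complex using that by (simp add: algebra_simps)
  show ?thesis
    by (rule aux[OF trans[OF E4[symmetric] E1[unfolded E2]]])
qed

lemma AE_continuous_bound:
  fixes g :: "'a::euclidean_space \<Rightarrow> real"
  assumes "continuous_on UNIV g" "open U" "AE z in lborel. z \<in> U \<longrightarrow> g z \<le> B" "z \<in> U"
  shows "g z \<le> B"
proof (rule ccontr)
  assume "\<not> g z \<le> B"
  have "open (U \<inter> g -` {B<..})"
    using assms(1,2) by (intro open_Int open_vimage) (auto simp: continuous_on_eq_continuous_at)
  then obtain d where d: "d > 0" "ball z d \<subseteq> U \<inter> g -` {B<..}"
  proof (rule openE)
    show "z \<in> U \<inter> g -` {B<..}" using assms(4) \<open>\<not> g z \<le> B\<close> by simp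
  qed blast
  have "AE z' in lborel. z' \<notin> ball z d"
    using assms(3) by eventually_elim (use d in auto)
  then have "emeasure lborel (ball z d) = 0"
    by (subst (asm) AE_iff_measurable[of "ball z d"]) auto
  then show False using d(1) content_ball_pos[of d z] by (simp add: measure_def)
qed

text \<open>In the limit \<epsilon> -> 0 the Cauchy-Pompeiu formula compares cc times f with
  \<open>H\<close>, the difference being a Cauchy transform of \<open>e\<close> and so at most
  \<open>pot e\<close>. \<open>H\<close> integrates over the region where the cutoff varies, away
  from the smaller ball; hence it is holomorphic there and does not change with \<epsilon>. The
  constant cc is only known to lie in [1, 8], which is why the conclusion is a pair of inequalities
  with a factor 8.\<close>

lemma local_representation:
  assumes f: "integrable lborel f" and e: "integrable lborel e" and w: "weak_dbar (ball z0 (2 * a)) f e" and a: "a > 0"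
  obtains H H1 H2 where "has_partials H H1 H2" "\<And>z. z \<in> ball z0 (3 * a / 4) \<Longrightarrow> dbar H1 H2 z = 0"
    "\<And>z. norm (H z) \<le> 48 / a\<^sup>2 * (LINT x|lborel. norm (f x))"
    "AE z in lborel. z \<in> ball z0 (3 * a / 4) \<longrightarrow> ennreal (norm (f z)) \<le> ennreal (norm (H z)) + pot e z \<and>
        ennreal (norm (H z)) \<le> 8 * ennreal (norm (f z)) + pot e z"
proof -
  obtain c c1 c2 :: "real^2 \<Rightarrow> real" where c: "has_partials c c1 c2" and
    c01: "\<And>x. 0 \<le> c x" "\<And>x. c x \<le> 1" and
    cin: "\<And>x. norm (x - z0) \<le> a \<Longrightarrow> c x = 1 \<and> c1 x = 0 \<and> c2 x = 0" and
    cout: "\<And>x. norm (x - z0) \<ge> 2 * a \<Longrightarrow> c x = 0 \<and> c1 x = 0 \<and> c2 x = 0" and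
    cb: "\<And>x. \<bar>c1 x\<bar> \<le> 8 * (2 * a) / ((2 * a)\<^sup>2 - a\<^sup>2)" "\<And>x. \<bar>c2 x\<bar> \<le> 8 * (2 * a) / ((2 * a)\<^sup>2 - a\<^sup>2)"
    by (rule cutoff_exists[of a "2 * a" z0]) (use a in auto)
  define \<phi> where "\<phi> x = complex_of_real (c x)" for x
  define \<phi>1 where "\<phi>1 x = complex_of_real (c1 x)" for x
  define \<phi>2 where "\<phi>2 x = complex_of_real (c2 x)" for x
  have p: "has_partials \<phi> \<phi>1 \<phi>2"
    using has_partials_bounded_linear[OF bounded_linear_of_real c] unfolding \<phi>_def[abs_def] \<phi>1_def[abs_def] \<phi>2_def[abs_def] .
  have t: "test_in (ball z0 (2 * a)) \<phi> \<phi>1 \<phi>2"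
    unfolding test_in_def using p cout by (auto simp: \<phi>_def \<phi>1_def \<phi>2_def dist_norm norm_minus_commute)
  have cb': "8 * (2 * a) / ((2 * a)\<^sup>2 - a\<^sup>2) = 16 / (3 * a)"
    using a by (simp add: power2_eq_square field_simps)
  have db: "norm (dbar \<phi>1 \<phi>2 x) \<le> 16 / (3 * a)" for x
    by (rule norm_dbar_le) (use cb[of x, unfolded cb'] in \<open>simp_all add: \<phi>1_def \<phi>2_def\<close>)
  have din: "dbar \<phi>1 \<phi>2 x = 0" if "norm (x - z0) \<le> a" for x
    using cin[OF that] by (simp add: dbar_def \<phi>1_def \<phi>2_def)
  note [measurable] = has_partials_borel[OF p] dbar_measurable[OF p]
  have \<phi>B: "norm (\<phi> x) \<le> 1" for x using c01[of x] by (simp add: \<phi>_def)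
  define q where "q x = f x * dbar \<phi>1 \<phi>2 x" for x
  have q: "integrable lborel q"
    unfolding q_def[abs_def] by (rule integrable_mult_bounded[OF f _ db]) measurable
  have f\<phi>: "integrable lborel (\<lambda>x. f x * \<phi> x)" and e\<phi>: "integrable lborel (\<lambda>x. e x * \<phi> x)"
    by (rule integrable_mult_bounded[OF f _ \<phi>B] integrable_mult_bounded[OF e _ \<phi>B]; measurable)+
  define \<epsilon>0 where "\<epsilon>0 = a / 4"
  have \<epsilon>0: "\<epsilon>0 > 0" using a by (simp add: \<epsilon>0_def)
  define H where "H = conv q (ck \<epsilon>0)"
  define H1 where "H1 = conv q (ck1 \<epsilon>0)"
  define H2 where "H2 = conv q (ck2 \<epsilon>0)"
  \<comment> \<open>The cutoff is constant on the ball of radius a, so the source \<open>q\<close>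
    keeps the distance a - 3 a / 4 = a / 4 from z.\<close>
  have far: "norm (z - \<xi>) \<ge> \<epsilon>0" if "z \<in> ball z0 (3 * a / 4)" "q \<xi> \<noteq> 0" for z \<xi>
  proof -
    have "norm (\<xi> - z0) > a" using din[of \<xi>] that(2) by (force simp: q_def)
    moreover have "norm (z - z0) < 3 * a / 4" using that(1) by (simp add: dist_norm norm_minus_commute)
    ultimately show ?thesis using norm_triangle_ineq4[of "z - z0" "z - \<xi>"] by (simp add: \<epsilon>0_def)
  qed
  obtain B where B: "\<And>x. norm (ck \<epsilon>0 x) \<le> B" "\<And>x. norm (ck1 \<epsilon>0 x) \<le> B" "\<And>x. norm (ck2 \<epsilon>0 x) \<le> B"
    by (rule ck_bounded[OF \<epsilon>0]) blast
  note pk = has_partials_ck[OF \<epsilon>0]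
  have pH: "has_partials H H1 H2"
    unfolding H_def H1_def H2_def by (rule has_partials_conv[OF q pk B])
  moreover have "dbar H1 H2 z = 0" if "z \<in> ball z0 (3 * a / 4)" for z
  proof -
    have i: "integrable lborel (\<lambda>y. q y * ck1 \<epsilon>0 (z - y))" "integrable lborel (\<lambda>y. q y * ck2 \<epsilon>0 (z - y))"
      using conv_integrable[OF q has_partials_borel(2)[OF pk] B(2)] conv_integrable[OF q has_partials_borel(3)[OF pk] B(3)] .
    have "dbar H1 H2 z = (LINT y|lborel. q y * dbar (ck1 \<epsilon>0) (ck2 \<epsilon>0) (z - y))"
      using i by (simp add: dbar_def H1_def H2_def conv_def algebra_simps add_divide_distrib)
    also have "\<dots> = (LINT y|(lborel::(real^2) measure). 0)"
    proof (rule Bochner_Integration.integral_cong[OF refl])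
      fix y show "q y * dbar (ck1 \<epsilon>0) (ck2 \<epsilon>0) (z - y) = 0"
        using far[OF that, of y] cP_bounds(3)[OF \<epsilon>0, of "z - y"] dbar_ck[OF \<epsilon>0] by (cases "q y = 0") auto
    qed
    finally show ?thesis by simp
  qed
  moreover have "norm (H z) \<le> 48 / a\<^sup>2 * (LINT x|lborel. norm (f x))" for z
  proof -
    have A: "norm (H z) \<le> (2 / \<epsilon>0) * (LINT x|lborel. norm (q x))"
      unfolding H_def by (rule norm_conv_le[OF q has_partials_borel(1)[OF pk] norm_ck_bounds(1)[OF \<epsilon>0]])
    have "(LINT x|lborel. norm (q x)) \<le> (LINT x|lborel. norm (f x) * (16 / (3 * a)))"
    proof (rule Bochner_Integration.integral_mono)
      show "integrable lborel (\<lambda>x. norm (q x))" "integrable lborel (\<lambda>x. norm (f x) * (16 / (3 * a)))"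
        using f q by (auto intro!: integrable_mult_left)
      show "norm (q x) \<le> norm (f x) * (16 / (3 * a))" for x
        unfolding q_def norm_mult by (rule mult_left_mono[OF db]) simp
    qed
    then have "(2 / \<epsilon>0) * (LINT x|lborel. norm (q x)) \<le> (2 / \<epsilon>0) * (LINT x|lborel. norm (f x) * (16 / (3 * a)))"
      by (rule mult_left_mono) (use \<epsilon>0 in simp)
    note order_trans[OF A this]
    \<comment> \<open>The factor is (8 / a) (16 / (3 a)) = 128 / (3 a^2); the number 48 is a
      rounding upwards of 128 / 3.\<close>
    also have "(2 / \<epsilon>0) * (LINT x|lborel. norm (f x) * (16 / (3 * a))) = (128/3) / a\<^sup>2 * (LINT x|lborel. norm (f x))"
      by (simp add: \<epsilon>0_def power2_eq_square)
    also have "\<dots> \<le> 48 / a\<^sup>2 * (LINT x|lborel. norm (f x))"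
      by (intro mult_right_mono divide_right_mono integral_nonneg) auto
    finally show ?thesis .
  qed
  moreover have "AE z in lborel. z \<in> ball z0 (3 * a / 4) \<longrightarrow> ennreal (norm (f z)) \<le> ennreal (norm (H z)) + pot e z \<and>
        ennreal (norm (H z)) \<le> 8 * ennreal (norm (f z)) + pot e z"
  proof -
    define \<epsilon> where "\<epsilon> n = \<epsilon>0 * inverse (real (Suc n))" for n
    have \<epsilon>: "\<epsilon> n > 0" "\<epsilon> n \<le> \<epsilon>0" for n using \<epsilon>0 by (auto simp: \<epsilon>_def field_simps)
    have "\<epsilon> \<longlonglongrightarrow> 0"
      using tendsto_mult[OF tendsto_const LIMSEQ_inverse_real_of_nat, of \<epsilon>0] by (simp add: \<epsilon>_def[abs_def])
    then have L1: "(\<lambda>n. LINT x|lborel. norm (conv (\<lambda>x. f x * \<phi> x) (\<lambda>x. of_real (cP (\<epsilon> n) x / cc (\<epsilon> n))) x - f x * \<phi> x)) \<longlonglongrightarrow> 0"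
      by (intro mollify_L1_tendsto[OF f\<phi>, of \<epsilon> "\<lambda>n x. cP (\<epsilon> n) x / cc (\<epsilon> n)"] mollifier_cP \<epsilon>)
    have int: "integrable lborel (\<lambda>x. conv (\<lambda>x. f x * \<phi> x) (\<lambda>x. of_real (cP (\<epsilon> n) x / cc (\<epsilon> n))) x - f x * \<phi> x)" for n
    proof -
      have "(LINT x|lborel. norm (f (x - y) * \<phi> (x - y) - f x * \<phi> x)) \<le> 2 * (LINT x|lborel. norm (f x * \<phi> x))" for y
      proof -
        have i: "integrable lborel (\<lambda>x. f (x - y) * \<phi> (x - y))" using integrable_translate[OF f\<phi>] .
        have "(LINT x|lborel. norm (f (x - y) * \<phi> (x - y) - f x * \<phi> x)) \<le> (LINT x|lborel. norm (f (x - y) * \<phi> (x - y)) + norm (f x * \<phi> x))"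
          using i f\<phi> by (intro Bochner_Integration.integral_mono) (auto intro!: norm_triangle_ineq4 Bochner_Integration.integrable_diff integrable_norm Bochner_Integration.integrable_add)
        also have "\<dots> = (LINT x|lborel. norm (f (x - y) * \<phi> (x - y))) + (LINT x|lborel. norm (f x * \<phi> x))"
          using i f\<phi> by (intro Bochner_Integration.integral_add integrable_norm)
        also have "(LINT x|lborel. norm (f (x - y) * \<phi> (x - y))) = (LINT x|lborel. norm (f x * \<phi> x))"
          using borel_measurable_integrable[OF f\<phi>] by (intro integral_translate[of "\<lambda>x. norm (f x * \<phi> x)"]) simp
        finally show ?thesis by simp
      qed
      then show ?thesis
        by (intro Bochner_Integration.integrable_diff f\<phi> mollify_L1_bound(2)[OF f\<phi> mollifier_cP[OF \<epsilon>(1)]])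
    qed
    \<comment> \<open>L^1 convergence of the mollifications gives convergence almost everywhere
      along a subsequence.\<close>
    obtain r where r: "strict_mono r" "AE z in lborel. (\<lambda>n. conv (\<lambda>x. f x * \<phi> x) (\<lambda>x. of_real (cP (\<epsilon> (r n)) x / cc (\<epsilon> (r n)))) z - f z * \<phi> z) \<longlonglongrightarrow> 0"
      using tendsto_L1_AE_subseq[OF int L1] by blast
    from r(2) show ?thesis
    proof eventually_elim
      case (elim z)
      show ?case
      proof
        assume z: "z \<in> ball z0 (3 * a / 4)"
        have "norm (z - z0) \<le> a" using z a by (simp add: dist_norm norm_minus_commute)
        then have "\<phi> z = 1" using cin by (simp add: \<phi>_def)
        define v where "v n = conv (\<lambda>x. f x * \<phi> x) (\<lambda>x. of_real (cP (\<epsilon> (r n)) x / cc (\<epsilon> (r n)))) z" for n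
        have "(\<lambda>n. v n - f z) \<longlonglongrightarrow> 0" using elim \<open>\<phi> z = 1\<close> by (simp add: v_def)
        then have "v \<longlonglongrightarrow> f z" by (simp add: LIM_zero_iff)
        then have v: "(\<lambda>n. ennreal (norm (v n))) \<longlonglongrightarrow> ennreal (norm (f z))"
          by (intro tendsto_ennrealI tendsto_norm)
        have pe: "pot (\<lambda>x. e x * \<phi> x) z \<le> pot e z"
          unfolding pot_def
        proof (intro nn_integral_mono ennreal_leI mult_right_mono)
          fix x show "norm (e x * \<phi> x) \<le> norm (e x)"
            using mult_left_mono[OF \<phi>B[of x] norm_ge_zero[of "e x"]] by (simp add: norm_mult)
        qed auto
        have main: "norm (of_real (cc (\<epsilon> n)) * v' - H z) = norm (conv (\<lambda>x. e x * \<phi> x) (ck (\<epsilon> n)) z)"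
          if "v' = conv (\<lambda>x. f x * \<phi> x) (\<lambda>x. of_real (cP (\<epsilon> n) x / cc (\<epsilon> n))) z" for n v'
        proof -
          have "of_real (cc (\<epsilon> n)) * v' = conv (\<lambda>x. f x * \<phi> x) (\<lambda>x. of_real (cP (\<epsilon> n) x)) z"
            unfolding that conv_def using cc_bounds[OF \<epsilon>(1)[of n]]
            by (subst integral_mult_right_zero[symmetric]) (intro Bochner_Integration.integral_cong refl, simp)
          \<comment> \<open>On the support of \<open>q\<close> both kernels coincide with the
            unregularised 1/z, because \<epsilon> n \<le> \<epsilon>0.\<close>
          moreover have "conv q (ck (\<epsilon> n)) z = H z"
            unfolding H_def conv_def
          proof (rule Bochner_Integration.integral_cong[OF refl])
            fix y show "q y * ck (\<epsilon> n) (z - y) = q y * ck \<epsilon>0 (z - y)"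
            proof (cases "q y = 0")
              case False
              then have "norm (z - y) \<ge> \<epsilon>0" "norm (z - y) \<ge> \<epsilon> n" using far[OF z] \<epsilon>(2)[of n] order_trans by blast+
              then show ?thesis using ck_far[OF \<epsilon>0] ck_far[OF \<epsilon>(1)] by simp
            qed simp
          qed
          ultimately show ?thesis
            using weak_dbar_representation[OF f e w t \<epsilon>(1)[of n], of z] by (simp add: q_def[abs_def])
        qed
        have main': "ennreal (norm (of_real (cc (\<epsilon> (r n))) * v n - H z)) \<le> pot e z" for n
          unfolding main[OF v_def] using norm_conv_ck_le[OF e\<phi> \<epsilon>(1)] pe by (rule order_trans)
        show "ennreal (norm (f z)) \<le> ennreal (norm (H z)) + pot e z \<and> ennreal (norm (H z)) \<le> 8 * ennreal (norm (f z)) + pot e z"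
        proof
          have "ennreal (norm (v n)) \<le> ennreal (norm (H z)) + pot e z" for n
          proof -
            have "norm (v n) \<le> cc (\<epsilon> (r n)) * norm (v n)"
              using mult_right_mono[OF cc_bounds(1)[OF \<epsilon>(1)[of "r n"]] norm_ge_zero[of "v n"]] by simp
            also have "\<dots> = norm (of_real (cc (\<epsilon> (r n))) * v n)" using cc_bounds(1)[OF \<epsilon>(1)[of "r n"]] by (simp add: norm_mult)
            also have "\<dots> \<le> norm (H z) + norm (of_real (cc (\<epsilon> (r n))) * v n - H z)"
              using norm_triangle_ineq[of "H z" "of_real (cc (\<epsilon> (r n))) * v n - H z"] by simp
            finally have "ennreal (norm (v n)) \<le> ennreal (norm (H z)) + ennreal (norm (of_real (cc (\<epsilon> (r n))) * v n - H z))"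
              by (simp add: ennreal_leI flip: ennreal_plus)
            also have "\<dots> \<le> ennreal (norm (H z)) + pot e z" using main' by (rule add_left_mono)
            finally show ?thesis .
          qed
          then show "ennreal (norm (f z)) \<le> ennreal (norm (H z)) + pot e z"
            by (intro tendsto_upperbound[OF v]) auto
          have "ennreal (norm (H z)) \<le> 8 * ennreal (norm (v n)) + pot e z" for n
          proof -
            have "norm (H z) \<le> norm (of_real (cc (\<epsilon> (r n))) * v n) + norm (of_real (cc (\<epsilon> (r n))) * v n - H z)"
              using norm_triangle_ineq4[of "of_real (cc (\<epsilon> (r n))) * v n" "of_real (cc (\<epsilon> (r n))) * v n - H z"] by simp
            also have "norm (of_real (cc (\<epsilon> (r n))) * v n) \<le> 8 * norm (v n)"
              using cc_bounds[OF \<epsilon>(1)[of "r n"]] by (simp add: norm_mult mult_right_mono)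
            finally have "ennreal (norm (H z)) \<le> ennreal (8 * norm (v n)) + ennreal (norm (of_real (cc (\<epsilon> (r n))) * v n - H z))"
              by (simp add: ennreal_leI flip: ennreal_plus)
            also have "\<dots> \<le> ennreal (8 * norm (v n)) + pot e z" using main' by (rule add_left_mono)
            finally show ?thesis by (simp add: ennreal_mult)
          qed
          moreover have "(\<lambda>n. 8 * ennreal (norm (v n)) + pot e z) \<longlonglongrightarrow> 8 * ennreal (norm (f z)) + pot e z"
            by (intro tendsto_add tendsto_const ennreal_tendsto_cmult v) simp
          ultimately show "ennreal (norm (H z)) \<le> 8 * ennreal (norm (f z)) + pot e z"
            by (intro tendsto_lowerbound) auto
        qed
      qed
    qed
  qed
  ultimately show ?thesis by (rule that)
qed

text \<open>This is \<open>local_representation\<close> with error 0, applied to H cut off to the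
  ball. The jump of the cut function on the sphere is not seen by test functions that vanish outside
  the ball. Continuity of H turns the almost everywhere bound into a pointwise one.\<close>

lemma dbar_mean_value:
  assumes p: "has_partials H H1 H2" and h: "\<And>z. z \<in> ball z0 (2 * a) \<Longrightarrow> dbar H1 H2 z = 0" and a: "a > 0"
    and z: "z \<in> ball z0 (3 * a / 4)"
  shows "norm (H z) \<le> 48 / a\<^sup>2 * (LINT x|lborel. indicat_real (ball z0 (2 * a)) x * norm (H x))"
proof -
  let ?f = "\<lambda>x. indicat_real (ball z0 (2 * a)) x *\<^sub>R H x"
  note [measurable] = has_partials_borel[OF p]
  have "compact (H ` cball z0 (2 * a))" by (intro compact_continuous_image has_partialsD(2)[OF p] compact_cball)
  then have "bounded (H ` cball z0 (2 * a))" by (rule compact_imp_bounded)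
  then obtain B where B: "\<forall>x\<in>cball z0 (2 * a). norm (H x) \<le> B" unfolding bounded_iff by auto
  have f: "integrable lborel ?f"
    by (rule integrable_bounded_support[of _ "max B 0" z0 "2 * a"])
       (use B in \<open>auto simp: indicator_def le_max_iff_disj\<close>)
  have w: "weak_dbar (ball z0 (2 * a)) ?f (\<lambda>x. 0)"
    unfolding weak_dbar_def
  proof (intro allI impI)
    fix \<psi> \<psi>1 \<psi>2 :: "real^2 \<Rightarrow> complex" assume t: "test_in (ball z0 (2 * a)) \<psi> \<psi>1 \<psi>2"
    then have p': "has_partials \<psi> \<psi>1 \<psi>2" and o: "\<And>x. x \<notin> ball z0 (2 * a) \<Longrightarrow> \<psi> x = 0 \<and> \<psi>1 x = 0 \<and> \<psi>2 x = 0"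
      unfolding test_in_def by blast+
    let ?g1 = "\<lambda>x. H1 x * \<psi> x + H x * \<psi>1 x" and ?g2 = "\<lambda>x. H2 x * \<psi> x + H x * \<psi>2 x"
    have t': "test_in (ball z0 (2 * a)) (\<lambda>x. H x * \<psi> x) ?g1 ?g2"
      unfolding test_in_def using has_partials_mult[OF p p'] o by auto
    note [measurable] = has_partials_borel[OF has_partials_mult[OF p p']]
    obtain C where C: "\<And>x. norm (?g1 x) \<le> C" "\<And>x. norm (?g2 x) \<le> C" by (rule test_in_bounded[OF t']) blast
    have i: "integrable lborel ?g1" "integrable lborel ?g2"
      by (rule integrable_bounded_support[of _ C z0 "2 * a"]; use C o in auto)+
    have "(LINT x|lborel. ?f x * dbar \<psi>1 \<psi>2 x) = (LINT x|lborel. (?g1 x + \<i> * ?g2 x) / 2)"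
    proof (rule Bochner_Integration.integral_cong[OF refl])
      fix x
      show "?f x * dbar \<psi>1 \<psi>2 x = (?g1 x + \<i> * ?g2 x) / 2"
      proof (cases "x \<in> ball z0 (2 * a)")
        case True
        have "(?g1 x + \<i> * ?g2 x) / 2 = H x * dbar \<psi>1 \<psi>2 x + dbar H1 H2 x * \<psi> x"
          by (simp add: dbar_def field_simps)
        then show ?thesis using True h by simp
      qed (use o in simp)
    qed
    also have "\<dots> = ((LINT x|lborel. ?g1 x) + \<i> * (LINT x|lborel. ?g2 x)) / 2"
      using i by simp
    also have "\<dots> = 0" using integral_partials_zero[OF t'] by simp
    finally show "(LINT x|lborel. ?f x * dbar \<psi>1 \<psi>2 x) = (LINT x|lborel. 0 * \<psi> x)" by simp
  qed
  have e: "integrable (lborel :: (real^2) measure) (\<lambda>x. 0 :: complex)" by simp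
  obtain G :: "real^2 \<Rightarrow> complex" where G: "\<And>z. norm (G z) \<le> 48 / a\<^sup>2 * (LINT x|lborel. norm (?f x))"
    "AE z in lborel. z \<in> ball z0 (3 * a / 4) \<longrightarrow> ennreal (norm (?f z)) \<le> ennreal (norm (G z)) + pot (\<lambda>x. 0) z \<and>
        ennreal (norm (G z)) \<le> 8 * ennreal (norm (?f z)) + pot (\<lambda>x. 0) z"
    by (rule local_representation[OF f e w a]) blast
  have eq: "(LINT x|lborel. norm (?f x)) = (LINT x|lborel. indicat_real (ball z0 (2 * a)) x * norm (H x))"
    by (intro Bochner_Integration.integral_cong) auto
  have "AE z in lborel. z \<in> ball z0 (3 * a / 4) \<longrightarrow> norm (H z) \<le> 48 / a\<^sup>2 * (LINT x|lborel. indicat_real (ball z0 (2 * a)) x * norm (H x))"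
    using G(2)
  proof eventually_elim
    case (elim z)
    show ?case
    proof
      assume z: "z \<in> ball z0 (3 * a / 4)"
      moreover have "z \<in> ball z0 (2 * a)" using z a by auto
      ultimately have "ennreal (norm (H z)) \<le> ennreal (norm (G z))" using elim by (simp add: pot_def)
      then have "norm (H z) \<le> norm (G z)" by simp
      also have "\<dots> \<le> 48 / a\<^sup>2 * (LINT x|lborel. indicat_real (ball z0 (2 * a)) x * norm (H x))" using G(1) unfolding eq .
      finally show "norm (H z) \<le> 48 / a\<^sup>2 * (LINT x|lborel. indicat_real (ball z0 (2 * a)) x * norm (H x))" .
    qed
  qed
  then show ?thesis
    by (rule AE_continuous_bound[rotated 2, OF _ z]) (auto intro!: continuous_intros has_partialsD(2)[OF p])
qed

section \<open>Three circles and potential estimates\<close>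

definition cv :: "complex \<Rightarrow> real^2" where "cv w = (\<chi> i. if i = 1 then Re w else Im w)"

lemma cv_simps [simp]: "cv w $ 1 = Re w" "cv w $ 2 = Im w" "zc (cv w) = w" "cv (zc x) = x"
  by (auto simp: cv_def zc_def vec_eq_iff forall_2)

lemma norm_cv [simp]: "norm (cv w) = norm w"
  by (simp flip: norm_zc)

lemma dbar_zero_holomorphic:
  assumes p: "has_partials H H1 H2" and h: "\<And>z. z \<in> ball z0 \<rho> \<Longrightarrow> dbar H1 H2 z = 0"
  shows "(\<lambda>w. H (z0 + cv w)) holomorphic_on ball 0 \<rho>"
proof (rule holomorphic_onI)
  fix w :: complex assume w: "w \<in> ball 0 \<rho>"
  have "linear cv" by (intro linearI) (auto simp: vec_eq_iff forall_2)
  then have "(cv has_derivative cv) (at w)"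
    by (intro bounded_linear_imp_has_derivative) (simp add: linear_conv_bounded_linear)
  then have "((\<lambda>w. z0 + cv w) has_derivative cv) (at w)"
    by (auto intro!: derivative_eq_intros)
  from has_derivative_compose[OF this has_partialsD(1)[OF p]]
  have d: "((\<lambda>w. H (z0 + cv w)) has_derivative (\<lambda>h. Re h *\<^sub>R H1 (z0 + cv w) + Im h *\<^sub>R H2 (z0 + cv w))) (at w)"
    by simp
  have "z0 + cv w \<in> ball z0 \<rho>" using w by (simp add: dist_norm)
  from h[OF this] have "\<i> * (H1 (z0 + cv w) + \<i> * H2 (z0 + cv w)) = 0" by (simp add: dbar_def)
  then have "H2 (z0 + cv w) = \<i> * H1 (z0 + cv w)" by (simp add: algebra_simps)
  then have "Re h *\<^sub>R H1 (z0 + cv w) + Im h *\<^sub>R H2 (z0 + cv w) = H1 (z0 + cv w) * h" for h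
    by (auto simp: complex_eq_iff algebra_simps)
  with d have "((\<lambda>w. H (z0 + cv w)) has_field_derivative H1 (z0 + cv w)) (at w)"
    by (simp add: has_field_derivative_def)
  then show "(\<lambda>w. H (z0 + cv w)) field_differentiable at w within ball 0 \<rho>"
    by (meson field_differentiable_at_within field_differentiable_def)
qed

text \<open>A version of Hadamard's three circles theorem: the maximum principle for \<open>H(z) / z\<^sup>n\<close>
  with a free integer exponent \<open>n\<close>.\<close>

lemma three_circles:
  assumes p: "has_partials H H1 H2" and h: "\<And>z. z \<in> ball z0 \<rho> \<Longrightarrow> dbar H1 H2 z = 0"
    and r: "0 < r1" "r1 \<le> r2" "r2 \<le> r3" "r1 < r3" "r3 < \<rho>"
    and A: "\<And>z. norm (z - z0) \<le> r1 \<Longrightarrow> norm (H z) \<le> A"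
    and N: "\<And>z. norm (z - z0) \<le> r3 \<Longrightarrow> norm (H z) \<le> N"
    and z: "norm (z - z0) \<le> r2"
  shows "norm (H z) \<le> max (A * (r2 / r1)^n) (N * (r2 / r3)^n)"
proof -
  have "norm (H z0) \<le> A" using A[of z0] r by simp
  then have A0: "0 \<le> A" using norm_ge_zero order_trans by blast
  show ?thesis
  \<comment> \<open>The annulus avoids the zero of w^n; inside the small disc the bound A suffices,
    because r2 / r1 \<ge> 1.\<close>
  proof (cases "norm (z - z0) < r1")
    case True
    have "norm (H z) \<le> A * 1" using A[of z] True by simp
    also have "\<dots> \<le> A * (r2 / r1)^n" using r A0 by (intro mult_left_mono one_le_power) auto
    finally show ?thesis by simp
  next
    case False
    define S where "S = cball (0::complex) r3 - ball 0 r1"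
    define f where "f w = H (z0 + cv w) / w^n" for w
    \<comment> \<open>The bounds for |H| / |w|^n on the two boundary circles; multiplying the larger
      one by r2^n gives the claim.\<close>
    define B where "B = max (A / r1^n) (N / r3^n)"
    have S: "closed S" "bounded S" unfolding S_def by (auto intro: closed_Diff bounded_subset[OF bounded_cball])
    have hol: "f holomorphic_on S"
      unfolding f_def S_def
      by (intro holomorphic_intros holomorphic_on_subset[OF dbar_zero_holomorphic[OF p h]]) (use r in auto)
    have fr: "norm w = r1 \<or> norm w = r3" if "w \<in> frontier S" for w
    proof -
      have "open (ball (0::complex) r3 - cball 0 r1)" by (intro open_Diff) auto
      moreover have "ball (0::complex) r3 - cball 0 r1 \<subseteq> S" by (auto simp: S_def)
      ultimately have "ball (0::complex) r3 - cball 0 r1 \<subseteq> interior S" by (rule interior_maximal[rotated])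
      then show ?thesis using that S(1) unfolding frontier_def S_def by (force simp: closure_closed)
    qed
    have "norm (f (zc (z - z0))) \<le> B"
    proof (rule maximum_modulus_frontier[of f S])
      show "f holomorphic_on interior S" using hol interior_subset holomorphic_on_subset by blast
      show "continuous_on (closure S) f" using hol S(1) by (simp add: closure_closed holomorphic_on_imp_continuous_on)
      show "bounded S" by fact
      show "norm (f w) \<le> B" if "w \<in> frontier S" for w
        using fr[OF that]
      proof
        assume w: "norm w = r1"
        have "norm (H (z0 + cv w)) \<le> A" using A[of "z0 + cv w"] w by simp
        then have "norm (f w) \<le> A / r1^n" using r w by (simp add: f_def norm_divide norm_power divide_right_mono)
        then show ?thesis by (simp add: B_def)
      next
        assume w: "norm w = r3"
        have "norm (H (z0 + cv w)) \<le> N" using N[of "z0 + cv w"] w by simp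
        then have "norm (f w) \<le> N / r3^n" using r w by (simp add: f_def norm_divide norm_power divide_right_mono)
        then show ?thesis by (simp add: B_def)
      qed
      show "zc (z - z0) \<in> S" using False z r norm_zc[of "z - z0"] by (simp add: S_def del: norm_zc)
    qed
    then have "norm (H z) / norm (z - z0)^n \<le> B"
      using norm_zc[of "z - z0"] cv_simps(4)[of "z - z0"] by (simp add: f_def norm_divide norm_power del: norm_zc cv_simps zc_simps)
    moreover have pos: "norm (z - z0) > 0" using False r by linarith
    ultimately have "norm (H z) \<le> B * norm (z - z0)^n" by (simp add: divide_le_eq)
    also have "\<dots> \<le> B * r2^n"
      using z A0 r by (intro mult_left_mono power_mono) (auto simp: B_def le_max_iff_disj)
    also have "\<dots> = max (A * (r2 / r1)^n) (N * (r2 / r3)^n)"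
      using r by (simp add: B_def max_mult_distrib_right power_divide)
    finally show ?thesis .
  qed
qed

section \<open>Estimates of the potential: L^1, L^p and exponential integrability\<close>

lemma powr_minus_one_norm: "norm (x::'a::real_normed_vector) powr - 1 = inverse (norm x)"
  by (cases "x = 0") (auto simp: powr_minus)

lemma inverse_norm_integral:
  assumes "0 < r" "\<xi> \<in> ball z0 r"
  shows "(\<integral>\<^sup>+z. indicator (ball z0 r) z * ennreal (inverse (norm (z - \<xi> :: real^2))) \<partial>lborel) \<le> ennreal (52 * r)"
  using riesz_integral_ball'[of 1 r \<xi> z0] assms by (simp add: powr_minus_one_norm norm_minus_commute inverse_eq_divide)

text \<open>By Tonelli the kernel 1/|z - \<xi>| is integrated in z first, which costs at most 52 r
  for every \<xi> in the ball.\<close>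

lemma pot_L1:
  assumes [measurable]: "e \<in> borel_measurable borel" and s: "\<And>x. x \<notin> ball z0 r \<Longrightarrow> e x = 0" and r: "0 < r"
  shows "(\<integral>\<^sup>+z. indicator (ball z0 r) z * pot e z \<partial>lborel) \<le> ennreal (52 * r) * (\<integral>\<^sup>+x. ennreal (norm (e x)) \<partial>lborel)"
proof -
  have "(\<integral>\<^sup>+z. indicator (ball z0 r) z * pot e z \<partial>lborel)
     = (\<integral>\<^sup>+z. \<integral>\<^sup>+\<xi>. indicator (ball z0 r) z * ennreal (norm (e \<xi>) * inverse (norm (z - \<xi>))) \<partial>lborel \<partial>lborel)"
    unfolding pot_def by (subst nn_integral_cmult) auto
  also have "\<dots> = (\<integral>\<^sup>+\<xi>. \<integral>\<^sup>+z. indicator (ball z0 r) z * ennreal (norm (e \<xi>) * inverse (norm (z - \<xi>))) \<partial>lborel \<partial>lborel)"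
    by (rule lborel_pair.Fubini'[symmetric]) measurable
  also have "\<dots> \<le> (\<integral>\<^sup>+\<xi>. ennreal (52 * r) * ennreal (norm (e \<xi>)) \<partial>lborel)"
  proof (intro nn_integral_mono)
    fix \<xi>
    show "(\<integral>\<^sup>+z. indicator (ball z0 r) z * ennreal (norm (e \<xi>) * inverse (norm (z - \<xi>))) \<partial>lborel) \<le> ennreal (52 * r) * ennreal (norm (e \<xi>))"
    proof (cases "\<xi> \<in> ball z0 r")
      case True
      have "(\<integral>\<^sup>+z. indicator (ball z0 r) z * ennreal (norm (e \<xi>) * inverse (norm (z - \<xi>))) \<partial>lborel)
        = (\<integral>\<^sup>+z. ennreal (norm (e \<xi>)) * (indicator (ball z0 r) z * ennreal (inverse (norm (z - \<xi>)))) \<partial>lborel)"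
        by (intro nn_integral_cong) (simp add: ennreal_mult mult_ac)
      also have "\<dots> = ennreal (norm (e \<xi>)) * (\<integral>\<^sup>+z. indicator (ball z0 r) z * ennreal (inverse (norm (z - \<xi>))) \<partial>lborel)"
        by (rule nn_integral_cmult) measurable
      also have "\<dots> \<le> ennreal (norm (e \<xi>)) * ennreal (52 * r)"
        by (intro mult_left_mono inverse_norm_integral r True) simp
      finally show ?thesis by (simp add: mult.commute)
    qed (simp add: s)
  qed
  also have "\<dots> = ennreal (52 * r) * (\<integral>\<^sup>+x. ennreal (norm (e x)) \<partial>lborel)" by (rule nn_integral_cmult) measurable
  finally show ?thesis .
qed

text \<open>Hoelder's inequality with the dual exponent q, carried out pointwise through Young's
  inequality after normalising both factors. With a = 2 - q the q-th power of the kernel is |z -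
  \<xi>|^(a - 2), integrable because p > 2 means a > 0. Scaling in r produces the exponent a / q = 1
  - 2 / p.\<close>

lemma pot_Lp_bound:
  assumes [measurable]: "b \<in> borel_measurable borel" and s: "\<And>x. x \<notin> ball z0 r \<Longrightarrow> b x = 0" and r: "0 < r"
    and p: "2 < p" and K: "0 < K" "(\<integral>\<^sup>+x. ennreal (norm (b x) powr p) \<partial>lborel) \<le> ennreal (K powr p)"
    and z: "z \<in> ball z0 r"
  shows "pot b z \<le> ennreal ((1 + 52 * (p - 1) / (p - 2)) * K * r powr (1 - 2 / p))"
proof -
  define q where "q = p / (p - 1)"
  have q: "1 < q" "q < 2" using p by (auto simp: q_def field_simps)
  have pq: "1 / p + 1 / q = 1" using p by (simp add: q_def field_simps)
  define a where "a = 2 - q"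
  have a: "0 < a" "a \<le> 1" using q by (auto simp: a_def)
  have aq: "a = (p - 2) / (p - 1)" using p by (simp add: a_def q_def field_simps)
  \<comment> \<open>The L^q norm of the kernel on the ball is of this order. Dividing the kernel by
    R and \<open>b\<close> by K makes both terms of Young's inequality have an integral bounded
    independently of r and K.\<close>
  define R where "R = r powr (a / q)"
  have R: "R > 0" using r by (simp add: R_def)
  have Rq: "R powr q = r powr a" using q by (simp add: R_def powr_powr)
  have pt: "ennreal (norm (b \<xi>) * inverse (norm (z - \<xi>))) \<le> ennreal (K * R) *
     (ennreal (inverse (K powr p)) * ennreal (norm (b \<xi>) powr p) + ennreal (inverse (r powr a)) * (indicator (ball z0 r) \<xi> * ennreal (norm (z - \<xi>) powr (a - 2))))" for \<xi>
  proof (cases "\<xi> \<in> ball z0 r")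
    case True
    define x y where "x = norm (b \<xi>) / K" and "y = inverse (norm (z - \<xi>)) / R"
    have xy: "0 \<le> x" "0 \<le> y" using K R by (auto simp: x_def y_def)
    have "x * y \<le> x powr p / p + y powr q / q"
      using p q pq xy by (intro Youngs_inequality) auto
    also have "\<dots> \<le> x powr p + y powr q"
    proof -
      have "c / d \<le> c" if "1 \<le> d" "0 \<le> c" for c d :: real
        using that mult_left_mono[of 1 d c] by (simp add: divide_le_eq)
      then show ?thesis using p q by (intro add_mono) auto
    qed
    also have "x powr p = inverse (K powr p) * norm (b \<xi>) powr p"
    proof -
      have "x powr p = norm (b \<xi>) powr p / K powr p" using K by (simp add: x_def powr_divide)
      then show ?thesis by (simp add: divide_inverse mult.commute)
    qed
    also have "y powr q = inverse (r powr a) * norm (z - \<xi>) powr (a - 2)"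
    proof -
      have "inverse (norm (z - \<xi>)) powr q = norm (z - \<xi>) powr (a - 2)"
      proof -
        have "inverse (norm (z - \<xi>)) powr q = norm (z - \<xi>) powr (- 1 * q)"
          by (simp only: powr_minus_one_norm[symmetric] powr_powr)
        then show ?thesis by (simp add: a_def)
      qed
      moreover have "y powr q = inverse (norm (z - \<xi>)) powr q / R powr q" using R by (simp add: y_def powr_divide)
      ultimately show ?thesis using Rq by (simp add: divide_inverse mult.commute)
    qed
    finally have "K * R * (x * y) \<le> K * R * (inverse (K powr p) * norm (b \<xi>) powr p + inverse (r powr a) * norm (z - \<xi>) powr (a - 2))"
      using K R by (intro mult_left_mono) auto
    moreover have "K * R * (x * y) = norm (b \<xi>) * inverse (norm (z - \<xi>))" using K R by (simp add: x_def y_def)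
    ultimately have "ennreal (norm (b \<xi>) * inverse (norm (z - \<xi>))) \<le> ennreal (K * R * (inverse (K powr p) * norm (b \<xi>) powr p + inverse (r powr a) * norm (z - \<xi>) powr (a - 2)))"
      by (intro ennreal_leI) simp
    then show ?thesis using True K R by (simp add: ennreal_mult ennreal_plus)
  qed (simp add: s)
  have "pot b z \<le> (\<integral>\<^sup>+\<xi>. ennreal (K * R) *
     (ennreal (inverse (K powr p)) * ennreal (norm (b \<xi>) powr p) + ennreal (inverse (r powr a)) * (indicator (ball z0 r) \<xi> * ennreal (norm (z - \<xi>) powr (a - 2)))) \<partial>lborel)"
    unfolding pot_def by (intro nn_integral_mono pt)
  also have "\<dots> = ennreal (K * R) * (ennreal (inverse (K powr p)) * (\<integral>\<^sup>+\<xi>. ennreal (norm (b \<xi>) powr p) \<partial>lborel)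
     + ennreal (inverse (r powr a)) * (\<integral>\<^sup>+\<xi>. indicator (ball z0 r) \<xi> * ennreal (norm (z - \<xi>) powr (a - 2)) \<partial>lborel))"
    by (simp add: nn_integral_cmult nn_integral_add)
  also have "\<dots> \<le> ennreal (K * R) * (ennreal (inverse (K powr p)) * ennreal (K powr p) + ennreal (inverse (r powr a)) * ennreal (52 * r powr a / a))"
    using a r z by (intro mult_left_mono add_mono K riesz_integral_ball') auto
  also have "\<dots> = ennreal (K * R * (inverse (K powr p) * K powr p + inverse (r powr a) * (52 * r powr a / a)))"
  proof -
    have "ennreal A * (ennreal B * ennreal C + ennreal D * ennreal E) = ennreal (A * (B * C + D * E))"
      if "0 \<le> A" "0 \<le> B" "0 \<le> C" "0 \<le> D" "0 \<le> E" for A B C D E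
      using that by (simp add: ennreal_mult ennreal_plus)
    then show ?thesis using a K R by simp
  qed
  also have "K * R * (inverse (K powr p) * K powr p + inverse (r powr a) * (52 * r powr a / a)) = (1 + 52 / a) * K * R"
    using K r by (simp add: field_simps)
  also have "52 / a = 52 * (p - 1) / (p - 2)" by (simp add: aq)
  also have "R = r powr (1 - 2 / p)"
  proof -
    have "a / q = 1 - 2 / p" using p by (simp add: aq q_def field_simps)
    then show ?thesis by (simp add: R_def)
  qed
  finally show ?thesis .
qed

text \<open>The quotient (2 m)! / m! has m factors larger than m. In \<open>exp_pot_integral\<close>
  this leaves a spare m! below the moments.\<close>

lemma fact_double_ge: "(fact m :: real) * real m ^ m \<le> fact (2 * m)"
proof -
  have "(fact m :: real) * real m ^ k \<le> fact (m + k)" for k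
  proof (induction k)
    case (Suc k)
    have "(fact m :: real) * real m ^ Suc k = real m * (fact m * real m ^ k)" by simp
    also have "\<dots> \<le> real (m + k + 1) * fact (m + k)" using Suc by (intro mult_mono) auto
    finally show ?case by (simp add: algebra_simps)
  qed simp
  from this[of m] show ?thesis by (simp add: mult_2)
qed

text \<open>The kernel is split as |z - \<xi>|^(-a/2) times |z - \<xi>|^(a/2 - 1) with a = 1/m.
  Cauchy-Schwarz bounds the square of the potential by \<open>U\<close> times a Riesz integral
  proportional to m. Raising to the power m turns the kernel |z - \<xi>|^(-a) into 1/|z - \<xi>|,
  whose integral in z is bounded. The outcome is that the moment of order 2 m grows like m^m, as in
  Trudinger's inequality.\<close>

lemma pot_moment:
  assumes [measurable]: "b \<in> borel_measurable borel" and s: "\<And>x. x \<notin> ball z0 r \<Longrightarrow> b x = 0" and r: "0 < r"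
    and \<kappa>: "0 < \<kappa>" "(\<integral>\<^sup>+x. ennreal ((norm (b x))\<^sup>2) \<partial>lborel) \<le> ennreal (\<kappa>\<^sup>2)"
  shows "(\<integral>\<^sup>+z. indicator (ball z0 r) z * pot b z ^ (2 * m) \<partial>lborel) \<le> ennreal ((104 * real m)^m * 52 * r\<^sup>2 * \<kappa>^(2 * m))"
proof (cases "m = 0")
  case True
  have "ennreal (pi * r\<^sup>2) \<le> ennreal (52 * r\<^sup>2)"
    using pi_less_4 by (intro ennreal_leI mult_right_mono) auto
  then show ?thesis using True r by (simp add: emeasure_ball_2)
next
  case False
  define a where "a = 1 / real m"
  have a: "0 < a" "a \<le> 1" using False by (auto simp: a_def)
  define U where "U z = (\<integral>\<^sup>+\<xi>. ennreal ((norm (b \<xi>))\<^sup>2 * norm (z - \<xi>) powr (- a)) \<partial>lborel)" for z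
  define V where "V z = (\<integral>\<^sup>+\<xi>. ennreal ((norm (b \<xi>))\<^sup>2 * inverse (norm (z - \<xi>))) \<partial>lborel)" for z
  have S1: "pot b z ^ 2 \<le> U z * ennreal (52 * r powr a / a)" if z: "z \<in> ball z0 r" for z
  proof -
    let ?f = "\<lambda>\<xi>. ennreal (norm (b \<xi>) * norm (z - \<xi>) powr (- a / 2))"
    let ?g = "\<lambda>\<xi>. indicator (ball z0 r) \<xi> * ennreal (norm (z - \<xi>) powr (a / 2 - 1))"
    have "pot b z = (\<integral>\<^sup>+\<xi>. ?f \<xi> * ?g \<xi> \<partial>lborel)"
      unfolding pot_def
    proof (intro nn_integral_cong)
      fix \<xi>
      have "norm (z - \<xi>) powr (- a / 2) * norm (z - \<xi>) powr (a / 2 - 1) = inverse (norm (z - \<xi>))"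
        unfolding powr_add[symmetric] by (simp add: powr_minus_one_norm inverse_eq_divide)
      then show "ennreal (norm (b \<xi>) * inverse (norm (z - \<xi>))) = ?f \<xi> * ?g \<xi>"
        using s[of \<xi>] by (cases "\<xi> \<in> ball z0 r") (simp_all add: ennreal_mult[symmetric] mult.assoc)
    qed
    then have "pot b z ^ 2 \<le> (\<integral>\<^sup>+\<xi>. ?f \<xi> ^ 2 \<partial>lborel) * (\<integral>\<^sup>+\<xi>. ?g \<xi> ^ 2 \<partial>lborel)"
      using Cauchy_Schwarz_nn_integral[of ?f lborel ?g] by simp
    also have "(\<integral>\<^sup>+\<xi>. ?f \<xi> ^ 2 \<partial>lborel) = U z"
      unfolding U_def
    proof (intro nn_integral_cong)
      fix \<xi>
      have "(norm (z - \<xi>) powr (- a / 2))\<^sup>2 = norm (z - \<xi>) powr (- a)"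
        by (simp add: power2_eq_square flip: powr_add)
      then show "?f \<xi> ^ 2 = ennreal ((norm (b \<xi>))\<^sup>2 * norm (z - \<xi>) powr (- a))"
        by (simp add: ennreal_power power_mult_distrib)
    qed
    also have "(\<integral>\<^sup>+\<xi>. ?g \<xi> ^ 2 \<partial>lborel) = (\<integral>\<^sup>+\<xi>. indicator (ball z0 r) \<xi> * ennreal (norm (z - \<xi>) powr (a - 2)) \<partial>lborel)"
    proof (intro nn_integral_cong)
      fix \<xi>
      have "(norm (z - \<xi>) powr (a / 2 - 1))\<^sup>2 = norm (z - \<xi>) powr (a - 2)"
        by (simp add: power2_eq_square flip: powr_add)
      then show "?g \<xi> ^ 2 = indicator (ball z0 r) \<xi> * ennreal (norm (z - \<xi>) powr (a - 2))"
        by (simp add: ennreal_power power_mult_distrib indicator_def)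
    qed
    also have "\<dots> \<le> ennreal (52 * r powr a / a)" using riesz_integral_ball'[OF a r z] .
    finally show ?thesis by (auto simp: mult_left_mono)
  qed
  \<comment> \<open>Jensen's inequality for the measure |b|^2 of mass at most \<kappa>^2, up to a
    factor 2^m. It is replaced by the elementary y \<le> t + t^(1-m) y^m with a suitable t.\<close>
  have S2: "U z ^ m \<le> ennreal (2^m * \<kappa>^(2 * (m - 1))) * V z" for z
  proof (cases "V z")
    case top
    then show ?thesis using \<kappa> by (simp add: ennreal_mult_top)
  next
    case (real v)
    \<comment> \<open>At \<xi> = z both sides vanish by the conventions for \<open>powr\<close> and
      \<open>inverse\<close> at 0, so the two kernels have the same zero set.\<close>
    have y: "norm (z - \<xi>) powr (- a) = 0 \<longleftrightarrow> inverse (norm (z - \<xi>)) = 0" for \<xi> by auto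
    show ?thesis
    \<comment> \<open>For v = 0 the balancing t would be 0. In this case the integrand of
      \<open>V\<close> vanishes almost everywhere, and with it that of \<open>U\<close>.\<close>
    proof (cases "v = 0")
      case True
      then have "AE \<xi> in lborel. ennreal ((norm (b \<xi>))\<^sup>2 * inverse (norm (z - \<xi>))) = 0"
        using real unfolding V_def by (subst nn_integral_0_iff_AE[symmetric]) auto
      then have "AE \<xi> in lborel. ennreal ((norm (b \<xi>))\<^sup>2 * norm (z - \<xi>) powr (- a)) = 0"
      proof eventually_elim
        case (elim \<xi>)
        then have "(norm (b \<xi>))\<^sup>2 * inverse (norm (z - \<xi>)) \<le> 0" by (simp only: ennreal_eq_0_iff)
        moreover have "0 \<le> (norm (b \<xi>))\<^sup>2 * inverse (norm (z - \<xi>))" by simp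
        ultimately have "(norm (b \<xi>))\<^sup>2 * inverse (norm (z - \<xi>)) = 0" by (rule antisym)
        then have "(norm (b \<xi>))\<^sup>2 * norm (z - \<xi>) powr (- a) = 0" using y[of \<xi>] by (simp only: mult_eq_0_iff)
        then show ?case by simp
      qed
      then have "U z = 0" unfolding U_def by (subst nn_integral_0_iff_AE) auto
      then show ?thesis using False by (simp add: power_0_left)
    next
      case v: False
      \<comment> \<open>With this t both terms of the splitting contribute the same amount t
        \<kappa>^2.\<close>
      define t where "t = root m (v / \<kappa>\<^sup>2)"
      have vpos: "v > 0" using v real by simp
      have t: "t > 0" "t^m = v / \<kappa>\<^sup>2" using vpos False \<kappa> by (auto simp: t_def)
      have pw: "y \<le> t + inverse (t^(m-1)) * y^m" if "0 \<le> y" for y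
      proof (cases "y \<le> t")
        case True
        then show ?thesis using t that by (simp add: add_increasing2)
      next
        case False
        then have "1 \<le> (y / t)^(m-1)" using t by (intro one_le_power) (simp add: field_simps)
        then have "y * 1 \<le> y * (y / t)^(m-1)" using that by (rule mult_left_mono)
        also have "\<dots> = inverse (t^(m-1)) * y^m"
          using \<open>m \<noteq> 0\<close> by (cases m) (simp_all add: power_mult_distrib power_inverse divide_inverse mult_ac)
        finally show ?thesis using t by simp
      qed
      have "U z \<le> (\<integral>\<^sup>+\<xi>. ennreal t * ennreal ((norm (b \<xi>))\<^sup>2) + ennreal (inverse (t^(m-1))) * ennreal ((norm (b \<xi>))\<^sup>2 * inverse (norm (z - \<xi>))) \<partial>lborel)"
        unfolding U_def
      proof (intro nn_integral_mono)
        fix \<xi>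
        have "(norm (z - \<xi>) powr (- a))^m = inverse (norm (z - \<xi>))"
        proof (cases "z = \<xi>")
          case False
          then have "(norm (z - \<xi>) powr (- a))^m = norm (z - \<xi>) powr (- a * real m)"
            by (simp add: powr_realpow[symmetric] powr_powr)
          also have "- a * real m = - 1" using \<open>m \<noteq> 0\<close> by (simp add: a_def)
          finally show ?thesis using powr_minus_one_norm[of "z - \<xi>"] by metis
        qed (use \<open>m \<noteq> 0\<close> in auto)
        then have "norm (z - \<xi>) powr (- a) \<le> t + inverse (t^(m-1)) * inverse (norm (z - \<xi>))"
          using pw[of "norm (z - \<xi>) powr (- a)"] by simp
        from mult_left_mono[OF this, of "(norm (b \<xi>))\<^sup>2"]
        have "(norm (b \<xi>))\<^sup>2 * norm (z - \<xi>) powr (- a) \<le> t * (norm (b \<xi>))\<^sup>2 + inverse (t^(m-1)) * ((norm (b \<xi>))\<^sup>2 * inverse (norm (z - \<xi>)))"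
          by (simp add: algebra_simps)
        from ennreal_leI[OF this]
        show "ennreal ((norm (b \<xi>))\<^sup>2 * norm (z - \<xi>) powr (- a)) \<le> ennreal t * ennreal ((norm (b \<xi>))\<^sup>2) + ennreal (inverse (t^(m-1))) * ennreal ((norm (b \<xi>))\<^sup>2 * inverse (norm (z - \<xi>)))"
          using t(1) by (subst (asm) ennreal_plus) (auto simp flip: ennreal_mult)
      qed
      also have "\<dots> = ennreal t * (\<integral>\<^sup>+\<xi>. ennreal ((norm (b \<xi>))\<^sup>2) \<partial>lborel) + ennreal (inverse (t^(m-1))) * V z"
        unfolding V_def by (simp add: nn_integral_add nn_integral_cmult)
      also have "\<dots> \<le> ennreal t * ennreal (\<kappa>\<^sup>2) + ennreal (inverse (t^(m-1))) * ennreal v"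
        using real by (intro add_mono mult_left_mono \<kappa>) auto
      also have "\<dots> = ennreal (t * \<kappa>\<^sup>2 + inverse (t^(m-1)) * v)"
        using t(1) real by (simp add: ennreal_mult ennreal_plus)
      also have "inverse (t^(m-1)) * v = t * \<kappa>\<^sup>2"
      proof -
        have "v = t^m * \<kappa>\<^sup>2" using t(2) \<kappa> by simp
        also have "t^m = t * t^(m-1)" using \<open>m \<noteq> 0\<close> by (cases m) simp_all
        finally show ?thesis using t(1) by simp
      qed
      finally have "U z ^ m \<le> ennreal (t * \<kappa>\<^sup>2 + t * \<kappa>\<^sup>2) ^ m" by (rule power_mono) simp
      also have "\<dots> = ennreal ((t * \<kappa>\<^sup>2 + t * \<kappa>\<^sup>2)^m)" using t by (simp add: ennreal_power)
      also have "(t * \<kappa>\<^sup>2 + t * \<kappa>\<^sup>2)^m = 2^m * (t^m * (\<kappa>\<^sup>2)^m)"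
        by (simp add: power_mult_distrib flip: mult_2)
      also have "t^m * (\<kappa>\<^sup>2)^m = \<kappa>^(2 * (m - 1)) * v"
      proof -
        have "(\<kappa>\<^sup>2)^m = \<kappa>\<^sup>2 * \<kappa>^(2 * (m - 1))" using \<open>m \<noteq> 0\<close> by (cases m) (simp_all add: power_mult)
        then show ?thesis using t(2) \<kappa> by simp
      qed
      finally show ?thesis using real \<kappa> by (simp add: ennreal_mult mult.assoc)
    qed
  qed
  have S3: "pot b z ^ (2 * m) \<le> ennreal (2^m * \<kappa>^(2 * (m - 1)) * ((52 * real m)^m * r)) * V z" if z: "z \<in> ball z0 r" for z
  proof -
    have "pot b z ^ (2 * m) \<le> (U z * ennreal (52 * r powr a / a)) ^ m"
      unfolding power_mult by (intro power_mono S1 z) simp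
    also have "\<dots> = U z ^ m * ennreal ((52 * r powr a / a)^m)"
      using a by (simp add: power_mult_distrib ennreal_power)
    also have "(52 * r powr a / a)^m = (52 * real m)^m * r"
    proof -
      have "(r powr a)^m = r powr (a * real m)" using r by (simp add: powr_realpow[symmetric] powr_powr)
      also have "\<dots> = r" using False r by (simp add: a_def)
      finally have "(r powr a)^m = r" .
      moreover have "52 * r powr a / a = 52 * real m * r powr a" by (simp add: a_def)
      ultimately show ?thesis by (simp add: power_mult_distrib)
    qed
    also have "U z ^ m * ennreal ((52 * real m)^m * r) \<le> (ennreal (2^m * \<kappa>^(2 * (m - 1))) * V z) * ennreal ((52 * real m)^m * r)"
      by (intro mult_right_mono S2) simp
    also have "\<dots> = ennreal (2^m * \<kappa>^(2 * (m - 1)) * ((52 * real m)^m * r)) * V z"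
      using \<kappa> r by (simp add: ennreal_mult mult_ac)
    finally show ?thesis .
  qed
  have Vpot: "V z = pot (\<lambda>x. of_real ((norm (b x))\<^sup>2)) z" for z by (simp add: V_def pot_def norm_power)
  have Vm [measurable]: "V \<in> borel_measurable borel" unfolding V_def by measurable
  have "(\<integral>\<^sup>+z. indicator (ball z0 r) z * pot b z ^ (2 * m) \<partial>lborel)
     \<le> (\<integral>\<^sup>+z. ennreal (2^m * \<kappa>^(2 * (m - 1)) * ((52 * real m)^m * r)) * (indicator (ball z0 r) z * V z) \<partial>lborel)"
    by (intro nn_integral_mono) (use S3 in \<open>auto simp: indicator_def\<close>)
  also have "\<dots> = ennreal (2^m * \<kappa>^(2 * (m - 1)) * ((52 * real m)^m * r)) * (\<integral>\<^sup>+z. indicator (ball z0 r) z * V z \<partial>lborel)"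
    by (rule nn_integral_cmult) measurable
  also have "\<dots> \<le> ennreal (2^m * \<kappa>^(2 * (m - 1)) * ((52 * real m)^m * r)) * (ennreal (52 * r) * ennreal (\<kappa>\<^sup>2))"
  proof (intro mult_left_mono)
    have "(\<integral>\<^sup>+z. indicator (ball z0 r) z * V z \<partial>lborel) \<le> ennreal (52 * r) * (\<integral>\<^sup>+x. ennreal (norm (complex_of_real ((norm (b x))\<^sup>2))) \<partial>lborel)"
      unfolding Vpot by (rule pot_L1) (use s r in auto)
    also have "\<dots> \<le> ennreal (52 * r) * ennreal (\<kappa>\<^sup>2)" using \<kappa>(2) by (intro mult_left_mono) (auto simp: norm_power)
    finally show "(\<integral>\<^sup>+z. indicator (ball z0 r) z * V z \<partial>lborel) \<le> ennreal (52 * r) * ennreal (\<kappa>\<^sup>2)" .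
  qed simp
  also have "\<dots> = ennreal (2^m * \<kappa>^(2 * (m - 1)) * ((52 * real m)^m * r) * (52 * r * \<kappa>\<^sup>2))"
    using \<kappa> r by (simp add: ennreal_mult)
  also have "2^m * \<kappa>^(2 * (m - 1)) * ((52 * real m)^m * r) * (52 * r * \<kappa>\<^sup>2) = (104 * real m)^m * 52 * r\<^sup>2 * \<kappa>^(2 * m)"
  proof -
    have k: "\<kappa>^(2 * m) = \<kappa>^(2 * (m - 1)) * \<kappa>\<^sup>2" using False by (cases m) (auto simp: power2_eq_square)
    have "104 * real m = 2 * (52 * real m)" by simp
    then have k': "(104 * real m)^m = 2^m * (52 * real m)^m" by (simp only: power_mult_distrib)
    show ?thesis unfolding k k' by (simp only: power2_eq_square mult_ac)
  qed
  finally show ?thesis .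
qed

text \<open>Only even moments are available, so exp is majorised by 2 cosh, whose series has even
  powers. Moments of order 2 m growing like m^m against the denominator (2 m)! leave 1/m!, so the
  series converges for every size of \<kappa>.\<close>

lemma exp_pot_integral:
  assumes [measurable]: "b \<in> borel_measurable borel" and s: "\<And>x. x \<notin> ball z0 r \<Longrightarrow> b x = 0" and r: "0 < r"
    and \<kappa>: "0 < \<kappa>" "(\<integral>\<^sup>+x. ennreal ((norm (b x))\<^sup>2) \<partial>lborel) \<le> ennreal (\<kappa>\<^sup>2)"
    and [measurable]: "w \<in> borel_measurable borel" and w: "\<And>z. 0 \<le> w z" "\<And>z. z \<in> ball z0 r \<Longrightarrow> ennreal (w z) \<le> pot b z"
  shows "(\<integral>\<^sup>+z. indicator (ball z0 r) z * ennreal (exp (2 * w z)) \<partial>lborel) \<le> ennreal (104 * r\<^sup>2 * exp (416 * \<kappa>\<^sup>2))"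
proof -
  have e: "ennreal (exp x) \<le> (\<Sum>m. ennreal (2 * x^(2 * m) / fact (2 * m)))" if "0 \<le> x" for x :: real
  proof -
    have "(\<lambda>n. if even n then x ^ n /\<^sub>R fact n else 0) sums cosh x" by (rule cosh_converges)
    then have "(\<lambda>m. x^(2 * m) /\<^sub>R fact (2 * m)) sums cosh x"
      by (subst (asm) sums_mono_reindex[of "\<lambda>m. 2 * m", symmetric]) (auto simp: strict_mono_def elim!: evenE)
    from sums_mult[OF this, of 2] have "(\<lambda>m. 2 * x^(2 * m) / fact (2 * m)) sums (2 * cosh x)"
      by (simp add: divide_inverse mult_ac)
    then have "(\<Sum>m. ennreal (2 * x^(2 * m) / fact (2 * m))) = ennreal (2 * cosh x)"
      by (intro suminf_ennreal_eq) auto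
    moreover have "exp x \<le> 2 * cosh x" by (simp add: cosh_def)
    ultimately show ?thesis by (simp add: ennreal_leI)
  qed
  have t: "(\<integral>\<^sup>+z. indicator (ball z0 r) z * ennreal (2 * (2 * w z)^(2 * m) / fact (2 * m)) \<partial>lborel)
      \<le> ennreal (104 * r\<^sup>2 * ((416 * \<kappa>\<^sup>2)^m /\<^sub>R fact m))" for m
  proof -
    have "(\<integral>\<^sup>+z. indicator (ball z0 r) z * ennreal (2 * (2 * w z)^(2 * m) / fact (2 * m)) \<partial>lborel)
      \<le> (\<integral>\<^sup>+z. ennreal (2 * 4^m / fact (2 * m)) * (indicator (ball z0 r) z * pot b z ^ (2 * m)) \<partial>lborel)"
    proof (intro nn_integral_mono)
      fix z
      show "indicator (ball z0 r) z * ennreal (2 * (2 * w z)^(2 * m) / fact (2 * m)) \<le> ennreal (2 * 4^m / fact (2 * m)) * (indicator (ball z0 r) z * pot b z ^ (2 * m))"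
      proof (cases "z \<in> ball z0 r")
        case True
        have "2 * (2 * w z)^(2 * m) / fact (2 * m) = (2 * 4^m / fact (2 * m)) * w z ^ (2 * m)"
        proof -
          have "(2::real)^(2 * m) = 4^m" by (simp add: power_mult)
          then show ?thesis by (simp add: power_mult_distrib)
        qed
        note eq = this
        have "ennreal (2 * (2 * w z)^(2 * m) / fact (2 * m)) = ennreal (2 * 4^m / fact (2 * m)) * ennreal (w z) ^ (2 * m)"
          unfolding eq using w(1) by (simp add: ennreal_mult[symmetric] ennreal_power)
        also have "\<dots> \<le> ennreal (2 * 4^m / fact (2 * m)) * pot b z ^ (2 * m)"
          by (intro mult_left_mono power_mono w True) auto
        finally show ?thesis using True by simp
      qed simp
    qed
    also have "\<dots> = ennreal (2 * 4^m / fact (2 * m)) * (\<integral>\<^sup>+z. indicator (ball z0 r) z * pot b z ^ (2 * m) \<partial>lborel)"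
      unfolding pot_def by (rule nn_integral_cmult) measurable
    also have "\<dots> \<le> ennreal (2 * 4^m / fact (2 * m)) * ennreal ((104 * real m)^m * 52 * r\<^sup>2 * \<kappa>^(2 * m))"
      by (intro mult_left_mono pot_moment s r \<kappa>) auto
    also have "\<dots> = ennreal ((2 * 4^m / fact (2 * m)) * ((104 * real m)^m * 52 * r\<^sup>2 * \<kappa>^(2 * m)))"
      by (rule ennreal_mult[symmetric]) (use \<kappa> in auto)
    also have "\<dots> \<le> ennreal (104 * r\<^sup>2 * ((416 * \<kappa>\<^sup>2)^m /\<^sub>R fact m))"
    proof (rule ennreal_leI)
      have "(2 * 4^m / fact (2 * m)) * ((104 * real m)^m * 52 * r\<^sup>2 * \<kappa>^(2 * m)) = 104 * r\<^sup>2 * (416 * \<kappa>\<^sup>2)^m * (real m ^ m / fact (2 * m))"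
      proof -
        \<comment> \<open>In 416 = 4 * 104 the 4 comes from the square of 2 w and the 104 from the
          moments.\<close>
        have "(416 * \<kappa>\<^sup>2)^m = 4^m * 104^m * \<kappa>^(2 * m)"
          by (simp add: power_mult_distrib power_mult flip: power_mult_distrib[of 4 104])
        then show ?thesis by (simp add: power_mult_distrib)
      qed
      also have "\<dots> \<le> 104 * r\<^sup>2 * (416 * \<kappa>\<^sup>2)^m * (1 / fact m)"
      proof (intro mult_left_mono)
        show "real m ^ m / fact (2 * m) \<le> 1 / fact m"
          using fact_double_ge[of m] by (simp add: divide_le_eq pos_le_divide_eq mult.commute)
      qed auto
      finally show "(2 * 4^m / fact (2 * m)) * ((104 * real m)^m * 52 * r\<^sup>2 * \<kappa>^(2 * m)) \<le> 104 * r\<^sup>2 * ((416 * \<kappa>\<^sup>2)^m /\<^sub>R fact m)"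
        by (simp add: divide_inverse mult_ac)
    qed
    finally show ?thesis .
  qed
  have "(\<integral>\<^sup>+z. indicator (ball z0 r) z * ennreal (exp (2 * w z)) \<partial>lborel)
    \<le> (\<integral>\<^sup>+z. indicator (ball z0 r) z * (\<Sum>m. ennreal (2 * (2 * w z)^(2 * m) / fact (2 * m))) \<partial>lborel)"
    using w(1) by (intro nn_integral_mono mult_left_mono e) auto
  also have "\<dots> = (\<integral>\<^sup>+z. (\<Sum>m. indicator (ball z0 r) z * ennreal (2 * (2 * w z)^(2 * m) / fact (2 * m))) \<partial>lborel)"
    by (simp add: ennreal_suminf_cmult)
  also have "\<dots> = (\<Sum>m. \<integral>\<^sup>+z. indicator (ball z0 r) z * ennreal (2 * (2 * w z)^(2 * m) / fact (2 * m)) \<partial>lborel)"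
    by (rule nn_integral_suminf) measurable
  also have "\<dots> \<le> (\<Sum>m. ennreal (104 * r\<^sup>2 * ((416 * \<kappa>\<^sup>2)^m /\<^sub>R fact m)))"
    by (intro suminf_le t) auto
  also have "\<dots> = ennreal (104 * r\<^sup>2 * exp (416 * \<kappa>\<^sup>2))"
    by (intro suminf_ennreal_eq sums_mult exp_converges) auto
  finally show ?thesis .
qed

section \<open>Mollification and weak derivatives\<close>

text \<open>The powers of s in the denominator make the family stable under differentiation: the
  derivative of \<open>bumpf m\<close> is a combination of \<open>bumpf (m + 1)\<close> and
  \<open>bumpf (m + 2)\<close>. Smoothness of the classical bump, the case m = 0, then follows by
  induction.\<close>

definition bumpf :: "nat \<Rightarrow> real \<Rightarrow> real" where
  "bumpf m s = (if s > 0 then exp (- 1 / s) / s^m else 0)"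

lemma power_div_fact_le_exp: "0 \<le> (x::real) \<Longrightarrow> x^n / fact n \<le> exp x"
proof -
  assume x: "0 \<le> x"
  have "(\<Sum>k\<in>{n}. x^k /\<^sub>R fact k) \<le> (\<Sum>k. x^k /\<^sub>R fact k)"
    by (rule sum_le_suminf[OF summable_exp_generic]) (use x in auto)
  then show ?thesis by (simp add: exp_def divide_inverse mult.commute)
qed

lemma bumpf_nonneg: "0 \<le> bumpf m s"
  by (simp add: bumpf_def)

text \<open>Quadratic decay at 0, read off from a single term of the exponential series at 1/s; it
  gives the derivative 0 at the junction s = 0.\<close>

lemma bumpf_le: "0 < s \<Longrightarrow> bumpf m s \<le> fact (m + 2) * s\<^sup>2"
proof -
  assume s: "0 < s"
  have "(1/s)^(m+2) / fact (m + 2) \<le> exp (1/s)" using s by (intro power_div_fact_le_exp) auto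
  then have "1 \<le> exp (1/s) * (fact (m + 2) * s^(m+2))"
    using s by (simp add: power_divide divide_le_eq mult_ac)
  then have "exp (- 1 / s) * 1 \<le> exp (- 1 / s) * (exp (1/s) * (fact (m + 2) * s^(m+2)))"
    by (intro mult_left_mono) auto
  also have "\<dots> = fact (m + 2) * s^(m+2)" by (simp add: mult.assoc[symmetric] flip: exp_add)
  finally show ?thesis using s by (simp add: bumpf_def divide_le_eq power_add power2_eq_square mult_ac)
qed

lemma DERIV_bumpf: "(bumpf m has_real_derivative bumpf (m + 2) s - real m * bumpf (m + 1) s) (at s)"
proof -
  consider "s < 0" | "s = 0" | "s > 0" by linarith
  then show ?thesis
  proof cases
    case 1
    have "((\<lambda>s. 0) has_real_derivative 0) (at s)" by simp
    then have "(bumpf m has_real_derivative 0) (at s)"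
      by (rule has_field_derivative_transform_within_open[of _ _ _ "{..<0}"]) (use 1 in \<open>auto simp: bumpf_def\<close>)
    then show ?thesis using 1 by (simp add: bumpf_def)
  next
    case 2
    have "(\<lambda>h. bumpf m h / h) \<midarrow>0\<rightarrow> 0"
    proof (rule Lim_null_comparison)
      show "eventually (\<lambda>h. norm (bumpf m h / h) \<le> fact (m + 2) * \<bar>h\<bar>) (at 0)"
      proof (intro always_eventually allI)
        fix h :: real
        show "norm (bumpf m h / h) \<le> fact (m + 2) * \<bar>h\<bar>"
        proof (cases "h > 0")
          case True
          then show ?thesis using bumpf_le[OF True, of m] bumpf_nonneg[of m h]
            by (simp add: divide_le_eq power2_eq_square mult.assoc)
        next
          case False
          then have "norm (bumpf m h / h) = 0" by (simp add: bumpf_def)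
          also have "0 \<le> fact (m + 2) * \<bar>h\<bar>" by (intro mult_nonneg_nonneg) auto
          finally show ?thesis .
        qed
      qed
      show "((\<lambda>h. fact (m + 2) * \<bar>h\<bar>) \<longlongrightarrow> 0) (at (0::real))"
      proof -
        have "((\<lambda>h. fact (m + 2) * \<bar>h\<bar>) \<longlongrightarrow> fact (m + 2) * \<bar>0\<bar>) (at (0::real))"
          by (intro tendsto_mult_left tendsto_rabs tendsto_ident_at)
        then show ?thesis by simp
      qed
    qed
    then show ?thesis using 2 by (simp add: DERIV_def bumpf_def)
  next
    case 3
    have "((\<lambda>s. - 1 / s) has_real_derivative 1 / s\<^sup>2) (at s)"
      using 3 by (auto intro!: derivative_eq_intros simp: power2_eq_square)
    then have "((\<lambda>s. exp (- 1 / s) * inverse (s^m)) has_real_derivative exp (- 1 / s) * (1 / s\<^sup>2) * inverse (s^m)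
        + - (real m * s^(m - Suc 0) * inverse ((s^m)^Suc (Suc 0))) * exp (- 1 / s)) (at s)"
      using 3 by (intro DERIV_mult DERIV_chain2[OF DERIV_exp] DERIV_inverse_fun DERIV_pow) auto
    moreover have "exp (- 1 / s) * (1 / s\<^sup>2) * inverse (s^m)
        + - (real m * s^(m - Suc 0) * inverse ((s^m)^Suc (Suc 0))) * exp (- 1 / s) = bumpf (m + 2) s - real m * bumpf (m + 1) s"
    proof -
      have a: "exp (- 1 / s) * (1 / s\<^sup>2) * inverse (s^m) = bumpf (m + 2) s"
      proof -
        have "exp (- 1 / s) * (1 / s\<^sup>2) * inverse (s^m) = exp (- 1 / s) / s^(m + 2)"
          by (simp add: power_add power2_eq_square divide_inverse)
        then show ?thesis using 3 by (simp add: bumpf_def)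
      qed
      have b: "real m * s^(m - Suc 0) * inverse ((s^m)^Suc (Suc 0)) = real m * inverse (s^(m + 1))"
        using 3 by (cases m) (simp_all add: divide_simps)
      have c: "bumpf (m + 1) s = inverse (s^(m + 1)) * exp (- 1 / s)"
        using 3 by (simp add: bumpf_def divide_inverse)
      show ?thesis unfolding a b c by simp
    qed
    ultimately have "((\<lambda>s. exp (- 1 / s) * inverse (s^m)) has_real_derivative bumpf (m + 2) s - real m * bumpf (m + 1) s) (at s)" by simp
    then show ?thesis
      by (rule has_field_derivative_transform_within_open[of _ _ _ "{0<..}"]) (use 3 in \<open>auto simp: bumpf_def divide_inverse\<close>)
  qed
qed

lemma continuous_bumpf: "continuous_on S (bumpf m)"
  by (rule continuous_on_subset[of UNIV]) (auto intro!: DERIV_continuous_on DERIV_bumpf)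

lemma has_partials_bumpf:
  "has_partials (\<lambda>x::real^2. bumpf m (d - (norm (x - a))\<^sup>2))
     (\<lambda>x. 2 * (x - a)$1 * (real m * bumpf (m + 1) (d - (norm (x - a))\<^sup>2) - bumpf (m + 2) (d - (norm (x - a))\<^sup>2)))
     (\<lambda>x. 2 * (x - a)$2 * (real m * bumpf (m + 1) (d - (norm (x - a))\<^sup>2) - bumpf (m + 2) (d - (norm (x - a))\<^sup>2)))"
proof (rule has_partials_radial)
  show "((\<lambda>s. bumpf m (d - s)) has_real_derivative real m * bumpf (m + 1) (d - s) - bumpf (m + 2) (d - s)) (at s)" for s
  proof -
    have "((\<lambda>s. d - s) has_real_derivative 0 - 1) (at s)" by (intro DERIV_diff DERIV_const DERIV_ident)
    from DERIV_chain2[OF DERIV_bumpf this] show ?thesis by simp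
  qed
  show "continuous_on UNIV (\<lambda>s. real m * bumpf (m + 1) (d - s) - bumpf (m + 2) (d - s))"
    by (intro continuous_intros continuous_on_compose2[OF continuous_bumpf[of UNIV]]) auto
qed

text \<open>\<open>C_k\<close> is defined by iterated partial derivatives, so smoothness of a bump
  calls for a class of functions that contains all its derivatives. This algebra is closed under
  partials, and \<open>C_k\<close> follows by induction on k.\<close>

inductive smooth_alg :: "(real^2 \<Rightarrow> real) \<Rightarrow> bool" where
  bump: "smooth_alg (\<lambda>x. bumpf m (d - (norm (x - a))\<^sup>2))"
| const: "smooth_alg (\<lambda>x. c)"
| coord: "smooth_alg (\<lambda>x. (x - a)$i)"
| add: "smooth_alg f \<Longrightarrow> smooth_alg g \<Longrightarrow> smooth_alg (\<lambda>x. f x + g x)"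
| mult: "smooth_alg f \<Longrightarrow> smooth_alg g \<Longrightarrow> smooth_alg (\<lambda>x. f x * g x)"

lemma smooth_alg_has_partials:
  assumes "smooth_alg f"
  shows "\<exists>f1 f2. has_partials f f1 f2 \<and> smooth_alg f1 \<and> smooth_alg f2"
  using assms
proof induction
  case (bump m d a)
  have "smooth_alg (\<lambda>x. 2 * (x - a)$i * (real m * bumpf (m + 1) (d - (norm (x - a))\<^sup>2) + (- 1) * bumpf (m + 2) (d - (norm (x - a))\<^sup>2)))" for i
    by (intro smooth_alg.intros)
  then show ?case using has_partials_bumpf[of m d a] by auto
next
  case (const c)
  then show ?case using has_partials_const[of c] smooth_alg.const by blast
next
  case (coord a i)
  have "((\<lambda>x. (x - a)$i) has_derivative (\<lambda>h. h$i)) (at x)" for x :: "real^2"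
    by (auto intro!: derivative_eq_intros bounded_linear.has_derivative[OF bounded_linear_vec_nth])
  then have "has_partials (\<lambda>x. (x - a)$i) (\<lambda>x. if i = 1 then 1 else 0) (\<lambda>x. if i = 1 then 0 else 1)"
    unfolding has_partials_def using exhaust_2[of i] by auto
  then show ?case using smooth_alg.const by blast
next
  case (add f g)
  then show ?case by (metis has_partials_add smooth_alg.add)
next
  case (mult f g)
  then obtain f1 f2 g1 g2 where "has_partials f f1 f2" "has_partials g g1 g2"
    "smooth_alg f1" "smooth_alg f2" "smooth_alg g1" "smooth_alg g2" by blast
  with mult show ?case
    by (intro exI[of _ "\<lambda>x. f1 x * g x + f x * g1 x"] exI[of _ "\<lambda>x. f2 x * g x + f x * g2 x"] conjI has_partials_mult smooth_alg.intros)
qed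

lemma has_partials_partial_deriv:
  assumes "has_partials f f1 f2"
  shows "partial_deriv 1 f = f1" "partial_deriv 2 f = f2"
proof -
  have "frechet_derivative f (at x) = (\<lambda>h. (h$1) *\<^sub>R f1 x + (h$2) *\<^sub>R f2 x)" for x
    using frechet_derivative_at[OF has_partialsD(1)[OF assms, of x UNIV]] by simp
  then show "partial_deriv 1 f = f1" "partial_deriv 2 f = f2"
    by (auto simp: partial_deriv_def fun_eq_iff axis_def)
qed

lemma smooth_alg_C_k: "smooth_alg f \<Longrightarrow> C_k k f"
proof (induction k arbitrary: f)
  case 0
  then obtain f1 f2 where "has_partials f f1 f2" using smooth_alg_has_partials by blast
  then show ?case using has_partialsD(2) by (simp) blast
next
  case (Suc k)
  from smooth_alg_has_partials[OF Suc.prems] obtain f1 f2 where p: "has_partials f f1 f2" "smooth_alg f1" "smooth_alg f2" by blast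
  have "f differentiable_on UNIV"
    using has_partialsD(1)[OF p(1)] by (auto simp: differentiable_on_def differentiable_def)
  moreover have "C_k k (partial_deriv i f)" for i
    using has_partials_partial_deriv[OF p(1)] Suc.IH p exhaust_2[of i] by metis
  ultimately show ?case by simp
qed

section \<open>The smooth mollifier and its derivatives\<close>

definition rhoZ :: "real \<Rightarrow> real" where "rhoZ \<delta> = (LINT x|lborel. bumpf 0 (\<delta>\<^sup>2 - (norm (x::real^2))\<^sup>2))"
definition rho :: "real \<Rightarrow> real^2 \<Rightarrow> real" where "rho \<delta> x = inverse (rhoZ \<delta>) * bumpf 0 (\<delta>\<^sup>2 - (norm x)\<^sup>2)"
definition rho' :: "real \<Rightarrow> 2 \<Rightarrow> real^2 \<Rightarrow> real" where
  "rho' \<delta> i x = - 2 * inverse (rhoZ \<delta>) * (x$i * bumpf 2 (\<delta>\<^sup>2 - (norm x)\<^sup>2))"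
definition rho'' :: "real \<Rightarrow> 2 \<Rightarrow> 2 \<Rightarrow> real^2 \<Rightarrow> real" where
  "rho'' \<delta> i j x = - 2 * inverse (rhoZ \<delta>) * ((if i = j then 1 else 0) * bumpf 2 (\<delta>\<^sup>2 - (norm x)\<^sup>2)
     + x$i * (2 * x$j * (2 * bumpf 3 (\<delta>\<^sup>2 - (norm x)\<^sup>2) - bumpf 4 (\<delta>\<^sup>2 - (norm x)\<^sup>2))))"

lemma has_partials_cmult:
  fixes f :: "real^2 \<Rightarrow> 'a::real_normed_algebra"
  assumes "has_partials f f1 f2"
  shows "has_partials (\<lambda>x. c * f x) (\<lambda>x. c * f1 x) (\<lambda>x. c * f2 x)"
  using has_partials_mult[OF has_partials_const[of c] assms] by simp

lemma has_partials_rho: "has_partials (rho \<delta>) (rho' \<delta> 1) (rho' \<delta> 2)"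
  using has_partials_cmult[OF has_partials_bumpf[of 0 "\<delta>\<^sup>2" 0], of "inverse (rhoZ \<delta>)"]
proof -
  have "rho' \<delta> i = (\<lambda>x. inverse (rhoZ \<delta>) * (2 * (x - 0)$i * (real 0 * bumpf (0 + 1) (\<delta>\<^sup>2 - (norm (x - 0))\<^sup>2) - bumpf (0 + 2) (\<delta>\<^sup>2 - (norm (x - 0))\<^sup>2))))" for i
    unfolding rho'_def[abs_def] add_0 by (simp add: fun_eq_iff)
  then show ?thesis
    using has_partials_cmult[OF has_partials_bumpf[of 0 "\<delta>\<^sup>2" 0], of "inverse (rhoZ \<delta>)"]
    by (simp only: rho_def[abs_def] diff_zero)
qed

lemma has_partials_rho': "has_partials (rho' \<delta> i) (rho'' \<delta> i 1) (rho'' \<delta> i 2)"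
proof -
  have "((\<lambda>x. x$i) has_derivative (\<lambda>h. h$i)) (at x)" for x :: "real^2"
    by (rule bounded_linear.has_derivative[OF bounded_linear_vec_nth has_derivative_ident])
  then have "has_partials (\<lambda>x. x$i) (\<lambda>x. if i = 1 then 1 else 0) (\<lambda>x. if i = 2 then 1 else 0)"
    unfolding has_partials_def using exhaust_2[of i] by auto
  from has_partials_cmult[OF has_partials_mult[OF this has_partials_bumpf[of 2 "\<delta>\<^sup>2" 0]], of "- 2 * inverse (rhoZ \<delta>)"]
  show ?thesis
    by (simp add: rho'_def[abs_def] rho''_def[abs_def])
qed

lemma rho''_commute: "rho'' \<delta> i j = rho'' \<delta> j i"
  by (auto simp: rho''_def fun_eq_iff)

lemma bumpf_zero_far: "0 < \<delta> \<Longrightarrow> norm x \<ge> \<delta> \<Longrightarrow> bumpf m (\<delta>\<^sup>2 - (norm x)\<^sup>2) = 0"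
proof -
  assume "0 < \<delta>" "norm x \<ge> \<delta>"
  then have "\<delta>\<^sup>2 \<le> (norm x)\<^sup>2" by (intro power_mono) auto
  then show ?thesis by (simp add: bumpf_def)
qed

lemma rho_far:
  assumes "0 < \<delta>" "norm x \<ge> \<delta>"
  shows "rho \<delta> x = 0" "rho' \<delta> i x = 0" "rho'' \<delta> i j x = 0"
  using bumpf_zero_far[OF assms] by (simp_all add: rho_def rho'_def rho''_def)

lemma test_in_rho: "0 < \<delta> \<Longrightarrow> test_in (ball 0 \<delta>) (rho \<delta>) (rho' \<delta> 1) (rho' \<delta> 2)"
  and test_in_rho': "0 < \<delta> \<Longrightarrow> test_in (ball 0 \<delta>) (rho' \<delta> i) (rho'' \<delta> i 1) (rho'' \<delta> i 2)"
  using rho_far has_partials_rho has_partials_rho' by (auto simp: test_in_def not_less)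

lemma rhoZ_pos:
  assumes "0 < \<delta>"
  shows "0 < rhoZ \<delta>"
proof -
  let ?f = "\<lambda>x::real^2. bumpf 0 (\<delta>\<^sup>2 - (norm x)\<^sup>2)"
  have c: "continuous_on UNIV ?f"
    by (intro continuous_on_compose2[OF continuous_bumpf[of UNIV]] continuous_intros) auto
  obtain B where B: "\<And>x. norm (?f x) \<le> B"
    by (rule continuous_support_bounded[OF c, of 0 \<delta>]) (use bumpf_zero_far[OF assms] in \<open>auto simp: not_less\<close>)
  have i: "integrable lborel ?f"
    by (rule integrable_bounded_support[OF borel_measurable_continuous_onI[OF c] B, of 0 \<delta>]) (use bumpf_zero_far[OF assms] in \<open>auto simp: not_less\<close>)
  have "(LINT x|lborel. indicat_real (ball (0::real^2) (\<delta>/2)) x * exp (- 1 / (3 / 4 * \<delta>\<^sup>2))) \<le> rhoZ \<delta>"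
    unfolding rhoZ_def
  proof (rule Bochner_Integration.integral_mono[OF integrable_indicator_ball i])
    fix x :: "real^2"
    show "indicat_real (ball (0::real^2) (\<delta>/2)) x * exp (- 1 / (3 / 4 * \<delta>\<^sup>2)) \<le> ?f x"
    proof (cases "x \<in> ball 0 (\<delta>/2)")
      case True
      then have "(norm x)\<^sup>2 \<le> (\<delta>/2)\<^sup>2" by (intro power_mono) auto
      then have le: "3 / 4 * \<delta>\<^sup>2 \<le> \<delta>\<^sup>2 - (norm x)\<^sup>2" by (simp add: power_divide)
      moreover have d: "0 < 3 / 4 * \<delta>\<^sup>2" using assms by simp
      ultimately have p: "0 < \<delta>\<^sup>2 - (norm x)\<^sup>2" by linarith
      have "1 / (\<delta>\<^sup>2 - (norm x)\<^sup>2) \<le> 1 / (3 / 4 * \<delta>\<^sup>2)"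
        by (rule divide_left_mono[OF le]) (use p d in auto)
      moreover note p
      ultimately show ?thesis using True by (simp add: bumpf_def)
    qed (simp add: bumpf_nonneg)
  qed
  moreover have "(LINT x|lborel. indicat_real (ball (0::real^2) (\<delta>/2)) x * exp (- 1 / (3 / 4 * \<delta>\<^sup>2))) > 0"
    using assms by (simp add: content_ball_2)
  ultimately show ?thesis by linarith
qed

lemma mollifier_rho:
  assumes "0 < \<delta>"
  shows "mollifier \<delta> (rho \<delta>)"
  unfolding mollifier_def
proof (intro conjI allI impI)
  show "rho \<delta> \<in> borel_measurable borel" by (rule has_partials_borel(1)[OF has_partials_rho])
  show "0 \<le> rho \<delta> x" for x using rhoZ_pos[OF assms] bumpf_nonneg by (simp add: rho_def)
  show "bounded (range (rho \<delta>))"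
    by (rule test_in_bounded[OF test_in_rho[OF assms]]) (auto simp: bounded_iff)
  show "rho \<delta> x = 0" if "\<delta> \<le> norm x" for x using rho_far[OF assms that] by simp
  show "(LINT x|lborel. rho \<delta> x) = 1"
    using rhoZ_pos[OF assms] unfolding rho_def by (simp add: rhoZ_def[symmetric])
qed

lemma test_function_rho:
  assumes "0 < \<delta>"
  shows "test_function (\<lambda>y. rho \<delta> (x - y))"
proof -
  have "(\<lambda>y. rho \<delta> (x - y)) = (\<lambda>y. inverse (rhoZ \<delta>) * bumpf 0 (\<delta>\<^sup>2 - (norm (y - x))\<^sup>2))"
    by (simp add: rho_def norm_minus_commute)
  then have "smooth_alg (\<lambda>y. rho \<delta> (x - y))"
    using smooth_alg.mult[OF smooth_alg.const smooth_alg.bump] by simp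
  then have "C_k k (\<lambda>y. rho \<delta> (x - y))" for k by (rule smooth_alg_C_k)
  moreover have "{y. rho \<delta> (x - y) \<noteq> 0} \<subseteq> cball x \<delta>"
    using rho_far(1)[OF assms] by (force simp: dist_norm)
  then have "compact (closure {y. rho \<delta> (x - y) \<noteq> 0})"
    by (meson bounded_cball bounded_subset compact_closure)
  ultimately show ?thesis by (simp add: test_function_def)
qed

lemma partial_deriv_rho: "partial_deriv i (\<lambda>y. rho \<delta> (x - y)) = (\<lambda>y. - rho' \<delta> i (x - y))"
  using has_partials_partial_deriv[OF has_partials_reflect[OF has_partials_rho]] exhaust_2[of i] by metis

lemma mollify_L1_tendsto_real:
  fixes f :: "real^2 \<Rightarrow> real"
  assumes f: "integrable lborel f" and \<delta>: "\<And>n. 0 < \<delta> n" "\<delta> \<longlonglongrightarrow> 0"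
  shows "(\<lambda>n. LINT x|lborel. norm (conv f (rho (\<delta> n)) x - f x)) \<longlonglongrightarrow> 0"
    and "integrable lborel (conv f (rho (\<delta> n)))"
proof -
  show "(\<lambda>n. LINT x|lborel. norm (conv f (rho (\<delta> n)) x - f x)) \<longlonglongrightarrow> 0"
    using mollify_L1_tendsto[OF f mollifier_rho[OF \<delta>(1)] \<delta>(2)] by simp
  \<comment> \<open>A crude modulus of continuity, valid for every shift, is enough to obtain
    integrability of the mollification from \<open>mollify_L1_bound\<close>.\<close>
  have "(LINT x|lborel. norm (f (x - y) - f x)) \<le> 2 * (LINT x|lborel. norm (f x))" for y
  proof -
    have i: "integrable lborel (\<lambda>x. f (x - y))" using integrable_translate[OF f] .
    have "(LINT x|lborel. norm (f (x - y) - f x)) \<le> (LINT x|lborel. norm (f (x - y)) + norm (f x))"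
      using i f by (intro Bochner_Integration.integral_mono) (auto intro!: norm_triangle_ineq4 Bochner_Integration.integrable_diff integrable_norm Bochner_Integration.integrable_add)
    also have "\<dots> = (LINT x|lborel. norm (f (x - y))) + (LINT x|lborel. norm (f x))"
      using i f by (intro Bochner_Integration.integral_add integrable_norm)
    also have "(LINT x|lborel. norm (f (x - y))) = (LINT x|lborel. norm (f x))"
      using borel_measurable_integrable[OF f] by (intro integral_translate[of "\<lambda>x. norm (f x)"]) simp
    finally show ?thesis by simp
  qed
  from mollify_L1_bound(2)[OF f mollifier_rho[OF \<delta>(1)] this]
  show "integrable lborel (conv f (rho (\<delta> n)))" by simp
qed

lemma mollify_weak_tendsto:
  fixes f :: "real^2 \<Rightarrow> real"
  assumes f: "integrable lborel f" and \<delta>: "\<And>n. 0 < \<delta> n" "\<delta> \<longlonglongrightarrow> 0"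
    and [measurable]: "\<theta> \<in> borel_measurable borel" and B: "\<And>x. norm (\<theta> x) \<le> B"
  shows "(\<lambda>n. LINT x|lborel. conv f (rho (\<delta> n)) x * \<theta> x) \<longlonglongrightarrow> (LINT x|lborel. f x * \<theta> x)"
proof (rule LIM_zero_cancel, rule Lim_null_comparison)
  show "(\<lambda>n. B * (LINT x|lborel. norm (conv f (rho (\<delta> n)) x - f x))) \<longlonglongrightarrow> 0"
    using tendsto_mult_left[OF mollify_L1_tendsto_real(1)[OF f \<delta>], of B] by simp
  show "eventually (\<lambda>n. norm ((LINT x|lborel. conv f (rho (\<delta> n)) x * \<theta> x) - (LINT x|lborel. f x * \<theta> x)) \<le> B * (LINT x|lborel. norm (conv f (rho (\<delta> n)) x - f x))) sequentially"
  proof (intro always_eventually allI)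
    fix n
    note i = mollify_L1_tendsto_real(2)[OF f \<delta>, of n]
    have i1: "integrable lborel (\<lambda>x. conv f (rho (\<delta> n)) x * \<theta> x)" "integrable lborel (\<lambda>x. f x * \<theta> x)"
      by (rule integrable_mult_bounded[OF _ _ B]; use i f in simp)+
    have id: "integrable lborel (\<lambda>x. conv f (rho (\<delta> n)) x - f x)" using i f by simp
    have "norm ((LINT x|lborel. conv f (rho (\<delta> n)) x * \<theta> x) - (LINT x|lborel. f x * \<theta> x)) = norm (LINT x|lborel. (conv f (rho (\<delta> n)) x - f x) * \<theta> x)"
      using i1 by (simp add: left_diff_distrib)
    also have "\<dots> \<le> (LINT x|lborel. B * norm (conv f (rho (\<delta> n)) x - f x))"
    proof (rule Bochner_Integration.integral_norm_bound_integral)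
      show "integrable lborel (\<lambda>x. (conv f (rho (\<delta> n)) x - f x) * \<theta> x)"
        by (rule integrable_mult_bounded[OF id _ B]) simp
      show "integrable lborel (\<lambda>x. B * norm (conv f (rho (\<delta> n)) x - f x))" using id by simp
      show "norm ((conv f (rho (\<delta> n)) x - f x) * \<theta> x) \<le> B * norm (conv f (rho (\<delta> n)) x - f x)" for x
        unfolding norm_mult using mult_right_mono[OF B[of x] norm_ge_zero[of "conv f (rho (\<delta> n)) x - f x"]] by (simp add: mult.commute)
    qed
    finally show "norm ((LINT x|lborel. conv f (rho (\<delta> n)) x * \<theta> x) - (LINT x|lborel. f x * \<theta> x)) \<le> B * (LINT x|lborel. norm (conv f (rho (\<delta> n)) x - f x))"
      by simp
  qed
qed

definition loc_int :: "(real^2 \<Rightarrow> real) \<Rightarrow> bool" where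
  "loc_int f \<longleftrightarrow> f \<in> borel_measurable borel \<and> (\<forall>L. integrable lborel (\<lambda>x. indicat_real (ball 0 L) x * f x))"

text \<open>The counterpart of \<open>has_weak_partial\<close> for Borel functions and the measure
  \<open>lborel\<close>, for which the convolution lemmas are stated.\<close>

definition weakp :: "2 \<Rightarrow> (real^2 \<Rightarrow> real) \<Rightarrow> (real^2 \<Rightarrow> real) \<Rightarrow> bool" where
  "weakp i f g \<longleftrightarrow> loc_int f \<and> loc_int g \<and> (\<forall>\<phi>. test_function \<phi> \<longrightarrow>
     (LINT x|lborel. f x * partial_deriv i \<phi> x) = - (LINT x|lborel. g x * \<phi> x))"

text \<open>The convolution lemmas ask for globally integrable functions. The cutoff supplies these
  and is invisible to a kernel of radius \<delta> at points with |x| + \<delta> \<le> L.\<close>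

abbreviation cut :: "real \<Rightarrow> (real^2 \<Rightarrow> real) \<Rightarrow> real^2 \<Rightarrow> real" where
  "cut L f \<equiv> (\<lambda>x. indicat_real (ball 0 L) x * f x)"

lemma conv_cut:
  assumes "\<And>y. norm y \<ge> \<delta> \<Longrightarrow> K y = 0" "norm x + \<delta> \<le> L"
  shows "conv (cut L f) K x = (LINT y|lborel. f y * K (x - y))"
  unfolding conv_def
proof (rule Bochner_Integration.integral_cong[OF refl])
  fix y
  show "cut L f y * K (x - y) = f y * K (x - y)"
  proof (cases "norm (x - y) \<ge> \<delta>")
    case False
    then have "norm y < L" using assms(2) norm_triangle_ineq4[of x "x - y"] by simp
    then show ?thesis by simp
  qed (simp add: assms)
qed

text \<open>The test function is the reflected kernel y -> rho(x - y), whose partial derivative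
  carries a minus sign. Hence differentiating the mollification amounts to mollifying the weak
  derivative.\<close>

lemma weakp_conv:
  assumes "weakp i f g" "0 < \<delta>" "norm x + \<delta> \<le> L"
  shows "conv (cut L f) (rho' \<delta> i) x = conv (cut L g) (rho \<delta>) x"
proof -
  have "(LINT y|lborel. f y * - rho' \<delta> i (x - y)) = - (LINT y|lborel. g y * rho \<delta> (x - y))"
  proof -
    have "(LINT y|lborel. f y * partial_deriv i (\<lambda>y. rho \<delta> (x - y)) y) = - (LINT y|lborel. g y * rho \<delta> (x - y))"
      using assms(1) test_function_rho[OF assms(2), of x] unfolding weakp_def by blast
    then show ?thesis by (simp only: partial_deriv_rho)
  qed
  then have "(LINT y|lborel. f y * rho' \<delta> i (x - y)) = (LINT y|lborel. g y * rho \<delta> (x - y))" by simp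
  then show ?thesis
    using conv_cut[OF rho_far(2)[OF assms(2)] assms(3)] conv_cut[OF rho_far(1)[OF assms(2)] assms(3)] by simp
qed

lemma has_partials_conv_rho:
  assumes "integrable lborel f" "0 < \<delta>"
  shows "has_partials (conv f (rho \<delta>)) (conv f (rho' \<delta> 1)) (conv f (rho' \<delta> 2))"
    and "has_partials (conv f (rho' \<delta> i)) (conv f (rho'' \<delta> i 1)) (conv f (rho'' \<delta> i 2))"
proof -
  obtain B where B: "\<And>x. norm (rho \<delta> x) \<le> B" "\<And>x. norm (rho' \<delta> 1 x) \<le> B" "\<And>x. norm (rho' \<delta> 2 x) \<le> B"
    by (rule test_in_bounded[OF test_in_rho[OF assms(2)]]) blast
  show "has_partials (conv f (rho \<delta>)) (conv f (rho' \<delta> 1)) (conv f (rho' \<delta> 2))"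
    by (rule has_partials_conv[OF assms(1) has_partials_rho B])
  obtain C where C: "\<And>x. norm (rho' \<delta> i x) \<le> C" "\<And>x. norm (rho'' \<delta> i 1 x) \<le> C" "\<And>x. norm (rho'' \<delta> i 2 x) \<le> C"
    by (rule test_in_bounded[OF test_in_rho'[OF assms(2)]]) blast
  show "has_partials (conv f (rho' \<delta> i)) (conv f (rho'' \<delta> i 1)) (conv f (rho'' \<delta> i 2))"
    by (rule has_partials_conv[OF assms(1) has_partials_rho' C])
qed

lemma integrable_test_mult:
  fixes f :: "real^2 \<Rightarrow> real"
  assumes "continuous_on UNIV f" "continuous_on UNIV \<psi>" "\<And>x. x \<notin> ball z r \<Longrightarrow> \<psi> x = 0"
  shows "integrable lborel (\<lambda>x. f x * \<psi> x)"
proof -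
  have c: "continuous_on UNIV (\<lambda>x. f x * \<psi> x)" by (intro continuous_intros assms)
  obtain B where B: "\<And>x. norm (f x * \<psi> x) \<le> B"
    by (rule continuous_support_bounded[OF c, of z r]) (use assms(3) in auto)
  show ?thesis
    by (rule integrable_bounded_support[OF borel_measurable_continuous_onI[OF c] B, of z r]) (use assms(3) in auto)
qed

text \<open>The definition tests against smooth functions only, while the cutoffs and kernels here
  are C^1. For the mollification of f the identity is ordinary integration by parts, and it passes
  to the limit because \<psi> and its partials are bounded.\<close>

lemma weakp_C1:
  fixes \<psi>' :: "2 \<Rightarrow> real^2 \<Rightarrow> real"
  assumes w: "weakp i f g" and t: "test_in (ball 0 L) \<psi> (\<psi>' 1) (\<psi>' 2)"
  shows "(LINT x|lborel. f x * \<psi>' i x) = - (LINT x|lborel. g x * \<psi> x)"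
proof -
  have p: "has_partials \<psi> (\<psi>' 1) (\<psi>' 2)" and o: "\<And>x. x \<notin> ball 0 L \<Longrightarrow> \<psi> x = 0 \<and> \<psi>' 1 x = 0 \<and> \<psi>' 2 x = 0"
    using t unfolding test_in_def by blast+
  have o': "\<psi>' i x = 0" if "x \<notin> ball 0 L" for x using o[OF that] exhaust_2[of i] by auto
  have c': "continuous_on UNIV (\<psi>' i)" using has_partialsD(3,4)[OF p] exhaust_2[of i] by auto
  obtain B where B: "\<And>x. norm (\<psi> x) \<le> B" "\<And>x. norm (\<psi>' 1 x) \<le> B" "\<And>x. norm (\<psi>' 2 x) \<le> B"
    by (rule test_in_bounded[OF t]) blast
  have Bi: "norm (\<psi>' i x) \<le> B" for x using B exhaust_2[of i] by auto
  \<comment> \<open>The margin 1 leaves room for mollification radii up to 1 at all points of the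
    support of \<psi>.\<close>
  have f: "integrable lborel (cut (L + 1) f)" and g: "integrable lborel (cut (L + 1) g)"
    using w unfolding weakp_def loc_int_def by blast+
  define \<delta> where "\<delta> n = inverse (real (Suc n))" for n
  have \<delta>: "0 < \<delta> n" "\<delta> n \<le> 1" "\<delta> \<longlonglongrightarrow> 0" for n
    using LIMSEQ_inverse_real_of_nat by (auto simp: \<delta>_def[abs_def] field_simps)
  have eq: "(LINT x|lborel. conv (cut (L + 1) f) (rho (\<delta> n)) x * \<psi>' i x) = - (LINT x|lborel. conv (cut (L + 1) g) (rho (\<delta> n)) x * \<psi> x)" for n
  proof -
    let ?F = "conv (cut (L + 1) f) (rho (\<delta> n))" and ?F' = "\<lambda>i. conv (cut (L + 1) f) (rho' (\<delta> n) i)"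
    note pF = has_partials_conv_rho(1)[OF f \<delta>(1)[of n]]
    have tF: "test_in (ball 0 L) (\<lambda>x. ?F x * \<psi> x) (\<lambda>x. ?F' 1 x * \<psi> x + ?F x * \<psi>' 1 x) (\<lambda>x. ?F' 2 x * \<psi> x + ?F x * \<psi>' 2 x)"
      unfolding test_in_def using has_partials_mult[OF pF p] o by auto
    have "(LINT x|lborel. ?F' i x * \<psi> x + ?F x * \<psi>' i x) = 0"
      using integral_partials_zero[OF tF] exhaust_2[of i] by auto
    moreover have "continuous_on UNIV (?F' i)" using has_partialsD(3,4)[OF pF] exhaust_2[of i] by auto
    then have "integrable lborel (\<lambda>x. ?F' i x * \<psi> x)"
      by (rule integrable_test_mult[OF _ has_partialsD(2)[OF p]]) (use o in blast)
    moreover have "integrable lborel (\<lambda>x. ?F x * \<psi>' i x)"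
      by (rule integrable_test_mult[OF has_partialsD(2)[OF pF] c' o'])
    ultimately have "(LINT x|lborel. ?F x * \<psi>' i x) = - (LINT x|lborel. ?F' i x * \<psi> x)" by simp
    also have "(LINT x|lborel. ?F' i x * \<psi> x) = (LINT x|lborel. conv (cut (L + 1) g) (rho (\<delta> n)) x * \<psi> x)"
    proof (rule Bochner_Integration.integral_cong[OF refl])
      fix x
      show "?F' i x * \<psi> x = conv (cut (L + 1) g) (rho (\<delta> n)) x * \<psi> x"
        using weakp_conv[OF w \<delta>(1)[of n], of x "L + 1"] o[of x] \<delta>(2)[of n] by (cases "x \<in> ball 0 L") auto
    qed
    finally show ?thesis .
  qed
  have l1: "(\<lambda>n. LINT x|lborel. conv (cut (L + 1) f) (rho (\<delta> n)) x * \<psi>' i x) \<longlonglongrightarrow> (LINT x|lborel. cut (L + 1) f x * \<psi>' i x)"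
    by (rule mollify_weak_tendsto[OF f \<delta>(1,3) borel_measurable_continuous_onI[OF c'] Bi])
  have l2: "(\<lambda>n. LINT x|lborel. conv (cut (L + 1) g) (rho (\<delta> n)) x * \<psi> x) \<longlonglongrightarrow> (LINT x|lborel. cut (L + 1) g x * \<psi> x)"
    by (rule mollify_weak_tendsto[OF g \<delta>(1,3) has_partials_borel(1)[OF p] B(1)])
  have "(LINT x|lborel. cut (L + 1) f x * \<psi>' i x) = - (LINT x|lborel. cut (L + 1) g x * \<psi> x)"
    using LIMSEQ_unique[OF l1[unfolded eq] tendsto_minus[OF l2]] .
  moreover have "(LINT x|lborel. cut (L + 1) f x * \<psi>' i x) = (LINT x|lborel. f x * \<psi>' i x)"
    by (rule Bochner_Integration.integral_cong[OF refl]) (use o' in \<open>auto simp: indicator_def\<close>)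
  moreover have "(LINT x|lborel. cut (L + 1) g x * \<psi> x) = (LINT x|lborel. g x * \<psi> x)"
    by (rule Bochner_Integration.integral_cong[OF refl]) (use o in \<open>auto simp: indicator_def\<close>)
  ultimately show ?thesis by simp
qed

text \<open>Equality of mixed derivatives in weak form; for the mollified functions it is the symmetry of
  the second derivatives of \<^const>\<open>rho\<close>.\<close>

lemma weakp_curl_free:
  fixes \<psi>' :: "2 \<Rightarrow> real^2 \<Rightarrow> real"
  assumes w1: "weakp 1 f g1" and w2: "weakp 2 f g2" and t: "test_in (ball 0 L) \<psi> (\<psi>' 1) (\<psi>' 2)"
  shows "(LINT x|lborel. g1 x * \<psi>' 2 x) = (LINT x|lborel. g2 x * \<psi>' 1 x)"
proof -
  have p: "has_partials \<psi> (\<psi>' 1) (\<psi>' 2)" and o: "\<And>x. x \<notin> ball 0 L \<Longrightarrow> \<psi> x = 0 \<and> \<psi>' 1 x = 0 \<and> \<psi>' 2 x = 0"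
    using t unfolding test_in_def by blast+
  have o': "\<psi>' i x = 0" if "x \<notin> ball 0 L" for x i using o[OF that] exhaust_2[of i] by auto
  have c': "continuous_on UNIV (\<psi>' i)" for i using has_partialsD(3,4)[OF p] exhaust_2[of i] by auto
  obtain B where B: "\<And>x. norm (\<psi> x) \<le> B" "\<And>x. norm (\<psi>' 1 x) \<le> B" "\<And>x. norm (\<psi>' 2 x) \<le> B"
    by (rule test_in_bounded[OF t]) blast
  have Bi: "norm (\<psi>' i x) \<le> B" for x i using B exhaust_2[of i] by auto
  have f: "integrable lborel (cut (L + 1) f)" and g: "integrable lborel (cut (L + 1) g1)" "integrable lborel (cut (L + 1) g2)"
    using w1 w2 unfolding weakp_def loc_int_def by blast+
  define \<delta> where "\<delta> n = inverse (real (Suc n))" for n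
  have \<delta>: "0 < \<delta> n" "\<delta> n \<le> 1" "\<delta> \<longlonglongrightarrow> 0" for n
    using LIMSEQ_inverse_real_of_nat by (auto simp: \<delta>_def[abs_def] field_simps)
  let ?F = "\<lambda>n i. conv (cut (L + 1) f) (rho' (\<delta> n) i)" and ?F' = "\<lambda>n i j. conv (cut (L + 1) f) (rho'' (\<delta> n) i j)"
  have parts: "(LINT x|lborel. ?F n i x * \<psi>' j x) = - (LINT x|lborel. ?F' n i j x * \<psi> x)" for n i j
  proof -
    note pF = has_partials_conv_rho(2)[OF f \<delta>(1)[of n], of i]
    have tF: "test_in (ball 0 L) (\<lambda>x. ?F n i x * \<psi> x) (\<lambda>x. ?F' n i 1 x * \<psi> x + ?F n i x * \<psi>' 1 x) (\<lambda>x. ?F' n i 2 x * \<psi> x + ?F n i x * \<psi>' 2 x)"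
      unfolding test_in_def using has_partials_mult[OF pF p] o by auto
    have "(LINT x|lborel. ?F' n i j x * \<psi> x + ?F n i x * \<psi>' j x) = 0"
      using integral_partials_zero[OF tF] exhaust_2[of j] by auto
    moreover have "continuous_on UNIV (?F' n i j)" using has_partialsD(3,4)[OF pF] exhaust_2[of j] by auto
    then have "integrable lborel (\<lambda>x. ?F' n i j x * \<psi> x)"
      by (rule integrable_test_mult[OF _ has_partialsD(2)[OF p]]) (use o in blast)
    moreover have "integrable lborel (\<lambda>x. ?F n i x * \<psi>' j x)"
      by (rule integrable_test_mult[OF has_partialsD(2)[OF pF] c' o'])
    ultimately show ?thesis by simp
  qed
  have repl: "(LINT x|lborel. ?F n i x * \<psi>' j x) = (LINT x|lborel. conv (cut (L + 1) g) (rho (\<delta> n)) x * \<psi>' j x)"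
    if "weakp i f g" for n i j g
  proof (rule Bochner_Integration.integral_cong[OF refl])
    fix x
    show "?F n i x * \<psi>' j x = conv (cut (L + 1) g) (rho (\<delta> n)) x * \<psi>' j x"
      using weakp_conv[OF that \<delta>(1)[of n], of x "L + 1"] o'[of x] \<delta>(2)[of n] by (cases "x \<in> ball 0 L") auto
  qed
  have eq: "(LINT x|lborel. conv (cut (L + 1) g1) (rho (\<delta> n)) x * \<psi>' 2 x) = (LINT x|lborel. conv (cut (L + 1) g2) (rho (\<delta> n)) x * \<psi>' 1 x)" for n
    unfolding repl[OF w1, symmetric] repl[OF w2, symmetric] parts by (simp only: rho''_commute[of _ 1 2])
  have l: "(\<lambda>n. LINT x|lborel. conv (cut (L + 1) g1) (rho (\<delta> n)) x * \<psi>' 2 x) \<longlonglongrightarrow> (LINT x|lborel. cut (L + 1) g1 x * \<psi>' 2 x)"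
    "(\<lambda>n. LINT x|lborel. conv (cut (L + 1) g2) (rho (\<delta> n)) x * \<psi>' 1 x) \<longlonglongrightarrow> (LINT x|lborel. cut (L + 1) g2 x * \<psi>' 1 x)"
    by (rule mollify_weak_tendsto[OF _ \<delta>(1,3) borel_measurable_continuous_onI[OF c'] Bi], rule g)+
  have "(LINT x|lborel. cut (L + 1) g1 x * \<psi>' 2 x) = (LINT x|lborel. cut (L + 1) g2 x * \<psi>' 1 x)"
    using LIMSEQ_unique[OF l(1)[unfolded eq] l(2)] .
  moreover have "(LINT x|lborel. cut (L + 1) g x * \<psi>' j x) = (LINT x|lborel. g x * \<psi>' j x)" for g j
    by (rule Bochner_Integration.integral_cong[OF refl]) (use o' in \<open>auto simp: indicator_def\<close>)
  ultimately show ?thesis by simp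
qed

text \<open>Both functions have the mollification that \<open>weakp_conv\<close> computes from f
  alone. So the mollifications of their difference vanish on a ball, while they converge to the
  difference in L^1.\<close>

lemma weakp_unique:
  assumes w1: "weakp i f g" and w2: "weakp i f g'"
  shows "AE x in lborel. g x = g' x"
proof -
  have "AE x in lborel. x \<in> ball 0 (real L) \<longrightarrow> g x = g' x" for L :: nat
  proof -
    let ?L = "real L + 1"
    have g: "integrable lborel (cut ?L g)" "integrable lborel (cut ?L g')"
      using w1 w2 unfolding weakp_def loc_int_def by blast+
    define d where "d x = cut ?L g x - cut ?L g' x" for x
    have d: "integrable lborel d" unfolding d_def using g by simp
    define \<delta> where "\<delta> n = inverse (real (Suc n))" for n
    have \<delta>: "0 < \<delta> n" "\<delta> n \<le> 1" "\<delta> \<longlonglongrightarrow> 0" for n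
      using LIMSEQ_inverse_real_of_nat by (auto simp: \<delta>_def[abs_def] field_simps)
    have z: "conv d (rho (\<delta> n)) x = 0" if "x \<in> ball 0 (real L)" for n x
    proof -
      obtain B where B: "\<And>x. norm (rho (\<delta> n) x) \<le> B" using mollifierD(6)[OF mollifier_rho[OF \<delta>(1)[of n]]] by blast
      have m: "rho (\<delta> n) \<in> borel_measurable borel" by (rule has_partials_borel(1)[OF has_partials_rho])
      have x: "norm x + \<delta> n \<le> ?L" using that \<delta>(2)[of n] by simp
      have "conv d (rho (\<delta> n)) x = conv (cut ?L g) (rho (\<delta> n)) x - conv (cut ?L g') (rho (\<delta> n)) x"
        unfolding conv_def d_def left_diff_distrib
        by (rule Bochner_Integration.integral_diff; rule conv_integrable[OF _ m B]; rule g)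
      also have "\<dots> = 0" using weakp_conv[OF w1 \<delta>(1) x] weakp_conv[OF w2 \<delta>(1) x] by simp
      finally show ?thesis .
    qed
    have "(\<lambda>n. LINT x|lborel. norm (indicat_real (ball 0 (real L)) x * d x)) \<longlonglongrightarrow> 0"
    proof (rule tendsto_sandwich[OF _ _ tendsto_const mollify_L1_tendsto_real(1)[OF d \<delta>(1,3)]]; intro always_eventually allI)
      fix n
      show "(LINT x|lborel. norm (indicat_real (ball 0 (real L)) x * d x)) \<le> (LINT x|lborel. norm (conv d (rho (\<delta> n)) x - d x))"
      proof (rule Bochner_Integration.integral_mono')
        show "integrable lborel (\<lambda>x. norm (conv d (rho (\<delta> n)) x - d x))"
          using mollify_L1_tendsto_real(2)[OF d \<delta>(1,3)] d by simp
        show "norm (indicat_real (ball 0 (real L)) x * d x) \<le> norm (conv d (rho (\<delta> n)) x - d x)" for x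
          using z[of x n] by (cases "x \<in> ball 0 (real L)") auto
      qed simp
    qed simp
    then have "(LINT x|lborel. norm (indicat_real (ball 0 (real L)) x * d x)) = 0"
      using LIMSEQ_unique tendsto_const by blast
    moreover have "integrable lborel (\<lambda>x. norm (indicat_real (ball 0 (real L)) x * d x))"
      using integrable_mult_bounded[OF d, of "indicat_real (ball 0 (real L))" 1] by (simp add: mult.commute)
    ultimately have "AE x in lborel. norm (indicat_real (ball 0 (real L)) x * d x) = 0"
      by (subst (asm) integral_nonneg_eq_0_iff_AE) auto
    then show ?thesis
    proof eventually_elim
      case (elim x)
      show ?case
      proof
        assume x: "x \<in> ball 0 (real L)"
        then have "d x = 0" using elim by simp
        then show "g x = g' x" using x by (simp add: d_def)
      qed
    qed
  qed
  then have "AE x in lborel. \<forall>L::nat. x \<in> ball 0 (real L) \<longrightarrow> g x = g' x" unfolding AE_all_countable by blast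
  then show ?thesis
  proof eventually_elim
    case (elim x)
    obtain L :: nat where "norm x < real L" using reals_Archimedean2 by blast
    then have "x \<in> ball 0 (real L)" by simp
    then show ?case using elim by blast
  qed
qed

section \<open>Reduction to a first order equation\<close>

lemma borel_version:
  fixes f :: "real^2 \<Rightarrow> real"
  assumes "f \<in> borel_measurable lebesgue"
  obtains f' where "f' \<in> borel_measurable borel" "AE x in lebesgue. f x = f' x"
proof -
  obtain f' where "f' \<in> borel_measurable lborel" "AE x in lborel. f x = f' x"
    using completion_ex_borel_measurable_real[OF assms] by blast
  then show ?thesis by (intro that[of f']) (auto intro: AE_completion)
qed

lemma AE_lebesgue_lborel: "Measurable.pred borel P \<Longrightarrow> (AE x in lebesgue. P x) \<longleftrightarrow> (AE x in lborel. P (x::real^2))"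
  by (simp add: AE_completion_iff)

lemma borel_lebesgue: "f \<in> borel_measurable borel \<Longrightarrow> f \<in> borel_measurable (lebesgue :: (real^2) measure)"
  by (intro measurable_completion) simp

lemma locally_Lp_cut:
  fixes f f' :: "real^2 \<Rightarrow> real"
  assumes f: "locally_Lp p f" and [measurable]: "f' \<in> borel_measurable borel" and ae: "AE x in lebesgue. f x = f' x"
  shows "integrable lborel (\<lambda>x. indicat_real (ball 0 L) x * \<bar>f' x\<bar> powr p)"
proof -
  have [measurable]: "f \<in> borel_measurable lebesgue" "f' \<in> borel_measurable lebesgue"
    using f borel_lebesgue[OF assms(2)] by (auto simp: locally_Lp_def)
  have [measurable]: "ball (0::real^2) L \<in> sets lebesgue" by simp
  have "set_integrable lebesgue (cball 0 L) (\<lambda>x. \<bar>f x\<bar> powr p)"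
    using f by (simp add: locally_Lp_def)
  then have "set_integrable lebesgue (ball 0 L) (\<lambda>x. \<bar>f x\<bar> powr p)"
    by (rule set_integrable_subset) auto
  then have "integrable lebesgue (\<lambda>x. indicat_real (ball 0 L) x * \<bar>f x\<bar> powr p)"
    by (simp add: set_integrable_def)
  then have "integrable lebesgue (\<lambda>x. indicat_real (ball 0 L) x * \<bar>f' x\<bar> powr p)"
    by (rule integrable_cong_AE_imp) (use ae in \<open>auto elim: eventually_mono\<close>)
  then show ?thesis by (subst (asm) integrable_completion) auto
qed

lemma locally_L1_loc_int:
  assumes f: "locally_Lp 1 f" and f': "f' \<in> borel_measurable borel" and ae: "AE x in lebesgue. f x = f' x"
  shows "loc_int f'"
  unfolding loc_int_def
proof (intro conjI allI f')
  fix L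
  note [measurable] = f'
  have "integrable lborel (\<lambda>x. indicat_real (ball 0 L) x * \<bar>f' x\<bar> powr 1)" by (rule locally_Lp_cut[OF f f' ae])
  then show "integrable lborel (\<lambda>x. indicat_real (ball 0 L) x * f' x)"
    by (rule Bochner_Integration.integrable_bound) (auto simp: indicator_def)
qed

lemma test_function_borel:
  assumes "test_function (\<phi> :: real^2 \<Rightarrow> real)"
  shows "\<phi> \<in> borel_measurable borel" "partial_deriv i \<phi> \<in> borel_measurable borel"
proof -
  have "C_k 0 \<phi>" "C_k (Suc 0) \<phi>" using assms unfolding test_function_def by blast+
  then show "\<phi> \<in> borel_measurable borel" "partial_deriv i \<phi> \<in> borel_measurable borel"
    by (auto intro: borel_measurable_continuous_onI)
qed

lemma integral_AE_borel:
  fixes f f' h :: "real^2 \<Rightarrow> real"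
  assumes "f \<in> borel_measurable lebesgue" and [measurable]: "f' \<in> borel_measurable borel" "h \<in> borel_measurable borel"
    and ae: "AE x in lebesgue. f x = f' x"
  shows "(LINT x|lebesgue. f x * h x) = (LINT x|lborel. f' x * h x)"
proof -
  have [measurable]: "h \<in> borel_measurable lebesgue" "f' \<in> borel_measurable lebesgue" by (auto intro: borel_lebesgue)
  have "(LINT x|lebesgue. f x * h x) = (LINT x|lebesgue. f' x * h x)"
    by (rule Bochner_Integration.integral_cong_AE) (use assms(1) ae in \<open>auto elim: eventually_mono\<close>)
  also have "\<dots> = (LINT x|lborel. f' x * h x)" by (rule integral_completion) simp
  finally show ?thesis .
qed

lemma has_weak_partial_weakp:
  assumes w: "has_weak_partial i f g" and b: "f' \<in> borel_measurable borel" "g' \<in> borel_measurable borel"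
    and ae: "AE x in lebesgue. f x = f' x" "AE x in lebesgue. g x = g' x"
  shows "weakp i f' g'"
  unfolding weakp_def
proof (intro conjI allI impI)
  show "loc_int f'" "loc_int g'"
    using w b ae locally_L1_loc_int unfolding has_weak_partial_def by blast+
  have m: "f \<in> borel_measurable lebesgue" "g \<in> borel_measurable lebesgue"
    using w by (auto simp: has_weak_partial_def locally_Lp_def)
  fix \<phi> :: "real^2 \<Rightarrow> real" assume t: "test_function \<phi>"
  then have "(LINT x|lebesgue. f x * partial_deriv i \<phi> x) = - (LINT x|lebesgue. g x * \<phi> x)"
    using w by (simp add: has_weak_partial_def)
  then show "(LINT x|lborel. f' x * partial_deriv i \<phi> x) = - (LINT x|lborel. g' x * \<phi> x)"
    using integral_AE_borel[OF m(1) b(1) test_function_borel(2)[OF t] ae(1)]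
      integral_AE_borel[OF m(2) b(2) test_function_borel(1)[OF t] ae(2)] by simp
qed

text \<open>\<open>weak_partial\<close> is a choice, and second derivatives are taken of the chosen
  first derivative. Uniqueness lets the witnesses provided by \<open>sobolev_loc\<close> be
  exchanged for the chosen ones.\<close>

lemma has_weak_partial_unique:
  fixes f :: "real^2 \<Rightarrow> real"
  assumes "has_weak_partial i f g" "has_weak_partial i f h"
  shows "AE x in lebesgue. g x = h x"
proof -
  have m: "f \<in> borel_measurable lebesgue" "g \<in> borel_measurable lebesgue" "h \<in> borel_measurable lebesgue"
    using assms by (auto simp: has_weak_partial_def locally_Lp_def)
  obtain f' where f': "f' \<in> borel_measurable borel" "AE x in lebesgue. f x = f' x" by (rule borel_version[OF m(1)])
  obtain g' where g': "g' \<in> borel_measurable borel" "AE x in lebesgue. g x = g' x" by (rule borel_version[OF m(2)])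
  obtain h' where h': "h' \<in> borel_measurable borel" "AE x in lebesgue. h x = h' x" by (rule borel_version[OF m(3)])
  have "AE x in lborel. g' x = h' x"
    using weakp_unique has_weak_partial_weakp[OF assms(1) f'(1) g'(1) f'(2) g'(2)]
      has_weak_partial_weakp[OF assms(2) f'(1) h'(1) f'(2) h'(2)] by blast
  then have "AE x in lebesgue. g' x = h' x" by (rule AE_completion)
  with g'(2) h'(2) show ?thesis by eventually_elim simp
qed

lemma locally_Lp_cong:
  fixes f f' :: "real^2 \<Rightarrow> real"
  assumes "locally_Lp p f" "AE x in lebesgue. f x = f' x" and [measurable]: "f' \<in> borel_measurable lebesgue"
  shows "locally_Lp p f'"
  unfolding locally_Lp_def
proof (intro conjI allI impI)
  fix K :: "(real^2) set" assume K: "compact K"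
  then have [measurable]: "K \<in> sets lebesgue" using lmeasurable_compact by blast
  have [measurable]: "f \<in> borel_measurable lebesgue" using assms by (simp add: locally_Lp_def)
  have "set_integrable lebesgue K (\<lambda>x. \<bar>f x\<bar> powr p)" using assms K by (simp add: locally_Lp_def)
  then show "set_integrable lebesgue K (\<lambda>x. \<bar>f' x\<bar> powr p)"
    unfolding set_integrable_def
    by (rule integrable_cong_AE_imp) (use assms(2) in \<open>auto elim: eventually_mono\<close>)
qed fact

lemma has_weak_partial_cong:
  fixes f f' :: "real^2 \<Rightarrow> real"
  assumes w: "has_weak_partial i f g" and ae: "AE x in lebesgue. f x = f' x" and m: "f' \<in> borel_measurable lebesgue"
  shows "has_weak_partial i f' g"
  unfolding has_weak_partial_def
proof (intro conjI allI impI)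
  show "locally_Lp 1 f'" "locally_Lp 1 g"
    using w locally_Lp_cong[OF _ ae m] unfolding has_weak_partial_def by blast+
  fix \<phi> :: "real^2 \<Rightarrow> real" assume t: "test_function \<phi>"
  have [measurable]: "partial_deriv i \<phi> \<in> borel_measurable lebesgue" "f \<in> borel_measurable lebesgue" "f' \<in> borel_measurable lebesgue"
    using borel_lebesgue[OF test_function_borel(2)[OF t]] w m by (auto simp: has_weak_partial_def locally_Lp_def)
  have "(LINT x|lebesgue. f' x * partial_deriv i \<phi> x) = (LINT x|lebesgue. f x * partial_deriv i \<phi> x)"
    by (rule Bochner_Integration.integral_cong_AE) (use ae in \<open>auto elim: eventually_mono\<close>)
  then show "(LINT x|lebesgue. f' x * partial_deriv i \<phi> x) = - (LINT x|lebesgue. g x * \<phi> x)"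
    using w t by (simp add: has_weak_partial_def)
qed

section \<open>Local square integrability and the setting of the estimates\<close>

definition sq_loc :: "(real^2 \<Rightarrow> real) \<Rightarrow> bool" where
  "sq_loc f \<longleftrightarrow> f \<in> borel_measurable borel \<and> (\<forall>L. integrable lborel (\<lambda>x. indicat_real (ball 0 L) x * (f x)\<^sup>2))"

lemma sq_le_1_powr: "2 \<le> p \<Longrightarrow> 0 \<le> (t::real) \<Longrightarrow> t\<^sup>2 \<le> 1 + t powr p"
proof (cases "t \<le> 1")
  case True
  assume "0 \<le> t"
  then have "t\<^sup>2 \<le> 1" using True by (simp add: power_le_one)
  then show ?thesis by (simp add: add_increasing2)
next
  case False
  assume "2 \<le> p"
  then have "t powr 2 \<le> t powr p" using False by (intro powr_mono) auto
  then show ?thesis using False by simp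
qed

lemma sq_loc_Lp:
  assumes [measurable]: "f \<in> borel_measurable borel" and p: "2 \<le> p"
    and i: "\<And>L. integrable lborel (\<lambda>x. indicat_real (ball 0 L) x * \<bar>f x\<bar> powr p)"
  shows "sq_loc f"
  unfolding sq_loc_def
proof (intro conjI allI)
  fix L
  have "integrable lborel (\<lambda>x. indicat_real (ball 0 L) x * 1 + indicat_real (ball 0 L) x * \<bar>f x\<bar> powr p)"
    by (intro Bochner_Integration.integrable_add integrable_indicator_ball i)
  then show "integrable lborel (\<lambda>x. indicat_real (ball 0 L) x * (f x)\<^sup>2)"
  proof (rule Bochner_Integration.integrable_bound)
    show "AE x in lborel. norm (indicat_real (ball 0 L) x * (f x)\<^sup>2) \<le> norm (indicat_real (ball 0 L) x * 1 + indicat_real (ball 0 L) x * \<bar>f x\<bar> powr p)"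
      using sq_le_1_powr[OF p, of "\<bar>f x\<bar>" for x] by (intro AE_I2) (auto simp: indicator_def)
  qed measurable
qed measurable

text \<open>The differential equation enters as a pointwise inequality between the Laplacian F1 + F2
  and the gradient, with a Borel function \<open>w\<close> in the role of |W|. Of the exponent p
  only local square integrability is retained here; the global bound on \<open>w\<close> is passed
  to the lemmas that use it.\<close>

locale drift_solution =
  fixes u G1 G2 F1 F2 w :: "real^2 \<Rightarrow> real" and C0 :: real
  assumes u: "continuous_on UNIV u" "\<And>x. \<bar>u x\<bar> \<le> C0"
    and G: "weakp 1 u G1" "weakp 2 u G2"
    and F: "weakp 1 G1 F1" "weakp 2 G2 F2"
    and sq: "sq_loc G1" "sq_loc G2" "sq_loc F1" "sq_loc F2" "sq_loc w"
    and w: "\<And>x. 0 \<le> w x" "AE x in lborel. \<bar>F1 x + F2 x\<bar> \<le> w x * sqrt ((G1 x)\<^sup>2 + (G2 x)\<^sup>2)"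

lemma bounded_solution_drift:
  assumes sol: "bounded_solution p C0 W u" and p: "2 \<le> p" and W: "in_Lp p W" "Lp_norm p W \<le> K"
  obtains G1 G2 F1 F2 w where "drift_solution u G1 G2 F1 F2 w C0"
    "AE x in lebesgue. (norm (weak_grad u x))\<^sup>2 = (G1 x)\<^sup>2 + (G2 x)\<^sup>2"
    "(\<integral>\<^sup>+x. ennreal (w x powr p) \<partial>lborel) \<le> ennreal (\<bar>K\<bar> powr p)"
proof -
  have sob: "sobolev_loc 2 p u" and uc: "continuous_on UNIV u"
    and eq: "AE x in lebesgue. weak_laplacian u x + W x \<bullet> weak_grad u x = 0"
    and ub: "\<And>z. \<bar>u z\<bar> \<le> C0"
    using sol unfolding bounded_solution_def by auto
  have um: "u \<in> borel_measurable borel" by (rule borel_measurable_continuous_onI[OF uc])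
  have X: "has_weak_partial i u (weak_partial i u) \<and> locally_Lp p (weak_partial i u) \<and>
     has_weak_partial i (weak_partial i u) (weak_partial i (weak_partial i u)) \<and> locally_Lp p (weak_partial i (weak_partial i u))" for i
  proof -
    obtain g where g: "has_weak_partial i u g" "sobolev_loc (Suc 0) p g"
      using sob[unfolded numeral_2_eq_2 sobolev_loc.simps(2)[of "Suc 0"]] by blast
    have h: "has_weak_partial i u (weak_partial i u)"
      unfolding weak_partial_def by (rule someI[of "has_weak_partial i u", OF g(1)])
    have hm: "weak_partial i u \<in> borel_measurable lebesgue" using h by (simp add: has_weak_partial_def locally_Lp_def)
    \<comment> \<open>The Sobolev witness \<open>g\<close> and the chosen derivative agree almost
      everywhere, so a weak derivative of \<open>g\<close> is also one of the chosen
      derivative.\<close>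
    have ae: "AE x in lebesgue. g x = weak_partial i u x" by (rule has_weak_partial_unique[OF g(1) h])
    obtain k where k: "has_weak_partial i g k" "locally_Lp p k" and gp: "locally_Lp p g"
      using g(2) unfolding sobolev_loc.simps by blast
    have hk: "has_weak_partial i (weak_partial i u) k" by (rule has_weak_partial_cong[OF k(1) ae hm])
    have hh: "has_weak_partial i (weak_partial i u) (weak_partial i (weak_partial i u))"
      unfolding weak_partial_def[of i "weak_partial i u"]
      by (rule someI[of "has_weak_partial i (weak_partial i u)", OF hk])
    have hhm: "weak_partial i (weak_partial i u) \<in> borel_measurable lebesgue" using hh by (simp add: has_weak_partial_def locally_Lp_def)
    show ?thesis
      using h hh locally_Lp_cong[OF gp ae hm] locally_Lp_cong[OF k(2) has_weak_partial_unique[OF hk hh] hhm] by blast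
  qed
  have "\<exists>G F. G \<in> borel_measurable borel \<and> F \<in> borel_measurable borel \<and> weakp i u G \<and> weakp i G F \<and> sq_loc G \<and> sq_loc F \<and>
     (AE x in lebesgue. weak_partial i u x = G x) \<and> (AE x in lebesgue. weak_partial i (weak_partial i u) x = F x)" for i
  proof -
    have m: "weak_partial i u \<in> borel_measurable lebesgue" "weak_partial i (weak_partial i u) \<in> borel_measurable lebesgue"
      using X[of i] by (auto simp: locally_Lp_def)
    obtain G where G: "G \<in> borel_measurable borel" "AE x in lebesgue. weak_partial i u x = G x" by (rule borel_version[OF m(1)])
    obtain F where F: "F \<in> borel_measurable borel" "AE x in lebesgue. weak_partial i (weak_partial i u) x = F x" by (rule borel_version[OF m(2)])
    have "weakp i u G" using X[of i] by (intro has_weak_partial_weakp[OF _ um G(1) _ G(2)]) auto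
    moreover have "weakp i G F" using X[of i] by (intro has_weak_partial_weakp[OF _ G(1) F(1) G(2) F(2)]) auto
    moreover have "sq_loc G" "sq_loc F"
      using X[of i] locally_Lp_cut[OF _ G] locally_Lp_cut[OF _ F] by (auto intro!: sq_loc_Lp[OF _ p] G(1) F(1))
    ultimately show ?thesis using G F by blast
  qed
  from this[of 1] this[of 2] obtain G1 F1 G2 F2 where
    G1: "G1 \<in> borel_measurable borel" "F1 \<in> borel_measurable borel" "weakp 1 u G1" "weakp 1 G1 F1" "sq_loc G1" "sq_loc F1"
      "AE x in lebesgue. weak_partial 1 u x = G1 x" "AE x in lebesgue. weak_partial 1 (weak_partial 1 u) x = F1 x" and
    G2: "G2 \<in> borel_measurable borel" "F2 \<in> borel_measurable borel" "weakp 2 u G2" "weakp 2 G2 F2" "sq_loc G2" "sq_loc F2"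
      "AE x in lebesgue. weak_partial 2 u x = G2 x" "AE x in lebesgue. weak_partial 2 (weak_partial 2 u) x = F2 x"
    by blast
  note [measurable] = G1(1,2) G2(1,2)
  have Wm: "W \<in> borel_measurable lebesgue" and Wi: "integrable lebesgue (\<lambda>x. norm (W x) powr p)" using W by (auto simp: in_Lp_def)
  then have "(\<lambda>x. norm (W x)) \<in> borel_measurable lebesgue" by simp
  then obtain w0 where w0: "w0 \<in> borel_measurable borel" "AE x in lebesgue. norm (W x) = w0 x" by (rule borel_version)
  define w where "w x = \<bar>w0 x\<bar>" for x
  have w: "w \<in> borel_measurable borel" "AE x in lebesgue. norm (W x) = w x" "\<And>x. 0 \<le> w x"
  proof -
    show "w \<in> borel_measurable borel" "\<And>x. 0 \<le> w x" using w0(1) by (auto simp: w_def[abs_def])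
    show "AE x in lebesgue. norm (W x) = w x"
      using w0(2) by eventually_elim (metis w_def abs_norm_cancel)
  qed
  note [measurable] = w(1)
  have [measurable]: "w \<in> borel_measurable lebesgue" by (rule borel_lebesgue[OF w(1)])
  have wi: "integrable lebesgue (\<lambda>x. w x powr p)" and wI: "(LINT x|lebesgue. w x powr p) = (LINT x|lebesgue. norm (W x) powr p)"
  proof -
    have ae: "AE x in lebesgue. norm (W x) powr p = w x powr p" using w(2) by eventually_elim simp
    show "integrable lebesgue (\<lambda>x. w x powr p)"
      by (rule integrable_cong_AE_imp[OF Wi]) (use ae in \<open>auto elim: eventually_mono\<close>)
    show "(LINT x|lebesgue. w x powr p) = (LINT x|lebesgue. norm (W x) powr p)"
      by (rule Bochner_Integration.integral_cong_AE) (use ae Wm in \<open>auto elim: eventually_mono\<close>)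
  qed
  have wi': "integrable lborel (\<lambda>x. w x powr p)" using wi by (subst (asm) integrable_completion) auto
  have wI': "(LINT x|lborel. w x powr p) = (LINT x|lebesgue. norm (W x) powr p)"
    using wI by (subst (asm) integral_completion) auto
  have wsq: "sq_loc w"
  proof (rule sq_loc_Lp[OF w(1) p])
    fix L show "integrable lborel (\<lambda>x. indicat_real (ball 0 L) x * \<bar>w x\<bar> powr p)"
      using integrable_mult_bounded[OF wi', of "indicat_real (ball 0 L)" 1] w(3) by (simp add: mult.commute)
  qed
  have I0: "0 \<le> (LINT x|lebesgue. norm (W x) powr p)" by (intro integral_nonneg_AE) auto
  have "(LINT x|lebesgue. norm (W x) powr p) = Lp_norm p W powr p"
    using p I0 by (simp add: Lp_norm_def powr_powr)
  \<comment> \<open>The bound K comes without a sign, hence the absolute value.\<close>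
  also have "\<dots> \<le> \<bar>K\<bar> powr p" using W(2) p by (intro powr_mono2) (auto simp: Lp_norm_def)
  finally have "(\<integral>\<^sup>+x. ennreal (w x powr p) \<partial>lborel) \<le> ennreal (\<bar>K\<bar> powr p)"
    using wI' by (subst nn_integral_eq_integral[OF wi']) (auto simp: ennreal_leI)
  moreover have ng: "AE x in lebesgue. norm (weak_grad u x) = sqrt ((G1 x)\<^sup>2 + (G2 x)\<^sup>2)"
    using G1(7) G2(7) by eventually_elim (simp add: weak_grad_def norm_vec_def L2_set_def sum_2)
  then have "AE x in lebesgue. (norm (weak_grad u x))\<^sup>2 = (G1 x)\<^sup>2 + (G2 x)\<^sup>2"
    by eventually_elim simp
  moreover have "AE x in lebesgue. \<bar>F1 x + F2 x\<bar> \<le> w x * sqrt ((G1 x)\<^sup>2 + (G2 x)\<^sup>2)"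
    using eq ng w(2) G1(8) G2(8)
  proof eventually_elim
    case (elim x)
    have "F1 x + F2 x = - (W x \<bullet> weak_grad u x)" using elim by (simp add: weak_laplacian_def sum_2)
    then have "\<bar>F1 x + F2 x\<bar> \<le> norm (W x) * norm (weak_grad u x)" by (simp add: Cauchy_Schwarz_ineq2)
    then show ?case using elim by simp
  qed
  then have "AE x in lborel. \<bar>F1 x + F2 x\<bar> \<le> w x * sqrt ((G1 x)\<^sup>2 + (G2 x)\<^sup>2)"
    by (subst (asm) AE_lebesgue_lborel) measurable
  with uc ub G1 G2 wsq w(3) have "drift_solution u G1 G2 F1 F2 w C0" by unfold_locales auto
  ultimately show ?thesis using that by blast
qed

section \<open>The Caccioppoli inequality\<close>

lemma sq_loc_ball:
  assumes "sq_loc f"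
  shows "integrable lborel (\<lambda>x. indicat_real (ball z b) x * (f x)\<^sup>2)"
proof (rule Bochner_Integration.integrable_bound)
  have [measurable]: "f \<in> borel_measurable borel" using assms by (simp add: sq_loc_def)
  show "integrable lborel (\<lambda>x. indicat_real (ball 0 (norm z + b)) x * (f x)\<^sup>2)" using assms by (simp add: sq_loc_def)
  show "(\<lambda>x. indicat_real (ball z b) x * (f x)\<^sup>2) \<in> borel_measurable lborel" by measurable
  show "AE x in lborel. norm (indicat_real (ball z b) x * (f x)\<^sup>2) \<le> norm (indicat_real (ball 0 (norm z + b)) x * (f x)\<^sup>2)"
  proof (intro AE_I2)
    fix x
    have "norm x < norm z + b" if "x \<in> ball z b"
      using that norm_triangle_ineq4[of z "z - x"] by (simp add: dist_norm)
    then show "norm (indicat_real (ball z b) x * (f x)\<^sup>2) \<le> norm (indicat_real (ball 0 (norm z + b)) x * (f x)\<^sup>2)"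
      by (auto simp: indicator_def)
  qed
qed

lemma conv_rho_bound:
  assumes f: "integrable lborel (cut L f)" and \<delta>: "0 < \<delta>" and ae: "AE y in lborel. y \<in> ball x \<delta> \<longrightarrow> \<bar>f y\<bar> \<le> m" and m: "0 \<le> m"
  shows "\<bar>conv (cut L f) (rho \<delta>) x\<bar> \<le> m"
proof -
  note mol = mollifier_rho[OF \<delta>]
  obtain B where B: "\<And>x. norm (rho \<delta> x) \<le> B" using mollifierD(6)[OF mol] by blast
  have i: "integrable lborel (\<lambda>y. cut L f y * rho \<delta> (x - y))" by (rule conv_integrable[OF f mollifierD(1)[OF mol] B])
  have "\<bar>conv (cut L f) (rho \<delta>) x\<bar> \<le> (LINT y|lborel. norm (cut L f y * rho \<delta> (x - y)))"
    unfolding conv_def using integral_norm_bound[of lborel "\<lambda>y. cut L f y * rho \<delta> (x - y)"] by simp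
  also have "\<dots> \<le> (LINT y|lborel. m * rho \<delta> (x - y))"
  proof (rule integral_mono_AE)
    show "integrable lborel (\<lambda>y. norm (cut L f y * rho \<delta> (x - y)))" using i by (rule integrable_norm)
    show "integrable lborel (\<lambda>y. m * rho \<delta> (x - y))"
      using integrable_reflect[OF mollifierD(5)[OF mol]] by simp
    show "AE y in lborel. norm (cut L f y * rho \<delta> (x - y)) \<le> m * rho \<delta> (x - y)"
      using ae
    proof eventually_elim
      case (elim y)
      show ?case
      proof (cases "y \<in> ball x \<delta>")
        case True
        then have "\<bar>cut L f y\<bar> \<le> m" using elim m by (auto simp: indicator_def)
        then have "\<bar>cut L f y\<bar> * rho \<delta> (x - y) \<le> m * rho \<delta> (x - y)"
          using mollifierD(2)[OF mol] by (rule mult_right_mono)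
        then show ?thesis using mollifierD(2)[OF mol, of "x - y"] by (simp only: abs_mult real_norm_def abs_of_nonneg)
      next
        case False
        then have "rho \<delta> (x - y) = 0" using rho_far(1)[OF \<delta>, of "x - y"] by (simp add: dist_norm)
        then show ?thesis by simp
      qed
    qed
  qed
  also have "\<dots> = m * (LINT y|lborel. rho \<delta> (x - y))" by simp
  also have "(LINT y|lborel. rho \<delta> (x - y)) = 1"
    using integral_reflect[OF mollifierD(1)[OF mol], of x] mollifierD(4)[OF mol] by simp
  finally show ?thesis by simp
qed

lemma integrable_continuous_support:
  fixes f :: "real^2 \<Rightarrow> real"
  assumes "continuous_on UNIV f" "\<And>x. x \<notin> ball z r \<Longrightarrow> f x = 0"
  shows "integrable lborel f"
  using integrable_test_mult[of "\<lambda>_. 1" f z r] assms by simp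

context drift_solution
begin

lemma borel: "u \<in> borel_measurable borel" "G1 \<in> borel_measurable borel" "G2 \<in> borel_measurable borel"
  "F1 \<in> borel_measurable borel" "F2 \<in> borel_measurable borel" "w \<in> borel_measurable borel"
  using sq borel_measurable_continuous_onI[OF u(1)] by (auto simp: sq_loc_def)

lemma cut_integrable: "integrable lborel (cut L u)" "integrable lborel (cut L G1)" "integrable lborel (cut L G2)"
  "integrable lborel (cut L F1)" "integrable lborel (cut L F2)"
  using G F unfolding weakp_def loc_int_def by blast+

text \<open>The classical argument tests the equation with c^2 u and absorbs half of the gradient
  energy. Here it is run on the mollification v of u, for which c^2 v grad v is a compactly
  supported C^1 field on whose divergence the integral is 0. The limit uses Fatou's lemma for the
  energy and L^1 convergence for the Laplacian.\<close>

lemma caccioppoli: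
  assumes ab: "0 < a" "a < b" and s: "0 < s" and m: "\<And>x. x \<in> ball z0 (b + s) \<Longrightarrow> \<bar>u x\<bar> \<le> m"
  shows "(LINT x|lborel. indicat_real (ball z0 a) x * ((G1 x)\<^sup>2 + (G2 x)\<^sup>2))
    \<le> 4 * m\<^sup>2 * (LINT x|lborel. indicat_real (ball z0 b) x * (w x)\<^sup>2) + 16 * m\<^sup>2 * (8 * b / (b\<^sup>2 - a\<^sup>2))\<^sup>2 * (pi * b\<^sup>2)"
proof -
  note [measurable] = borel
  have m0: "0 \<le> m" using m[of z0] ab s by (auto intro: order_trans[OF abs_ge_zero])
  define L where "L = norm z0 + b + 1"
  define F where "F x = F1 x + F2 x" for x
  have [measurable]: "F \<in> borel_measurable borel" unfolding F_def by measurable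
  have cF: "integrable lborel (cut L F)"
    using Bochner_Integration.integrable_add[OF cut_integrable(4,5)[of L]] by (simp add: F_def distrib_left)
  obtain c c1 c2 :: "real^2 \<Rightarrow> real" where c: "has_partials c c1 c2" and
    c01: "\<And>x. 0 \<le> c x" "\<And>x. c x \<le> 1" and
    cin: "\<And>x. norm (x - z0) \<le> a \<Longrightarrow> c x = 1 \<and> c1 x = 0 \<and> c2 x = 0" and
    cout: "\<And>x. norm (x - z0) \<ge> b \<Longrightarrow> c x = 0 \<and> c1 x = 0 \<and> c2 x = 0" and
    cb: "\<And>x. \<bar>c1 x\<bar> \<le> 8 * b / (b\<^sup>2 - a\<^sup>2)" "\<And>x. \<bar>c2 x\<bar> \<le> 8 * b / (b\<^sup>2 - a\<^sup>2)"
    by (rule cutoff_exists[OF ab, of z0]) blast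
  note [measurable] = has_partials_borel[OF c]
  have out: "c x = 0 \<and> c1 x = 0 \<and> c2 x = 0" if "x \<notin> ball z0 b" for x
    using cout[of x] that by (simp add: dist_norm norm_minus_commute)
  have cc1: "(c x)\<^sup>2 \<le> 1" for x using c01[of x] by (simp add: power_le_one)
  have inL: "norm x < L - 1" if "x \<in> ball z0 b" for x
    using that norm_triangle_ineq4[of z0 "z0 - x"] by (simp add: dist_norm L_def)
  \<comment> \<open>Radii at most s let the mollification on ball b see u only on ball b + s, where
    |u| \<le> m; radii at most 1 keep it inside the cutoff of radius L.\<close>
  define \<delta> where "\<delta> n = min s 1 * inverse (real (Suc n))" for n
  have i1: "inverse (real (Suc n)) \<le> 1" "0 < inverse (real (Suc n))" for n by (auto simp: field_simps)
  have \<delta>: "0 < \<delta> n" "\<delta> n \<le> 1" "\<delta> n \<le> s" for n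
    using s mult_left_mono[OF i1(1)[of n], of "min s 1"] i1(2)[of n] by (auto simp: \<delta>_def)
  have \<delta>0: "\<delta> \<longlonglongrightarrow> 0"
    using tendsto_mult[OF tendsto_const LIMSEQ_inverse_real_of_nat, of "min s 1"] by (simp add: \<delta>_def[abs_def])
  define v where "v n = conv (cut L u) (rho (\<delta> n))" for n
  define P1 where "P1 n = conv (cut L G1) (rho (\<delta> n))" for n
  define P2 where "P2 n = conv (cut L G2) (rho (\<delta> n))" for n
  define \<Phi> where "\<Phi> n = conv (cut L F) (rho (\<delta> n))" for n
  define E where "E = (LINT x|lborel. (c1 x)\<^sup>2 + (c2 x)\<^sup>2)"
  have cont: "continuous_on UNIV (v n)" "continuous_on UNIV (P1 n)" "continuous_on UNIV (P2 n)" "continuous_on UNIV (\<Phi> n)" for n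
    unfolding v_def P1_def P2_def \<Phi>_def using has_partialsD(2)[OF has_partials_conv_rho(1)[OF _ \<delta>(1)]] cut_integrable cF by blast+
  note [measurable] = borel_measurable_continuous_onI[OF cont(1)] borel_measurable_continuous_onI[OF cont(2)]
    borel_measurable_continuous_onI[OF cont(3)] borel_measurable_continuous_onI[OF cont(4)]
  have iE: "integrable lborel (\<lambda>x. (c1 x)\<^sup>2 + (c2 x)\<^sup>2)"
    by (rule integrable_continuous_support[of _ z0 b]) (use out in \<open>auto intro!: continuous_intros has_partialsD[OF c]\<close>)
  have iP: "integrable lborel (\<lambda>x. (c x)\<^sup>2 * ((P1 n x)\<^sup>2 + (P2 n x)\<^sup>2))" for n
    by (rule integrable_continuous_support[of _ z0 b]) (use out in \<open>auto intro!: continuous_intros has_partialsD[OF c] cont\<close>)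
  have i\<Phi>: "integrable lborel (\<lambda>x. (c x)\<^sup>2 * \<bar>\<Phi> n x\<bar>)" for n
    by (rule integrable_continuous_support[of _ z0 b]) (use out in \<open>auto intro!: continuous_intros has_partialsD[OF c] cont\<close>)
  have main: "(LINT x|lborel. (c x)\<^sup>2 * ((P1 n x)\<^sup>2 + (P2 n x)\<^sup>2)) \<le> 2 * m * (LINT x|lborel. (c x)\<^sup>2 * \<bar>\<Phi> n x\<bar>) + 4 * m\<^sup>2 * E" for n
  proof -
    define v1 where "v1 = conv (cut L u) (rho' (\<delta> n) 1)"
    define v2 where "v2 = conv (cut L u) (rho' (\<delta> n) 2)"
    define Q11 where "Q11 = conv (cut L G1) (rho' (\<delta> n) 1)"
    define Q12 where "Q12 = conv (cut L G1) (rho' (\<delta> n) 2)"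
    define Q21 where "Q21 = conv (cut L G2) (rho' (\<delta> n) 1)"
    define Q22 where "Q22 = conv (cut L G2) (rho' (\<delta> n) 2)"
    have pv: "has_partials (v n) v1 v2" and pP1: "has_partials (P1 n) Q11 Q12" and pP2: "has_partials (P2 n) Q21 Q22"
      unfolding v_def v1_def v2_def P1_def P2_def Q11_def Q12_def Q21_def Q22_def
      by (rule has_partials_conv_rho(1)[OF cut_integrable(1) \<delta>(1)] has_partials_conv_rho(1)[OF cut_integrable(2) \<delta>(1)] has_partials_conv_rho(1)[OF cut_integrable(3) \<delta>(1)])+
    note pcv = has_partials_mult[OF has_partials_mult[OF c c] pv]
    \<comment> \<open>D1 and D2 are the two terms of the divergence of c^2 v (P1, P2). Each is a
      partial derivative of a compactly supported C^1 function and so integrates to 0.\<close>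
    define D1 where "D1 x = ((c1 x * c x + c x * c1 x) * v n x + (c x * c x) * v1 x) * P1 n x + (c x * c x * v n x) * Q11 x" for x
    define D2 where "D2 x = ((c2 x * c x + c x * c2 x) * v n x + (c x * c x) * v2 x) * P2 n x + (c x * c x * v n x) * Q22 x" for x
    have t1: "test_in (ball z0 b) (\<lambda>x. c x * c x * v n x * P1 n x) D1
       (\<lambda>x. ((c2 x * c x + c x * c2 x) * v n x + (c x * c x) * v2 x) * P1 n x + (c x * c x * v n x) * Q12 x)"
      unfolding test_in_def D1_def using has_partials_mult[OF pcv pP1] out by auto
    have t2: "test_in (ball z0 b) (\<lambda>x. c x * c x * v n x * P2 n x)
       (\<lambda>x. ((c1 x * c x + c x * c1 x) * v n x + (c x * c x) * v1 x) * P2 n x + (c x * c x * v n x) * Q21 x) D2"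
      unfolding test_in_def D2_def using has_partials_mult[OF pcv pP2] out by auto
    have z: "(LINT x|lborel. D1 x) = 0" "(LINT x|lborel. D2 x) = 0"
      using integral_partials_zero(1)[OF t1] integral_partials_zero(2)[OF t2] .
    have iD: "integrable lborel D1" "integrable lborel D2"
    proof -
      have "continuous_on UNIV D1" "continuous_on UNIV D2"
        using has_partialsD(3)[OF conjunct1[OF t1[unfolded test_in_def]]] has_partialsD(4)[OF conjunct1[OF t2[unfolded test_in_def]]] .
      moreover have "D1 x = 0" "D2 x = 0" if "x \<notin> ball z0 b" for x using out[OF that] by (simp_all add: D1_def D2_def)
      ultimately show "integrable lborel D1" "integrable lborel D2"
        using integrable_continuous_support[of D1 z0 b] integrable_continuous_support[of D2 z0 b] by blast+
    qed
    have pw: "(c x)\<^sup>2 * ((P1 n x)\<^sup>2 + (P2 n x)\<^sup>2) \<le> 2 * (D1 x + D2 x) + 2 * m * ((c x)\<^sup>2 * \<bar>\<Phi> n x\<bar>) + 4 * m\<^sup>2 * ((c1 x)\<^sup>2 + (c2 x)\<^sup>2)" for x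
    proof (cases "x \<in> ball z0 b")
      case True
      have nx: "norm x + \<delta> n \<le> L" using inL[OF True] \<delta>(2)[of n] by simp
      have e: "v1 x = P1 n x" "v2 x = P2 n x" "Q11 x = conv (cut L F1) (rho (\<delta> n)) x" "Q22 x = conv (cut L F2) (rho (\<delta> n)) x"
        unfolding v1_def v2_def P1_def P2_def Q11_def Q22_def
        using weakp_conv[OF G(1) \<delta>(1) nx] weakp_conv[OF G(2) \<delta>(1) nx] weakp_conv[OF F(1) \<delta>(1) nx] weakp_conv[OF F(2) \<delta>(1) nx] by auto
      have QF: "Q11 x + Q22 x = \<Phi> n x"
      proof -
        obtain B where B: "\<And>x. norm (rho (\<delta> n) x) \<le> B" using mollifierD(6)[OF mollifier_rho[OF \<delta>(1)[of n]]] by blast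
        have r: "rho (\<delta> n) \<in> borel_measurable borel" by (rule has_partials_borel(1)[OF has_partials_rho])
        show ?thesis
          unfolding e \<Phi>_def conv_def F_def distrib_left distrib_right
          by (rule Bochner_Integration.integral_add[symmetric]; rule conv_integrable[OF _ r B]; rule cut_integrable)
      qed
      have vm: "\<bar>v n x\<bar> \<le> m"
        unfolding v_def
      proof (rule conv_rho_bound[OF cut_integrable(1) \<delta>(1) _ m0], intro AE_I2 impI)
        fix y assume y: "y \<in> ball x (\<delta> n)"
        have "dist z0 y < b + s"
          using dist_triangle[of z0 y x] True y \<delta>(3)[of n] by simp
        then show "\<bar>u y\<bar> \<le> m" by (intro m) simp
      qed
      have DD: "D1 x + D2 x = 2 * c x * v n x * (c1 x * P1 n x + c2 x * P2 n x) + (c x)\<^sup>2 * ((P1 n x)\<^sup>2 + (P2 n x)\<^sup>2) + (c x)\<^sup>2 * v n x * \<Phi> n x"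
        unfolding D1_def D2_def QF[symmetric] e by (simp add: power2_eq_square algebra_simps)
      \<comment> \<open>The cross term is split by completing the square. It uses up one of the two
        copies of c^2 P^2 that occur in 2 (D1 + D2).\<close>
      have k: "- (4 * c x * v n x * (c' * P)) \<le> (c x)\<^sup>2 * P\<^sup>2 + 4 * m\<^sup>2 * c'\<^sup>2" for c' P
      proof -
        have "0 \<le> (c x * P + 2 * v n x * c')\<^sup>2" by simp
        then have "- (4 * c x * v n x * (c' * P)) \<le> (c x)\<^sup>2 * P\<^sup>2 + 4 * (v n x)\<^sup>2 * c'\<^sup>2"
          by (simp add: power2_eq_square algebra_simps)
        moreover have "(v n x)\<^sup>2 * c'\<^sup>2 \<le> m\<^sup>2 * c'\<^sup>2"
          using vm m0 by (intro mult_right_mono) (auto simp: abs_le_square_iff[symmetric])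
        ultimately show ?thesis by simp
      qed
      have q: "- ((c x)\<^sup>2 * v n x * \<Phi> n x) \<le> m * ((c x)\<^sup>2 * \<bar>\<Phi> n x\<bar>)"
      proof -
        have "- ((c x)\<^sup>2 * v n x * \<Phi> n x) \<le> \<bar>(c x)\<^sup>2 * v n x * \<Phi> n x\<bar>" by (rule abs_ge_minus_self)
        also have "\<dots> = \<bar>v n x\<bar> * ((c x)\<^sup>2 * \<bar>\<Phi> n x\<bar>)" by (simp add: abs_mult)
        also have "\<dots> \<le> m * ((c x)\<^sup>2 * \<bar>\<Phi> n x\<bar>)" using vm by (intro mult_right_mono) auto
        finally show ?thesis .
      qed
      show ?thesis
        using k[of "c1 x" "P1 n x"] k[of "c2 x" "P2 n x"] q unfolding DD by (simp add: algebra_simps)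
    qed (use out[of x] in \<open>simp add: D1_def D2_def\<close>)
    have "(LINT x|lborel. (c x)\<^sup>2 * ((P1 n x)\<^sup>2 + (P2 n x)\<^sup>2))
      \<le> (LINT x|lborel. 2 * (D1 x + D2 x) + 2 * m * ((c x)\<^sup>2 * \<bar>\<Phi> n x\<bar>) + 4 * m\<^sup>2 * ((c1 x)\<^sup>2 + (c2 x)\<^sup>2))"
      by (rule Bochner_Integration.integral_mono[OF iP _ pw]) (use iD i\<Phi> iE in auto)
    also have "\<dots> = 2 * ((LINT x|lborel. D1 x) + (LINT x|lborel. D2 x)) + 2 * m * (LINT x|lborel. (c x)\<^sup>2 * \<bar>\<Phi> n x\<bar>) + 4 * m\<^sup>2 * E"
      unfolding E_def using iD i\<Phi>[of n] iE by (simp del: integral_mult_right_zero add: integral_mult_right[symmetric])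
    finally show ?thesis using z by simp
  qed
  have lim\<Phi>: "(\<lambda>n. LINT x|lborel. (c x)\<^sup>2 * \<bar>\<Phi> n x\<bar>) \<longlonglongrightarrow> (LINT x|lborel. (c x)\<^sup>2 * \<bar>F x\<bar>)"
  proof (rule LIM_zero_cancel, rule Lim_null_comparison)
    show "(\<lambda>n. LINT x|lborel. norm (\<Phi> n x - cut L F x)) \<longlonglongrightarrow> 0"
      unfolding \<Phi>_def by (rule mollify_L1_tendsto_real(1)[OF cF \<delta>(1) \<delta>0])
    show "eventually (\<lambda>n. norm ((LINT x|lborel. (c x)\<^sup>2 * \<bar>\<Phi> n x\<bar>) - (LINT x|lborel. (c x)\<^sup>2 * \<bar>F x\<bar>)) \<le> (LINT x|lborel. norm (\<Phi> n x - cut L F x))) sequentially"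
    proof (intro always_eventually allI)
      fix n
      have cutF: "(c x)\<^sup>2 * \<bar>F x\<bar> = (c x)\<^sup>2 * \<bar>cut L F x\<bar>" for x
        using out[of x] inL[of x] by (cases "x \<in> ball z0 b") auto
      have iF: "integrable lborel (\<lambda>x. (c x)\<^sup>2 * \<bar>F x\<bar>)"
        unfolding cutF using integrable_mult_bounded[OF integrable_norm[OF cF], of "\<lambda>x. (c x)\<^sup>2" 1] cc1
        by (simp add: mult.commute)
      have id: "integrable lborel (\<lambda>x. \<Phi> n x - cut L F x)"
        unfolding \<Phi>_def using mollify_L1_tendsto_real(2)[OF cF \<delta>(1) \<delta>0] cF by simp
      have "norm ((LINT x|lborel. (c x)\<^sup>2 * \<bar>\<Phi> n x\<bar>) - (LINT x|lborel. (c x)\<^sup>2 * \<bar>F x\<bar>)) = norm (LINT x|lborel. (c x)\<^sup>2 * \<bar>\<Phi> n x\<bar> - (c x)\<^sup>2 * \<bar>F x\<bar>)"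
        using i\<Phi>[of n] iF by simp
      also have "\<dots> \<le> (LINT x|lborel. norm (\<Phi> n x - cut L F x))"
      proof (rule Bochner_Integration.integral_norm_bound_integral)
        show "integrable lborel (\<lambda>x. (c x)\<^sup>2 * \<bar>\<Phi> n x\<bar> - (c x)\<^sup>2 * \<bar>F x\<bar>)" using i\<Phi>[of n] iF by simp
        show "integrable lborel (\<lambda>x. norm (\<Phi> n x - cut L F x))" using id by (rule integrable_norm)
        fix x
        have "norm ((c x)\<^sup>2 * \<bar>\<Phi> n x\<bar> - (c x)\<^sup>2 * \<bar>F x\<bar>) = (c x)\<^sup>2 * \<bar>\<bar>\<Phi> n x\<bar> - \<bar>cut L F x\<bar>\<bar>"
          unfolding cutF by (simp add: abs_mult flip: right_diff_distrib)
        also have "\<dots> \<le> 1 * \<bar>\<Phi> n x - cut L F x\<bar>"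
          using cc1 by (intro mult_mono abs_triangle_ineq3) auto
        finally show "norm ((c x)\<^sup>2 * \<bar>\<Phi> n x\<bar> - (c x)\<^sup>2 * \<bar>F x\<bar>) \<le> norm (\<Phi> n x - cut L F x)" by simp
      qed
      finally show "norm ((LINT x|lborel. (c x)\<^sup>2 * \<bar>\<Phi> n x\<bar>) - (LINT x|lborel. (c x)\<^sup>2 * \<bar>F x\<bar>)) \<le> (LINT x|lborel. norm (\<Phi> n x - cut L F x))" .
    qed
  qed
  obtain r where r: "strict_mono r" "AE x in lborel. (\<lambda>n. \<bar>P1 (r n) x - cut L G1 x\<bar> + \<bar>P2 (r n) x - cut L G2 x\<bar>) \<longlonglongrightarrow> 0"
  proof -
    have i: "integrable lborel (\<lambda>x. P1 n x - cut L G1 x)" "integrable lborel (\<lambda>x. P2 n x - cut L G2 x)" for n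
      unfolding P1_def P2_def using mollify_L1_tendsto_real(2)[OF cut_integrable(2) \<delta>(1) \<delta>0] mollify_L1_tendsto_real(2)[OF cut_integrable(3) \<delta>(1) \<delta>0] cut_integrable by auto
    have "(\<lambda>n. (LINT x|lborel. norm (P1 n x - cut L G1 x)) + (LINT x|lborel. norm (P2 n x - cut L G2 x))) \<longlonglongrightarrow> 0 + 0"
      unfolding P1_def P2_def by (intro tendsto_add mollify_L1_tendsto_real(1)[OF _ \<delta>(1) \<delta>0] cut_integrable)
    moreover have "(LINT x|lborel. norm (P1 n x - cut L G1 x)) + (LINT x|lborel. norm (P2 n x - cut L G2 x))
       = (LINT x|lborel. norm (\<bar>P1 n x - cut L G1 x\<bar> + \<bar>P2 n x - cut L G2 x\<bar>))" for n
      using i[of n] by (subst Bochner_Integration.integral_add[symmetric]) auto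
    ultimately have "(\<lambda>n. LINT x|lborel. norm (\<bar>P1 n x - cut L G1 x\<bar> + \<bar>P2 n x - cut L G2 x\<bar>)) \<longlonglongrightarrow> 0" by simp
    moreover have "integrable lborel (\<lambda>x. \<bar>P1 n x - cut L G1 x\<bar> + \<bar>P2 n x - cut L G2 x\<bar>)" for n
      using i[of n] by auto
    ultimately show ?thesis using tendsto_L1_AE_subseq[of lborel "\<lambda>n x. \<bar>P1 n x - cut L G1 x\<bar> + \<bar>P2 n x - cut L G2 x\<bar>"] that by blast
  qed
  let ?GG = "\<lambda>x. (c x)\<^sup>2 * ((G1 x)\<^sup>2 + (G2 x)\<^sup>2)"
  have igg: "integrable lborel (\<lambda>x. indicat_real (ball z0 b) x * ((G1 x)\<^sup>2 + (G2 x)\<^sup>2))" for b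
    using Bochner_Integration.integrable_add[OF sq_loc_ball[OF sq(1)] sq_loc_ball[OF sq(2)]] by (simp add: distrib_left)
  have cind: "(c x)\<^sup>2 \<le> indicat_real (ball z0 b) x" for x using cc1[of x] out[of x] by (auto simp: indicator_def)
  have iG: "integrable lborel ?GG"
    by (rule Bochner_Integration.integrable_bound[OF igg[of b]]) (use cind in \<open>auto intro!: AE_I2 mult_right_mono simp: abs_mult\<close>)
  have iw: "integrable lborel (\<lambda>x. (c x)\<^sup>2 * (w x)\<^sup>2)"
    by (rule Bochner_Integration.integrable_bound[OF sq_loc_ball[OF sq(5), of z0 b]]) (use cind in \<open>auto intro!: AE_I2 mult_right_mono simp: abs_mult\<close>)
  \<comment> \<open>The gradients are known to converge almost everywhere along a subsequence, which
    is what Fatou's lemma asks for.\<close>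
  have "(\<integral>\<^sup>+x. ennreal (?GG x) \<partial>lborel) \<le> (\<integral>\<^sup>+x. liminf (\<lambda>n. ennreal ((c x)\<^sup>2 * ((P1 (r n) x)\<^sup>2 + (P2 (r n) x)\<^sup>2))) \<partial>lborel)"
  proof (rule nn_integral_mono_AE)
    show "AE x in lborel. ennreal (?GG x) \<le> liminf (\<lambda>n. ennreal ((c x)\<^sup>2 * ((P1 (r n) x)\<^sup>2 + (P2 (r n) x)\<^sup>2)))"
      using r(2)
    proof eventually_elim
      case (elim x)
      have l: "(\<lambda>n. P1 (r n) x) \<longlonglongrightarrow> cut L G1 x" "(\<lambda>n. P2 (r n) x) \<longlonglongrightarrow> cut L G2 x"
        by (rule LIM_zero_cancel, rule Lim_null_comparison[OF _ elim], simp)+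
      have T: "(\<lambda>n. ennreal ((c x)\<^sup>2 * ((P1 (r n) x)\<^sup>2 + (P2 (r n) x)\<^sup>2))) \<longlonglongrightarrow> ennreal ((c x)\<^sup>2 * ((cut L G1 x)\<^sup>2 + (cut L G2 x)\<^sup>2))"
        by (intro tendsto_ennrealI tendsto_intros l)
      have Q: "(c x)\<^sup>2 * ((cut L G1 x)\<^sup>2 + (cut L G2 x)\<^sup>2) = ?GG x"
        using out[of x] inL[of x] by (cases "x \<in> ball z0 b") auto
      show ?case using lim_imp_Liminf[OF sequentially_bot T] unfolding Q by simp
    qed
  qed
  also have "\<dots> \<le> liminf (\<lambda>n. \<integral>\<^sup>+x. ennreal ((c x)\<^sup>2 * ((P1 (r n) x)\<^sup>2 + (P2 (r n) x)\<^sup>2)) \<partial>lborel)"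
    by (rule nn_integral_liminf) measurable
  also have "\<dots> \<le> liminf (\<lambda>n. ennreal (2 * m * (LINT x|lborel. (c x)\<^sup>2 * \<bar>\<Phi> (r n) x\<bar>) + 4 * m\<^sup>2 * E))"
  proof (intro Liminf_mono always_eventually allI)
    fix n
    have "(\<integral>\<^sup>+x. ennreal ((c x)\<^sup>2 * ((P1 (r n) x)\<^sup>2 + (P2 (r n) x)\<^sup>2)) \<partial>lborel) = ennreal (LINT x|lborel. (c x)\<^sup>2 * ((P1 (r n) x)\<^sup>2 + (P2 (r n) x)\<^sup>2))"
      by (rule nn_integral_eq_integral[OF iP]) auto
    then show "(\<integral>\<^sup>+x. ennreal ((c x)\<^sup>2 * ((P1 (r n) x)\<^sup>2 + (P2 (r n) x)\<^sup>2)) \<partial>lborel) \<le> ennreal (2 * m * (LINT x|lborel. (c x)\<^sup>2 * \<bar>\<Phi> (r n) x\<bar>) + 4 * m\<^sup>2 * E)"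
      using ennreal_leI[OF main[of "r n"]] by simp
  qed
  also have "\<dots> = ennreal (2 * m * (LINT x|lborel. (c x)\<^sup>2 * \<bar>F x\<bar>) + 4 * m\<^sup>2 * E)"
  proof -
    have "(\<lambda>n. LINT x|lborel. (c x)\<^sup>2 * \<bar>\<Phi> (r n) x\<bar>) \<longlonglongrightarrow> (LINT x|lborel. (c x)\<^sup>2 * \<bar>F x\<bar>)"
      using LIMSEQ_subseq_LIMSEQ[OF lim\<Phi> r(1)] by (simp add: comp_def)
    from tendsto_add[OF tendsto_mult_left[OF this, of "2 * m"] tendsto_const[of "4 * m\<^sup>2 * E"]]
    show ?thesis by (rule lim_imp_Liminf[OF sequentially_bot tendsto_ennrealI])
  qed
  finally have A1: "ennreal (LINT x|lborel. ?GG x) \<le> ennreal (2 * m * (LINT x|lborel. (c x)\<^sup>2 * \<bar>F x\<bar>) + 4 * m\<^sup>2 * E)"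
    by (subst (asm) nn_integral_eq_integral[OF iG]) auto
  have A2: "0 \<le> 2 * m * (LINT x|lborel. (c x)\<^sup>2 * \<bar>F x\<bar>) + 4 * m\<^sup>2 * E"
    unfolding E_def using m0 by (intro add_nonneg_nonneg mult_nonneg_nonneg Bochner_Integration.integral_nonneg) auto
  have Y1: "(LINT x|lborel. ?GG x) \<le> 2 * m * (LINT x|lborel. (c x)\<^sup>2 * \<bar>F x\<bar>) + 4 * m\<^sup>2 * E"
    by (rule iffD1[OF ennreal_le_iff[OF A2] A1])
  have "2 * m * (LINT x|lborel. (c x)\<^sup>2 * \<bar>F x\<bar>) = (LINT x|lborel. 2 * m * ((c x)\<^sup>2 * \<bar>F x\<bar>))" by simp
  also have "\<dots> \<le> (LINT x|lborel. ?GG x / 2 + 2 * m\<^sup>2 * ((c x)\<^sup>2 * (w x)\<^sup>2))"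
  proof (rule integral_mono_AE')
    show "integrable lborel (\<lambda>x. ?GG x / 2 + 2 * m\<^sup>2 * ((c x)\<^sup>2 * (w x)\<^sup>2))" using iG iw by simp
    show "AE x in lborel. 2 * m * ((c x)\<^sup>2 * \<bar>F x\<bar>) \<le> ?GG x / 2 + 2 * m\<^sup>2 * ((c x)\<^sup>2 * (w x)\<^sup>2)"
      using w(2)
    proof eventually_elim
      case (elim x)
      define t where "t = sqrt ((G1 x)\<^sup>2 + (G2 x)\<^sup>2)"
      have t: "t\<^sup>2 = (G1 x)\<^sup>2 + (G2 x)\<^sup>2" by (simp add: t_def)
      \<comment> \<open>Young's inequality, weighted so that exactly half of the gradient energy
        appears and is absorbed in \<open>Y2\<close>.\<close>
      have "0 \<le> (t - 2 * (m * w x))\<^sup>2" by simp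
      then have "2 * m * (w x * t) \<le> t\<^sup>2 / 2 + 2 * m\<^sup>2 * (w x)\<^sup>2" by (simp add: power2_eq_square algebra_simps)
      moreover have "2 * m * \<bar>F x\<bar> \<le> 2 * m * (w x * t)"
        using elim m0 by (intro mult_left_mono) (auto simp: F_def t_def)
      ultimately have "2 * m * \<bar>F x\<bar> \<le> t\<^sup>2 / 2 + 2 * m\<^sup>2 * (w x)\<^sup>2" by simp
      from mult_left_mono[OF this, of "(c x)\<^sup>2"] show ?case by (simp add: t algebra_simps)
    qed
    show "AE x in lborel. 0 \<le> ?GG x / 2 + 2 * m\<^sup>2 * ((c x)\<^sup>2 * (w x)\<^sup>2)" by (intro AE_I2) simp
  qed
  also have "\<dots> = (LINT x|lborel. ?GG x) / 2 + 2 * m\<^sup>2 * (LINT x|lborel. (c x)\<^sup>2 * (w x)\<^sup>2)"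
    using iG iw by simp
  finally have Y2: "(LINT x|lborel. ?GG x) \<le> 4 * m\<^sup>2 * (LINT x|lborel. (c x)\<^sup>2 * (w x)\<^sup>2) + 8 * m\<^sup>2 * E" using Y1 by simp
  have A: "(LINT x|lborel. indicat_real (ball z0 a) x * ((G1 x)\<^sup>2 + (G2 x)\<^sup>2)) \<le> (LINT x|lborel. ?GG x)"
    by (rule Bochner_Integration.integral_mono[OF igg iG]) (use cin in \<open>auto simp: indicator_def dist_norm norm_minus_commute\<close>)
  have B: "(LINT x|lborel. (c x)\<^sup>2 * (w x)\<^sup>2) \<le> (LINT x|lborel. indicat_real (ball z0 b) x * (w x)\<^sup>2)"
    by (rule Bochner_Integration.integral_mono[OF iw sq_loc_ball[OF sq(5)]]) (use cind in \<open>auto intro: mult_right_mono\<close>)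
  define e where "e = 8 * b / (b\<^sup>2 - a\<^sup>2)"
  have "E \<le> (LINT x|lborel. indicat_real (ball z0 b) x * (2 * e\<^sup>2))"
    unfolding E_def
  proof (rule Bochner_Integration.integral_mono[OF iE integrable_indicator_ball])
    fix x
    show "(c1 x)\<^sup>2 + (c2 x)\<^sup>2 \<le> indicat_real (ball z0 b) x * (2 * e\<^sup>2)"
    proof (cases "x \<in> ball z0 b")
      case True
      have e0: "0 \<le> e" using cb(1)[of x] by (simp add: e_def)
      have "(c1 x)\<^sup>2 \<le> e\<^sup>2" "(c2 x)\<^sup>2 \<le> e\<^sup>2"
        using power_mono[of "\<bar>c1 x\<bar>" e 2] power_mono[of "\<bar>c2 x\<bar>" e 2] cb[of x, folded e_def] by simp_all
      then show ?thesis using True by simp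
    qed (use out[of x] in simp)
  qed
  also have "\<dots> = 2 * e\<^sup>2 * (pi * b\<^sup>2)" using ab by (simp add: content_ball_2)
  finally have "8 * m\<^sup>2 * E \<le> 8 * m\<^sup>2 * (2 * e\<^sup>2 * (pi * b\<^sup>2))" by (intro mult_left_mono) auto
  moreover have "4 * m\<^sup>2 * (LINT x|lborel. (c x)\<^sup>2 * (w x)\<^sup>2) \<le> 4 * m\<^sup>2 * (LINT x|lborel. indicat_real (ball z0 b) x * (w x)\<^sup>2)"
    using B by (intro mult_left_mono) auto
  ultimately show ?thesis using A Y2 unfolding e_def by (simp add: mult_ac)
qed

text \<open>Mollification averages the gradient and thus keeps the bound M on a slightly smaller
  ball. There the mean value inequality applies to the mollified function, and continuity of u makes
  the mollifications converge at x and at 0.\<close>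

lemma lipschitz_of_gradient_bound:
  assumes M: "AE x in lborel. x \<in> ball 0 R \<longrightarrow> (G1 x)\<^sup>2 + (G2 x)\<^sup>2 \<le> M\<^sup>2" "0 \<le> M" and x: "x \<in> ball 0 R"
  shows "\<bar>u x - u 0\<bar> \<le> M * norm x"
proof -
  note [measurable] = borel
  \<comment> \<open>Halfway between |x| and R: a ball that contains x and whose neighbourhood of
    radius R - R' still lies where the gradient bound is assumed.\<close>
  define R' where "R' = (norm x + R) / 2"
  have R': "norm x < R'" "R' < R" "0 < R'" using x norm_ge_zero[of x] by (auto simp: R'_def simp del: norm_ge_zero)
  define \<delta> where "\<delta> n = (R - R') * inverse (real (Suc n))" for n
  have i1: "inverse (real (Suc n)) \<le> 1" "0 < inverse (real (Suc n))" for n by (auto simp: field_simps)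
  have \<delta>: "0 < \<delta> n" "\<delta> n \<le> R - R'" for n
    using R' mult_left_mono[OF i1(1)[of n], of "R - R'"] i1(2)[of n] by (auto simp: \<delta>_def)
  have \<delta>0: "\<delta> \<longlonglongrightarrow> 0"
    using tendsto_mult[OF tendsto_const LIMSEQ_inverse_real_of_nat, of "R - R'"] by (simp add: \<delta>_def[abs_def])
  define v where "v n = conv (cut R u) (rho (\<delta> n))" for n
  have inR: "norm y + \<delta> n \<le> R" if "y \<in> ball 0 R'" for y n using that \<delta>(2)[of n] by simp
  have vlip: "\<bar>v n x - v n 0\<bar> \<le> M * norm x" for n
  proof -
    note pv = has_partials_conv_rho(1)[OF cut_integrable(1)[of R] \<delta>(1)[of n]]
    have ptw: "\<bar>h$1 * conv (cut R u) (rho' (\<delta> n) 1) y + h$2 * conv (cut R u) (rho' (\<delta> n) 2) y\<bar> \<le> M * norm h" if y: "y \<in> ball 0 R'" for h :: "real^2" and y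
    proof -
      obtain B where B: "\<And>x. norm (rho (\<delta> n) x) \<le> B" using mollifierD(6)[OF mollifier_rho[OF \<delta>(1)[of n]]] by blast
      have r: "rho (\<delta> n) \<in> borel_measurable borel" by (rule has_partials_borel(1)[OF has_partials_rho])
      have i: "integrable lborel (\<lambda>z. cut R G1 z * rho (\<delta> n) (y - z))" "integrable lborel (\<lambda>z. cut R G2 z * rho (\<delta> n) (y - z))"
        by (rule conv_integrable[OF _ r B]; rule cut_integrable)+
      let ?g = "\<lambda>z. h$1 * G1 z + h$2 * G2 z"
      have "h$1 * conv (cut R u) (rho' (\<delta> n) 1) y + h$2 * conv (cut R u) (rho' (\<delta> n) 2) y = h$1 * conv (cut R G1) (rho (\<delta> n)) y + h$2 * conv (cut R G2) (rho (\<delta> n)) y"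
        using weakp_conv[OF G(1) \<delta>(1) inR[OF y]] weakp_conv[OF G(2) \<delta>(1) inR[OF y]] by simp
      also have "\<dots> = (LINT z|lborel. h$1 * (cut R G1 z * rho (\<delta> n) (y - z)) + h$2 * (cut R G2 z * rho (\<delta> n) (y - z)))"
        using i by (simp add: conv_def)
      also have "\<dots> = conv (cut R ?g) (rho (\<delta> n)) y"
        unfolding conv_def by (intro Bochner_Integration.integral_cong refl) (simp add: algebra_simps)
      also have "\<bar>\<dots>\<bar> \<le> M * norm h"
      proof (rule conv_rho_bound[OF _ \<delta>(1)])
        have "integrable lborel (\<lambda>z. h$1 * cut R G1 z + h$2 * cut R G2 z)" using cut_integrable[of R] by simp
        then show "integrable lborel (cut R ?g)" by (simp add: algebra_simps)
        show "AE z in lborel. z \<in> ball y (\<delta> n) \<longrightarrow> \<bar>?g z\<bar> \<le> M * norm h"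
          using M(1)
        proof eventually_elim
          case (elim z)
          show ?case
          proof
            assume z: "z \<in> ball y (\<delta> n)"
            have "norm z < R" using norm_triangle_ineq4[of y "y - z"] z inR[OF y, of n] by (simp add: dist_norm)
            then have e: "(G1 z)\<^sup>2 + (G2 z)\<^sup>2 \<le> M\<^sup>2" using elim by simp
            \<comment> \<open>Cauchy-Schwarz in the plane by Lagrange's identity.\<close>
            have "0 \<le> (h$1 * G2 z - h$2 * G1 z)\<^sup>2" by simp
            then have "(?g z)\<^sup>2 \<le> ((G1 z)\<^sup>2 + (G2 z)\<^sup>2) * ((h$1)\<^sup>2 + (h$2)\<^sup>2)" by (simp add: power2_eq_square algebra_simps)
            also have "\<dots> \<le> M\<^sup>2 * ((h$1)\<^sup>2 + (h$2)\<^sup>2)" using e by (intro mult_right_mono) auto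
            also have "\<dots> = (M * norm h)\<^sup>2" by (simp add: norm_sq_2 power_mult_distrib)
            finally show "\<bar>?g z\<bar> \<le> M * norm h" using M(2) by (simp add: abs_le_square_iff[symmetric])
          qed
        qed
      qed (use M(2) in simp)
      finally show ?thesis .
    qed
    have "norm (v n x - v n 0) \<le> M * norm (x - 0)"
      unfolding v_def
    proof (rule differentiable_bound[of "ball 0 R'"])
      show "(conv (cut R u) (rho (\<delta> n)) has_derivative (\<lambda>h::real^2. (h$1) *\<^sub>R conv (cut R u) (rho' (\<delta> n) 1) y + (h$2) *\<^sub>R conv (cut R u) (rho' (\<delta> n) 2) y)) (at y within ball 0 R')" for y
        by (rule has_partialsD(1)[OF pv])
      show "onorm (\<lambda>h::real^2. (h$1) *\<^sub>R conv (cut R u) (rho' (\<delta> n) 1) y + (h$2) *\<^sub>R conv (cut R u) (rho' (\<delta> n) 2) y) \<le> M" if "y \<in> ball 0 R'" for y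
        by (rule onorm_le) (use ptw[OF that] in simp)
    qed (use R' in auto)
    then show ?thesis by simp
  qed
  have vlim: "(\<lambda>n. v n y) \<longlonglongrightarrow> u y" if y: "y \<in> ball 0 R'" for y
  proof (rule LIMSEQ_I)
    fix \<epsilon> :: real assume \<epsilon>: "\<epsilon> > 0"
    obtain d where d: "d > 0" "\<And>z. dist z y < d \<Longrightarrow> dist (u z) (u y) < \<epsilon> / 2"
      using u(1) \<epsilon> unfolding continuous_on_iff by (metis UNIV_I half_gt_zero)
    obtain N where N: "\<And>n. n \<ge> N \<Longrightarrow> \<delta> n < d"
      using order_tendstoD(2)[OF \<delta>0 d(1)] by (auto simp: eventually_sequentially)
    have "norm (v n y - u y) < \<epsilon>" if n: "n \<ge> N" for n
    proof -
      obtain B where B: "\<And>x. norm (rho (\<delta> n) x) \<le> B" using mollifierD(6)[OF mollifier_rho[OF \<delta>(1)[of n]]] by blast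
      have r: "rho (\<delta> n) \<in> borel_measurable borel" by (rule has_partials_borel(1)[OF has_partials_rho])
      have ic: "integrable lborel (cut R (\<lambda>z. u y))" using integrable_indicator_ball by simp
      have "conv (cut R (\<lambda>z. u y)) (rho (\<delta> n)) y = (LINT z|lborel. u y * rho (\<delta> n) (y - z))"
        by (rule conv_cut[OF rho_far(1)[OF \<delta>(1)] inR[OF y]])
      also have "\<dots> = u y"
        using integral_reflect[OF r, of y] mollifierD(4)[OF mollifier_rho[OF \<delta>(1)[of n]]] by simp
      finally have "v n y - u y = conv (cut R u) (rho (\<delta> n)) y - conv (cut R (\<lambda>z. u y)) (rho (\<delta> n)) y" by (simp add: v_def)
      also have "\<dots> = conv (cut R (\<lambda>z. u z - u y)) (rho (\<delta> n)) y"
        unfolding conv_def right_diff_distrib left_diff_distrib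
        by (rule Bochner_Integration.integral_diff[symmetric]; rule conv_integrable[OF _ r B]) (rule cut_integrable ic)+
      finally have eq: "v n y - u y = conv (cut R (\<lambda>z. u z - u y)) (rho (\<delta> n)) y" .
      have "\<bar>conv (cut R (\<lambda>z. u z - u y)) (rho (\<delta> n)) y\<bar> \<le> \<epsilon> / 2"
      proof (rule conv_rho_bound[OF _ \<delta>(1)])
        show "integrable lborel (cut R (\<lambda>z. u z - u y))"
          using Bochner_Integration.integrable_diff[OF cut_integrable(1)[of R] ic] by (simp add: right_diff_distrib)
        show "AE z in lborel. z \<in> ball y (\<delta> n) \<longrightarrow> \<bar>u z - u y\<bar> \<le> \<epsilon> / 2"
        proof (intro AE_I2 impI)
          fix z assume "z \<in> ball y (\<delta> n)"
          then have "dist z y < d" using N[OF n] by (simp add: dist_commute)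
          from d(2)[OF this] show "\<bar>u z - u y\<bar> \<le> \<epsilon> / 2" by (simp add: dist_real_def)
        qed
      qed (use \<epsilon> in simp)
      then show ?thesis using \<epsilon> by (simp add: eq)
    qed
    then show "\<exists>N. \<forall>n\<ge>N. norm (v n y - u y) < \<epsilon>" by blast
  qed
  have "(\<lambda>n. \<bar>v n x - v n 0\<bar>) \<longlonglongrightarrow> \<bar>u x - u 0\<bar>"
    using R' by (intro tendsto_intros vlim) auto
  then show ?thesis by (rule tendsto_upperbound) (use vlip in auto)
qed

text \<open>Links the classical gradient at the single point 0, to which the normalisation refers,
  with almost everywhere bounds on the weak gradient. A small step in the direction of g itself
  realises the full norm of g.\<close>

lemma gradient_norm_le:
  assumes M: "AE x in lborel. x \<in> ball 0 R \<longrightarrow> (G1 x)\<^sup>2 + (G2 x)\<^sup>2 \<le> M\<^sup>2" "0 \<le> M" and R: "0 < R"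
    and g: "GDERIV u 0 :> g"
  shows "norm g \<le> M"
proof (cases "g = 0")
  case False
  have "((\<lambda>h. norm (u (0 + h) - u 0 - h \<bullet> g) / norm h) \<longlongrightarrow> 0) (at 0)"
    using g by (simp add: gderiv_def has_derivative_at)
  then have T: "((\<lambda>h. norm (u h - u 0 - h \<bullet> g) / norm h) \<longlongrightarrow> 0) (at 0)" by simp
  show ?thesis
  proof (rule field_le_epsilon)
    fix \<epsilon> :: real assume \<epsilon>: "\<epsilon> > 0"
    have "eventually (\<lambda>h. norm (u h - u 0 - h \<bullet> g) / norm h < \<epsilon>) (at 0)"
      using order_tendstoD(2)[OF T \<epsilon>] .
    then obtain d where d: "d > 0" "\<And>h. h \<noteq> 0 \<Longrightarrow> norm h < d \<Longrightarrow> norm (u h - u 0 - h \<bullet> g) / norm h < \<epsilon>"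
      unfolding eventually_at by (auto simp: dist_norm)
    define t where "t = min d R / (2 * norm g)"
    have t: "t > 0" using d R False by (simp add: t_def)
    define h where "h = t *\<^sub>R g"
    have nh: "norm h = min d R / 2" using False t d R by (simp add: h_def t_def)
    have h: "h \<noteq> 0" "norm h < d" "h \<in> ball 0 R" using nh d R t False by (auto simp: h_def)
    have "h \<bullet> g = norm h * norm g" using t by (simp add: h_def dot_square_norm power2_eq_square)
    moreover have "norm (u h - u 0 - h \<bullet> g) < \<epsilon> * norm h" using d(2)[OF h(1,2)] h(1) by (simp add: divide_less_eq)
    moreover have "\<bar>u h - u 0\<bar> \<le> M * norm h" by (rule lipschitz_of_gradient_bound[OF M h(3)])
    ultimately have "norm h * norm g \<le> M * norm h + \<epsilon> * norm h"
      unfolding real_norm_def by linarith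
    then have "norm h * norm g \<le> norm h * (M + \<epsilon>)" by (simp add: algebra_simps)
    then show "norm g \<le> M + \<epsilon>" using h(1) by simp
  qed
qed (use M in simp)

end

section \<open>Lower bounds for solutions\<close>

lemma ennreal_sq_le:
  assumes "x\<^sup>2 \<le> ennreal (c\<^sup>2)" "0 \<le> c"
  shows "x \<le> ennreal c"
proof (cases x)
  case (real y)
  then have "ennreal (y\<^sup>2) \<le> ennreal (c\<^sup>2)" using assms(1) by (simp add: ennreal_power)
  then have "y\<^sup>2 \<le> c\<^sup>2" by (auto simp: ennreal_le_iff2)
  then have "y \<le> c" using assms(2) by (rule power2_le_imp_le)
  then show ?thesis using real by (simp add: ennreal_leI)
next
  case top
  then show ?thesis using assms(1) by (simp add: power2_eq_square ennreal_top_mult top_unique)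
qed

lemma norm_mollify_le:
  fixes f :: "real^2 \<Rightarrow> complex"
  assumes f: "integrable lborel f" and K: "mollifier \<delta> K" and b: "\<And>x. norm (f x) \<le> B"
  shows "norm (conv f (\<lambda>x. of_real (K x)) z) \<le> B"
proof -
  obtain C where C: "\<And>x. norm (K x) \<le> C" using mollifierD(6)[OF K] by blast
  note [measurable] = mollifierD(1)[OF K]
  have "norm (conv f (\<lambda>x. of_real (K x)) z) \<le> (LINT y|lborel. B * K (z - y))"
    unfolding conv_def
  proof (rule Bochner_Integration.integral_norm_bound_integral)
    show "integrable lborel (\<lambda>y. f y * complex_of_real (K (z - y)))"
      by (rule conv_integrable[OF f, of "\<lambda>x. of_real (K x)" C]) (use C in auto)
    show "integrable lborel (\<lambda>y. B * K (z - y))" using integrable_reflect[OF mollifierD(5)[OF K]] by simp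
    show "norm (f y * complex_of_real (K (z - y))) \<le> B * K (z - y)" for y
      using mult_right_mono[OF b[of y] mollifierD(2)[OF K, of "z - y"]] mollifierD(2)[OF K, of "z - y"] by (simp add: norm_mult)
  qed
  also have "\<dots> = B * (LINT y|lborel. K (z - y))" by simp
  also have "(LINT y|lborel. K (z - y)) = 1"
    using integral_reflect[OF mollifierD(1)[OF K], of z] mollifierD(4)[OF K] by simp
  finally show ?thesis by simp
qed

lemma test_in_mono: "test_in A f f1 f2 \<Longrightarrow> A \<subseteq> B \<Longrightarrow> test_in B f f1 f2"
  unfolding test_in_def by blast

lemma ball_subset_origin: "ball z0 r \<subseteq> ball (0::'a::real_normed_vector) (norm z0 + r)"
proof
  fix x assume "x \<in> ball z0 r"
  then show "x \<in> ball 0 (norm z0 + r)"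
    using norm_triangle_ineq4[of z0 "z0 - x"] by (simp add: dist_norm)
qed

lemma loc_int_test_integrable:
  fixes \<chi>' :: "real^2 \<Rightarrow> complex"
  assumes k: "loc_int k" and c: "continuous_on UNIV \<chi>'" "\<And>x. x \<notin> ball z0 r \<Longrightarrow> \<chi>' x = 0"
  shows "integrable lborel (\<lambda>x. of_real (k x) * \<chi>' x)"
proof -
  obtain B where "\<forall>x. norm (\<chi>' x) \<le> B" by (rule continuous_support_bounded[OF c]) auto
  then have B: "\<And>x. norm (\<chi>' x) \<le> B" by blast
  have "integrable lborel (\<lambda>x. complex_of_real (cut (norm z0 + r) k x))"
    using k by (intro integrable_of_real) (simp add: loc_int_def)
  then have "integrable lborel (\<lambda>x. complex_of_real (cut (norm z0 + r) k x) * \<chi>' x)"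
    by (rule integrable_mult_bounded[OF _ _ B]) (use borel_measurable_continuous_onI[OF c(1)] in simp)
  note i = this
  have eq: "complex_of_real (cut (norm z0 + r) k x) * \<chi>' x = of_real (k x) * \<chi>' x" for x
    using c(2)[of x] ball_subset_origin[of z0 r] by (cases "x \<in> ball z0 r") (auto simp: indicator_def)
  from i show ?thesis unfolding eq .
qed

text \<open>Packs two functions as a family indexed by the type \<open>2\<close>, the form in which
  \<open>weakp_C1\<close> and \<open>weakp_curl_free\<close> take the partials of a test
  function.\<close>

definition pick2 :: "'a \<Rightarrow> 'a \<Rightarrow> 2 \<Rightarrow> 'a" where "pick2 a b i = (if i = 1 then a else b)"

lemma pick2_simps [simp]: "pick2 a b 1 = a" "pick2 a b 2 = b"
  by (auto simp: pick2_def)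

section \<open>The first order equation for \<open>gz\<close>\<close>

context drift_solution
begin

definition gz :: "real^2 \<Rightarrow> complex" where "gz x = (of_real (G1 x) - \<i> * of_real (G2 x)) / 2"
text \<open>A quarter of the Laplacian, since the Laplacian is 4 times the product of the two
  Wirtinger derivatives; it is the right-hand side of dbar gz = Fz.\<close>

definition Fz :: "real^2 \<Rightarrow> complex" where "Fz x = of_real (F1 x + F2 x) / 4"

lemma norm_gz: "(norm (gz x))\<^sup>2 = ((G1 x)\<^sup>2 + (G2 x)\<^sup>2) / 4"
proof -
  have re: "Re (gz x) = G1 x / 2" and im: "Im (gz x) = - G2 x / 2" by (auto simp: gz_def)
  show ?thesis unfolding cmod_power2 re im by (simp add: power_divide add_divide_distrib)
qed

lemma gz_borel [measurable]: "gz \<in> borel_measurable borel" "Fz \<in> borel_measurable borel"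
  unfolding gz_def[abs_def] Fz_def[abs_def] using borel by measurable

lemma integrable_gz2: "integrable lborel (\<lambda>x. indicat_real (ball z r) x * (norm (gz x))\<^sup>2)"
  using Bochner_Integration.integrable_add[OF sq_loc_ball[OF sq(1), of z r] sq_loc_ball[OF sq(2), of z r]]
  by (simp add: norm_gz distrib_left[symmetric])

lemma integrable_Fz2: "integrable lborel (\<lambda>x. indicat_real (ball z r) x * (norm (Fz x))\<^sup>2)"
proof (rule Bochner_Integration.integrable_bound)
  note [measurable] = borel
  show "integrable lborel (\<lambda>x. indicat_real (ball z r) x * (F1 x)\<^sup>2 + indicat_real (ball z r) x * (F2 x)\<^sup>2)"
    by (intro Bochner_Integration.integrable_add sq_loc_ball sq)
  show "(\<lambda>x. indicat_real (ball z r) x * (norm (Fz x))\<^sup>2) \<in> borel_measurable lborel" by measurable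
  have k: "(norm (Fz x))\<^sup>2 \<le> (F1 x)\<^sup>2 + (F2 x)\<^sup>2" for x
  proof -
    define X where "X = (F1 x + F2 x)\<^sup>2"
    define S where "S = (F1 x)\<^sup>2 + (F2 x)\<^sup>2"
    have "(norm (Fz x))\<^sup>2 = X / 16" unfolding Fz_def norm_divide norm_of_real by (simp add: power_divide X_def)
    moreover have "X \<le> 2 * S"
      using zero_le_power2[of "F1 x - F2 x"] by (simp add: X_def S_def power2_eq_square algebra_simps)
    moreover have "0 \<le> S" by (simp add: S_def)
    ultimately show ?thesis unfolding S_def[symmetric] by linarith
  qed
  show "AE x in lborel. norm (indicat_real (ball z r) x * (norm (Fz x))\<^sup>2) \<le> norm (indicat_real (ball z r) x * (F1 x)\<^sup>2 + indicat_real (ball z r) x * (F2 x)\<^sup>2)"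
    using k by (intro AE_I2) (simp add: indicator_def)
qed

text \<open>The weak identities are available for real test functions. They are applied to the
  images of \<psi> under Re and Im, treated together as a bounded linear map T.\<close>

lemma weak_complex:
  assumes t: "test_in (ball z0 r) \<psi> \<psi>1 \<psi>2"
  shows "(LINT x|lborel. complex_of_real (G1 x) * \<psi>1 x) = - (LINT x|lborel. complex_of_real (F1 x) * \<psi> x)"
    "(LINT x|lborel. complex_of_real (G2 x) * \<psi>2 x) = - (LINT x|lborel. complex_of_real (F2 x) * \<psi> x)"
    "(LINT x|lborel. complex_of_real (G1 x) * \<psi>2 x) = (LINT x|lborel. complex_of_real (G2 x) * \<psi>1 x)"
proof -
  have p: "has_partials \<psi> \<psi>1 \<psi>2" and o: "\<And>x. x \<notin> ball z0 r \<Longrightarrow> \<psi> x = 0 \<and> \<psi>1 x = 0 \<and> \<psi>2 x = 0"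
    using t unfolding test_in_def by blast+
  let ?L = "norm z0 + r"
  have o1: "\<psi>1 x = 0" "\<psi>2 x = 0" "\<psi> x = 0" if "x \<notin> ball z0 r" for x using o[OF that] by auto
  have li: "loc_int G1" "loc_int G2" "loc_int F1" "loc_int F2" using G F by (auto simp: weakp_def)
  have i1: "integrable lborel (\<lambda>x. complex_of_real (k x) * \<psi>1 x)" and i2: "integrable lborel (\<lambda>x. complex_of_real (k x) * \<psi>2 x)"
    and i0: "integrable lborel (\<lambda>x. complex_of_real (k x) * \<psi> x)" if "loc_int k" for k
    using loc_int_test_integrable[OF that has_partialsD(3)[OF p] o1(1)] loc_int_test_integrable[OF that has_partialsD(4)[OF p] o1(2)]
      loc_int_test_integrable[OF that has_partialsD(2)[OF p] o1(3)] by auto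
  have tT: "test_in (ball 0 ?L) (\<lambda>x. T (\<psi> x)) (pick2 (\<lambda>x. T (\<psi>1 x)) (\<lambda>x. T (\<psi>2 x)) 1) (pick2 (\<lambda>x. T (\<psi>1 x)) (\<lambda>x. T (\<psi>2 x)) 2)"
    if T: "bounded_linear T" for T :: "complex \<Rightarrow> real"
  proof (rule test_in_mono[OF _ ball_subset_origin])
    show "test_in (ball z0 r) (\<lambda>x. T (\<psi> x)) (pick2 (\<lambda>x. T (\<psi>1 x)) (\<lambda>x. T (\<psi>2 x)) 1) (pick2 (\<lambda>x. T (\<psi>1 x)) (\<lambda>x. T (\<psi>2 x)) 2)"
      unfolding test_in_def pick2_simps
      using has_partials_bounded_linear[OF T p] o linear_0[OF bounded_linear.linear[OF T]] by simp
  qed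
  have ir: "T (LINT x|lborel. complex_of_real (k x) * c x) = (LINT x|lborel. k x * T (c x))"
    if T: "bounded_linear T" and i: "integrable lborel (\<lambda>x. complex_of_real (k x) * c x)" for T :: "complex \<Rightarrow> real" and k c
  proof -
    have "T (complex_of_real a * b) = a * T b" for a b
      using linear_cmul[OF bounded_linear.linear[OF T], of a b] by (simp add: scaleR_conv_of_real)
    then show ?thesis using integral_bounded_linear[OF T i] by simp
  qed
  have e1: "T (LINT x|lborel. complex_of_real (G1 x) * \<psi>1 x) = - T (LINT x|lborel. complex_of_real (F1 x) * \<psi> x)"
    and e2: "T (LINT x|lborel. complex_of_real (G2 x) * \<psi>2 x) = - T (LINT x|lborel. complex_of_real (F2 x) * \<psi> x)"
    and e3: "T (LINT x|lborel. complex_of_real (G1 x) * \<psi>2 x) = T (LINT x|lborel. complex_of_real (G2 x) * \<psi>1 x)"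
    if T: "bounded_linear T" for T :: "complex \<Rightarrow> real"
    unfolding ir[OF T i1[OF li(1)]] ir[OF T i0[OF li(3)]] ir[OF T i2[OF li(2)]] ir[OF T i0[OF li(4)]] ir[OF T i2[OF li(1)]] ir[OF T i1[OF li(2)]]
    using weakp_C1[OF F(1) tT[OF T]] weakp_C1[OF F(2) tT[OF T]] weakp_curl_free[OF G tT[OF T]] by (simp_all only: pick2_simps)
  note b = bounded_linear_Re bounded_linear_Im
  show "(LINT x|lborel. complex_of_real (G1 x) * \<psi>1 x) = - (LINT x|lborel. complex_of_real (F1 x) * \<psi> x)"
    "(LINT x|lborel. complex_of_real (G2 x) * \<psi>2 x) = - (LINT x|lborel. complex_of_real (F2 x) * \<psi> x)"
    by (rule complex_eqI; simp only: uminus_complex.sel; rule e1[OF b(1)] e1[OF b(2)] e2[OF b(1)] e2[OF b(2)])+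
  show "(LINT x|lborel. complex_of_real (G1 x) * \<psi>2 x) = (LINT x|lborel. complex_of_real (G2 x) * \<psi>1 x)"
    by (rule complex_eqI[OF e3[OF b(1)] e3[OF b(2)]])
qed

text \<open>Expanding the product gives the weak Laplacian plus \<i> times the weak curl of the
  gradient, and the curl vanishes. The minus sign is that of the integration by parts.\<close>

lemma gz_weak:
  assumes t: "test_in (ball z0 r) \<psi> \<psi>1 \<psi>2"
  shows "(LINT x|lborel. gz x * dbar \<psi>1 \<psi>2 x) = - (LINT x|lborel. Fz x * \<psi> x)"
proof -
  have p: "has_partials \<psi> \<psi>1 \<psi>2" and o: "\<And>x. x \<notin> ball z0 r \<Longrightarrow> \<psi> x = 0 \<and> \<psi>1 x = 0 \<and> \<psi>2 x = 0"
    using t unfolding test_in_def by blast+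
  have o1: "\<psi>1 x = 0" "\<psi>2 x = 0" "\<psi> x = 0" if "x \<notin> ball z0 r" for x using o[OF that] by auto
  have li: "loc_int G1" "loc_int G2" "loc_int F1" "loc_int F2" using G F by (auto simp: weakp_def)
  have i1: "integrable lborel (\<lambda>x. complex_of_real (k x) * \<psi>1 x)" and i2: "integrable lborel (\<lambda>x. complex_of_real (k x) * \<psi>2 x)"
    and i0: "integrable lborel (\<lambda>x. complex_of_real (k x) * \<psi> x)" if "loc_int k" for k
    using loc_int_test_integrable[OF that has_partialsD(3)[OF p] o1(1)] loc_int_test_integrable[OF that has_partialsD(4)[OF p] o1(2)]
      loc_int_test_integrable[OF that has_partialsD(2)[OF p] o1(3)] by auto
  have "(LINT x|lborel. gz x * dbar \<psi>1 \<psi>2 x) = (LINT x|lborel. (complex_of_real (G1 x) * \<psi>1 x + complex_of_real (G2 x) * \<psi>2 x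
      + \<i> * (complex_of_real (G1 x) * \<psi>2 x - complex_of_real (G2 x) * \<psi>1 x)) / 4)"
    by (intro Bochner_Integration.integral_cong refl) (simp add: gz_def dbar_def field_simps)
  also have "\<dots> = ((LINT x|lborel. complex_of_real (G1 x) * \<psi>1 x) + (LINT x|lborel. complex_of_real (G2 x) * \<psi>2 x)
      + \<i> * ((LINT x|lborel. complex_of_real (G1 x) * \<psi>2 x) - (LINT x|lborel. complex_of_real (G2 x) * \<psi>1 x))) / 4"
    using i1[OF li(1)] i1[OF li(2)] i2[OF li(1)] i2[OF li(2)] by simp
  also have "\<dots> = - (((LINT x|lborel. complex_of_real (F1 x) * \<psi> x) + (LINT x|lborel. complex_of_real (F2 x) * \<psi> x)) / 4)"
    unfolding weak_complex[OF t] by (simp add: field_simps)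
  also have "((LINT x|lborel. complex_of_real (F1 x) * \<psi> x) + (LINT x|lborel. complex_of_real (F2 x) * \<psi> x)) / 4
      = (LINT x|lborel. (complex_of_real (F1 x) * \<psi> x + complex_of_real (F2 x) * \<psi> x) / 4)"
    using i0[OF li(3)] i0[OF li(4)] by simp
  also have "\<dots> = (LINT x|lborel. Fz x * \<psi> x)"
    by (intro Bochner_Integration.integral_cong refl) (simp add: Fz_def field_simps)
  finally show ?thesis .
qed

text \<open>What the estimates retain of \<omega>: it is dominated by the potential of some
  \<open>b\<close> with |b| \<le> w, supported in the ball. Bounds for all admissible functions are
  uniform in the truncation and mollification that produce \<omega>.\<close>

definition admissible :: "real^2 \<Rightarrow> real \<Rightarrow> (real^2 \<Rightarrow> real) \<Rightarrow> bool" where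
  "admissible z0 r \<omega> \<longleftrightarrow> \<omega> \<in> borel_measurable borel \<and> (\<forall>z. 0 \<le> \<omega> z) \<and>
     (\<exists>b. b \<in> borel_measurable borel \<and> (\<forall>x. norm (b x) \<le> w x) \<and> (\<forall>x. x \<notin> ball z0 r \<longrightarrow> b x = 0) \<and>
        (\<forall>z\<in>ball z0 r. ennreal (\<omega> z) \<le> pot b z))"

text \<open>The drift enters the equation for \<open>gz\<close> through \<open>\<alpha> = Fz / gz\<close>, which is truncated to a bounded
  function before its Cauchy transform is taken. The truncation is also on the size of \<open>gz\<close>, so that the
  error is controlled by \<open>Fz\<close>, which is square integrable.\<close>

lemma approximate_solution:
  assumes r: "0 < r" and Q: "\<And>\<omega>. admissible z0 r \<omega> \<Longrightarrow> (\<integral>\<^sup>+z. indicator (ball z0 r) z * ennreal (exp (2 * \<omega> z)) \<partial>lborel) \<le> ennreal Q"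
    and Q0: "0 \<le> Q" and \<eta>: "0 < \<eta>"
  obtains \<omega> e where "\<omega> \<in> borel_measurable borel" "admissible z0 r (\<lambda>z. norm (\<omega> z))"
    "integrable lborel (\<lambda>x. indicat_real (ball z0 r) x *\<^sub>R (gz x * exp (- \<omega> x)))" "integrable lborel e"
    "weak_dbar (ball z0 r) (\<lambda>x. indicat_real (ball z0 r) x *\<^sub>R (gz x * exp (- \<omega> x))) e"
    "\<And>x. x \<notin> ball z0 r \<Longrightarrow> e x = 0" "(\<integral>\<^sup>+x. ennreal (norm (e x)) \<partial>lborel) \<le> ennreal \<eta>"
proof -
  note [measurable] = borel gz_borel
  let ?D = "ball z0 r"
  define \<alpha> where "\<alpha> x = (if gz x = 0 then 0 else Fz x / gz x)" for x
  have [measurable]: "\<alpha> \<in> borel_measurable borel" unfolding \<alpha>_def by measurable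
  \<comment> \<open>The condition |\<alpha>| \<le> w holds almost everywhere by the equation;
    imposing it makes |\<beta>| \<le> w true at every point, as \<open>admissible\<close>
    demands.\<close>
  define \<beta> where "\<beta> k x = (if x \<in> ?D \<and> norm (gz x) \<le> real k \<and> norm (\<alpha> x) \<le> real k \<and> norm (\<alpha> x) \<le> w x then \<alpha> x else 0)" for k :: nat and x
  have \<beta>m [measurable]: "\<beta> k \<in> borel_measurable borel" for k unfolding \<beta>_def by measurable
  have \<beta>b: "norm (\<beta> k x) \<le> real k" "norm (\<beta> k x) \<le> w x" "x \<notin> ?D \<Longrightarrow> \<beta> k x = 0" for k x
    using w(1)[of x] by (auto simp: \<beta>_def)
  have \<beta>i: "integrable lborel (\<beta> k)" for k
    by (rule integrable_bounded_support[OF \<beta>m \<beta>b(1) \<beta>b(3)])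
  have AEF: "AE x in lborel. \<alpha> x * gz x = Fz x \<and> norm (\<alpha> x) \<le> w x"
    using w(2)
  proof eventually_elim
    case (elim x)
    have "norm (Fz x) = \<bar>F1 x + F2 x\<bar> / 4" unfolding Fz_def norm_divide norm_of_real by simp
    moreover have "sqrt ((G1 x)\<^sup>2 + (G2 x)\<^sup>2) = 2 * norm (gz x)"
    proof -
      have "(G1 x)\<^sup>2 + (G2 x)\<^sup>2 = (2 * norm (gz x))\<^sup>2" using norm_gz[of x] by (simp add: power_mult_distrib)
      then show ?thesis by (simp add: real_sqrt_unique)
    qed
    ultimately have n: "norm (Fz x) \<le> w x * norm (gz x) / 2" using elim by simp
    show ?case
    proof (cases "gz x = 0")
      case True
      then show ?thesis using n w(1)[of x] by (simp add: \<alpha>_def)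
    next
      case False
      have "norm (\<alpha> x) \<le> w x / 2" using n False by (simp add: \<alpha>_def norm_divide field_simps)
      then show ?thesis using False w(1)[of x] by (simp add: \<alpha>_def)
    qed
  qed
  define S where "S k = (LINT x|lborel. indicat_real ?D x * (norm (\<beta> k x * gz x - Fz x))\<^sup>2)" for k
  \<comment> \<open>Where \<alpha> is kept the difference is 0, elsewhere in the ball it is -Fz; so
    |Fz|^2 dominates for all k.\<close>
  have dom: "AE x in lborel. norm (indicat_real ?D x * (norm (\<beta> k x * gz x - Fz x))\<^sup>2) \<le> indicat_real ?D x * (norm (Fz x))\<^sup>2" for k
    using AEF by eventually_elim (auto simp: \<beta>_def indicator_def)
  have Si: "integrable lborel (\<lambda>x. indicat_real ?D x * (norm (\<beta> k x * gz x - Fz x))\<^sup>2)" for k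
    by (rule Bochner_Integration.integrable_bound[OF integrable_Fz2[of z0 r]]) (use dom[of k] in \<open>auto elim!: eventually_mono\<close>)
  have "S \<longlonglongrightarrow> (LINT x|(lborel::(real^2) measure). 0)"
    unfolding S_def
  proof (rule integral_dominated_convergence[OF _ _ integrable_Fz2[of z0 r] _ dom])
    show "AE x in lborel. (\<lambda>k. indicat_real ?D x * (norm (\<beta> k x * gz x - Fz x))\<^sup>2) \<longlonglongrightarrow> 0"
      using AEF
    proof eventually_elim
      case (elim x)
      obtain N :: nat where N: "max (norm (gz x)) (norm (\<alpha> x)) \<le> real N" using real_arch_simple by blast
      have "eventually (\<lambda>k. indicat_real ?D x * (norm (\<beta> k x * gz x - Fz x))\<^sup>2 = 0) sequentially"
        using eventually_ge_at_top[of N]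
      proof eventually_elim
        case (elim k)
        then have "real N \<le> real k" by simp
        then have "norm (gz x) \<le> real k" "norm (\<alpha> x) \<le> real k" using N by auto
        then show ?case using \<open>\<alpha> x * gz x = Fz x \<and> norm (\<alpha> x) \<le> w x\<close> by (simp add: \<beta>_def indicator_def)
      qed
      then show ?case by (rule tendsto_eventually)
    qed
  qed measurable
  then have S0: "S \<longlonglongrightarrow> 0" by simp
  \<comment> \<open>Cauchy-Schwarz against exp |\<omega>| costs the factor Q under the root;
    \<kappa> Q \<le> (\<eta>/2)^2 leaves \<eta>/2 for the truncation error.\<close>
  define \<kappa> where "\<kappa> = (\<eta> / 2)\<^sup>2 / (Q + 1)"
  have \<kappa>: "\<kappa> > 0" using \<eta> Q0 by (simp add: \<kappa>_def)
  obtain k where k: "S k < \<kappa>" using order_tendstoD(2)[OF S0 \<kappa>] by (auto simp: eventually_sequentially)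
  \<comment> \<open>A bound for |\<omega>| on the ball that depends on k but not on the
    mollification index j. Since k is fixed before j, exp c may enter the choice of j.\<close>
  define c where "c = real k * (52 * r)"
  define B where "B = (LINT x|lborel. indicat_real ?D x * (norm (gz x))\<^sup>2)"
  have B0: "0 \<le> B" unfolding B_def by (intro Bochner_Integration.integral_nonneg) auto
  define \<epsilon> where "\<epsilon> j = inverse (real (Suc j))" for j
  have \<epsilon>: "0 < \<epsilon> j" "\<epsilon> \<longlonglongrightarrow> 0" for j using LIMSEQ_inverse_real_of_nat by (auto simp: \<epsilon>_def[abs_def])
  let ?P = "\<lambda>j x. cP (\<epsilon> j) x / cc (\<epsilon> j)"
  define \<beta>' where "\<beta>' j = conv (\<beta> k) (\<lambda>x. of_real (?P j x))" for j
  define J where "J j = (LINT x|lborel. norm (\<beta>' j x - \<beta> k x))" for j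
  have "J \<longlonglongrightarrow> 0" unfolding J_def \<beta>'_def by (rule mollify_L1_tendsto[OF \<beta>i mollifier_cP[OF \<epsilon>(1)] \<epsilon>(2)])
  then have "(\<lambda>j. exp c ^ 2 * (2 * real k * B) * J j) \<longlonglongrightarrow> exp c ^ 2 * (2 * real k * B) * 0" by (intro tendsto_intros)
  then have "eventually (\<lambda>j. exp c ^ 2 * (2 * real k * B) * J j < (\<eta> / 2)\<^sup>2) sequentially"
    using \<eta> by (intro order_tendstoD(2)) auto
  then obtain j where j: "exp c ^ 2 * (2 * real k * B) * J j < (\<eta> / 2)\<^sup>2" by (auto simp: eventually_sequentially)
  note ej = \<epsilon>(1)[of j]
  note ccj = cc_bounds[OF ej]
  \<comment> \<open>Division by cc turns \<open>cP\<close> into a mollifier, so that dbar \<omega>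
    is the mollification \<open>\<beta>'\<close> of \<open>\<beta> k\<close>. Their difference is
    the second source of error.\<close>
  define \<omega> where "\<omega> x = of_real (inverse (cc (\<epsilon> j))) * conv (\<beta> k) (ck (\<epsilon> j)) x" for x
  define \<omega>1 where "\<omega>1 x = of_real (inverse (cc (\<epsilon> j))) * conv (\<beta> k) (ck1 (\<epsilon> j)) x" for x
  define \<omega>2 where "\<omega>2 x = of_real (inverse (cc (\<epsilon> j))) * conv (\<beta> k) (ck2 (\<epsilon> j)) x" for x
  obtain Bk where Bk: "\<And>x. norm (ck (\<epsilon> j) x) \<le> Bk" "\<And>x. norm (ck1 (\<epsilon> j) x) \<le> Bk" "\<And>x. norm (ck2 (\<epsilon> j) x) \<le> Bk"
    by (rule ck_bounded[OF ej]) blast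
  note pk = has_partials_ck[OF ej]
  have p\<omega>: "has_partials \<omega> \<omega>1 \<omega>2"
    unfolding \<omega>_def \<omega>1_def \<omega>2_def by (rule has_partials_cmult[OF has_partials_conv[OF \<beta>i pk Bk]])
  note [measurable] = has_partials_borel[OF p\<omega>]
  have db\<omega>: "dbar \<omega>1 \<omega>2 x = \<beta>' j x" for x
  proof -
    have i: "integrable lborel (\<lambda>y. \<beta> k y * ck1 (\<epsilon> j) (x - y))" "integrable lborel (\<lambda>y. \<beta> k y * ck2 (\<epsilon> j) (x - y))"
      using conv_integrable[OF \<beta>i has_partials_borel(2)[OF pk] Bk(2)] conv_integrable[OF \<beta>i has_partials_borel(3)[OF pk] Bk(3)] .
    have "dbar \<omega>1 \<omega>2 x = of_real (inverse (cc (\<epsilon> j))) * (((LINT y|lborel. \<beta> k y * ck1 (\<epsilon> j) (x - y)) + \<i> * (LINT y|lborel. \<beta> k y * ck2 (\<epsilon> j) (x - y))) / 2)"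
      by (simp add: dbar_def \<omega>1_def \<omega>2_def conv_def algebra_simps add_divide_distrib)
    also have "((LINT y|lborel. \<beta> k y * ck1 (\<epsilon> j) (x - y)) + \<i> * (LINT y|lborel. \<beta> k y * ck2 (\<epsilon> j) (x - y))) / 2
       = (LINT y|lborel. (\<beta> k y * ck1 (\<epsilon> j) (x - y) + \<i> * (\<beta> k y * ck2 (\<epsilon> j) (x - y))) / 2)"
      using i by simp
    also have "of_real (inverse (cc (\<epsilon> j))) * \<dots> = (LINT y|lborel. of_real (inverse (cc (\<epsilon> j))) * ((\<beta> k y * ck1 (\<epsilon> j) (x - y) + \<i> * (\<beta> k y * ck2 (\<epsilon> j) (x - y))) / 2))"
      by (rule integral_mult_right_zero[symmetric])
    also have "\<dots> = \<beta>' j x"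
      unfolding \<beta>'_def conv_def
    proof (rule Bochner_Integration.integral_cong[OF refl])
      fix y
      have a: "(\<beta> k y * ck1 (\<epsilon> j) (x - y) + \<i> * (\<beta> k y * ck2 (\<epsilon> j) (x - y))) / 2 = \<beta> k y * of_real (cP (\<epsilon> j) (x - y))"
        unfolding dbar_ck[OF ej, symmetric] by (simp add: dbar_def algebra_simps)
      have b: "complex_of_real (?P j (x - y)) = of_real (inverse (cc (\<epsilon> j))) * of_real (cP (\<epsilon> j) (x - y))"
        by (simp add: divide_inverse)
      show "of_real (inverse (cc (\<epsilon> j))) * ((\<beta> k y * ck1 (\<epsilon> j) (x - y) + \<i> * (\<beta> k y * ck2 (\<epsilon> j) (x - y))) / 2) = \<beta> k y * of_real (?P j (x - y))"
        unfolding a b by (rule mult.left_commute)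
    qed
    finally show ?thesis .
  qed
  have \<omega>pot: "ennreal (norm (\<omega> z)) \<le> pot (\<beta> k) z" for z
  proof -
    have "norm (\<omega> z) = inverse (cc (\<epsilon> j)) * norm (conv (\<beta> k) (ck (\<epsilon> j)) z)" unfolding \<omega>_def norm_mult norm_of_real using ccj by simp
    also have "\<dots> \<le> 1 * norm (conv (\<beta> k) (ck (\<epsilon> j)) z)" using ccj by (intro mult_right_mono) (auto simp: inverse_le_1_iff)
    finally have "norm (\<omega> z) \<le> norm (conv (\<beta> k) (ck (\<epsilon> j)) z)" by simp
    from order_trans[OF ennreal_leI[OF this] norm_conv_ck_le[OF \<beta>i ej]] show ?thesis .
  qed
  have adm: "admissible z0 r (\<lambda>z. norm (\<omega> z))"
    unfolding admissible_def using \<beta>b(2,3) \<omega>pot by (intro conjI exI[of _ "\<beta> k"]) auto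
  have \<omega>c: "norm (\<omega> z) \<le> c" if z: "z \<in> ?D" for z
  proof -
    have "pot (\<beta> k) z \<le> (\<integral>\<^sup>+\<xi>. ennreal (real k) * (indicator ?D \<xi> * ennreal (inverse (norm (\<xi> - z)))) \<partial>lborel)"
      unfolding pot_def
    proof (intro nn_integral_mono)
      fix \<xi>
      show "ennreal (norm (\<beta> k \<xi>) * inverse (norm (z - \<xi>))) \<le> ennreal (real k) * (indicator ?D \<xi> * ennreal (inverse (norm (\<xi> - z))))"
      proof (cases "\<xi> \<in> ?D")
        case True
        have "norm (\<beta> k \<xi>) * inverse (norm (z - \<xi>)) \<le> real k * inverse (norm (\<xi> - z))"
          unfolding norm_minus_commute[of z \<xi>] by (rule mult_right_mono[OF \<beta>b(1)]) simp
        from ennreal_leI[OF this] show ?thesis using True by (simp add: ennreal_mult)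
      qed (simp add: \<beta>b(3))
    qed
    also have "\<dots> = ennreal (real k) * (\<integral>\<^sup>+\<xi>. indicator ?D \<xi> * ennreal (inverse (norm (\<xi> - z))) \<partial>lborel)"
      by (rule nn_integral_cmult) measurable
    also have "\<dots> \<le> ennreal (real k) * ennreal (52 * r)" by (intro mult_left_mono inverse_norm_integral r z) auto
    also have "\<dots> = ennreal c" using r by (simp add: c_def ennreal_mult)
    finally have "ennreal (norm (\<omega> z)) \<le> ennreal c" using \<omega>pot order_trans by blast
    moreover have "0 \<le> c" using r by (simp add: c_def)
    ultimately show ?thesis by (simp add: ennreal_le_iff)
  qed
  have ne: "norm (exp (- \<omega> z)) \<le> exp (norm (\<omega> z))" for z
    using abs_Re_le_cmod[of "\<omega> z"] by (simp add: norm_exp_eq_Re)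
  define f where "f x = indicat_real ?D x *\<^sub>R (gz x * exp (- \<omega> x))" for x
  define e where "e x = indicat_real ?D x *\<^sub>R ((\<beta>' j x * gz x - Fz x) * exp (- \<omega> x))" for x
  have [measurable]: "\<beta>' j \<in> borel_measurable borel"
  proof -
    have "\<beta>' j = dbar \<omega>1 \<omega>2" using db\<omega> by (simp add: fun_eq_iff)
    then show ?thesis using dbar_measurable[OF p\<omega>] by simp
  qed
  have \<beta>'b: "norm (\<beta>' j x) \<le> real k" for x
    unfolding \<beta>'_def by (rule norm_mollify_le[OF \<beta>i mollifier_cP[OF ej] \<beta>b(1)])
  have sqi: "integrable lborel (\<lambda>x. indicat_real ?D x * norm (h x))"
    if [measurable]: "h \<in> borel_measurable borel" and i: "integrable lborel (\<lambda>x. indicat_real ?D x * (norm (h x))\<^sup>2)" for h :: "real^2 \<Rightarrow> complex"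
  proof (rule Bochner_Integration.integrable_bound[OF Bochner_Integration.integrable_add[OF integrable_indicator_ball[of z0 r 1] i]])
    show "AE x in lborel. norm (indicat_real ?D x * norm (h x)) \<le> norm (indicat_real ?D x * 1 + indicat_real ?D x * (norm (h x))\<^sup>2)"
    proof (intro AE_I2)
      fix x
      have "norm (h x) \<le> 1 + (norm (h x))\<^sup>2"
        using zero_le_power2[of "norm (h x) - 1/2"] by (simp add: power2_eq_square algebra_simps)
      then show "norm (indicat_real ?D x * norm (h x)) \<le> norm (indicat_real ?D x * 1 + indicat_real ?D x * (norm (h x))\<^sup>2)"
        by (simp add: indicator_def)
    qed
  qed measurable
  have fi: "integrable lborel f"
  proof (rule Bochner_Integration.integrable_bound)
    show "integrable lborel (\<lambda>x. exp c * (indicat_real ?D x * norm (gz x)))"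
      using sqi[OF gz_borel(1) integrable_gz2] by simp
    show "f \<in> borel_measurable lborel" unfolding f_def by measurable
    show "AE x in lborel. norm (f x) \<le> norm (exp c * (indicat_real ?D x * norm (gz x)))"
    proof (intro AE_I2)
      fix x
      show "norm (f x) \<le> norm (exp c * (indicat_real ?D x * norm (gz x)))"
      proof (cases "x \<in> ?D")
        case True
        then have "norm (exp (- \<omega> x)) \<le> exp c" using \<omega>c[OF True] ne[of x] by (meson exp_le_cancel_iff order_trans)
        then show ?thesis using True mult_left_mono[of "norm (exp (- \<omega> x))" "exp c" "norm (gz x)"] by (simp add: f_def norm_mult mult.commute)
      qed (simp add: f_def)
    qed
  qed
  have CS1: "(\<integral>\<^sup>+x. ennreal (indicat_real ?D x * (norm (\<beta>' j x - \<beta> k x) * norm (gz x) * exp c)) \<partial>lborel) \<le> ennreal (\<eta> / 2)"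
  proof (rule ennreal_sq_le)
    have "(\<integral>\<^sup>+x. ennreal (indicat_real ?D x * (norm (\<beta>' j x - \<beta> k x) * norm (gz x) * exp c)) \<partial>lborel)\<^sup>2
      = (\<integral>\<^sup>+x. ennreal (exp c * norm (\<beta>' j x - \<beta> k x)) * ennreal (indicat_real ?D x * norm (gz x)) \<partial>lborel)\<^sup>2"
      by (intro arg_cong2[where f=power] nn_integral_cong refl) (simp add: mult_ac flip: ennreal_mult)
    also have "\<dots> \<le> (\<integral>\<^sup>+x. ennreal (exp c * norm (\<beta>' j x - \<beta> k x)) ^ 2 \<partial>lborel) * (\<integral>\<^sup>+x. ennreal (indicat_real ?D x * norm (gz x)) ^ 2 \<partial>lborel)"
      by (rule Cauchy_Schwarz_nn_integral) measurable
    also have "(\<integral>\<^sup>+x. ennreal (indicat_real ?D x * norm (gz x)) ^ 2 \<partial>lborel) = (\<integral>\<^sup>+x. ennreal (indicat_real ?D x * (norm (gz x))\<^sup>2) \<partial>lborel)"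
      by (intro nn_integral_cong) (simp add: ennreal_power power_mult_distrib indicator_def)
    also have "\<dots> = ennreal B" unfolding B_def by (rule nn_integral_eq_integral[OF integrable_gz2]) auto
    \<comment> \<open>Both functions are bounded by k, so the square of the difference is at most 2
      k times its first power, which is small in L^1.\<close>
    also have "(\<integral>\<^sup>+x. ennreal (exp c * norm (\<beta>' j x - \<beta> k x)) ^ 2 \<partial>lborel) \<le> (\<integral>\<^sup>+x. ennreal (exp c ^ 2 * (2 * real k) * norm (\<beta>' j x - \<beta> k x)) \<partial>lborel)"
    proof (intro nn_integral_mono)
      fix x
      have "norm (\<beta>' j x - \<beta> k x) \<le> 2 * real k" using norm_triangle_ineq4[of "\<beta>' j x" "\<beta> k x"] \<beta>'b[of x] \<beta>b(1)[of k x] by simp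
      then have "norm (\<beta>' j x - \<beta> k x) * norm (\<beta>' j x - \<beta> k x) \<le> 2 * real k * norm (\<beta>' j x - \<beta> k x)" by (rule mult_right_mono) simp
      then have "exp c ^ 2 * (norm (\<beta>' j x - \<beta> k x) * norm (\<beta>' j x - \<beta> k x)) \<le> exp c ^ 2 * (2 * real k * norm (\<beta>' j x - \<beta> k x))" by (rule mult_left_mono) simp
      then have le: "(exp c * norm (\<beta>' j x - \<beta> k x))\<^sup>2 \<le> exp c ^ 2 * (2 * real k) * norm (\<beta>' j x - \<beta> k x)"
        by (simp only: power_mult_distrib power2_eq_square mult_ac)
      have "ennreal (exp c * norm (\<beta>' j x - \<beta> k x)) ^ 2 = ennreal ((exp c * norm (\<beta>' j x - \<beta> k x))\<^sup>2)"
        by (rule ennreal_power) simp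
      with ennreal_leI[OF le] show "ennreal (exp c * norm (\<beta>' j x - \<beta> k x)) ^ 2 \<le> ennreal (exp c ^ 2 * (2 * real k) * norm (\<beta>' j x - \<beta> k x))"
        by (simp only:)
    qed
    also have "\<dots> = ennreal (exp c ^ 2 * (2 * real k) * J j)"
    proof -
      have i: "integrable lborel (\<lambda>x. \<beta>' j x - \<beta> k x)"
      proof (rule Bochner_Integration.integrable_diff[OF _ \<beta>i])
        have "(LINT x|lborel. norm (\<beta> k (x - y) - \<beta> k x)) \<le> (LINT x|lborel. norm (\<beta> k x)) + (LINT x|lborel. norm (\<beta> k x))" for y
        proof -
          have it: "integrable lborel (\<lambda>x. \<beta> k (x - y))" using integrable_translate[OF \<beta>i] .
          have "(LINT x|lborel. norm (\<beta> k (x - y) - \<beta> k x)) \<le> (LINT x|lborel. norm (\<beta> k (x - y)) + norm (\<beta> k x))"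
            using it \<beta>i by (intro Bochner_Integration.integral_mono) (auto intro!: norm_triangle_ineq4 Bochner_Integration.integrable_diff integrable_norm Bochner_Integration.integrable_add)
          also have "\<dots> = (LINT x|lborel. norm (\<beta> k (x - y))) + (LINT x|lborel. norm (\<beta> k x))"
            using it \<beta>i by (intro Bochner_Integration.integral_add integrable_norm)
          also have "(LINT x|lborel. norm (\<beta> k (x - y))) = (LINT x|lborel. norm (\<beta> k x))"
            by (intro integral_translate[of "\<lambda>x. norm (\<beta> k x)"]) simp
          finally show ?thesis .
        qed
        from mollify_L1_bound(2)[OF \<beta>i mollifier_cP[OF ej] this] show "integrable lborel (\<beta>' j)" by (simp add: \<beta>'_def)
      qed
      then have "integrable lborel (\<lambda>x. exp c ^ 2 * (2 * real k) * norm (\<beta>' j x - \<beta> k x))" by simp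
      from nn_integral_eq_integral[OF this] show ?thesis by (simp add: J_def)
    qed
    finally have "(\<integral>\<^sup>+x. ennreal (indicat_real ?D x * (norm (\<beta>' j x - \<beta> k x) * norm (gz x) * exp c)) \<partial>lborel)\<^sup>2 \<le> ennreal (exp c ^ 2 * (2 * real k) * J j) * ennreal B"
      by (simp add: mult_right_mono)
    also have "\<dots> = ennreal (exp c ^ 2 * (2 * real k) * J j * B)" using B0 by (intro ennreal_mult''[symmetric])
    also have "\<dots> \<le> ennreal ((\<eta> / 2)\<^sup>2)" using j by (intro ennreal_leI) (simp add: mult_ac)
    finally show "(\<integral>\<^sup>+x. ennreal (indicat_real ?D x * (norm (\<beta>' j x - \<beta> k x) * norm (gz x) * exp c)) \<partial>lborel)\<^sup>2 \<le> ennreal ((\<eta> / 2)\<^sup>2)" .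
  qed (use \<eta> in simp)
  have CS2: "(\<integral>\<^sup>+x. ennreal (indicat_real ?D x * (norm (\<beta> k x * gz x - Fz x) * exp (norm (\<omega> x)))) \<partial>lborel) \<le> ennreal (\<eta> / 2)"
  proof (rule ennreal_sq_le)
    have "(\<integral>\<^sup>+x. ennreal (indicat_real ?D x * (norm (\<beta> k x * gz x - Fz x) * exp (norm (\<omega> x)))) \<partial>lborel)\<^sup>2
      = (\<integral>\<^sup>+x. ennreal (indicat_real ?D x * norm (\<beta> k x * gz x - Fz x)) * (indicator ?D x * ennreal (exp (norm (\<omega> x)))) \<partial>lborel)\<^sup>2"
      by (intro arg_cong2[where f=power] nn_integral_cong refl) (simp add: indicator_def flip: ennreal_mult)
    also have "\<dots> \<le> (\<integral>\<^sup>+x. ennreal (indicat_real ?D x * norm (\<beta> k x * gz x - Fz x)) ^ 2 \<partial>lborel) * (\<integral>\<^sup>+x. (indicator ?D x * ennreal (exp (norm (\<omega> x)))) ^ 2 \<partial>lborel)"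
      by (rule Cauchy_Schwarz_nn_integral) measurable
    also have "(\<integral>\<^sup>+x. ennreal (indicat_real ?D x * norm (\<beta> k x * gz x - Fz x)) ^ 2 \<partial>lborel) = (\<integral>\<^sup>+x. ennreal (indicat_real ?D x * (norm (\<beta> k x * gz x - Fz x))\<^sup>2) \<partial>lborel)"
      by (intro nn_integral_cong) (simp add: ennreal_power power_mult_distrib indicator_def)
    also have "\<dots> = ennreal (S k)" unfolding S_def by (rule nn_integral_eq_integral[OF Si]) auto
    also have "(\<integral>\<^sup>+x. (indicator ?D x * ennreal (exp (norm (\<omega> x)))) ^ 2 \<partial>lborel) = (\<integral>\<^sup>+x. indicator ?D x * ennreal (exp (2 * norm (\<omega> x))) \<partial>lborel)"
      by (intro nn_integral_cong) (simp add: ennreal_power power_mult_distrib indicator_def exp_double)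
    also have "ennreal (S k) * \<dots> \<le> ennreal \<kappa> * ennreal Q"
      using k by (intro mult_mono Q[OF adm] ennreal_leI) auto
    also have "\<dots> = ennreal (\<kappa> * Q)" using \<kappa> Q0 by (simp add: ennreal_mult)
    also have "\<dots> \<le> ennreal ((\<eta> / 2)\<^sup>2)"
    proof (rule ennreal_leI)
      have "\<kappa> * Q \<le> \<kappa> * (Q + 1)" using \<kappa> by (intro mult_left_mono) auto
      also have "\<dots> = (\<eta> / 2)\<^sup>2" using Q0 by (simp add: \<kappa>_def)
      finally show "\<kappa> * Q \<le> (\<eta> / 2)\<^sup>2" .
    qed
    finally show "(\<integral>\<^sup>+x. ennreal (indicat_real ?D x * (norm (\<beta> k x * gz x - Fz x) * exp (norm (\<omega> x)))) \<partial>lborel)\<^sup>2 \<le> ennreal ((\<eta> / 2)\<^sup>2)" .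
  qed (use \<eta> in simp)
  have em [measurable]: "e \<in> borel_measurable borel" unfolding e_def by measurable
  have e\<eta>: "(\<integral>\<^sup>+x. ennreal (norm (e x)) \<partial>lborel) \<le> ennreal \<eta>"
  proof -
    have "(\<integral>\<^sup>+x. ennreal (norm (e x)) \<partial>lborel) \<le> (\<integral>\<^sup>+x. ennreal (indicat_real ?D x * (norm (\<beta>' j x - \<beta> k x) * norm (gz x) * exp c))
       + ennreal (indicat_real ?D x * (norm (\<beta> k x * gz x - Fz x) * exp (norm (\<omega> x)))) \<partial>lborel)"
    proof (intro nn_integral_mono)
      fix x
      have "norm (e x) \<le> indicat_real ?D x * (norm (\<beta>' j x - \<beta> k x) * norm (gz x) * exp c) + indicat_real ?D x * (norm (\<beta> k x * gz x - Fz x) * exp (norm (\<omega> x)))"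
      proof (cases "x \<in> ?D")
        case True
        have "norm (e x) = norm ((\<beta>' j x - \<beta> k x) * gz x * exp (- \<omega> x) + (\<beta> k x * gz x - Fz x) * exp (- \<omega> x))"
          using True by (simp add: e_def algebra_simps)
        also have "\<dots> \<le> norm (\<beta>' j x - \<beta> k x) * norm (gz x) * norm (exp (- \<omega> x)) + norm (\<beta> k x * gz x - Fz x) * norm (exp (- \<omega> x))"
          by (rule order_trans[OF norm_triangle_ineq]) (simp add: norm_mult)
        also have "\<dots> \<le> norm (\<beta>' j x - \<beta> k x) * norm (gz x) * exp c + norm (\<beta> k x * gz x - Fz x) * exp (norm (\<omega> x))"
        proof (intro add_mono mult_left_mono ne)
          show "norm (exp (- \<omega> x)) \<le> exp c" using \<omega>c[OF True] ne[of x] by (meson exp_le_cancel_iff order_trans)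
        qed auto
        finally show ?thesis using True by simp
      qed (simp add: e_def)
      then show "ennreal (norm (e x)) \<le> ennreal (indicat_real ?D x * (norm (\<beta>' j x - \<beta> k x) * norm (gz x) * exp c))
         + ennreal (indicat_real ?D x * (norm (\<beta> k x * gz x - Fz x) * exp (norm (\<omega> x))))"
        by (simp add: ennreal_leI flip: ennreal_plus)
    qed
    also have "\<dots> = (\<integral>\<^sup>+x. ennreal (indicat_real ?D x * (norm (\<beta>' j x - \<beta> k x) * norm (gz x) * exp c)) \<partial>lborel)
       + (\<integral>\<^sup>+x. ennreal (indicat_real ?D x * (norm (\<beta> k x * gz x - Fz x) * exp (norm (\<omega> x)))) \<partial>lborel)"
      by (rule nn_integral_add) measurable
    also have "\<dots> \<le> ennreal (\<eta> / 2) + ennreal (\<eta> / 2)" by (intro add_mono CS1 CS2)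
    also have "\<dots> = ennreal \<eta>" using \<eta> by (simp flip: ennreal_plus)
    finally show ?thesis .
  qed
  have ei: "integrable lborel e"
    by (rule integrableI_bounded) (use em le_less_trans[OF e\<eta> ennreal_less_top] in auto)
  have wd: "weak_dbar ?D f e"
    unfolding weak_dbar_def
  proof (intro allI impI)
    fix \<psi> \<psi>1 \<psi>2 :: "real^2 \<Rightarrow> complex" assume t: "test_in ?D \<psi> \<psi>1 \<psi>2"
    then have p: "has_partials \<psi> \<psi>1 \<psi>2" and o: "\<And>x. x \<notin> ?D \<Longrightarrow> \<psi> x = 0 \<and> \<psi>1 x = 0 \<and> \<psi>2 x = 0"
      unfolding test_in_def by blast+
    obtain Bt where Bt: "\<And>x. norm (\<psi> x) \<le> Bt" "\<And>x. norm (\<psi>1 x) \<le> Bt" "\<And>x. norm (\<psi>2 x) \<le> Bt"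
      by (rule test_in_bounded[OF t]) blast
    note [measurable] = has_partials_borel[OF p] dbar_measurable[OF p]
    have pe: "has_partials (\<lambda>x. exp (- \<omega> x)) (\<lambda>x. - \<omega>1 x * exp (- \<omega> x)) (\<lambda>x. - \<omega>2 x * exp (- \<omega> x))"
      using has_partials_exp[OF has_partials_bounded_linear[OF bounded_linear_minus[OF bounded_linear_ident] p\<omega>]] by simp
    let ?X1 = "\<lambda>x. - \<omega>1 x * exp (- \<omega> x) * \<psi> x + exp (- \<omega> x) * \<psi>1 x" and ?X2 = "\<lambda>x. - \<omega>2 x * exp (- \<omega> x) * \<psi> x + exp (- \<omega> x) * \<psi>2 x"
    \<comment> \<open>Testing the equation for gz with exp(-\<omega>) \<psi> is the weak form of the
      product rule for exp(-\<omega>) gz.\<close>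
    have tX: "test_in ?D (\<lambda>x. exp (- \<omega> x) * \<psi> x) ?X1 ?X2"
      unfolding test_in_def using has_partials_mult[OF pe p] o by auto
    have dX: "dbar ?X1 ?X2 x = exp (- \<omega> x) * (dbar \<psi>1 \<psi>2 x - \<beta>' j x * \<psi> x)" for x
      unfolding db\<omega>[symmetric] by (simp add: dbar_def field_simps)
    have g1: "gz x * dbar ?X1 ?X2 x = f x * dbar \<psi>1 \<psi>2 x - f x * (\<beta>' j x * \<psi> x)" for x
      unfolding dX f_def using o[of x] by (cases "x \<in> ?D") (auto simp: algebra_simps dbar_def)
    have g2: "Fz x * (exp (- \<omega> x) * \<psi> x) = f x * (\<beta>' j x * \<psi> x) - e x * \<psi> x" for x
      unfolding f_def e_def using o[of x] by (cases "x \<in> ?D") (auto simp: algebra_simps)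
    have i1: "integrable lborel (\<lambda>x. f x * dbar \<psi>1 \<psi>2 x)"
      by (rule integrable_mult_bounded[OF fi _ norm_dbar_le[OF Bt(2,3)]]) measurable
    have i2: "integrable lborel (\<lambda>x. f x * (\<beta>' j x * \<psi> x))"
    proof (rule integrable_mult_bounded[OF fi])
      show "norm (\<beta>' j x * \<psi> x) \<le> real k * Bt" for x unfolding norm_mult by (intro mult_mono \<beta>'b Bt) auto
    qed measurable
    have i3: "integrable lborel (\<lambda>x. e x * \<psi> x)" by (rule integrable_mult_bounded[OF ei _ Bt(1)]) measurable
    have "(LINT x|lborel. f x * dbar \<psi>1 \<psi>2 x) - (LINT x|lborel. f x * (\<beta>' j x * \<psi> x)) = - ((LINT x|lborel. f x * (\<beta>' j x * \<psi> x)) - (LINT x|lborel. e x * \<psi> x))"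
      using gz_weak[OF tX] unfolding g1 g2 using i1 i2 i3 by simp
    then show "(LINT x|lborel. f x * dbar \<psi>1 \<psi>2 x) = (LINT x|lborel. e x * \<psi> x)" by simp
  qed
  show ?thesis
    by (rule that[of \<omega> e]) (use adm fi ei wd e\<eta> in \<open>simp_all add: f_def[abs_def] e_def\<close>)
qed

end

lemma norm_exp_minus_ge: "exp (- norm w) \<le> norm (exp (- w :: complex))"
  using complex_Re_le_cmod[of w] by (simp add: norm_exp_eq_Re)

lemma norm_exp_minus_le: "norm (exp (- w :: complex)) \<le> exp (norm w)"
  using abs_Re_le_cmod[of w] by (simp add: norm_exp_eq_Re)

section \<open>The three circles estimate and its consequences at the origin\<close>

context drift_solution
begin

text \<open>The two terms of the three circles bound at radius 2 R with inner radius 1/8 and outer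
  radius 5 R / 2: the ratios are 16 R and 4/5. The prefactors bound the holomorphic function on the
  two circles, up to an error in the first. There \<sigma> is the L^2 size of gz near z0, \<Gamma>
  the one on the large ball, and q measures exp \<omega> in mean square.\<close>

abbreviation level :: "real \<Rightarrow> real \<Rightarrow> real \<Rightarrow> real \<Rightarrow> nat \<Rightarrow> real" where
  "level R q \<Gamma> \<sigma> n \<equiv> max (6144 * \<sigma> * R * q * (16 * R)^n) (3 * \<Gamma> * q / R * (4 / 5)^n)"

text \<open>Up to a factor and the potential of the error, f = exp(-\<omega>) gz is comparable with
  a function H holomorphic on the ball of radius 3 R. Cauchy-Schwarz with the integral of exp(2
  \<omega>) turns L^2 bounds of gz into L^1 bounds of f, hence into sup bounds of H on the two
  circles. The estimate returns to gz wherever the potential of the error is small.\<close>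

lemma core_estimate:
  assumes R: "1 \<le> R" and q: "0 < q"
    and Q: "\<And>\<omega>. admissible z0 (8 * R) \<omega> \<Longrightarrow> (\<integral>\<^sup>+z. indicator (ball z0 (8 * R)) z * ennreal (exp (2 * \<omega> z)) \<partial>lborel) \<le> ennreal ((R * q)\<^sup>2)"
    and \<Gamma>: "(LINT x|lborel. indicat_real (ball z0 (8 * R)) x * (norm (gz x))\<^sup>2) \<le> \<Gamma>\<^sup>2" "0 \<le> \<Gamma>"
    and \<sigma>: "(LINT x|lborel. indicat_real (ball z0 (1/2)) x * (norm (gz x))\<^sup>2) \<le> \<sigma>\<^sup>2" "0 \<le> \<sigma>"
    and \<tau>: "0 < \<tau>" and \<eta>: "0 < \<eta>"
  obtains \<omega> Z where "admissible z0 (8 * R) \<omega>" "Z \<in> sets borel" "emeasure lborel Z \<le> ennreal \<eta>"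
    "AE z in lborel. z \<in> ball z0 (2 * R) - Z \<longrightarrow> norm (gz z) \<le> exp (\<omega> z) * (level R q \<Gamma> \<sigma> n + \<tau>)"
proof -
  let ?D = "ball z0 (8 * R)"
  define c1 where "c1 = 768 * (416 * R) * (16 * R)^n"
  have c1: "c1 > 0" using R by (simp add: c1_def)
  \<comment> \<open>The error e has to be small for two purposes: its contribution to the inner
    circle, amplified by c1, is at most \<tau>/2, and the set where its potential exceeds \<tau>/2
    has measure at most \<eta>.\<close>
  define \<eta>1 where "\<eta>1 = min (\<tau> / 2 / c1) (\<tau> / 2 * \<eta> / (416 * R))"
  have \<eta>1: "0 < \<eta>1" "c1 * \<eta>1 \<le> \<tau> / 2" "416 * R * \<eta>1 \<le> \<tau> / 2 * \<eta>"
  proof -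
    show "0 < \<eta>1" using \<tau> \<eta> c1 R by (simp add: \<eta>1_def)
    have "\<eta>1 \<le> \<tau> / 2 / c1" "\<eta>1 \<le> \<tau> / 2 * \<eta> / (416 * R)" by (simp_all add: \<eta>1_def)
    moreover have "0 < 416 * R" using R by simp
    ultimately have "\<eta>1 * c1 \<le> \<tau> / 2" "\<eta>1 * (416 * R) \<le> \<tau> / 2 * \<eta>"
      using c1 by (simp_all only: pos_le_divide_eq)
    then show "c1 * \<eta>1 \<le> \<tau> / 2" "416 * R * \<eta>1 \<le> \<tau> / 2 * \<eta>"
      by (simp_all only: mult.commute[of _ \<eta>1])
  qed
  have R8: "0 < 8 * R" using R by simp
  obtain \<omega> e where [measurable]: "\<omega> \<in> borel_measurable borel" and adm: "admissible z0 (8 * R) (\<lambda>z. norm (\<omega> z))"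
    and fi: "integrable lborel (\<lambda>x. indicat_real ?D x *\<^sub>R (gz x * exp (- \<omega> x)))" and ei: "integrable lborel e"
    and wd: "weak_dbar ?D (\<lambda>x. indicat_real ?D x *\<^sub>R (gz x * exp (- \<omega> x))) e"
    and eo: "\<And>x. x \<notin> ?D \<Longrightarrow> e x = 0" and e\<eta>: "(\<integral>\<^sup>+x. ennreal (norm (e x)) \<partial>lborel) \<le> ennreal \<eta>1"
    by (rule approximate_solution[OF R8 Q _ \<eta>1(1)]) auto
  define f where "f x = indicat_real ?D x *\<^sub>R (gz x * exp (- \<omega> x))" for x
  note fi = fi[folded f_def] and wd = wd[folded f_def]
  note [measurable] = gz_borel
  have [measurable]: "f \<in> borel_measurable borel" "e \<in> borel_measurable borel"
    using borel_measurable_integrable[OF fi] borel_measurable_integrable[OF ei] by auto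
  have Rq: "0 \<le> R * q" using R q by simp
  have fL1: "(\<integral>\<^sup>+x. indicator (ball z0 \<rho>) x * ennreal (norm (f x)) \<partial>lborel) \<le> ennreal (s * (R * q))"
    if s: "(LINT x|lborel. indicat_real (ball z0 \<rho>) x * (norm (gz x))\<^sup>2) \<le> s\<^sup>2" "0 \<le> s" for \<rho> s
  proof (rule ennreal_sq_le)
    have "(\<integral>\<^sup>+x. indicator (ball z0 \<rho>) x * ennreal (norm (f x)) \<partial>lborel) \<le>
      (\<integral>\<^sup>+x. ennreal (indicat_real (ball z0 \<rho>) x * norm (gz x)) * (indicator ?D x * ennreal (exp (norm (\<omega> x)))) \<partial>lborel)"
    proof (intro nn_integral_mono)
      fix x
      have "norm (gz x) * norm (exp (- \<omega> x)) \<le> norm (gz x) * exp (norm (\<omega> x))"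
        by (rule mult_left_mono[OF norm_exp_minus_le]) simp
      from ennreal_leI[OF this]
      show "indicator (ball z0 \<rho>) x * ennreal (norm (f x)) \<le> ennreal (indicat_real (ball z0 \<rho>) x * norm (gz x)) * (indicator ?D x * ennreal (exp (norm (\<omega> x))))"
        by (simp add: f_def indicator_def norm_mult ennreal_mult)
    qed
    then have "(\<integral>\<^sup>+x. indicator (ball z0 \<rho>) x * ennreal (norm (f x)) \<partial>lborel)\<^sup>2 \<le>
      (\<integral>\<^sup>+x. ennreal (indicat_real (ball z0 \<rho>) x * norm (gz x)) * (indicator ?D x * ennreal (exp (norm (\<omega> x)))) \<partial>lborel)\<^sup>2"
      by (rule power_mono) simp
    also have "\<dots> \<le> (\<integral>\<^sup>+x. ennreal (indicat_real (ball z0 \<rho>) x * norm (gz x)) ^ 2 \<partial>lborel) * (\<integral>\<^sup>+x. (indicator ?D x * ennreal (exp (norm (\<omega> x)))) ^ 2 \<partial>lborel)"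
      by (rule Cauchy_Schwarz_nn_integral) measurable
    also have "(\<integral>\<^sup>+x. ennreal (indicat_real (ball z0 \<rho>) x * norm (gz x)) ^ 2 \<partial>lborel) = (\<integral>\<^sup>+x. ennreal (indicat_real (ball z0 \<rho>) x * (norm (gz x))\<^sup>2) \<partial>lborel)"
      by (intro nn_integral_cong) (simp add: ennreal_power power_mult_distrib indicator_def)
    also have "\<dots> = ennreal (LINT x|lborel. indicat_real (ball z0 \<rho>) x * (norm (gz x))\<^sup>2)"
      by (rule nn_integral_eq_integral[OF integrable_gz2]) auto
    also have "(\<integral>\<^sup>+x. (indicator ?D x * ennreal (exp (norm (\<omega> x)))) ^ 2 \<partial>lborel) = (\<integral>\<^sup>+x. indicator ?D x * ennreal (exp (2 * norm (\<omega> x))) \<partial>lborel)"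
      by (intro nn_integral_cong) (simp add: ennreal_power power_mult_distrib indicator_def exp_double)
    also have "ennreal (LINT x|lborel. indicat_real (ball z0 \<rho>) x * (norm (gz x))\<^sup>2) * \<dots> \<le> ennreal (s\<^sup>2) * ennreal ((R * q)\<^sup>2)"
      by (intro mult_mono Q[OF adm] ennreal_leI s) auto
    also have "\<dots> = ennreal ((s * (R * q))\<^sup>2)" by (simp add: power_mult_distrib ennreal_mult)
    finally show "(\<integral>\<^sup>+x. indicator (ball z0 \<rho>) x * ennreal (norm (f x)) \<partial>lborel)\<^sup>2 \<le> ennreal ((s * (R * q))\<^sup>2)" .
  qed (use s Rq in simp)
  have IF: "(LINT x|lborel. norm (f x)) \<le> \<Gamma> * (R * q)"
  proof -
    have "ennreal (LINT x|lborel. norm (f x)) = (\<integral>\<^sup>+x. ennreal (norm (f x)) \<partial>lborel)"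
      by (rule nn_integral_eq_integral[symmetric]) (use fi in auto)
    also have "\<dots> = (\<integral>\<^sup>+x. indicator ?D x * ennreal (norm (f x)) \<partial>lborel)"
      by (intro nn_integral_cong) (simp add: f_def indicator_def)
    also have "\<dots> \<le> ennreal (\<Gamma> * (R * q))" by (rule fL1[OF \<Gamma>])
    finally have le: "ennreal (LINT x|lborel. norm (f x)) \<le> ennreal (\<Gamma> * (R * q))" .
    have "0 \<le> \<Gamma> * (R * q)" using \<Gamma>(2) Rq by simp
    from iffD1[OF ennreal_le_iff[OF this] le] show ?thesis .
  qed
  have wd': "weak_dbar (ball z0 (2 * (4 * R))) f e" using wd by simp
  have R4: "0 < 4 * R" using R by simp
  obtain H H1 H2 where pH: "has_partials H H1 H2" and dH: "\<And>z. z \<in> ball z0 (3 * (4 * R) / 4) \<Longrightarrow> dbar H1 H2 z = 0"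
    and Hb: "\<And>z. norm (H z) \<le> 48 / (4 * R)\<^sup>2 * (LINT x|lborel. norm (f x))"
    and Hae: "AE z in lborel. z \<in> ball z0 (3 * (4 * R) / 4) \<longrightarrow> ennreal (norm (f z)) \<le> ennreal (norm (H z)) + pot e z \<and>
        ennreal (norm (H z)) \<le> 8 * ennreal (norm (f z)) + pot e z"
    by (rule local_representation[OF fi ei wd' R4]) (rule that, assumption, blast+)
  have R3: "3 * (4 * R) / 4 = 3 * R" by simp
  note dH = dH[unfolded R3] and Hae = Hae[unfolded R3]
  have HN: "norm (H z) \<le> 3 * \<Gamma> * q / R" for z
  proof -
    have "norm (H z) \<le> 48 / (4 * R)\<^sup>2 * (\<Gamma> * (R * q))"
      by (rule order_trans[OF Hb mult_left_mono[OF IF]]) simp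
    also have "\<dots> = 3 * \<Gamma> * q / R" using R by (simp add: power2_eq_square)
    finally show ?thesis .
  qed
  have potL1: "(\<integral>\<^sup>+z. indicator ?D z * pot e z \<partial>lborel) \<le> ennreal (416 * R * \<eta>1)"
  proof -
    have "(\<integral>\<^sup>+z. indicator ?D z * pot e z \<partial>lborel) \<le> ennreal (52 * (8 * R)) * (\<integral>\<^sup>+x. ennreal (norm (e x)) \<partial>lborel)"
      by (rule pot_L1[OF _ eo R8]) measurable
    also have "\<dots> \<le> ennreal (52 * (8 * R)) * ennreal \<eta>1" by (intro mult_left_mono e\<eta>) simp
    also have "\<dots> = ennreal (416 * R * \<eta>1)" using R \<eta>1(1) by (simp add: ennreal_mult[symmetric])
    finally show ?thesis .
  qed
  have [measurable]: "pot e \<in> borel_measurable borel" unfolding pot_def by measurable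
  note [measurable] = has_partials_borel[OF pH]
  \<comment> \<open>768 = 48 / (1/4)^2 is the mean value constant for the ball of radius 1/2; the
    factor 8 is that of \<open>local_representation\<close>.\<close>
  define A where "A = 768 * (8 * (\<sigma> * (R * q)) + 416 * R * \<eta>1)"
  have HA: "norm (H z) \<le> A" if z: "norm (z - z0) \<le> 1/8" for z
  proof -
    have iH: "integrable lborel (\<lambda>x. indicat_real (ball z0 (1/2)) x * norm (H x))"
    proof (rule Bochner_Integration.integrable_bound[OF integrable_indicator_ball[of z0 "1/2" "3 * \<Gamma> * q / R"]])
      show "AE x in lborel. norm (indicat_real (ball z0 (1/2)) x * norm (H x)) \<le> norm (indicat_real (ball z0 (1/2)) x * (3 * \<Gamma> * q / R))"
        using HN order_trans[OF HN abs_ge_self] by (intro AE_I2) (simp add: indicator_def)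
    qed measurable
    have sub: "ball z0 (1/2) \<subseteq> ball z0 (3 * R)" "ball z0 (1/2) \<subseteq> ?D" using R by (auto intro!: subset_ball)
    have "ennreal (LINT x|lborel. indicat_real (ball z0 (1/2)) x * norm (H x)) = (\<integral>\<^sup>+x. ennreal (indicat_real (ball z0 (1/2)) x * norm (H x)) \<partial>lborel)"
      by (rule nn_integral_eq_integral[OF iH, symmetric]) auto
    also have "\<dots> \<le> (\<integral>\<^sup>+x. 8 * (indicator (ball z0 (1/2)) x * ennreal (norm (f x))) + indicator ?D x * pot e x \<partial>lborel)"
    proof (rule nn_integral_mono_AE)
      show "AE x in lborel. ennreal (indicat_real (ball z0 (1/2)) x * norm (H x)) \<le> 8 * (indicator (ball z0 (1/2)) x * ennreal (norm (f x))) + indicator ?D x * pot e x"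
        using Hae
      proof eventually_elim
        case (elim x)
        show ?case
        proof (cases "x \<in> ball z0 (1/2)")
          case True
          then have "x \<in> ball z0 (3 * R)" "x \<in> ?D" using sub by blast+
          then show ?thesis using elim True by (simp only: indicator_simps) simp
        qed simp
      qed
    qed
    also have "\<dots> = 8 * (\<integral>\<^sup>+x. indicator (ball z0 (1/2)) x * ennreal (norm (f x)) \<partial>lborel) + (\<integral>\<^sup>+x. indicator ?D x * pot e x \<partial>lborel)"
      by (subst nn_integral_add) (auto simp: nn_integral_cmult)
    also have "\<dots> \<le> 8 * ennreal (\<sigma> * (R * q)) + ennreal (416 * R * \<eta>1)"
      by (intro add_mono mult_left_mono fL1[OF \<sigma>] potL1) simp
    also have "\<dots> = ennreal (8 * (\<sigma> * (R * q)) + 416 * R * \<eta>1)"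
    proof -
      have "0 \<le> \<sigma> * (R * q)" "0 \<le> 416 * R * \<eta>1" using \<sigma>(2) Rq R \<eta>1(1) by auto
      then show ?thesis by (simp only: ennreal_plus ennreal_mult'' mult_nonneg_nonneg zero_le_numeral ennreal_numeral)
    qed
    finally have le: "ennreal (LINT x|lborel. indicat_real (ball z0 (1/2)) x * norm (H x)) \<le> ennreal (8 * (\<sigma> * (R * q)) + 416 * R * \<eta>1)" .
    have "0 \<le> 8 * (\<sigma> * (R * q)) + 416 * R * \<eta>1" using \<sigma>(2) Rq R \<eta>1(1) by auto
    from iffD1[OF ennreal_le_iff[OF this] le]
    have I: "(LINT x|lborel. indicat_real (ball z0 (1/2)) x * norm (H x)) \<le> 8 * (\<sigma> * (R * q)) + 416 * R * \<eta>1" .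
    have "norm (H z) \<le> 48 / (1/4)\<^sup>2 * (LINT x|lborel. indicat_real (ball z0 (2 * (1/4))) x * norm (H x))"
    proof (rule dbar_mean_value[OF pH])
      show "dbar H1 H2 y = 0" if "y \<in> ball z0 (2 * (1/4))" for y using that sub by (intro dH) auto
      show "z \<in> ball z0 (3 * (1/4) / 4)" using z by (simp add: dist_norm norm_minus_commute)
    qed simp
    also have "\<dots> = 768 * (LINT x|lborel. indicat_real (ball z0 (1/2)) x * norm (H x))" by (simp add: power2_eq_square)
    also have "\<dots> \<le> A" unfolding A_def using I by (intro mult_left_mono) auto
    finally show ?thesis .
  qed
  have Hm: "norm (H z) \<le> level R q \<Gamma> \<sigma> n + \<tau> / 2" if z: "norm (z - z0) \<le> 2 * R" for z
  proof -
    have "norm (H z) \<le> max (A * (2 * R / (1/8))^n) (3 * \<Gamma> * q / R * (2 * R / (5 / 2 * R))^n)"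
    proof (rule three_circles[where H=H and ?z0.0=z0 and \<rho>="3 * R" and ?r1.0="1/8" and ?r2.0="2 * R" and ?r3.0="5 / 2 * R" and A=A and N="3 * \<Gamma> * q / R" and n=n and z=z])
    qed (use R pH HA HN z dH in auto)
    also have "2 * R / (1/8) = 16 * R" by simp
    also have "2 * R / (5 / 2 * R) = 4 / 5" using R by simp
    also have "A * (16 * R)^n = 6144 * \<sigma> * R * q * (16 * R)^n + c1 * \<eta>1" by (simp add: A_def c1_def algebra_simps)
    also have "max (6144 * \<sigma> * R * q * (16 * R)^n + c1 * \<eta>1) (3 * \<Gamma> * q / R * (4 / 5)^n) \<le> level R q \<Gamma> \<sigma> n + \<tau> / 2"
      using \<eta>1(2) \<tau> by (simp add: max_def)
    finally show ?thesis .
  qed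
  \<comment> \<open>Chebyshev's inequality for the potential, whose integral over the ball is at
    most \<eta> \<tau> / 2.\<close>
  define Z where "Z = {z \<in> ?D. ennreal (\<tau> / 2) < pot e z}"
  have Zm [measurable]: "Z \<in> sets borel"
  proof -
    have "{z \<in> space borel. z \<in> ?D \<and> ennreal (\<tau> / 2) < pot e z} \<in> sets borel" by measurable
    then show ?thesis by (simp add: Z_def)
  qed
  have Z\<eta>: "emeasure lborel Z \<le> ennreal \<eta>"
  proof -
    have "ennreal (\<tau> / 2) * emeasure lborel Z = (\<integral>\<^sup>+z. ennreal (\<tau> / 2) * indicator Z z \<partial>lborel)"
      by (rule nn_integral_cmult_indicator[symmetric]) simp
    also have "\<dots> \<le> (\<integral>\<^sup>+z. indicator ?D z * pot e z \<partial>lborel)"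
      by (intro nn_integral_mono) (auto simp: Z_def indicator_def)
    also have "\<dots> \<le> ennreal (\<tau> / 2 * \<eta>)" using order_trans[OF potL1 ennreal_leI[OF \<eta>1(3)]] .
    also have "\<dots> = ennreal (\<tau> / 2) * ennreal \<eta>" using \<tau> \<eta> by (intro ennreal_mult) auto
    finally show ?thesis using \<tau> by (subst (asm) ennreal_mult_le_mult_iff) auto
  qed
  have main: "AE z in lborel. z \<in> ball z0 (2 * R) - Z \<longrightarrow> norm (gz z) \<le> exp (norm (\<omega> z)) * (level R q \<Gamma> \<sigma> n + \<tau>)"
    using Hae
  proof eventually_elim
    case (elim z)
    show ?case
    proof
      assume z: "z \<in> ball z0 (2 * R) - Z"
      then have zz: "z \<in> ball z0 (3 * R)" "z \<in> ?D" "norm (z - z0) \<le> 2 * R" using R by (auto simp: dist_norm norm_minus_commute)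
      then have "pot e z \<le> ennreal (\<tau> / 2)" using z by (auto simp: Z_def not_less)
      then have "ennreal (norm (f z)) \<le> ennreal (norm (H z)) + ennreal (\<tau> / 2)"
        using elim zz(1) by (meson add_left_mono order_trans)
      also have "\<dots> = ennreal (norm (H z) + \<tau> / 2)" using \<tau> by (intro ennreal_plus[symmetric]) auto
      finally have le: "ennreal (norm (f z)) \<le> ennreal (norm (H z) + \<tau> / 2)" .
      have "0 \<le> norm (H z) + \<tau> / 2" using \<tau> by simp
      from iffD1[OF ennreal_le_iff[OF this] le] have "norm (f z) \<le> level R q \<Gamma> \<sigma> n + \<tau>" using Hm[OF zz(3)] by simp
      moreover have "norm (f z) = norm (gz z) * norm (exp (- \<omega> z))" using zz(2) by (simp add: f_def norm_mult)
      moreover have "norm (gz z) * exp (- norm (\<omega> z)) \<le> norm (gz z) * norm (exp (- \<omega> z))"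
        by (rule mult_left_mono[OF norm_exp_minus_ge]) simp
      ultimately have "norm (gz z) * exp (- norm (\<omega> z)) \<le> level R q \<Gamma> \<sigma> n + \<tau>" by linarith
      then have "exp (norm (\<omega> z)) * (norm (gz z) * exp (- norm (\<omega> z))) \<le> exp (norm (\<omega> z)) * (level R q \<Gamma> \<sigma> n + \<tau>)"
        by (rule mult_left_mono) simp
      moreover have "exp a * (b * exp (- a)) = b" for a b :: real by (simp add: exp_minus)
      ultimately show "norm (gz z) \<le> exp (norm (\<omega> z)) * (level R q \<Gamma> \<sigma> n + \<tau>)" by simp
    qed
  qed
  show ?thesis by (rule that[OF adm Zm Z\<eta> main])
qed

lemma ball_origin_subset:
  fixes z0 :: "'a::real_normed_vector"
  assumes "norm z0 = R"
  shows "ball 0 R \<subseteq> ball z0 (2 * R)"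
proof
  fix x :: 'a assume "x \<in> ball 0 R"
  with assms show "x \<in> ball z0 (2 * R)" using norm_triangle_ineq4[of z0 x] by (simp add: dist_norm)
qed

text \<open>Squaring and integrating the core estimate over the unit ball bounds the energy there by
  (R q)^2 times the squared level. The exceptional set Z may carry energy of gz, so |gz| is
  truncated at a height T beforehand, and Z contributes at most T^2 \<eta>. The 1/4 in
  \<open>low\<close> reflects |gz| = |grad u| / 2.\<close>

lemma level_bound_L2:
  assumes R: "1 \<le> R" "norm z0 = R" and q: "0 < q"
    and Q: "\<And>\<omega>. admissible z0 (8 * R) \<omega> \<Longrightarrow> (\<integral>\<^sup>+z. indicator (ball z0 (8 * R)) z * ennreal (exp (2 * \<omega> z)) \<partial>lborel) \<le> ennreal ((R * q)\<^sup>2)"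
    and \<Gamma>: "(LINT x|lborel. indicat_real (ball z0 (8 * R)) x * (norm (gz x))\<^sup>2) \<le> \<Gamma>\<^sup>2" "0 \<le> \<Gamma>"
    and \<sigma>: "(LINT x|lborel. indicat_real (ball z0 (1/2)) x * (norm (gz x))\<^sup>2) \<le> \<sigma>\<^sup>2" "0 \<le> \<sigma>"
    and low: "1 / 4 \<le> (LINT x|lborel. indicat_real (ball 0 1) x * (norm (gz x))\<^sup>2)"
  shows "1 \<le> 3 * R * q * level R q \<Gamma> \<sigma> n"
proof -
  let ?m = "level R q \<Gamma> \<sigma> n"
  note [measurable] = gz_borel
  have m0: "0 \<le> ?m" using R q \<Gamma>(2) by (simp add: le_max_iff_disj)
  define h where "h T x = indicat_real (ball 0 1) x * (min (norm (gz x)) (real T))\<^sup>2" for T x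
  have hm [measurable]: "h T \<in> borel_measurable borel" for T unfolding h_def by measurable
  have hle: "norm (h T x) \<le> indicat_real (ball 0 1) x * (norm (gz x))\<^sup>2" for T x
    unfolding h_def by (auto simp: indicator_def intro!: power_mono)
  have hi: "integrable lborel (h T)" for T
    by (rule Bochner_Integration.integrable_bound[OF integrable_gz2[of 0 1]]) (use hle in \<open>auto intro!: AE_I2 intro: order_trans[OF hle abs_ge_self]\<close>)
  have "(\<lambda>T. LINT x|lborel. h T x) \<longlonglongrightarrow> (LINT x|lborel. indicat_real (ball 0 1) x * (norm (gz x))\<^sup>2)"
  proof (rule integral_dominated_convergence[OF _ _ integrable_gz2[of 0 1]])
    show "AE x in lborel. (\<lambda>T. h T x) \<longlonglongrightarrow> indicat_real (ball 0 1) x * (norm (gz x))\<^sup>2"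
    proof (intro AE_I2)
      fix x
      obtain N :: nat where N: "norm (gz x) \<le> real N" using real_arch_simple by blast
      have "eventually (\<lambda>T. h T x = indicat_real (ball 0 1) x * (norm (gz x))\<^sup>2) sequentially"
        using eventually_ge_at_top[of N] by eventually_elim (use N in \<open>simp add: h_def min_def\<close>)
      then show "(\<lambda>T. h T x) \<longlonglongrightarrow> indicat_real (ball 0 1) x * (norm (gz x))\<^sup>2" by (rule tendsto_eventually)
    qed
  qed (use hle in auto)
  then have "eventually (\<lambda>T. 1 / 8 < (LINT x|lborel. h T x)) sequentially"
    using low by (intro order_tendstoD(1)) auto
  then obtain T where T: "1 / 8 < (LINT x|lborel. h T x)" by (auto simp: eventually_sequentially)
  \<comment> \<open>For large T the truncated energy still exceeds 1/8; the surplus \<delta> pays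
    for the set Z.\<close>
  define \<delta> where "\<delta> = (LINT x|lborel. h T x) - 1 / 8"
  have \<delta>: "\<delta> > 0" using T by (simp add: \<delta>_def)
  have "1 \<le> 3 * R * q * (?m + \<tau>)" if \<tau>: "\<tau> > 0" for \<tau>
  proof -
    define \<eta> where "\<eta> = \<delta> / ((real T)\<^sup>2 + 1)"
    have \<eta>: "\<eta> > 0" using \<delta> by (simp add: \<eta>_def add_nonneg_pos)
    have T\<eta>: "(real T)\<^sup>2 * \<eta> \<le> \<delta>"
    proof -
      have "(real T)\<^sup>2 * \<eta> \<le> ((real T)\<^sup>2 + 1) * \<eta>" using \<eta> by (intro mult_right_mono) auto
      also have "\<dots> = \<delta>"
        using zero_le_power2[of "real T"] by (simp add: \<eta>_def add_nonneg_eq_0_iff)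
      finally show ?thesis .
    qed
    obtain \<omega> Z where adm: "admissible z0 (8 * R) \<omega>" and [measurable]: "Z \<in> sets borel" and Z: "emeasure lborel Z \<le> ennreal \<eta>"
      and ae: "AE z in lborel. z \<in> ball z0 (2 * R) - Z \<longrightarrow> norm (gz z) \<le> exp (\<omega> z) * (?m + \<tau>)"
      by (rule core_estimate[OF R(1) q Q \<Gamma> \<sigma> \<tau> \<eta>, where n=n]) auto
    have [measurable]: "\<omega> \<in> borel_measurable borel" using adm by (simp add: admissible_def)
    have sub: "x \<in> ball z0 (2 * R)" "x \<in> ball z0 (8 * R)" if "x \<in> ball 0 1" for x
    proof -
      have "x \<in> ball 0 R" using that R by simp
      then show "x \<in> ball z0 (2 * R)" using ball_origin_subset[OF R(2)] by blast
      then show "x \<in> ball z0 (8 * R)" using R by simp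
    qed
    have "ennreal (1 / 8 + \<delta>) = (\<integral>\<^sup>+x. ennreal (h T x) \<partial>lborel)"
      using nn_integral_eq_integral[OF hi[of T]] by (simp add: \<delta>_def) (simp add: h_def)
    also have "\<dots> \<le> (\<integral>\<^sup>+x. ennreal ((?m + \<tau>)\<^sup>2) * (indicator (ball z0 (8 * R)) x * ennreal (exp (2 * \<omega> x))) + ennreal ((real T)\<^sup>2) * indicator Z x \<partial>lborel)"
    proof (rule nn_integral_mono_AE)
      show "AE x in lborel. ennreal (h T x) \<le> ennreal ((?m + \<tau>)\<^sup>2) * (indicator (ball z0 (8 * R)) x * ennreal (exp (2 * \<omega> x))) + ennreal ((real T)\<^sup>2) * indicator Z x"
        using ae
      proof eventually_elim
        case (elim x)
        show ?case
        proof (cases "x \<in> ball 0 1")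
          case x: True
          show ?thesis
          proof (cases "x \<in> Z")
            case True
            have "h T x \<le> (real T)\<^sup>2" using x by (simp add: h_def power_mono)
            then have "ennreal (h T x) \<le> ennreal ((real T)\<^sup>2) * indicator Z x" using True by (simp add: ennreal_leI)
            then show ?thesis by (rule order_trans) simp
          next
            case False
            then have "norm (gz x) \<le> exp (\<omega> x) * (?m + \<tau>)" using elim sub[OF x] by blast
            then have "(min (norm (gz x)) (real T))\<^sup>2 \<le> (exp (\<omega> x) * (?m + \<tau>))\<^sup>2" by (intro power_mono) auto
            moreover have "(exp (\<omega> x) * (?m + \<tau>))\<^sup>2 = (?m + \<tau>)\<^sup>2 * exp (2 * \<omega> x)"
              by (subst exp_double) (simp only: power_mult_distrib[of "exp (\<omega> x)"] mult.commute)
            ultimately have "h T x \<le> (?m + \<tau>)\<^sup>2 * exp (2 * \<omega> x)" using x by (simp add: h_def)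
            then have "ennreal (h T x) \<le> ennreal ((?m + \<tau>)\<^sup>2) * (indicator (ball z0 (8 * R)) x * ennreal (exp (2 * \<omega> x)))"
              using sub(2)[OF x] by (simp add: ennreal_leI flip: ennreal_mult)
            then show ?thesis by (rule order_trans) simp
          qed
        qed (simp add: h_def)
      qed
    qed
    also have "\<dots> = ennreal ((?m + \<tau>)\<^sup>2) * (\<integral>\<^sup>+x. indicator (ball z0 (8 * R)) x * ennreal (exp (2 * \<omega> x)) \<partial>lborel) + ennreal ((real T)\<^sup>2) * emeasure lborel Z"
      by (subst nn_integral_add) (auto simp: nn_integral_cmult nn_integral_cmult_indicator)
    also have "\<dots> \<le> ennreal ((?m + \<tau>)\<^sup>2) * ennreal ((R * q)\<^sup>2) + ennreal ((real T)\<^sup>2) * ennreal \<eta>"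
      by (intro add_mono mult_left_mono Q[OF adm] Z) auto
    also have "\<dots> = ennreal ((?m + \<tau>)\<^sup>2 * (R * q)\<^sup>2 + (real T)\<^sup>2 * \<eta>)"
    proof -
      have "ennreal a * ennreal b + ennreal c * ennreal d = ennreal (a * b + c * d)" if "0 \<le> a" "0 \<le> b" "0 \<le> c" "0 \<le> d" for a b c d
        using that by (simp add: ennreal_mult ennreal_plus)
      then show ?thesis using \<eta> by simp
    qed
    finally have le: "ennreal (1 / 8 + \<delta>) \<le> ennreal ((?m + \<tau>)\<^sup>2 * (R * q)\<^sup>2 + (real T)\<^sup>2 * \<eta>)" .
    have "0 \<le> (?m + \<tau>)\<^sup>2 * (R * q)\<^sup>2 + (real T)\<^sup>2 * \<eta>" using \<eta> by simp
    from iffD1[OF ennreal_le_iff[OF this] le] have "1 / 8 \<le> (?m + \<tau>)\<^sup>2 * (R * q)\<^sup>2" using T\<eta> by simp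
    \<comment> \<open>The factor 3 exceeds the square root of 8, so that 9 times 1/8 is at least
      1.\<close>
    moreover have "(3 * R * q * (?m + \<tau>))\<^sup>2 = 9 * ((?m + \<tau>)\<^sup>2 * (R * q)\<^sup>2)" by (simp only: power_mult_distrib) simp
    ultimately have "1\<^sup>2 \<le> (3 * R * q * (?m + \<tau>))\<^sup>2" by simp
    moreover have "0 \<le> 3 * R * q * (?m + \<tau>)" using R q m0 \<tau> by (intro mult_nonneg_nonneg) auto
    ultimately show ?thesis by (rule power2_le_imp_le)
  qed
  note step = this
  show ?thesis
  proof (rule field_le_epsilon)
    fix \<epsilon> :: real assume \<epsilon>: "\<epsilon> > 0"
    have pos: "3 * R * q > 0" using R q by simp
    have "1 \<le> 3 * R * q * (?m + \<epsilon> / (3 * R * q))" using \<epsilon> pos by (intro step) simp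
    also have "\<dots> = 3 * R * q * ?m + \<epsilon>" unfolding distrib_left using R q by simp
    finally show "1 \<le> 3 * R * q * ?m + \<epsilon>" .
  qed
qed

text \<open>When every admissible \<omega> is at most A, the exceptional points can be collected in
  a set that does not refer to \<omega>; its measure is below every \<eta>, so it is null. The
  resulting gradient bound, valid almost everywhere on ball R, passes to the gradient at 0.\<close>

lemma level_bound_sup:
  assumes R: "1 \<le> R" "norm z0 = R" and q: "0 < q"
    and Q: "\<And>\<omega>. admissible z0 (8 * R) \<omega> \<Longrightarrow> (\<integral>\<^sup>+z. indicator (ball z0 (8 * R)) z * ennreal (exp (2 * \<omega> z)) \<partial>lborel) \<le> ennreal ((R * q)\<^sup>2)"
    and \<Gamma>: "(LINT x|lborel. indicat_real (ball z0 (8 * R)) x * (norm (gz x))\<^sup>2) \<le> \<Gamma>\<^sup>2" "0 \<le> \<Gamma>"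
    and \<sigma>: "(LINT x|lborel. indicat_real (ball z0 (1/2)) x * (norm (gz x))\<^sup>2) \<le> \<sigma>\<^sup>2" "0 \<le> \<sigma>"
    and A: "\<And>\<omega> z. admissible z0 (8 * R) \<omega> \<Longrightarrow> z \<in> ball z0 (8 * R) \<Longrightarrow> \<omega> z \<le> A" "exp A \<le> q"
    and g: "GDERIV u 0 :> g" "norm g = 1"
  shows "1 \<le> 3 * R * q * level R q \<Gamma> \<sigma> n"
proof (rule field_le_epsilon)
  let ?m = "level R q \<Gamma> \<sigma> n"
  note [measurable] = gz_borel
  have m0: "0 \<le> ?m" using R q \<Gamma>(2) by (simp add: le_max_iff_disj)
  fix \<epsilon> :: real assume \<epsilon>: "\<epsilon> > 0"
  have pos: "3 * R * q > 0" using R q by simp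
  define \<tau> where "\<tau> = \<epsilon> / (3 * R * q)"
  have \<tau>: "\<tau> > 0" using \<epsilon> pos by (simp add: \<tau>_def)
  define Bad where "Bad = {z \<in> ball 0 R. exp A * (?m + \<tau>) < norm (gz z)}"
  have Badm [measurable]: "Bad \<in> sets borel"
  proof -
    have "{z \<in> space borel. z \<in> ball 0 R \<and> exp A * (?m + \<tau>) < norm (gz z)} \<in> sets borel" by measurable
    then show ?thesis by (simp add: Bad_def)
  qed
  have Bad_le: "emeasure lborel Bad \<le> ennreal \<eta>" if \<eta>: "\<eta> > 0" for \<eta>
  proof -
    obtain \<omega> Z where adm: "admissible z0 (8 * R) \<omega>" and [measurable]: "Z \<in> sets borel" and Z: "emeasure lborel Z \<le> ennreal \<eta>"
      and ae: "AE z in lborel. z \<in> ball z0 (2 * R) - Z \<longrightarrow> norm (gz z) \<le> exp (\<omega> z) * (?m + \<tau>)"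
      by (rule core_estimate[OF R(1) q Q \<Gamma> \<sigma> \<tau> \<eta>, where n=n]) auto
    have "AE z in lborel. z \<in> Bad \<longrightarrow> z \<in> Z"
      using ae
    proof eventually_elim
      case (elim z)
      show ?case
      proof (intro impI, rule ccontr)
        assume z: "z \<in> Bad" "z \<notin> Z"
        then have z2: "z \<in> ball z0 (2 * R)" using ball_origin_subset[OF R(2)] by (auto simp: Bad_def)
        then have "z \<in> ball z0 (8 * R)" using R by simp
        then have "exp (\<omega> z) * (?m + \<tau>) \<le> exp A * (?m + \<tau>)" using A(1)[OF adm] m0 \<tau> by (intro mult_right_mono) auto
        moreover have "norm (gz z) \<le> exp (\<omega> z) * (?m + \<tau>)" using elim z2 z by blast
        moreover have "exp A * (?m + \<tau>) < norm (gz z)" using z by (simp add: Bad_def)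
        ultimately show False by linarith
      qed
    qed
    then have "emeasure lborel Bad \<le> emeasure lborel Z" by (intro emeasure_mono_AE) auto
    then show ?thesis using Z by (rule order_trans)
  qed
  have "emeasure lborel Bad \<le> 0"
    by (rule ennreal_le_epsilon) (simp only: add_0 Bad_le)
  then have "emeasure lborel Bad = 0" by (simp only: le_zero_eq)
  then have "Bad \<in> null_sets lborel" by (rule null_setsI) (simp only: sets_lborel Badm)
  then have "AE z in lborel. z \<notin> Bad" by (rule AE_not_in)
  then have "AE z in lborel. z \<in> ball 0 R \<longrightarrow> (G1 z)\<^sup>2 + (G2 z)\<^sup>2 \<le> (2 * (exp A * (?m + \<tau>)))\<^sup>2"
  proof eventually_elim
    case (elim z)
    show ?case
    proof
      assume "z \<in> ball 0 R"
      then have "norm (gz z) \<le> exp A * (?m + \<tau>)" using elim unfolding Bad_def by auto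
      then have "(norm (gz z))\<^sup>2 \<le> (exp A * (?m + \<tau>))\<^sup>2" by (rule power_mono) simp
      then show "(G1 z)\<^sup>2 + (G2 z)\<^sup>2 \<le> (2 * (exp A * (?m + \<tau>)))\<^sup>2"
        unfolding norm_gz power_mult_distrib[of 2] by simp
    qed
  qed
  then have "norm g \<le> 2 * (exp A * (?m + \<tau>))"
    by (rule gradient_norm_le[OF _ _ _ g(1)]) (use m0 \<tau> R in auto)
  also have "\<dots> \<le> 2 * (q * (?m + \<tau>))" using A(2) m0 \<tau> by (intro mult_left_mono mult_right_mono) auto
  \<comment> \<open>Weakened from 2 to 3 R so that both cases end with the same inequality.\<close>
  also have "\<dots> \<le> (3 * R) * (q * (?m + \<tau>))"
    using R m0 \<tau> q by (intro mult_right_mono) auto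
  also have "\<dots> = 3 * R * q * ?m + 3 * R * q * \<tau>" by (simp only: distrib_left mult.assoc)
  also have "3 * R * q * \<tau> = \<epsilon>" using R q by (simp add: \<tau>_def)
  finally show "1 \<le> 3 * R * q * ?m + \<epsilon>" using g(2) by simp
qed

text \<open>If n is so large that 3 R q times the far term is below 1, the maximum must be the near
  term, which is then bounded below. The constants are 9 = 3 * 3 and 18432 = 3 * 6144.\<close>

lemma level_conclusion:
  assumes R: "1 \<le> R" and q: "0 < q" and n: "9 * \<Gamma> * q\<^sup>2 < (5 / 4)^n" and l: "1 \<le> 3 * R * q * level R q \<Gamma> \<sigma> n"
  shows "1 \<le> 18432 * R\<^sup>2 * q\<^sup>2 * \<sigma> * (16 * R)^n"
proof -
  have "3 * R * q * (3 * \<Gamma> * q / R * (4 / 5)^n) = 9 * \<Gamma> * q\<^sup>2 * (4 / 5)^n" using R by (simp add: power2_eq_square)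
  also have "\<dots> < (5 / 4)^n * (4 / 5)^n" using n by (intro mult_strict_right_mono) auto
  also have "\<dots> = 1" by (simp flip: power_mult_distrib)
  finally have lt: "3 * R * q * (3 * \<Gamma> * q / R * (4 / 5)^n) < 1" .
  have "level R q \<Gamma> \<sigma> n = 6144 * \<sigma> * R * q * (16 * R)^n"
  proof (rule ccontr)
    assume "level R q \<Gamma> \<sigma> n \<noteq> 6144 * \<sigma> * R * q * (16 * R)^n"
    then have "level R q \<Gamma> \<sigma> n = 3 * \<Gamma> * q / R * (4 / 5)^n" by (simp add: max_def split: if_splits)
    then show False using l lt by simp
  qed
  with l have "1 \<le> 3 * R * q * (6144 * \<sigma> * R * q * (16 * R)^n)" by simp
  also have "\<dots> = 18432 * R\<^sup>2 * q\<^sup>2 * \<sigma> * (16 * R)^n" by (simp add: power2_eq_square)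
  finally show ?thesis .
qed

text \<open>Caccioppoli between the radii 8 R and 16 R, with |u| \<le> C0. By scaling the cutoff
  term does not depend on R: it is pi * 4096 / 9, about 1430.\<close>

lemma gz_energy_large:
  assumes R: "1 \<le> R" and S: "(LINT x|lborel. indicat_real (ball z0 (16 * R)) x * (w x)\<^sup>2) \<le> S"
  shows "(LINT x|lborel. indicat_real (ball z0 (8 * R)) x * (norm (gz x))\<^sup>2) \<le> C0\<^sup>2 * (S + 1432)"
proof -
  have R16: "0 < 8 * R" "8 * R < 16 * R" using R by auto
  have "(LINT x|lborel. indicat_real (ball z0 (8 * R)) x * (norm (gz x))\<^sup>2) = (LINT x|lborel. indicat_real (ball z0 (8 * R)) x * ((G1 x)\<^sup>2 + (G2 x)\<^sup>2)) / 4"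
    by (simp add: norm_gz)
  also have "\<dots> \<le> (4 * C0\<^sup>2 * (LINT x|lborel. indicat_real (ball z0 (16 * R)) x * (w x)\<^sup>2) + 16 * C0\<^sup>2 * (8 * (16 * R) / ((16 * R)\<^sup>2 - (8 * R)\<^sup>2))\<^sup>2 * (pi * (16 * R)\<^sup>2)) / 4"
    by (intro divide_right_mono caccioppoli[OF R16, of 1] u) auto
  also have "8 * (16 * R) / ((16 * R)\<^sup>2 - (8 * R)\<^sup>2) = 2 / (3 * R)" using R by (simp add: power_mult_distrib power2_eq_square)
  also have "16 * C0\<^sup>2 * (2 / (3 * R))\<^sup>2 * (pi * (16 * R)\<^sup>2) = C0\<^sup>2 * (pi * (16384 / 9))"
    using R by (simp add: power_divide power_mult_distrib)
  also have "(4 * C0\<^sup>2 * (LINT x|lborel. indicat_real (ball z0 (16 * R)) x * (w x)\<^sup>2) + C0\<^sup>2 * (pi * (16384 / 9))) / 4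
     = C0\<^sup>2 * ((LINT x|lborel. indicat_real (ball z0 (16 * R)) x * (w x)\<^sup>2) + pi * (4096 / 9))" by (simp add: algebra_simps)
  also have "\<dots> \<le> C0\<^sup>2 * (S + 1432)"
  proof (intro mult_left_mono add_mono S)
    have "pi \<le> 3.1416" using pi_approx by simp
    then show "pi * (4096 / 9) \<le> 1432" by simp
  qed auto
  finally show ?thesis .
qed

text \<open>The radii 1/2 and 3/4 with mollification margin 1/4 use u on the unit ball only, which
  is the ball of the supremum in the theorem. The cutoff term is 829.44 pi, about 2606.\<close>

lemma gz_energy_small:
  assumes s: "\<And>x. x \<in> ball z0 1 \<Longrightarrow> \<bar>u x\<bar> \<le> s" and S: "(LINT x|lborel. indicat_real (ball z0 (3/4)) x * (w x)\<^sup>2) \<le> S"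
  shows "(LINT x|lborel. indicat_real (ball z0 (1/2)) x * (norm (gz x))\<^sup>2) \<le> s\<^sup>2 * (S + 2608)"
proof -
  have "(LINT x|lborel. indicat_real (ball z0 (1/2)) x * (norm (gz x))\<^sup>2) = (LINT x|lborel. indicat_real (ball z0 (1/2)) x * ((G1 x)\<^sup>2 + (G2 x)\<^sup>2)) / 4"
    by (simp add: norm_gz)
  also have "\<dots> \<le> (4 * s\<^sup>2 * (LINT x|lborel. indicat_real (ball z0 (3/4)) x * (w x)\<^sup>2) + 16 * s\<^sup>2 * (8 * (3/4) / ((3/4)\<^sup>2 - (1/2)\<^sup>2))\<^sup>2 * (pi * (3/4)\<^sup>2)) / 4"
    by (intro divide_right_mono caccioppoli[where s="1/4"] s) auto
  also have "16 * s\<^sup>2 * (8 * (3/4) / ((3/4)\<^sup>2 - (1/2)\<^sup>2))\<^sup>2 * (pi * (3/4)\<^sup>2) = 4 * s\<^sup>2 * (pi * 829.44)"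
    by (simp add: power2_eq_square)
  also have "(4 * s\<^sup>2 * (LINT x|lborel. indicat_real (ball z0 (3/4)) x * (w x)\<^sup>2) + 4 * s\<^sup>2 * (pi * 829.44)) / 4
     = s\<^sup>2 * ((LINT x|lborel. indicat_real (ball z0 (3/4)) x * (w x)\<^sup>2) + pi * 829.44)" by (simp add: algebra_simps)
  also have "\<dots> \<le> s\<^sup>2 * (S + 2608)"
  proof (intro mult_left_mono add_mono S)
    have "pi \<le> 3.1416" using pi_approx by simp
    then show "pi * 829.44 \<le> 2608" by simp
  qed auto
  finally show ?thesis .
qed

end

section \<open>Energy of the drift and size of the exponent\<close>

lemma pi_bounds: "3 < pi" "pi < 3.1416"
  using pi_approx by auto

context drift_solution
begin

lemma w_borel [measurable]: "w \<in> borel_measurable borel"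
  using sq(5) by (simp add: sq_loc_def)

text \<open>Used with c = 0 for p = 2, and with c = 1 for p > 2, where t^2 \<le> 1 + t^p trades the
  local L^2 norm for the area of the ball plus the global L^p norm.\<close>

lemma drift_energy_le:
  assumes le: "\<And>x. (w x)\<^sup>2 \<le> c + w x powr p" and c: "0 \<le> c" and r: "0 \<le> r"
    and S: "(\<integral>\<^sup>+x. ennreal (w x powr p) \<partial>lborel) \<le> ennreal S" "0 \<le> S"
  shows "(LINT x|lborel. indicat_real (ball z0 r) x * (w x)\<^sup>2) \<le> c * (pi * r\<^sup>2) + S"
proof -
  have "ennreal (LINT x|lborel. indicat_real (ball z0 r) x * (w x)\<^sup>2) = (\<integral>\<^sup>+x. ennreal (indicat_real (ball z0 r) x * (w x)\<^sup>2) \<partial>lborel)"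
    by (rule nn_integral_eq_integral[OF sq_loc_ball[OF sq(5)], symmetric]) auto
  also have "\<dots> \<le> (\<integral>\<^sup>+x. ennreal c * indicator (ball z0 r) x + ennreal (w x powr p) \<partial>lborel)"
  proof (intro nn_integral_mono)
    fix x
    have "ennreal ((w x)\<^sup>2) \<le> ennreal c + ennreal (w x powr p)"
      using ennreal_leI[OF le[of x]] c by (simp add: ennreal_plus)
    then show "ennreal (indicat_real (ball z0 r) x * (w x)\<^sup>2) \<le> ennreal c * indicator (ball z0 r) x + ennreal (w x powr p)"
      by (simp add: indicator_def)
  qed
  also have "\<dots> = ennreal c * emeasure lborel (ball z0 r) + (\<integral>\<^sup>+x. ennreal (w x powr p) \<partial>lborel)"
    by (subst nn_integral_add) (auto simp: nn_integral_cmult_indicator)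
  also have "\<dots> \<le> ennreal c * ennreal (pi * r\<^sup>2) + ennreal S"
    by (intro add_mono S) (simp add: emeasure_ball_2[OF r])
  also have "\<dots> = ennreal (c * (pi * r\<^sup>2) + S)"
  proof -
    have "0 \<le> c * (pi * r\<^sup>2)" using c by simp
    then show ?thesis using c S(2) by (simp only: ennreal_mult' ennreal_plus)
  qed
  finally have fin: "ennreal (LINT x|lborel. indicat_real (ball z0 r) x * (w x)\<^sup>2) \<le> ennreal (c * (pi * r\<^sup>2) + S)" .
  have "0 \<le> c * (pi * r\<^sup>2) + S" using c S(2) by simp
  from iffD1[OF ennreal_le_iff[OF this] fin] show ?thesis .
qed

lemma admissible_exp_integral:
  assumes adm: "admissible z0 (8 * R) \<omega>" and \<kappa>: "0 < \<kappa>" and w2: "(\<integral>\<^sup>+x. ennreal (w x powr 2) \<partial>lborel) \<le> ennreal (\<kappa>\<^sup>2)"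
    and R: "1 \<le> R"
  shows "(\<integral>\<^sup>+z. indicator (ball z0 (8 * R)) z * ennreal (exp (2 * \<omega> z)) \<partial>lborel) \<le> ennreal ((R * (82 * exp (208 * \<kappa>\<^sup>2)))\<^sup>2)"
proof -
  obtain b where b: "b \<in> borel_measurable borel" "\<And>x. norm (b x) \<le> w x" "\<And>x. x \<notin> ball z0 (8 * R) \<Longrightarrow> b x = 0"
    "\<And>z. z \<in> ball z0 (8 * R) \<Longrightarrow> ennreal (\<omega> z) \<le> pot b z"
    using adm unfolding admissible_def by auto
  have "(\<integral>\<^sup>+x. ennreal ((norm (b x))\<^sup>2) \<partial>lborel) \<le> (\<integral>\<^sup>+x. ennreal (w x powr 2) \<partial>lborel)"
  proof (intro nn_integral_mono ennreal_leI)
    fix x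
    have "(norm (b x))\<^sup>2 \<le> (w x)\<^sup>2" using b(2)[of x] by (intro power_mono) auto
    then show "(norm (b x))\<^sup>2 \<le> w x powr 2" using w(1)[of x] by simp
  qed
  then have b2: "(\<integral>\<^sup>+x. ennreal ((norm (b x))\<^sup>2) \<partial>lborel) \<le> ennreal (\<kappa>\<^sup>2)" using w2 by (rule order_trans)
  have "(\<integral>\<^sup>+z. indicator (ball z0 (8 * R)) z * ennreal (exp (2 * \<omega> z)) \<partial>lborel) \<le> ennreal (104 * (8 * R)\<^sup>2 * exp (416 * \<kappa>\<^sup>2))"
    by (rule exp_pot_integral[OF b(1,3) _ \<kappa> b2 _ _ b(4)]) (use adm R in \<open>auto simp: admissible_def\<close>)
  also have "\<dots> \<le> ennreal ((R * (82 * exp (208 * \<kappa>\<^sup>2)))\<^sup>2)"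
  proof (rule ennreal_leI)
    have "416 * \<kappa>\<^sup>2 = 2 * (208 * \<kappa>\<^sup>2)" by simp
    then have e: "exp (416 * \<kappa>\<^sup>2) = (exp (208 * \<kappa>\<^sup>2))\<^sup>2" by (simp only: exp_double)
    have "104 * (8 * R)\<^sup>2 * (exp (208 * \<kappa>\<^sup>2))\<^sup>2 = 6656 * (R\<^sup>2 * (exp (208 * \<kappa>\<^sup>2))\<^sup>2)" by (simp add: power_mult_distrib)
    \<comment> \<open>104 * 64 = 6656 is rounded up to the square 82^2 = 6724.\<close>
    also have "\<dots> \<le> 6724 * (R\<^sup>2 * (exp (208 * \<kappa>\<^sup>2))\<^sup>2)" by (intro mult_right_mono) auto
    also have "\<dots> = (R * (82 * exp (208 * \<kappa>\<^sup>2)))\<^sup>2" by (simp add: power_mult_distrib)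
    finally show "104 * (8 * R)\<^sup>2 * exp (416 * \<kappa>\<^sup>2) \<le> (R * (82 * exp (208 * \<kappa>\<^sup>2)))\<^sup>2" unfolding e .
  qed
  finally show ?thesis .
qed

lemma admissible_le:
  assumes adm: "admissible z0 r \<omega>" and p: "2 < p" and K: "0 < K" "(\<integral>\<^sup>+x. ennreal (w x powr p) \<partial>lborel) \<le> ennreal (K powr p)"
    and r: "0 < r" and z: "z \<in> ball z0 r"
  shows "\<omega> z \<le> (1 + 52 * (p - 1) / (p - 2)) * K * r powr (1 - 2 / p)"
proof -
  obtain b where b: "b \<in> borel_measurable borel" "\<And>x. norm (b x) \<le> w x" "\<And>x. x \<notin> ball z0 r \<Longrightarrow> b x = 0"
    "\<And>z. z \<in> ball z0 r \<Longrightarrow> ennreal (\<omega> z) \<le> pot b z"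
    using adm unfolding admissible_def by auto
  have "(\<integral>\<^sup>+x. ennreal (norm (b x) powr p) \<partial>lborel) \<le> (\<integral>\<^sup>+x. ennreal (w x powr p) \<partial>lborel)"
    using b(2) p by (intro nn_integral_mono ennreal_leI powr_mono2) auto
  then have bp: "(\<integral>\<^sup>+x. ennreal (norm (b x) powr p) \<partial>lborel) \<le> ennreal (K powr p)" using K(2) by (rule order_trans)
  have le: "ennreal (\<omega> z) \<le> ennreal ((1 + 52 * (p - 1) / (p - 2)) * K * r powr (1 - 2 / p))"
    using b(4)[OF z] pot_Lp_bound[OF b(1,3) r p K(1) bp z] by (rule order_trans)
  have "0 \<le> (1 + 52 * (p - 1) / (p - 2)) * K * r powr (1 - 2 / p)"
    using p K(1) by (intro mult_nonneg_nonneg add_nonneg_nonneg divide_nonneg_nonneg) auto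
  from iffD1[OF ennreal_le_iff[OF this] le] show ?thesis .
qed

text \<open>The number 15 is chosen so that 15^2 = 225 is above 64 pi.\<close>

lemma exp_integral_of_bound:
  fixes z0 :: "real^2"
  assumes A: "\<And>z. z \<in> ball z0 (8 * R) \<Longrightarrow> \<omega> z \<le> A" and R: "0 \<le> R"
  shows "(\<integral>\<^sup>+z. indicator (ball z0 (8 * R)) z * ennreal (exp (2 * \<omega> z)) \<partial>lborel) \<le> ennreal ((R * (15 * exp A))\<^sup>2)"
proof -
  have "(\<integral>\<^sup>+z. indicator (ball z0 (8 * R)) z * ennreal (exp (2 * \<omega> z)) \<partial>lborel) \<le> (\<integral>\<^sup>+z. ennreal ((exp A)\<^sup>2) * indicator (ball z0 (8 * R)) z \<partial>lborel)"
  proof (intro nn_integral_mono)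
    fix z
    show "indicator (ball z0 (8 * R)) z * ennreal (exp (2 * \<omega> z)) \<le> ennreal ((exp A)\<^sup>2) * indicator (ball z0 (8 * R)) z"
    proof (cases "z \<in> ball z0 (8 * R)")
      case True
      have "exp (2 * \<omega> z) \<le> exp (2 * A)" using A[OF True] by simp
      then show ?thesis using True by (simp add: ennreal_leI exp_double)
    qed simp
  qed
  also have "\<dots> = ennreal ((exp A)\<^sup>2) * emeasure lborel (ball z0 (8 * R))"
    by (rule nn_integral_cmult_indicator) simp
  also have "emeasure lborel (ball z0 (8 * R)) = ennreal (pi * (8 * R)\<^sup>2)"
    using R by (intro emeasure_ball_2) simp
  also have "ennreal ((exp A)\<^sup>2) * \<dots> = ennreal ((exp A)\<^sup>2 * (pi * (8 * R)\<^sup>2))" by (rule ennreal_mult[symmetric]) auto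
  also have "\<dots> \<le> ennreal ((R * (15 * exp A))\<^sup>2)"
  proof (rule ennreal_leI)
    have "(exp A)\<^sup>2 * (pi * (8 * R)\<^sup>2) = (64 * pi) * ((exp A)\<^sup>2 * R\<^sup>2)" by (simp add: power_mult_distrib)
    also have "\<dots> \<le> 225 * ((exp A)\<^sup>2 * R\<^sup>2)" using pi_bounds by (intro mult_right_mono) auto
    also have "\<dots> = (R * (15 * exp A))\<^sup>2" by (simp add: power_mult_distrib)
    finally show "(exp A)\<^sup>2 * (pi * (8 * R)\<^sup>2) \<le> (R * (15 * exp A))\<^sup>2" .
  qed
  finally show ?thesis .
qed

text \<open>The part common to both cases. Premise \<open>l\<close> stands for
  \<open>level_bound_sup\<close> or \<open>level_bound_L2\<close>, whose other hypotheses are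
  supplied by the caller. Through the Caccioppoli inequality, \<sigma> becomes a constant times the
  supremum of |u| near z0.\<close>

lemma sup_lower_bound:
  assumes R: "1 \<le> R" and q: "0 < q" and C0: "0 < C0"
    and S: "(LINT x|lborel. indicat_real (ball z0 (16 * R)) x * (w x)\<^sup>2) \<le> S" "0 \<le> S"
    and n: "9 * (C0 * sqrt (S + 1432)) * q\<^sup>2 < (5 / 4)^n"
    and l: "\<And>\<sigma>. 0 \<le> \<sigma> \<Longrightarrow> (LINT x|lborel. indicat_real (ball z0 (1/2)) x * (norm (gz x))\<^sup>2) \<le> \<sigma>\<^sup>2 \<Longrightarrow>
      (LINT x|lborel. indicat_real (ball z0 (8 * R)) x * (norm (gz x))\<^sup>2) \<le> (C0 * sqrt (S + 1432))\<^sup>2 \<Longrightarrow>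
      1 \<le> 3 * R * q * level R q (C0 * sqrt (S + 1432)) \<sigma> n"
  shows "0 \<le> (SUP z\<in>ball z0 1. \<bar>u z\<bar>)"
    and "1 \<le> 18432 * R\<^sup>2 * q\<^sup>2 * ((SUP z\<in>ball z0 1. \<bar>u z\<bar>) * sqrt (S + 2608)) * (16 * R)^n"
proof -
  define s where "s = (SUP z\<in>ball z0 1. \<bar>u z\<bar>)"
  have bdd: "bdd_above ((\<lambda>z. \<bar>u z\<bar>) ` ball z0 1)" using u(2) by (intro bdd_aboveI2[where M=C0])
  have us: "\<bar>u z\<bar> \<le> s" if "z \<in> ball z0 1" for z
    unfolding s_def using that bdd by (rule cSUP_upper)
  have s0: "0 \<le> s" using us[of z0] by simp
  then show "0 \<le> (SUP z\<in>ball z0 1. \<bar>u z\<bar>)" by (simp only: s_def)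
  have "(LINT x|lborel. indicat_real (ball z0 (3/4)) x * (w x)\<^sup>2) \<le> (LINT x|lborel. indicat_real (ball z0 (16 * R)) x * (w x)\<^sup>2)"
    by (intro integral_mono sq_loc_ball[OF sq(5)]) (use R in \<open>auto simp: indicator_def\<close>)
  then have S': "(LINT x|lborel. indicat_real (ball z0 (3/4)) x * (w x)\<^sup>2) \<le> S" using S(1) by (rule order_trans)
  have "(LINT x|lborel. indicat_real (ball z0 (1/2)) x * (norm (gz x))\<^sup>2) \<le> s\<^sup>2 * (S + 2608)"
    by (rule gz_energy_small[OF us S'])
  also have "\<dots> = (s * sqrt (S + 2608))\<^sup>2" using S(2) by (simp add: power_mult_distrib)
  finally have small: "(LINT x|lborel. indicat_real (ball z0 (1/2)) x * (norm (gz x))\<^sup>2) \<le> (s * sqrt (S + 2608))\<^sup>2" .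
  have "(LINT x|lborel. indicat_real (ball z0 (8 * R)) x * (norm (gz x))\<^sup>2) \<le> C0\<^sup>2 * (S + 1432)"
    by (rule gz_energy_large[OF R S(1)])
  also have "\<dots> = (C0 * sqrt (S + 1432))\<^sup>2" using S(2) by (simp add: power_mult_distrib)
  finally have large: "(LINT x|lborel. indicat_real (ball z0 (8 * R)) x * (norm (gz x))\<^sup>2) \<le> (C0 * sqrt (S + 1432))\<^sup>2" .
  have "0 \<le> s * sqrt (S + 2608)" using s0 S(2) by simp
  from level_conclusion[OF R q n l[OF this small large]]
  show "1 \<le> 18432 * R\<^sup>2 * q\<^sup>2 * ((SUP z\<in>ball z0 1. \<bar>u z\<bar>) * sqrt (S + 2608)) * (16 * R)^n" unfolding s_def .
qed

end

section \<open>Choice of n and conversion of constants into powers of R\<close>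

lemma exists_power_gt:
  assumes "0 < (Y::real)"
  obtains n :: nat where "Y < (5 / 4)^n" "real n \<le> \<bar>ln Y\<bar> / ln (5 / 4) + 1"
proof -
  define t where "t = \<bar>ln Y\<bar> / ln (5 / 4 :: real)"
  define n where "n = nat \<lfloor>t\<rfloor> + 1"
  have t: "0 \<le> t" by (simp add: t_def)
  have n: "t < real n" "real n \<le> t + 1" using t unfolding n_def by linarith+
  have "ln Y \<le> t * ln (5 / 4)" by (simp add: t_def)
  also have "\<dots> < real n * ln (5 / 4)" using n(1) by simp
  also have "\<dots> = ln ((5 / 4)^n)" by (simp add: ln_realpow)
  finally have "Y < (5 / 4)^n" using assms by simp
  then show ?thesis using n(2) by (intro that[of n]) (simp_all only: t_def)
qed

text \<open>Used with a = ln R or a larger multiple of it: for R \<ge> 2 a constant factor X is at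
  most a power of R whose exponent coefficient depends on X alone.\<close>

lemma two_powr_abs_ln:
  assumes "0 < (X::real)" and a: "ln 2 \<le> a"
  shows "X \<le> exp (\<bar>ln X\<bar> / ln 2 * a)"
proof -
  have "ln X \<le> \<bar>ln X\<bar> / ln 2 * ln 2" by simp
  also have "\<dots> \<le> \<bar>ln X\<bar> / ln 2 * a" using a by (intro mult_left_mono) auto
  finally have "exp (ln X) \<le> exp (\<bar>ln X\<bar> / ln 2 * a)" by simp
  then show ?thesis using assms by simp
qed

lemma powr_lower_bound:
  fixes R q s T :: real
  assumes R: "2 \<le> R" and q: "0 < q" and T: "0 < T" and s: "0 \<le> s"
    and le: "1 \<le> 18432 * R\<^sup>2 * q\<^sup>2 * (s * T) * (16 * R)^n"
  shows "R powr (- (real n + 2 + \<bar>ln (18432 * q\<^sup>2 * T * 16^n)\<bar> / ln 2)) \<le> s"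
proof -
  let ?X = "18432 * q\<^sup>2 * T * 16^n"
  let ?a = "\<bar>ln ?X\<bar> / ln 2"
  have X: "0 < ?X" using q T by simp
  have "?X \<le> exp (?a * ln R)" using R by (intro two_powr_abs_ln X) simp
  then have XR: "?X \<le> R powr ?a" using R by (simp add: powr_def)
  have "1 \<le> s * (?X * R^(n + 2))" using le by (simp add: power_mult_distrib power_add power2_eq_square mult_ac)
  also have "\<dots> \<le> s * (R powr ?a * R^(n + 2))" using XR R s by (intro mult_left_mono mult_right_mono) auto
  also have "R^(n + 2) = R powr (real n + 2)"
  proof -
    have "R powr real (n + 2) = R^(n + 2)" using R by (intro powr_realpow) simp
    moreover have "real (n + 2) = real n + 2" by simp
    ultimately show ?thesis by (simp only:)
  qed
  also have "R powr ?a * R powr (real n + 2) = R powr (real n + 2 + ?a)" by (simp add: powr_add)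
  finally have "1 / R powr (real n + 2 + ?a) \<le> s" using R by (subst pos_divide_le_eq) auto
  then show ?thesis using R by (simp only: powr_minus_divide)
qed

text \<open>Every factor is at most exp of a constant times P ln R, where P = R^(1 - 2/p) in the
  application: constants by \<open>two_powr_abs_ln\<close>, powers of R since P \<ge> 1, exp(2 A P)
  since ln R \<ge> ln 2, and (16 R)^n since n \<le> c P and 16 R \<le> R^5.\<close>

lemma exp_lower_bound:
  fixes R s t P A c :: real
  assumes R: "2 \<le> R" and P: "1 \<le> P" and t: "0 < t" and s: "0 \<le> s" and A: "0 \<le> A" and T: "T \<le> t * R" and n: "real n \<le> c * P"
    and le: "1 \<le> 18432 * R\<^sup>2 * (15 * exp (A * P))\<^sup>2 * (s * T) * (16 * R)^n"
  shows "exp (- (\<bar>ln (18432 * 225 * t)\<bar> / ln 2 + 3 + 2 * A / ln 2 + 5 * c) * P * ln R) \<le> s"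
proof -
  define L where "L = ln R"
  have L: "ln 2 \<le> L" "R = exp L" using R by (simp_all add: L_def)
  have l2: "0 < ln (2::real)" by simp
  have L0: "0 \<le> L" using L(1) l2 by linarith
  have LP: "ln 2 \<le> P * L" "L \<le> P * L"
  proof -
    show "L \<le> P * L" using mult_right_mono[OF P L0] by simp
    then show "ln 2 \<le> P * L" using L(1) by linarith
  qed
  let ?a = "\<bar>ln (18432 * 225 * t)\<bar> / ln 2"
  have 1: "18432 * 225 * t \<le> exp (?a * (P * L))" using t LP(1) by (intro two_powr_abs_ln) auto
  have 2: "R^3 \<le> exp (3 * (P * L))"
  proof -
    have "R^3 = exp (3 * L)" unfolding L(2) by (simp add: exp_of_nat_mult[of 3, simplified])
    also have "\<dots> \<le> exp (3 * (P * L))" using LP(2) by simp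
    finally show ?thesis .
  qed
  have 3: "exp (2 * (A * P)) \<le> exp (2 * A / ln 2 * (P * L))"
  proof -
    have "2 * (A * P) = 2 * A / ln 2 * (P * ln 2)" by simp
    also have "\<dots> \<le> 2 * A / ln 2 * (P * L)" using A P L(1) by (intro mult_left_mono) auto
    finally show ?thesis by simp
  qed
  have 4: "(16 * R)^n \<le> exp (5 * c * (P * L))"
  proof -
    have "ln (16 * R) = ln (2^4) + L" using R by (simp add: ln_mult L_def)
    also have "ln (2^4 :: real) = 4 * ln 2" by (subst ln_realpow) auto
    finally have le5: "ln (16 * R) \<le> 5 * L" using L(1) by simp
    have "(16 * R)^n = exp (ln (16 * R))^n" using R by simp
    also have "\<dots> = exp (real n * ln (16 * R))" by (rule exp_of_nat_mult[symmetric])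
    also have "\<dots> \<le> exp (c * P * (5 * L))"
    proof -
      have "real n * ln (16 * R) \<le> real n * (5 * L)" using le5 by (intro mult_left_mono) auto
      also have "\<dots> \<le> c * P * (5 * L)" using n L0 by (intro mult_right_mono) auto
      finally show ?thesis by simp
    qed
    finally show ?thesis by (simp only: mult_ac)
  qed
  define E where "E = exp ((?a + 3 + 2 * A / ln 2 + 5 * c) * (P * L))"
  have "1 \<le> 18432 * R\<^sup>2 * (15 * exp (A * P))\<^sup>2 * (s * T) * (16 * R)^n" by (rule le)
  also have "\<dots> \<le> 18432 * R\<^sup>2 * (15 * exp (A * P))\<^sup>2 * (s * (t * R)) * (16 * R)^n"
    using T s R by (intro mult_right_mono mult_left_mono) auto
  also have "\<dots> = s * (18432 * 225 * t * R^3 * exp (2 * (A * P)) * (16 * R)^n)"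
    unfolding exp_double by (simp add: power_mult_distrib power2_eq_square power3_eq_cube)
  also have "\<dots> \<le> s * (exp (?a * (P * L)) * exp (3 * (P * L)) * exp (2 * A / ln 2 * (P * L)) * exp (5 * c * (P * L)))"
    using t R s by (intro mult_left_mono mult_mono 1 2 3 4) auto
  also have "\<dots> = s * E" by (simp only: E_def exp_add distrib_right)
  finally have "1 / E \<le> s" by (subst pos_divide_le_eq) (auto simp: E_def)
  moreover have "exp (- (?a + 3 + 2 * A / ln 2 + 5 * c) * P * ln R) = 1 / E"
    unfolding E_def L_def by (simp only: exp_minus inverse_eq_divide mult_minus_left mult.assoc)
  ultimately show ?thesis by simp
qed

text \<open>The bound of \<open>pot_Lp_bound\<close> on a ball of radius 8 R, with R^(1 - 2/p) split
  off.\<close>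

definition coeff_Lp :: "real \<Rightarrow> real \<Rightarrow> real" where
  "coeff_Lp p K = (1 + 52 * (p - 1) / (p - 2)) * K * 8 powr (1 - 2 / p)"

text \<open>A bound for n in units of R^(1 - 2/p). Here 2025 = 9 * 15^2 combines the constant of
  \<open>level_conclusion\<close> with q = 15 exp(A P), 805 is above 256 pi from the area of ball 16
  R, and 1 / (1 - 2/p) is the cost of ln R in \<open>abs_ln_le\<close>.\<close>

definition degree_Lp :: "real \<Rightarrow> real \<Rightarrow> real \<Rightarrow> real" where
  "degree_Lp p K C0 = (\<bar>ln (2025 * (C0 * sqrt (805 + K powr p + 1432)))\<bar> + 1 / (1 - 2 / p) + 2 * coeff_Lp p K) / ln (5 / 4) + 1"

definition rate_Lp :: "real \<Rightarrow> real \<Rightarrow> real \<Rightarrow> real" where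
  "rate_Lp p K C0 = \<bar>ln (18432 * 225 * sqrt (805 + K powr p + 2608))\<bar> / ln 2 + 3 + 2 * coeff_Lp p K / ln 2 + 5 * degree_Lp p K C0"

lemma coeff_Lp_nonneg: "2 < p \<Longrightarrow> 0 < K \<Longrightarrow> 0 \<le> coeff_Lp p K"
  unfolding coeff_Lp_def by (intro mult_nonneg_nonneg add_nonneg_nonneg divide_nonneg_nonneg) auto

lemma degree_Lp_nonneg: "2 < p \<Longrightarrow> 0 < K \<Longrightarrow> 0 \<le> degree_Lp p K C0"
  unfolding degree_Lp_def using coeff_Lp_nonneg[of p K]
  by (intro add_nonneg_nonneg divide_nonneg_nonneg) auto

lemma rate_Lp_pos: "2 < p \<Longrightarrow> 0 < K \<Longrightarrow> 0 < rate_Lp p K C0"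
  unfolding rate_Lp_def using coeff_Lp_nonneg[of p K] degree_Lp_nonneg[of p K C0]
  by (intro add_pos_nonneg add_nonneg_pos divide_nonneg_nonneg) auto

text \<open>The inequality ln x \<le> x - 1 at x = R^\<theta> gives ln R \<le> R^\<theta> /
  \<theta>, so a factor R inside the logarithm does not raise the order R^\<theta>.\<close>

lemma abs_ln_le:
  fixes g R \<theta> A :: real
  assumes g: "0 < g" and R: "2 \<le> R" and \<theta>: "0 < \<theta>" and A: "0 \<le> A"
  shows "\<bar>ln (g * R * exp (2 * (A * R powr \<theta>)))\<bar> \<le> (\<bar>ln g\<bar> + 1 / \<theta> + 2 * A) * R powr \<theta>"
proof -
  have P: "1 \<le> R powr \<theta>" using R \<theta> by (intro ge_one_powr_ge_zero) auto
  have "ln (R powr \<theta>) \<le> R powr \<theta> - 1" using R by (intro ln_le_minus_one) auto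
  then have "\<theta> * ln R \<le> R powr \<theta>" using R by (simp add: ln_powr)
  then have LR: "ln R \<le> 1 / \<theta> * R powr \<theta>" using \<theta> by (simp add: pos_le_divide_eq mult.commute)
  have L0: "0 \<le> ln R" using R by simp
  have "ln (g * R * exp (2 * (A * R powr \<theta>))) = ln g + ln R + 2 * A * R powr \<theta>"
    using g R by (simp add: ln_mult)
  then have "\<bar>ln (g * R * exp (2 * (A * R powr \<theta>)))\<bar> \<le> \<bar>ln g\<bar> + ln R + 2 * A * R powr \<theta>"
    using L0 mult_nonneg_nonneg[OF A, of "R powr \<theta>"] by simp
  also have "\<dots> \<le> \<bar>ln g\<bar> * R powr \<theta> + 1 / \<theta> * R powr \<theta> + 2 * A * R powr \<theta>"
    using LR mult_left_mono[OF P, of "\<bar>ln g\<bar>"] by linarith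
  also have "\<dots> = (\<bar>ln g\<bar> + 1 / \<theta> + 2 * A) * R powr \<theta>" by (simp only: distrib_right)
  finally show ?thesis .
qed

lemma sqrt_affine_le:
  fixes R S c :: real
  assumes "1 \<le> R" "0 \<le> S" "0 \<le> c"
  shows "sqrt (S * R\<^sup>2 + c) \<le> sqrt (S + c) * R"
proof -
  have "c * 1 \<le> c * R\<^sup>2" using assms by (intro mult_left_mono) auto
  then have "sqrt (S * R\<^sup>2 + c) \<le> sqrt ((S + c) * R\<^sup>2)" by (simp add: distrib_right)
  also have "\<dots> = sqrt (S + c) * R" using assms by (simp add: real_sqrt_mult)
  finally show ?thesis .
qed

context drift_solution
begin

text \<open>Two quantities grow with R. The factor q contains exp(A P), which makes n of order P =
  R^(1 - 2/p). The bound for the local L^2 energy of w is of order R^2, which contributes a factor R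
  through the square roots.\<close>

lemma sup_lower_bound_Lp:
  assumes p: "2 < p" and C0: "0 < C0" and K: "0 < K" and wp: "(\<integral>\<^sup>+x. ennreal (w x powr p) \<partial>lborel) \<le> ennreal (K powr p)"
    and g: "GDERIV u 0 :> g" "norm g = 1" and R: "2 \<le> R" "norm z0 = R"
  shows "exp (- rate_Lp p K C0 * R powr (1 - 2 / p) * ln R) \<le> (SUP z\<in>ball z0 1. \<bar>u z\<bar>)"
proof -
  define \<theta> where "\<theta> = 1 - 2 / p"
  have \<theta>: "0 < \<theta>" using p by (simp add: \<theta>_def)
  define P where "P = R powr \<theta>"
  have P: "1 \<le> P" unfolding P_def using R \<theta> by (intro ge_one_powr_ge_zero) auto
  define A where "A = coeff_Lp p K"
  have A: "0 \<le> A" unfolding A_def by (rule coeff_Lp_nonneg[OF p K])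
  define S0 where "S0 = 805 + K powr p"
  define S where "S = S0 * R\<^sup>2"
  have S0: "0 \<le> S0" by (simp add: S0_def)
  have S: "0 \<le> S" using S0 by (simp add: S_def)
  define q where "q = 15 * exp (A * P)"
  have q: "0 < q" by (simp add: q_def)
  have R1: "1 \<le> R" "0 \<le> R" "0 < 8 * R" "0 \<le> 16 * R" using R by auto
  have \<omega>A: "\<omega> z \<le> A * P" if "admissible z0 (8 * R) \<omega>" "z \<in> ball z0 (8 * R)" for \<omega> z
  proof -
    have "\<omega> z \<le> (1 + 52 * (p - 1) / (p - 2)) * K * (8 * R) powr \<theta>"
      unfolding \<theta>_def by (rule admissible_le[OF that(1) p K wp R1(3) that(2)])
    also have "\<dots> = A * P" unfolding A_def coeff_Lp_def P_def \<theta>_def[symmetric] using R1 by (simp add: powr_mult)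
    finally show ?thesis .
  qed
  have Q: "(\<integral>\<^sup>+z. indicator (ball z0 (8 * R)) z * ennreal (exp (2 * \<omega> z)) \<partial>lborel) \<le> ennreal ((R * q)\<^sup>2)"
    if "admissible z0 (8 * R) \<omega>" for \<omega>
    unfolding q_def by (rule exp_integral_of_bound[OF \<omega>A[OF that] R1(2)])
  have LS: "(LINT x|lborel. indicat_real (ball z0 (16 * R)) x * (w x)\<^sup>2) \<le> S"
  proof -
    have "(LINT x|lborel. indicat_real (ball z0 (16 * R)) x * (w x)\<^sup>2) \<le> 1 * (pi * (16 * R)\<^sup>2) + K powr p"
      by (rule drift_energy_le[OF _ _ R1(4) wp]) (use sq_le_1_powr[of p] p w(1) in auto)
    also have "\<dots> \<le> 805 * R\<^sup>2 + K powr p * R\<^sup>2"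
    proof (rule add_mono)
      have "1 * (pi * (16 * R)\<^sup>2) = (256 * pi) * R\<^sup>2" by (simp add: power_mult_distrib)
      also have "\<dots> \<le> 805 * R\<^sup>2" using pi_bounds by (intro mult_right_mono) auto
      finally show "1 * (pi * (16 * R)\<^sup>2) \<le> 805 * R\<^sup>2" .
      have "K powr p * 1 \<le> K powr p * R\<^sup>2" using R1 by (intro mult_left_mono) auto
      then show "K powr p \<le> K powr p * R\<^sup>2" by simp
    qed
    also have "\<dots> = S" by (simp add: S_def S0_def distrib_right)
    finally show ?thesis .
  qed
  define \<gamma> where "\<gamma> = C0 * sqrt (S0 + 1432)"
  have \<gamma>: "0 < 2025 * \<gamma>" using C0 S0 by (simp add: \<gamma>_def)
  define Y where "Y = 2025 * \<gamma> * R * exp (2 * (A * P))"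
  have Y: "0 < Y" using \<gamma> R by (simp add: Y_def)
  obtain n where n: "Y < (5 / 4)^n" "real n \<le> \<bar>ln Y\<bar> / ln (5 / 4) + 1" by (rule exists_power_gt[OF Y])
  have "9 * (C0 * sqrt (S + 1432)) * q\<^sup>2 \<le> Y"
  proof -
    have "9 * (C0 * sqrt (S + 1432)) * q\<^sup>2 \<le> 9 * (C0 * (sqrt (S0 + 1432) * R)) * q\<^sup>2"
      unfolding S_def using C0 R1 S0 by (intro mult_right_mono mult_left_mono sqrt_affine_le) auto
    also have "\<dots> = Y" unfolding Y_def \<gamma>_def q_def exp_double by (simp add: power_mult_distrib)
    finally show ?thesis .
  qed
  then have nY: "9 * (C0 * sqrt (S + 1432)) * q\<^sup>2 < (5 / 4)^n" using n(1) by (rule le_less_trans)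
  have l: "1 \<le> 3 * R * q * level R q (C0 * sqrt (S + 1432)) \<sigma> n"
    if \<sigma>: "0 \<le> \<sigma>" "(LINT x|lborel. indicat_real (ball z0 (1/2)) x * (norm (gz x))\<^sup>2) \<le> \<sigma>\<^sup>2"
      "(LINT x|lborel. indicat_real (ball z0 (8 * R)) x * (norm (gz x))\<^sup>2) \<le> (C0 * sqrt (S + 1432))\<^sup>2" for \<sigma>
  proof (rule level_bound_sup[where A="A * P" and ?z0.0=z0])
    show "\<omega> z \<le> A * P" if "admissible z0 (8 * R) \<omega>" "z \<in> ball z0 (8 * R)" for \<omega> z
      by (rule \<omega>A[OF that])
    show "(\<integral>\<^sup>+z. indicator (ball z0 (8 * R)) z * ennreal (exp (2 * \<omega> z)) \<partial>lborel) \<le> ennreal ((R * q)\<^sup>2)"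
      if "admissible z0 (8 * R) \<omega>" for \<omega>
      by (rule Q[OF that])
    show "0 \<le> C0 * sqrt (S + 1432)" using C0 S by simp
    show "exp (A * P) \<le> q" by (simp add: q_def)
  qed (fact R1(1) R(2) q \<sigma> g)+
  define s where "s = (SUP z\<in>ball z0 1. \<bar>u z\<bar>)"
  note lb = sup_lower_bound[OF R1(1) q C0 LS S nY l, folded s_def, unfolded q_def]
  have deg: "real n \<le> degree_Lp p K C0 * P"
  proof -
    have ln54: "0 < ln (5 / 4 :: real)" by simp
    have "\<bar>ln Y\<bar> \<le> (\<bar>ln (2025 * \<gamma>)\<bar> + 1 / \<theta> + 2 * A) * P"
      unfolding Y_def P_def by (rule abs_ln_le[OF \<gamma> R(1) \<theta> A])
    then have "\<bar>ln Y\<bar> / ln (5 / 4) \<le> (\<bar>ln (2025 * \<gamma>)\<bar> + 1 / \<theta> + 2 * A) * P / ln (5 / 4)"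
      using ln54 by (intro divide_right_mono) auto
    then have "real n \<le> (\<bar>ln (2025 * \<gamma>)\<bar> + 1 / \<theta> + 2 * A) * P / ln (5 / 4) + 1 * P"
      using n(2) P by linarith
    also have "\<dots> = ((\<bar>ln (2025 * \<gamma>)\<bar> + 1 / \<theta> + 2 * A) / ln (5 / 4) + 1) * P"
      by (simp only: distrib_right times_divide_eq_left)
    finally show ?thesis unfolding degree_Lp_def \<gamma>_def \<theta>_def A_def S0_def .
  qed
  have t: "0 < sqrt (S0 + 2608)" using S0 by simp
  have T: "sqrt (S + 2608) \<le> sqrt (S0 + 2608) * R"
    unfolding S_def using R1 S0 by (intro sqrt_affine_le) auto
  show ?thesis
    using exp_lower_bound[OF R(1) P t lb(1) A T deg lb(2)]
    unfolding rate_Lp_def s_def P_def \<theta>_def A_def S0_def .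
qed

text \<open>Neither q nor the energy bound \<kappa>^2 depends on R, so one n serves all R and the
  bound is a power of R.\<close>

lemma sup_lower_bound_L2:
  assumes C0: "0 < C0" and \<kappa>: "0 < \<kappa>" and w2: "(\<integral>\<^sup>+x. ennreal (w x powr 2) \<partial>lborel) \<le> ennreal (\<kappa>\<^sup>2)"
    and low: "1 / 4 \<le> (LINT x|lborel. indicat_real (ball 0 1) x * (norm (gz x))\<^sup>2)"
    and R: "2 \<le> R" "norm z0 = R" and q: "q = 82 * exp (208 * \<kappa>\<^sup>2)"
    and n: "9 * (C0 * sqrt (\<kappa>\<^sup>2 + 1432)) * q\<^sup>2 < (5 / 4)^n"
  shows "R powr (- (real n + 2 + \<bar>ln (18432 * q\<^sup>2 * sqrt (\<kappa>\<^sup>2 + 2608) * 16^n)\<bar> / ln 2)) \<le> (SUP z\<in>ball z0 1. \<bar>u z\<bar>)"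
proof -
  have R1: "1 \<le> R" "0 \<le> 16 * R" using R by auto
  have q0: "0 < q" by (simp add: q)
  have Q: "(\<integral>\<^sup>+z. indicator (ball z0 (8 * R)) z * ennreal (exp (2 * \<omega> z)) \<partial>lborel) \<le> ennreal ((R * q)\<^sup>2)"
    if "admissible z0 (8 * R) \<omega>" for \<omega>
    unfolding q by (rule admissible_exp_integral[OF that \<kappa> w2 R1(1)])
  have "(LINT x|lborel. indicat_real (ball z0 (16 * R)) x * (w x)\<^sup>2) \<le> 0 * (pi * (16 * R)\<^sup>2) + \<kappa>\<^sup>2"
    by (rule drift_energy_le[OF _ _ R1(2) w2]) (use w(1) in auto)
  then have LS: "(LINT x|lborel. indicat_real (ball z0 (16 * R)) x * (w x)\<^sup>2) \<le> \<kappa>\<^sup>2" by simp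
  have \<kappa>0: "0 \<le> \<kappa>\<^sup>2" by simp
  have l: "1 \<le> 3 * R * q * level R q (C0 * sqrt (\<kappa>\<^sup>2 + 1432)) \<sigma> n"
    if \<sigma>: "0 \<le> \<sigma>" "(LINT x|lborel. indicat_real (ball z0 (1/2)) x * (norm (gz x))\<^sup>2) \<le> \<sigma>\<^sup>2"
      "(LINT x|lborel. indicat_real (ball z0 (8 * R)) x * (norm (gz x))\<^sup>2) \<le> (C0 * sqrt (\<kappa>\<^sup>2 + 1432))\<^sup>2" for \<sigma>
    by (rule level_bound_L2[OF R1(1) R(2) q0 Q \<sigma>(3) _ \<sigma>(2,1) low]) (use C0 in auto)
  have T: "0 < sqrt (\<kappa>\<^sup>2 + 2608)" by (simp add: add_nonneg_pos)
  note lb = sup_lower_bound[OF R1(1) q0 C0 LS \<kappa>0 n l]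
  show ?thesis by (rule powr_lower_bound[OF R(1) q0 T lb])
qed

lemma energy_unit_ball:
  assumes wg: "AE x in lebesgue. (norm (weak_grad u x))\<^sup>2 = (G1 x)\<^sup>2 + (G2 x)\<^sup>2"
    and ge: "1 \<le> (LINT x:ball 0 1|lebesgue. (norm (weak_grad u x))\<^sup>2)"
  shows "1 / 4 \<le> (LINT x|lborel. indicat_real (ball 0 1) x * (norm (gz x))\<^sup>2)"
proof -
  let ?f = "\<lambda>x. indicat_real (ball 0 1) x *\<^sub>R (norm (weak_grad u x))\<^sup>2"
  let ?h = "\<lambda>x. indicat_real (ball 0 1) x * ((G1 x)\<^sup>2 + (G2 x)\<^sup>2)"
  note [measurable] = borel
  have ge': "1 \<le> (LINT x|lebesgue. ?f x)" using ge by (simp add: set_lebesgue_integral_def)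
  \<comment> \<open>A non-integrable function has Bochner integral 0, so the lower bound 1 already
    entails integrability, and with it measurability.\<close>
  have "integrable lebesgue ?f"
  proof (rule ccontr)
    assume "\<not> integrable lebesgue ?f"
    then show False using ge' not_integrable_integral_eq[of lebesgue ?f] by simp
  qed
  then have fm: "?f \<in> borel_measurable lebesgue" by (rule borel_measurable_integrable)
  have hm: "?h \<in> borel_measurable borel" by measurable
  have ae: "AE x in lebesgue. ?f x = ?h x" using wg by eventually_elim simp
  have "(LINT x|lebesgue. ?f x) = (LINT x|lborel. ?h x)"
    using integral_AE_borel[OF fm hm, of "\<lambda>_. 1"] ae by simp
  then have "1 \<le> (LINT x|lborel. ?h x)" using ge' by simp
  then show ?thesis by (simp add: norm_gz)
qed

end

theorem theorem1p1:
  shows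
   "(\<forall>(p::real) (Kt::real) (C0::real). 2 < p \<and> 0 < C0 \<longrightarrow>
      (\<exists>C>0. \<exists>R0>1. \<forall>(W::real^2 \<Rightarrow> real^2) (u::real^2 \<Rightarrow> real).
         bounded_solution p C0 W u \<and> in_Lp p W \<and> Lp_norm p W \<le> Kt \<and>
         (\<exists>g. GDERIV u 0 :> g \<and> norm g = 1) \<longrightarrow>
         (\<forall>R\<ge>R0. (INF z0\<in>sphere 0 R. SUP z\<in>ball z0 1. \<bar>u z\<bar>)
                    \<ge> exp (- C * R powr (1 - 2 / p) * ln R))))
    \<and>
    (\<forall>(K::real) (C0::real). 0 < C0 \<longrightarrow>
      (\<exists>C>0. \<exists>R0>1. \<forall>(W::real^2 \<Rightarrow> real^2) (u::real^2 \<Rightarrow> real).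
         bounded_solution 2 C0 W u \<and> in_Lp 2 W \<and> Lp_norm 2 W \<le> K \<and>
         (LINT x:ball 0 1|lebesgue. (norm (weak_grad u x))\<^sup>2) \<ge> 1 \<longrightarrow>
         (\<forall>R\<ge>R0. (INF z0\<in>sphere 0 R. SUP z\<in>ball z0 1. \<bar>u z\<bar>) \<ge> R powr (- C))))"
proof (intro conjI allI impI)
  fix p Kt C0 :: real
  assume pc: "2 < p \<and> 0 < C0"
  \<comment> \<open>Kt comes without a sign; the shift by 1 makes K positive, so that
    \<open>pot_Lp_bound\<close> may divide by it.\<close>
  define K where "K = \<bar>Kt\<bar> + 1"
  have K: "0 < K" by (simp add: K_def)
  have le: "exp (- rate_Lp p K C0 * R powr (1 - 2 / p) * ln R) \<le> (INF z0\<in>sphere 0 R. SUP z\<in>ball z0 1. \<bar>u z\<bar>)"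
    if h: "bounded_solution p C0 W u \<and> in_Lp p W \<and> Lp_norm p W \<le> Kt \<and> (\<exists>g. GDERIV u 0 :> g \<and> norm g = 1)" and R: "2 \<le> R"
    for W u and R :: real
  proof -
    obtain g where g: "GDERIV u 0 :> g" "norm g = 1" using h by blast
    have p2: "2 \<le> p" and hs: "bounded_solution p C0 W u" "in_Lp p W" "Lp_norm p W \<le> Kt" using pc h by auto
    obtain G1 G2 F1 F2 w where d: "drift_solution u G1 G2 F1 F2 w C0"
      and wp: "(\<integral>\<^sup>+x. ennreal (w x powr p) \<partial>lborel) \<le> ennreal (\<bar>Kt\<bar> powr p)"
      by (rule bounded_solution_drift[OF hs(1) p2 hs(2,3)])
    have "\<bar>Kt\<bar> powr p \<le> K powr p" using p2 by (intro powr_mono2) (auto simp: K_def)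
    with wp have wK: "(\<integral>\<^sup>+x. ennreal (w x powr p) \<partial>lborel) \<le> ennreal (K powr p)"
      by (meson ennreal_leI order_trans)
    show ?thesis
    proof (rule cINF_greatest)
      show "sphere (0::real^2) R \<noteq> {}" using R by simp
      show "exp (- rate_Lp p K C0 * R powr (1 - 2 / p) * ln R) \<le> (SUP z\<in>ball z0 1. \<bar>u z\<bar>)" if "z0 \<in> sphere 0 R" for z0
        using drift_solution.sup_lower_bound_Lp[OF d _ _ K wK g R] pc that by simp
    qed
  qed
  show "\<exists>C>0. \<exists>R0>1. \<forall>(W::real^2 \<Rightarrow> real^2) (u::real^2 \<Rightarrow> real).
         bounded_solution p C0 W u \<and> in_Lp p W \<and> Lp_norm p W \<le> Kt \<and>
         (\<exists>g. GDERIV u 0 :> g \<and> norm g = 1) \<longrightarrow>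
         (\<forall>R\<ge>R0. (INF z0\<in>sphere 0 R. SUP z\<in>ball z0 1. \<bar>u z\<bar>)
                    \<ge> exp (- C * R powr (1 - 2 / p) * ln R))"
  proof (intro exI conjI allI impI)
    show "0 < rate_Lp p K C0" using pc K by (intro rate_Lp_pos) auto
    \<comment> \<open>R0 = 2, because ln R \<ge> ln 2 is what lets constants be absorbed into powers
      of R.\<close>
    show "(1::real) < 2" by simp
  qed (rule le)
next
  fix K C0 :: real
  assume C0: "0 < C0"
  define \<kappa> where "\<kappa> = \<bar>K\<bar> + 1"
  have \<kappa>: "0 < \<kappa>" by (simp add: \<kappa>_def)
  define q where "q = 82 * exp (208 * \<kappa>\<^sup>2)"
  have Y: "0 < 9 * (C0 * sqrt (\<kappa>\<^sup>2 + 1432)) * q\<^sup>2" using C0 by (simp add: q_def add_nonneg_pos)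
  \<comment> \<open>The exponent is chosen before W, u and R are introduced; only K and C0
    enter.\<close>
  obtain n where n: "9 * (C0 * sqrt (\<kappa>\<^sup>2 + 1432)) * q\<^sup>2 < (5 / 4)^n" by (rule exists_power_gt[OF Y])
  define C where "C = real n + 2 + \<bar>ln (18432 * q\<^sup>2 * sqrt (\<kappa>\<^sup>2 + 2608) * 16^n)\<bar> / ln 2"
  have le: "R powr (- C) \<le> (INF z0\<in>sphere 0 R. SUP z\<in>ball z0 1. \<bar>u z\<bar>)"
    if h: "bounded_solution 2 C0 W u \<and> in_Lp 2 W \<and> Lp_norm 2 W \<le> K \<and>
         (LINT x:ball 0 1|lebesgue. (norm (weak_grad u x))\<^sup>2) \<ge> 1" and R: "2 \<le> R"
    for W u and R :: real
  proof -
    have hs: "bounded_solution 2 C0 W u" "in_Lp 2 W" "Lp_norm 2 W \<le> K"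
      and ge: "1 \<le> (LINT x:ball 0 1|lebesgue. (norm (weak_grad u x))\<^sup>2)" using h by auto
    obtain G1 G2 F1 F2 w where d: "drift_solution u G1 G2 F1 F2 w C0"
      and wg: "AE x in lebesgue. (norm (weak_grad u x))\<^sup>2 = (G1 x)\<^sup>2 + (G2 x)\<^sup>2"
      and wp: "(\<integral>\<^sup>+x. ennreal (w x powr 2) \<partial>lborel) \<le> ennreal (\<bar>K\<bar> powr 2)"
      by (rule bounded_solution_drift[OF hs(1) order_refl hs(2,3)])
    have "\<bar>K\<bar>\<^sup>2 \<le> \<kappa>\<^sup>2" by (intro power_mono) (auto simp: \<kappa>_def)
    then have "\<bar>K\<bar> powr 2 \<le> \<kappa>\<^sup>2" by simp
    with wp have wK: "(\<integral>\<^sup>+x. ennreal (w x powr 2) \<partial>lborel) \<le> ennreal (\<kappa>\<^sup>2)"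
      by (meson ennreal_leI order_trans)
    note low = drift_solution.energy_unit_ball[OF d wg ge]
    show ?thesis
    proof (rule cINF_greatest)
      show "sphere (0::real^2) R \<noteq> {}" using R by simp
      show "R powr (- C) \<le> (SUP z\<in>ball z0 1. \<bar>u z\<bar>)" if "z0 \<in> sphere 0 R" for z0
        unfolding C_def using that by (intro drift_solution.sup_lower_bound_L2[OF d C0 \<kappa> wK low R _ q_def n]) simp
    qed
  qed
  show "\<exists>C>0. \<exists>R0>1. \<forall>(W::real^2 \<Rightarrow> real^2) (u::real^2 \<Rightarrow> real).
         bounded_solution 2 C0 W u \<and> in_Lp 2 W \<and> Lp_norm 2 W \<le> K \<and>
         (LINT x:ball 0 1|lebesgue. (norm (weak_grad u x))\<^sup>2) \<ge> 1 \<longrightarrow>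
         (\<forall>R\<ge>R0. (INF z0\<in>sphere 0 R. SUP z\<in>ball z0 1. \<bar>u z\<bar>) \<ge> R powr (- C))"
  proof (intro exI conjI allI impI)
    show "0 < C" by (simp add: C_def add_pos_nonneg add_nonneg_pos)
    show "(1::real) < 2" by simp
  qed (rule le)
qed

end
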